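(* Let $\hat w=(\hat x,\hat u)\in W$ be an admissible process that is a weak local minimum in Problem P: $$J(x(t_0),x(t_1))\to\min,\qquad \dot x=f(x,u),\qquad G(x,u)\le 0,$$ and put $\hat\xi=(\hat x(t_0),\hat x(t_1))$. Then there exist $$\hat\alpha_0\in\mathbb{R},\quad \hat p\in BV([t_0,t_1],\mathbb{R}^{n*}),\quad \hat\lambda\in L^1([t_0,t_1],\mathbb{R}),\quad d\hat\eta\in C^*([t_0,t_1],\mathbb{R}),$$ and a $d\hat\eta$-measurable $d\hat\eta$-essentially bounded function $\hat s:[t_0,t_1]\to\mathbb{R}^{n*}$ such that all of the following hold. (1) $\hat\alpha_0\ge 0$; $\hat\lambda\ge 0$ and $\hat\lambda\,G(\hat w)=0$ a.e. on $[t_0,t_1]$; $d\hat\eta\ge 0$ and $d\hat\eta\cdot\chi_{\mathcal D}=d\hat\eta$. (2) (Nontriviality) $\hat\alpha_0+\|\hat\lambda\|_1+\int_{[t_0,t_1]}d\hat\eta>0$. (3) $\hat s(t)\in \operatorname{conv} S\big(\hat x(t),\operatorname{clm}(\hat u)(t)\big)$ for $d\hat\eta$-almost all $t$, i.e. there is a set $\mathcal R\subset\mathcal D$ with $\int_{\mathcal R}d\hat\eta=\int_{[t_0,t_1]}d\hat\eta$ such that the inclusion holds for all $t\in\mathcal R$. (4) (Adjoint equation, as an equality of $\mathbb{R}^{n*}$-valued measures on $[t_0,t_1]$) $$-d\hat p=H_x(\hat w,\hat p)\,dt+\hat\lambda\,G_x(\hat w)\,dt+\hat s\,d\hat\eta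 .$$ (5) (Transversality) $-\hat p(t_0-0)=\hat\alpha_0J_{x_0}(\hat\xi)$ and $\hat p(t_1+0)=\hat\alpha_0J_{x_1}(\hat\xi)$. (6) (Stationarity in the control) $H_u(\hat w(t),\hat p(t))+\hat\lambda(t)\,G_u(\hat w(t))=0$ for almost every $t\in[t_0,t_1]$ with respect to Lebesgue measure.
   Context: Setting. $[t_0,t_1]$ is a fixed interval, $t_0<t_1$. The functions $J:\mathbb{R}^{2n}\to\mathbb{R}$ (with arguments $(x_0,x_1)$), $f:\mathbb{R}^{n+m}\to\mathbb{R}^n$ and $G:\mathbb{R}^{n+m}\to\mathbb{R}$ (with arguments $(x,u)$) are continuously differentiable. Processes are pairs $w=(x,u)\in W=AC([t_0,t_1],\mathbb{R}^n)\times L^\infty([t_0,t_1],\mathbb{R}^m)$. A process is admissible in Problem P if $\dot x(t)=f(x(t),u(t))$ and $G(x(t),u(t))\le0$ for a.e. $t\in[t_0,t_1]$. An admissible $\hat w$ is a weak (local) minimum if there is $\varepsilon>0$ such that $J(x(t_0),x(t_1))\ge J(\hat x(t_0),\hat x(t_1))$ for every admissible $(x,u)$ with $\|x-\hat x\|_C+\|u-\hat u\|_\infty<\varepsilon$, where $\|x\|_C=\max_t|x(t)|$. Row vectors. $\mathbb{R}^{n*}$ is the space of row vectors of dimension $n$; gradients such as $G_x,G_u,J_{x_0},J_{x_1}$ are row vectors. The Pontryagin function is $H(x,u,p)=p\,f(x,u)$ with $p\in\mathbb{R}^{n*}$, so $H_x=pf_x$, $H_u=pf_u$. Closure in measure.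 Let $\Gamma=\{(t,\hat u(t)):t\in[t_0,t_1]\}$ and $\pi:\mathbb{R}^{1+m}\to\mathbb{R}$, $\pi(t,v)=t$. Then $$\operatorname{clm}(\hat u)=\{(t,v)\in\mathbb{R}^{1+m}:\ \operatorname{mes}\pi(O\cap\Gamma)>0\ \text{for every open set } O\ni(t,v)\},$$ where $\operatorname{mes}$ is Lebesgue measure (this does not depend on the representative of $\hat u$). For $t\in[t_0,t_1]$ put $\operatorname{clm}(\hat u)(t)=\{v\in\mathbb{R}^m:(t,v)\in\operatorname{clm}(\hat u)\}$ and $\operatorname{clm}(\hat w)(t)=\big(\hat x(t),\operatorname{clm}(\hat u)(t)\big)=\{(\hat x(t),v):v\in\operatorname{clm}(\hat u)(t)\}$. Phase points. $\mathcal N(G)=\{(x,u)\in\mathbb{R}^{n+m}:G(x,u)=0,\ G_u(x,u)=0\}$ is the set of phase points; it is assumed to be nonempty. Set $S(x,u)=\{G_x(x,u)\}$ if $(x,u)\in\mathcal N(G)$ and $S(x,u)=\emptyset$ otherwise; for $M\subset\mathbb{R}^{n+m}$ set $S(M)=\bigcup_{(x,u)\in M}S(x,u)$. Let $$\mathcal D=\{t\in[t_0,t_1]:\ \operatorname{clm}(\hat w)(t)\cap\mathcal N(G)\neq\emptyset\},$$ a closed, possibly empty, subset of $[t_0,t_1]$, with characteristic function $\chi_{\mathcal D}$. $\operatorname{conv}$ denotes the convex hull. Functions of bounded variation and measures. $BV([t_0,t_1],\mathbb{R}^{n*})$ is the space of functions $p:[t_0,t_1]\to\mathbb{R}^{n*}$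 of bounded variation, taken left-continuous, for which the values $p(t_0-0)$ and $p(t_1+0)$ are also defined. The Radon measure $dp$ on $[t_0,t_1]$ is determined by $\int_{[a,b]}dp=p(b+0)-p(a-0)$ for $[a,b]\subset[t_0,t_1]$; it may have atoms at the endpoints $t_0,t_1$. $C^*([t_0,t_1],\mathbb{R})$ is the space of finite signed Radon measures on $[t_0,t_1]$, the dual of $C([t_0,t_1],\mathbb{R})$. The values of $\hat s$ outside $\mathcal D$ are of no importance. *)

theory Defs
  imports "HOL-Analysis.Analysis" "HOL-Probability.Essential_Supremum"
begin

definition cont_differentiable :: "('a::real_normed_vector \<Rightarrow> 'b::real_normed_vector) \<Rightarrow> bool" where
  "cont_differentiable g \<longleftrightarrow>
     (\<exists>g'. (\<forall>z. (g has_derivative blinfun_apply (g' z)) (at z)) \<and> continuous_on UNIV g')"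

text \<open>Row vectors are identified with elements of \<open>real ^ 'n\<close>; the product of the row vector \<open>p\<close>
  and the column vector \<open>y\<close> is then \<open>p \<bullet> y\<close>.\<close>

definition gradient :: "('a::real_inner \<Rightarrow> real) \<Rightarrow> 'a \<Rightarrow> 'a" where
  "gradient g z = (THE D. GDERIV g z :> D)"

lemma gradient_eq:
  assumes "GDERIV g z :> D"
  shows "gradient g z = D"
proof -
  have "D' = D" if "GDERIV g z :> D'" for D'
  proof -
    have "(\<lambda>h. h \<bullet> D') = (\<lambda>h. h \<bullet> D)"
      using that assms unfolding gderiv_def by (rule has_derivative_unique)
    then have "\<forall>h. h \<bullet> D' = h \<bullet> D" by metis
    then show ?thesis by (metis vector_eq_ldot)
  qed
  then show ?thesis
    unfolding gradient_def using assms by blast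
qed

definition grad_1 :: "('a::real_inner \<times> 'b \<Rightarrow> real) \<Rightarrow> 'a \<times> 'b \<Rightarrow> 'a" where
  "grad_1 g z = gradient (\<lambda>y. g (y, snd z)) (fst z)"

definition grad_2 :: "('a \<times> 'b::real_inner \<Rightarrow> real) \<Rightarrow> 'a \<times> 'b \<Rightarrow> 'b" where
  "grad_2 g z = gradient (\<lambda>y. g (fst z, y)) (snd z)"

definition pontryagin ::
    "((real ^ 'n) \<times> (real ^ 'm) \<Rightarrow> real ^ 'n) \<Rightarrow> real ^ 'n \<Rightarrow> (real ^ 'n) \<times> (real ^ 'm) \<Rightarrow> real" where
  "pontryagin f p z = p \<bullet> f z"

text \<open>Functions on \<open>[t0, t1]\<close> are total functions on \<open>real\<close> whose values outside the interval
  play no role; elements of \<open>L\<^sup>1\<close> and \<open>L\<^sup>\<infinity>\<close> are given by representatives.\<close>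

definition abs_continuous_on :: "real \<Rightarrow> real \<Rightarrow> (real \<Rightarrow> 'a::real_normed_vector) \<Rightarrow> bool" where
  "abs_continuous_on t0 t1 x \<longleftrightarrow>
     (\<forall>\<epsilon>>0. \<exists>\<delta>>0. \<forall>(k::nat) a b.
        (\<forall>i<k. t0 \<le> a i \<and> a i \<le> b i \<and> b i \<le> t1) \<and>
        disjoint_family_on (\<lambda>i. {a i<..<b i}) {..<k} \<and>
        (\<Sum>i<k. b i - a i) < \<delta>
        \<longrightarrow> (\<Sum>i<k. norm (x (b i) - x (a i))) < \<epsilon>)"

definition C_norm :: "real \<Rightarrow> real \<Rightarrow> (real \<Rightarrow> 'a::real_normed_vector) \<Rightarrow> real" where
  "C_norm t0 t1 x = (SUP t\<in>{t0..t1}. norm (x t))"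

definition Linf_norm :: "'a measure \<Rightarrow> ('a \<Rightarrow> 'b::real_normed_vector) \<Rightarrow> ereal" where
  "Linf_norm M u = esssup M (\<lambda>t. ereal (norm (u t)))"

definition in_Linf :: "'a measure \<Rightarrow> ('a \<Rightarrow> 'b::real_normed_vector) \<Rightarrow> bool" where
  "in_Linf M u \<longleftrightarrow> u \<in> borel_measurable M \<and> Linf_norm M u < \<infinity>"

definition admissible ::
    "real \<Rightarrow> real \<Rightarrow> ((real ^ 'n) \<times> (real ^ 'm) \<Rightarrow> real ^ 'n) \<Rightarrow> ((real ^ 'n) \<times> (real ^ 'm) \<Rightarrow> real) \<Rightarrow>
     (real \<Rightarrow> real ^ 'n) \<Rightarrow> (real \<Rightarrow> real ^ 'm) \<Rightarrow> bool" where
  "admissible t0 t1 f G x u \<longleftrightarrow>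
     abs_continuous_on t0 t1 x \<and> in_Linf (lebesgue_on {t0..t1}) u \<and>
     (AE t in lebesgue_on {t0..t1}.
        (x has_vector_derivative f (x t, u t)) (at t within {t0..t1}) \<and> G (x t, u t) \<le> 0)"

definition weak_minimum ::
    "real \<Rightarrow> real \<Rightarrow> ((real ^ 'n) \<times> (real ^ 'n) \<Rightarrow> real) \<Rightarrow> ((real ^ 'n) \<times> (real ^ 'm) \<Rightarrow> real ^ 'n) \<Rightarrow>
     ((real ^ 'n) \<times> (real ^ 'm) \<Rightarrow> real) \<Rightarrow> (real \<Rightarrow> real ^ 'n) \<Rightarrow> (real \<Rightarrow> real ^ 'm) \<Rightarrow> bool" where
  "weak_minimum t0 t1 J f G xh uh \<longleftrightarrow>
     admissible t0 t1 f G xh uh \<and>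
     (\<exists>\<epsilon>>0. \<forall>x u. admissible t0 t1 f G x u \<and>
        ereal (C_norm t0 t1 (\<lambda>t. x t - xh t)) +
          Linf_norm (lebesgue_on {t0..t1}) (\<lambda>t. u t - uh t) < ereal \<epsilon>
        \<longrightarrow> J (x t0, x t1) \<ge> J (xh t0, xh t1))"

definition clm :: "real \<Rightarrow> real \<Rightarrow> (real \<Rightarrow> 'a::topological_space) \<Rightarrow> (real \<times> 'a) set" where
  "clm t0 t1 u =
     {z. \<forall>O'. open O' \<and> z \<in> O' \<longrightarrow>
           emeasure lebesgue (fst ` (O' \<inter> {(t, u t) | t. t \<in> {t0..t1}})) > 0}"

definition clm_at :: "real \<Rightarrow> real \<Rightarrow> (real \<Rightarrow> 'a::topological_space) \<Rightarrow> real \<Rightarrow> 'a set" where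
  "clm_at t0 t1 u t = {v. (t, v) \<in> clm t0 t1 u}"

definition clm_process_at ::
    "real \<Rightarrow> real \<Rightarrow> (real \<Rightarrow> 'b) \<Rightarrow> (real \<Rightarrow> 'a::topological_space) \<Rightarrow> real \<Rightarrow> ('b \<times> 'a) set" where
  "clm_process_at t0 t1 x u t = {(x t, v) | v. v \<in> clm_at t0 t1 u t}"

definition phase_points :: "((real ^ 'n) \<times> (real ^ 'm) \<Rightarrow> real) \<Rightarrow> ((real ^ 'n) \<times> (real ^ 'm)) set" where
  "phase_points G = {z. G z = 0 \<and> grad_2 G z = 0}"

definition phase_gradients ::
    "((real ^ 'n) \<times> (real ^ 'm) \<Rightarrow> real) \<Rightarrow> ((real ^ 'n) \<times> (real ^ 'm)) set \<Rightarrow> (real ^ 'n) set" where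
  "phase_gradients G M = (\<Union>z\<in>M. if z \<in> phase_points G then {grad_1 G z} else {})"

definition phase_times ::
    "real \<Rightarrow> real \<Rightarrow> ((real ^ 'n) \<times> (real ^ 'm) \<Rightarrow> real) \<Rightarrow>
     (real \<Rightarrow> real ^ 'n) \<Rightarrow> (real \<Rightarrow> real ^ 'm) \<Rightarrow> real set" where
  "phase_times t0 t1 G x u = {t\<in>{t0..t1}. clm_process_at t0 t1 x u t \<inter> phase_points G \<noteq> {}}"

definition left_lim :: "(real \<Rightarrow> 'a::t2_space) \<Rightarrow> real \<Rightarrow> 'a" where
  "left_lim p t = Lim (at_left t) p"

definition right_lim :: "(real \<Rightarrow> 'a::t2_space) \<Rightarrow> real \<Rightarrow> 'a" where
  "right_lim p t = Lim (at_right t) p"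

definition bounded_variation :: "(real \<Rightarrow> 'a::real_normed_vector) \<Rightarrow> bool" where
  "bounded_variation p \<longleftrightarrow>
     (\<exists>C. \<forall>(k::nat) r. mono_on {..k} r \<longrightarrow> (\<Sum>i<k. norm (p (r (Suc i)) - p (r i))) \<le> C)"

text \<open>A left-continuous function of bounded variation on \<open>[t0, t1]\<close> together with its outer values at
  \<open>t0 - 0\<close> and \<open>t1 + 0\<close> is encoded as a function on \<open>real\<close> that is constant on \<open>{..t0}\<close>, with the
  former value, and on \<open>{t1<..}\<close>, with the latter. The one-sided limits \<open>left_lim p t0\<close> and
  \<open>right_lim p t1\<close> recover these values, and jumps at both endpoints remain possible.\<close>

definition BV :: "real \<Rightarrow> real \<Rightarrow> (real \<Rightarrow> 'a::real_normed_vector) \<Rightarrow> bool" where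
  "BV t0 t1 p \<longleftrightarrow>
     bounded_variation p \<and> (\<forall>t. continuous (at_left t) p) \<and>
     (\<forall>t\<le>t0. p t = p t0) \<and> (\<exists>c. \<forall>t>t1. p t = c)"

definition borel_subsets :: "real \<Rightarrow> real \<Rightarrow> real set set" where
  "borel_subsets t0 t1 = {B \<in> sets borel. B \<subseteq> {t0..t1}}"

text \<open>Vector-valued measures on \<open>[t0, t1]\<close>, as set functions; the value outside their domain is
  fixed to be \<open>0\<close> so that such a measure is determined by its values on Borel sets.\<close>

definition vector_measure :: "real \<Rightarrow> real \<Rightarrow> (real set \<Rightarrow> 'a::real_normed_vector) \<Rightarrow> bool" where
  "vector_measure t0 t1 \<mu> \<longleftrightarrow>
     (\<forall>A. range A \<subseteq> borel_subsets t0 t1 \<and> disjoint_family A \<longrightarrow>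
        (\<lambda>i::nat. \<mu> (A i)) sums \<mu> (\<Union>i. A i)) \<and>
     (\<forall>B. B \<notin> borel_subsets t0 t1 \<longrightarrow> \<mu> B = 0)"

lemma vector_measure_unique:
  fixes \<mu> \<nu> :: "real set \<Rightarrow> 'a::real_normed_vector"
  assumes \<mu>: "vector_measure t0 t1 \<mu>" and \<nu>: "vector_measure t0 t1 \<nu>"
    and eq: "\<And>a b. t0 \<le> a \<Longrightarrow> a \<le> b \<Longrightarrow> b \<le> t1 \<Longrightarrow> \<mu> {a..b} = \<nu> {a..b}"
  shows "\<mu> = \<nu>"
proof -
  have null: "\<kappa> {} = 0" if "vector_measure t0 t1 \<kappa>" for \<kappa> :: "real set \<Rightarrow> 'a"
  proof -
    have "(\<lambda>i::nat. \<kappa> {}) sums \<kappa> {}"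
      using that[unfolded vector_measure_def, THEN conjunct1, rule_format, of "\<lambda>i. {}"]
      by (auto simp: borel_subsets_def disjoint_family_on_def)
    then have "(\<lambda>i::nat. \<kappa> {}) \<longlonglongrightarrow> 0"
      using sums_summable summable_LIMSEQ_zero by blast
    then show ?thesis by (simp add: LIMSEQ_const_iff)
  qed
  have add: "\<kappa> (A \<union> B) = \<kappa> A + \<kappa> B"
    if \<kappa>: "vector_measure t0 t1 \<kappa>" and AB: "A \<in> borel_subsets t0 t1" "B \<in> borel_subsets t0 t1"
      "A \<inter> B = {}" for \<kappa> :: "real set \<Rightarrow> 'a" and A B
  proof -
    have "range (binaryset A B) \<subseteq> borel_subsets t0 t1"
      using AB by (auto simp: range_binaryset_eq borel_subsets_def)
    moreover have "disjoint_family (binaryset A B)"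
      using AB by (auto simp: disjoint_family_on_def binaryset_def)
    ultimately have "(\<lambda>i. \<kappa> (binaryset A B i)) sums \<kappa> (A \<union> B)"
      using \<kappa> unfolding vector_measure_def by (metis UN_binaryset_eq)
    moreover have "(\<lambda>i. \<kappa> (binaryset A B i)) sums (\<kappa> A + \<kappa> B)"
      using null[OF \<kappa>] by (intro binaryset_sums) auto
    ultimately show ?thesis by (rule sums_unique2)
  qed
  have *: "\<mu> (B \<inter> {t0..t1}) = \<nu> (B \<inter> {t0..t1})" if B: "B \<in> sets borel" for B
  proof -
    have in_sub: "X \<inter> {t0..t1} \<in> borel_subsets t0 t1" if "X \<in> sets borel" for X
      using that by (auto simp: borel_subsets_def)
    have top: "\<mu> {t0..t1} = \<nu> {t0..t1}"
      using eq[of t0 t1] null[OF \<mu>] null[OF \<nu>] by (cases "t0 \<le> t1") auto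
    show ?thesis
      using B
    proof (induction rule: borel_set_induct)
      case empty
      then show ?case by (simp add: null[OF \<mu>] null[OF \<nu>])
    next
      case (interval a b)
      have AI: "{a..b} \<inter> {t0..t1} = {max a t0..min b t1}" by auto
      show ?case
      proof (cases "max a t0 \<le> min b t1")
        case True
        then show ?thesis using eq[of "max a t0" "min b t1"] AI by auto
      next
        case False
        then show ?thesis using AI null[OF \<mu>] null[OF \<nu>] by auto
      qed
    next
      case (compl A)
      have split: "{t0..t1} = (A \<inter> {t0..t1}) \<union> (- A \<inter> {t0..t1})" by auto
      have "\<kappa> {t0..t1} = \<kappa> (A \<inter> {t0..t1}) + \<kappa> (- A \<inter> {t0..t1})"
        if "vector_measure t0 t1 \<kappa>" for \<kappa> :: "real set \<Rightarrow> 'a"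
        by (subst split, rule add[OF that]) (use compl.hyps in \<open>auto intro!: in_sub borel_comp\<close>)
      from this[OF \<mu>] this[OF \<nu>] top compl.IH show ?case by simp
    next
      case (union A)
      have r: "range (\<lambda>i. A i \<inter> {t0..t1}) \<subseteq> borel_subsets t0 t1"
        using union.hyps in_sub by auto
      have d: "disjoint_family (\<lambda>i. A i \<inter> {t0..t1})"
        using union.hyps by (auto simp: disjoint_family_on_def)
      have "(\<lambda>i. \<kappa> (A i \<inter> {t0..t1})) sums \<kappa> (\<Union>i. A i \<inter> {t0..t1})"
        if "vector_measure t0 t1 \<kappa>" for \<kappa> :: "real set \<Rightarrow> 'a"
        using that r d unfolding vector_measure_def by blast
      from this[OF \<mu>] this[OF \<nu>] show ?case
        using union.IH sums_unique2 by (fastforce simp: Int_UN_distrib2)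
    qed
  qed
  show ?thesis
  proof
    fix B
    show "\<mu> B = \<nu> B"
    proof (cases "B \<in> borel_subsets t0 t1")
      case True
      then have "B \<inter> {t0..t1} = B" "B \<in> sets borel" by (auto simp: borel_subsets_def)
      then show ?thesis using *[of B] by simp
    next
      case False
      then show ?thesis using \<mu> \<nu> by (simp add: vector_measure_def)
    qed
  qed
qed

definition BV_measure :: "real \<Rightarrow> real \<Rightarrow> (real \<Rightarrow> 'a::real_normed_vector) \<Rightarrow> real set \<Rightarrow> 'a" where
  "BV_measure t0 t1 p =
     (THE \<mu>. vector_measure t0 t1 \<mu> \<and>
        (\<forall>a b. t0 \<le> a \<and> a \<le> b \<and> b \<le> t1 \<longrightarrow> \<mu> {a..b} = right_lim p b - left_lim p a))"

lemma BV_measure_eq: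
  assumes "vector_measure t0 t1 \<mu>"
    and "\<And>a b. t0 \<le> a \<Longrightarrow> a \<le> b \<Longrightarrow> b \<le> t1 \<Longrightarrow> \<mu> {a..b} = right_lim p b - left_lim p a"
  shows "BV_measure t0 t1 p = \<mu>"
  unfolding BV_measure_def
  by (rule the_equality) (use assms in \<open>auto intro!: vector_measure_unique[of t0 t1]\<close>)

text \<open>A nonnegative element of \<open>C\<^sup>*([t0, t1])\<close> is a finite Borel measure on \<open>[t0, t1]\<close>; finite
  Borel measures on a compact interval are automatically Radon.\<close>

definition nonneg_radon_on :: "real \<Rightarrow> real \<Rightarrow> real measure \<Rightarrow> bool" where
  "nonneg_radon_on t0 t1 \<eta> \<longleftrightarrow>
     sets \<eta> = sets (restrict_space borel {t0..t1}) \<and> finite_measure \<eta>"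

end

theory Submission
  imports Defs "HOL-Probability.Helly_Selection"
begin

text \<open>
  Why the theorem holds. If a trajectory \<open>y\<close> of the linearized state equation, driven by a bounded control
  variation \<open>v\<close>, lowers the cost to first order and satisfies \<open>G + G_x y + G_u v \<le> - c\<close> almost everywhere
  with \<open>c > 0\<close>, then a small step along \<open>(y, v)\<close>, corrected to a solution of the nonlinear equation, is
  admissible and cheaper than the given process (\<open>feasible_descent_from_linearization\<close>). At a weak minimum
  no such pair exists, however small \<open>c\<close> is (\<open>weak_minimum_excludes_descent\<close>).

  Separating convex sets in \<open>L\<^sup>\<infinity>\<close> would produce finitely additive multipliers. Instead, for each \<open>c > 0\<close>
  a quadratic penalty for the system "linearized cost at most \<open>- c\<close>, linearized constraint at most \<open>- c\<close>" is
  minimized over the unit ball of processes. A minimizer exists (\<open>minimizer_on_unit_processes\<close>), its penalty is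
  positive, and its first-order condition is a multiplier rule with bounded densities \<open>\<lambda>\<close> and error \<open>c\<close>
  (\<open>approximate_multipliers\<close>). With an adjoint variable \<open>p\<close> the state drops out, and what remains are three
  residuals of size \<open>c\<close>: in the transversality condition, in the stationarity condition and in the
  complementary slackness (\<open>approx_multiplier_exists\<close>).

  Now \<open>c\<close> tends to \<open>0\<close>. The densities are bounded in \<open>L\<^sup>1\<close> only, so they converge to a measure \<open>\<mu>0\<close>, and
  \<open>\<lambda> G_x\<close> converges to a vector measure; the adjoint variables converge outside a countable set. Since then
  \<open>\<lambda> G_u\<close> converges in mean by stationarity and \<open>\<lambda> G\<close> does so by slackness, the densities converge strongly to an
  integrable function wherever \<open>\<bar>G\<bar> + \<bar>G_u\<bar>\<close> is bounded away from zero (\<open>limit_multipliers\<close>). Mass is lost to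
  a singular remainder \<open>\<eta>\<close> only where \<open>\<bar>G\<bar> + \<bar>G_u\<bar>\<close> becomes small, and a bound \<open>q \<bullet> G_x \<le> r\<close> that holds
  there passes to the limit (\<open>limit_lower_bound\<close>). By compactness of the closure in measure such a bound follows
  from a strict bound at the phase points over a time interval (\<open>affine_bound_near_zeros\<close>). Hence the remainder
  of \<open>\<lambda> G_x\<close> has a density \<open>s\<close> with respect to \<open>\<eta>\<close>, and \<open>s t\<close> lies in every half-space containing the phase
  gradients at time \<open>t\<close>, that is, in their convex hull; over times without phase points the hull is empty, so
  \<open>\<eta>\<close> vanishes there (\<open>singular_multiplier\<close>). The normalization \<open>\<alpha> + \<integral>\<lambda> = 1\<close> becomes
  \<open>\<alpha> + \<integral>\<lambda> + \<integral>d\<eta> = 1\<close> in the limit, which is the nontriviality.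
\<close>

section \<open>Absolutely continuous functions and integrals\<close>

text \<open>Fix \<open>e > 0\<close>. By Vitali's theorem the points at which the difference quotient stays \<open>e\<close>-far from \<open>f\<close> are covered,
  up to a null set, by disjoint intervals on each of which \<open>f\<close> at the tag times the length misses the integral by
  more than \<open>e\<close> times the length. Henstock's lemma makes the sum of these errors, hence the total length,
  arbitrarily small.\<close>

lemma indefinite_integral_has_vector_derivative:
  fixes f :: "real \<Rightarrow> 'a::euclidean_space"
  assumes f: "f integrable_on {a..b}"
  obtains N where "negligible N"
    "\<And>t. t \<in> {a..b} - N \<Longrightarrow> ((\<lambda>t. integral {a..t} f) has_vector_derivative f t) (at t within {a..b})"
proof -
  define F where "F = (\<lambda>t. integral {a..t} f)"
  define bad where "bad e = {t\<in>{a..b}. \<forall>d>0. \<exists>y\<in>{a..b}. norm (y - t) < d \<and>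
      norm (F y - F t - (y - t) *\<^sub>R f t) > e * norm (y - t)}" for e
  have sub: "f integrable_on {c..d}" if "{c..d} \<subseteq> {a..b}" for c d
    using f that integrable_on_subinterval by blast
  have diffF: "integral {c..d} f = F d - F c" if "a \<le> c" "c \<le> d" "d \<le> b" for c d
    unfolding F_def using Henstock_Kurzweil_Integration.integral_combine[of a c d f] that sub[of a d]
    by (auto simp: algebra_simps)
  have neg: "negligible (bad e)" if e: "e > 0" for e
  proof (unfold negligible_outer_le, intro allI impI)
    fix \<eta> :: real assume \<eta>: "\<eta> > 0"
    obtain \<gamma> where \<gamma>: "gauge \<gamma>" and H: "\<And>p. \<lbrakk>p tagged_partial_division_of (cbox a b); \<gamma> fine p\<rbrakk> \<Longrightarrow>
             sum (\<lambda>(x,k). norm(measure lborel k *\<^sub>R f x - integral k f)) p < \<eta> * e"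
      using Henstock_lemma[of f a b "\<eta> * e"] f \<eta> e by (auto simp: box_real)
    define Ic where "Ic = (\<lambda>(t::real, y). cball ((t + y) / 2) (\<bar>y - t\<bar> / 2))"
    define K where "K = {(t, y). t \<in> bad e \<and> y \<in> {a..b} \<and> Ic (t, y) \<subseteq> \<gamma> t \<and>
        norm (F y - F t - (y - t) *\<^sub>R f t) > e * norm (y - t)}"
    have Ic: "Ic (t, y) = {min t y..max t y}" for t y
      unfolding Ic_def by (auto simp: cball_eq_atLeastAtMost min_def max_def field_simps)
    have Kne: "t \<noteq> y" if "(t, y) \<in> K" for t y
      using that by (auto simp: K_def)
    obtain C where C: "countable C" "C \<subseteq> K"
     "pairwise (\<lambda>i j. disjnt (Ic i) (Ic j)) C"
     "negligible(bad e - (\<Union>i \<in> C. Ic i))"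
    proof (rule Vitali_covering_theorem_cballs[of K "\<lambda>(t, y). \<bar>y - t\<bar> / 2" "bad e" "\<lambda>(t, y). (t + y) / 2"])
      show "0 < (case i of (t, y) \<Rightarrow> \<bar>y - t\<bar> / 2)" if "i \<in> K" for i
        using that Kne by (cases i) fastforce
    next
      fix x d :: real assume x: "x \<in> bad e" and d: "0 < d"
      obtain r where r: "r > 0" "ball x r \<subseteq> \<gamma> x"
        using \<gamma> unfolding gauge_def by (meson open_contains_ball)
      from x obtain y where y: "y \<in> {a..b}" "norm (y - x) < min r d"
        "norm (F y - F x - (y - x) *\<^sub>R f x) > e * norm (y - x)"
        using r(1) d unfolding bad_def mem_Collect_eq by (meson min_less_iff_conj[THEN iffD2])
      have "Ic (x, y) \<subseteq> ball x r" unfolding Ic using y(2) by (auto simp: dist_real_def)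
      then have "(x, y) \<in> K" using x y r by (auto simp: K_def)
      then show "\<exists>i. i \<in> K \<and> x \<in> cball (case i of (t, y) \<Rightarrow> (t + y) / 2) (case i of (t, y) \<Rightarrow> \<bar>y - t\<bar> / 2)
             \<and> (case i of (t, y) \<Rightarrow> \<bar>y - t\<bar> / 2) < d"
        using y(2) Ic[of x y] by (intro exI[of _ "(x, y)"]) (auto simp: Ic_def)
    qed (auto simp: Ic_def case_prod_unfold)
    have fin: "measure lebesgue (\<Union>i\<in>C'. Ic i) \<le> \<eta>" if C': "C' \<subseteq> C" "finite C'" for C'
    proof -
      define p where "p = (\<lambda>i. (fst i, Ic i)) ` C'"
      have inj: "inj_on (\<lambda>i. (fst i, Ic i)) C'"
      proof (rule inj_onI)
        fix i j assume ij: "i \<in> C'" "j \<in> C'" "(fst i, Ic i) = (fst j, Ic j)"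
        then have "\<not> disjnt (Ic i) (Ic j)"
          using Ic[of "fst i" "snd i"] by (cases i) (auto simp: disjnt_def)
        then show "i = j" using C(3) C' ij unfolding pairwise_def by blast
      qed
      have tp: "p tagged_partial_division_of (cbox a b)"
        unfolding tagged_partial_division_of_def
      proof (intro conjI allI impI; (elim conjE)?)
        show "finite p" using C' by (simp add: p_def)
      next
        fix x k assume "(x, k) \<in> p"
        then obtain y where y: "(x, y) \<in> C'" "k = Ic (x, y)" by (auto simp: p_def)
        then have "(x, y) \<in> K" using C' C by auto
        then show "x \<in> k" "k \<subseteq> cbox a b" "\<exists>a b. k = cbox a b"
          unfolding y Ic K_def bad_def by (auto simp flip: box_real)
      next
        fix x1 k1 x2 k2 assume *: "(x1, k1) \<in> p" "(x2, k2) \<in> p" "(x1, k1) \<noteq> (x2, k2)"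
        then obtain y1 y2 where y: "(x1, y1) \<in> C'" "k1 = Ic (x1, y1)" "(x2, y2) \<in> C'" "k2 = Ic (x2, y2)"
          unfolding p_def by force
        then have "(x1,y1) \<noteq> (x2,y2)" using * by auto
        then have "disjnt k1 k2" using y C(3) C' unfolding pairwise_def by blast
        then show "interior k1 \<inter> interior k2 = {}"
          using interior_subset unfolding disjnt_def by blast
      qed
      have fine: "\<gamma> fine p"
        using C' C(2) by (fastforce simp: fine_def p_def K_def)
      have "measure lebesgue (\<Union>i\<in>C'. Ic i) \<le> (\<Sum>i\<in>C'. measure lebesgue (Ic i))"
        by (rule measure_UNION_le) (use C' in \<open>auto simp: Ic_def case_prod_unfold\<close>)
      also have "\<dots> \<le> (\<Sum>i\<in>C'. (1/e) * norm (measure lborel (Ic i) *\<^sub>R f (fst i) - integral (Ic i) f))"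
      proof (rule sum_mono)
        fix i assume i: "i \<in> C'"
        obtain t y where ty: "i = (t, y)" by force
        have iK: "(t, y) \<in> K" using i C' C ty by auto
        then have ty2: "t \<in> {a..b}" "y \<in> {a..b}" "t \<noteq> y" "norm (F y - F t - (y - t) *\<^sub>R f t) > e * norm (y - t)"
          using Kne by (auto simp: K_def bad_def)
        have "norm (F y - F t - (y - t) *\<^sub>R f t) = norm (measure lborel (Ic i) *\<^sub>R f t - integral (Ic i) f)"
        proof (cases "t < y")
          case True
          then have "Ic i = {t..y}" using ty Ic by auto
          then have "measure lborel (Ic i) *\<^sub>R f t - integral (Ic i) f = - (F y - F t - (y - t) *\<^sub>R f t)"
            using True ty2 diffF[of t y] by simp
          then show ?thesis by (simp only: norm_minus_cancel)
        next
          case False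
          then have "Ic i = {y..t}" using ty Ic by auto
          then have "measure lborel (Ic i) *\<^sub>R f t - integral (Ic i) f = F y - F t - (y - t) *\<^sub>R f t"
            using False ty2 diffF[of y t] by (simp add: algebra_simps)
          then show ?thesis by simp
        qed
        moreover have "measure lebesgue (Ic i) = norm (y - t)"
          using ty2 by (simp add: ty Ic min_def max_def)
        ultimately show "measure lebesgue (Ic i) \<le> (1/e) * norm (measure lborel (Ic i) *\<^sub>R f (fst i) - integral (Ic i) f)"
          using ty2(4) e ty by (simp add: field_simps)
      qed
      also have "\<dots> = (1/e) * sum (\<lambda>(x,k). norm(measure lborel k *\<^sub>R f x - integral k f)) p"
        unfolding p_def by (subst sum.reindex[OF inj]) (simp add: sum_distrib_left)
      also have "\<dots> \<le> (1/e) * (\<eta> * e)"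
        using H[OF tp fine] e by (intro mult_left_mono) auto
      finally show ?thesis using e by simp
    qed
    have lm: "Ic i \<in> lmeasurable" for i
      by (simp add: Ic_def case_prod_unfold lmeasurable_cball)
    have U: "(\<Union>i\<in>C. Ic i) \<in> lmeasurable" "measure lebesgue (\<Union>i\<in>C. Ic i) \<le> \<eta>"
      by (auto intro: fmeasurable_UN_bound[OF C(1) lm fin] measure_UN_bound[OF C(1) lm fin])
    have n: "bad e - (\<Union>i \<in> C. Ic i) \<in> null_sets lebesgue"
      using C(4) by (simp add: negligible_iff_null_sets)
    let ?T = "(\<Union>i\<in>C. Ic i) \<union> (bad e - (\<Union>i \<in> C. Ic i))"
    have "measure lebesgue ?T \<le> \<eta>"
      using measure_Un_null_set[of "\<Union>i\<in>C. Ic i" lebesgue, OF fmeasurableD[OF U(1)] n] U(2) by simp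
    moreover have "?T \<in> lmeasurable"
      using U n C(4) negligible_imp_measurable by blast
    ultimately show "\<exists>T. bad e \<subseteq> T \<and> T \<in> lmeasurable \<and> measure lebesgue T \<le> \<eta>"
      by (intro exI[of _ ?T]) auto
  qed
  define N where "N = (\<Union>n::nat. bad (1 / real (Suc n)))"
  have "negligible N" unfolding N_def by (rule negligible_countable_Union) (auto intro!: neg)
  moreover have "((\<lambda>t. integral {a..t} f) has_vector_derivative f t) (at t within {a..b})"
    if t: "t \<in> {a..b} - N" for t
    unfolding has_vector_derivative_def has_derivative_within_alt F_def[symmetric]
  proof (intro conjI allI impI)
    show "bounded_linear (\<lambda>x. x *\<^sub>R f t)" by (simp add: bounded_linear_scaleR_left)
    fix e :: real assume "e > 0"
    then obtain n where n: "1 / real (Suc n) < e"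
      using nat_approx_posE by metis
    have "t \<notin> bad (1 / real (Suc n))" using t by (auto simp: N_def)
    then obtain d where d: "d > 0" "\<And>y. y \<in> {a..b} \<Longrightarrow> norm (y - t) < d \<Longrightarrow>
        norm (F y - F t - (y - t) *\<^sub>R f t) \<le> (1 / real (Suc n)) * norm (y - t)"
      using t unfolding bad_def mem_Collect_eq by (metis Diff_iff not_less)
    show "\<exists>d>0. \<forall>y\<in>{a..b}. norm (y - t) < d \<longrightarrow> norm (F y - F t - (y - t) *\<^sub>R f t) \<le> e * norm (y - t)"
    proof (intro exI[of _ d] conjI ballI impI d(1))
      fix y assume y: "y \<in> {a..b}" "norm (y - t) < d"
      from d(2)[OF y] show "norm (F y - F t - (y - t) *\<^sub>R f t) \<le> e * norm (y - t)"
        using mult_right_mono[OF less_imp_le[OF n], of "norm (y - t)"] by simp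
    qed
  qed
  ultimately show ?thesis using that by blast
qed

text \<open>The definition of absolute continuity speaks of families indexed by an initial segment of the naturals, whereas the
  pieces of a tagged division come as a finite set.\<close>

lemma abs_continuous_on_finite_family:
  assumes "abs_continuous_on a b x" "\<epsilon> > 0"
  shows "\<exists>\<delta>>0. \<forall>(S :: 'c set) l r. finite S \<and> (\<forall>i\<in>S. a \<le> l i \<and> l i \<le> r i \<and> r i \<le> b) \<and>
       disjoint_family_on (\<lambda>i. {l i<..<r i}) S \<and> (\<Sum>i\<in>S. r i - l i) < \<delta>
       \<longrightarrow> (\<Sum>i\<in>S. norm (x (r i) - x (l i))) < \<epsilon>"
proof -
  from assms obtain \<delta> where \<delta>: "\<delta> > 0" "\<And>(k::nat) l r.
        (\<forall>i<k. a \<le> l i \<and> l i \<le> r i \<and> r i \<le> b) \<Longrightarrow>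
        disjoint_family_on (\<lambda>i. {l i<..<r i}) {..<k} \<Longrightarrow>
        (\<Sum>i<k. r i - l i) < \<delta>
        \<Longrightarrow> (\<Sum>i<k. norm (x (r i) - x (l i))) < \<epsilon>"
    unfolding abs_continuous_on_def by meson
  have "(\<Sum>i\<in>S. norm (x (r i) - x (l i))) < \<epsilon>"
    if S: "finite S" "\<And>i. i \<in> S \<Longrightarrow> a \<le> l i \<and> l i \<le> r i \<and> r i \<le> b"
       "disjoint_family_on (\<lambda>i. {l i<..<r i}) S" "(\<Sum>i\<in>S. r i - l i) < \<delta>" for S and l r :: "'c \<Rightarrow> real"
  proof -
    obtain h where h: "bij_betw h {..<card S} S"
      using ex_bij_betw_nat_finite[OF S(1)] by (auto simp: atLeast0LessThan)
    have "(\<Sum>i<card S. norm (x ((r \<circ> h) i) - x ((l \<circ> h) i))) < \<epsilon>"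
    proof (rule \<delta>(2))
      show "\<forall>i<card S. a \<le> (l \<circ> h) i \<and> (l \<circ> h) i \<le> (r \<circ> h) i \<and> (r \<circ> h) i \<le> b"
        using h S(2) by (auto simp: bij_betw_def)
      show "disjoint_family_on (\<lambda>i. {(l \<circ> h) i<..<(r \<circ> h) i}) {..<card S}"
        using S(3) h unfolding disjoint_family_on_def bij_betw_def inj_on_def
        by (metis comp_apply image_eqI)
      show "(\<Sum>i<card S. (r \<circ> h) i - (l \<circ> h) i) < \<delta>"
        using sum.reindex_bij_betw[OF h, of "\<lambda>i. r i - l i"] S(4) by simp
    qed
    then show ?thesis
      using sum.reindex_bij_betw[OF h, of "\<lambda>i. norm (x (r i) - x (l i))"] by simp
  qed
  then show ?thesis
    by (intro exI[of _ \<delta>] conjI[OF \<delta>(1)] allI impI) (elim conjE, blast)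
qed

lemma lipschitz_imp_abs_continuous_on:
  assumes L: "\<And>s t. a \<le> s \<Longrightarrow> s \<le> t \<Longrightarrow> t \<le> b \<Longrightarrow> norm (x t - x s) \<le> L * (t - s)"
  shows "abs_continuous_on a b x"
  unfolding abs_continuous_on_def
proof (intro allI impI)
  fix \<epsilon> :: real assume \<epsilon>: "\<epsilon> > 0"
  show "\<exists>\<delta>>0. \<forall>(k::nat) l r. (\<forall>i<k. a \<le> l i \<and> l i \<le> r i \<and> r i \<le> b) \<and>
        disjoint_family_on (\<lambda>i. {l i<..<r i}) {..<k} \<and> (\<Sum>i<k. r i - l i) < \<delta>
        \<longrightarrow> (\<Sum>i<k. norm (x (r i) - x (l i))) < \<epsilon>"
  proof (intro exI[of _ "\<epsilon> / (\<bar>L\<bar> + 1)"] conjI allI impI, goal_cases)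
    case 1 then show ?case using \<epsilon> by (simp add: add_nonneg_pos)
  next
    case (2 k l r)
    have "(\<Sum>i<k. norm (x (r i) - x (l i))) \<le> (\<Sum>i<k. (\<bar>L\<bar> + 1) * (r i - l i))"
    proof (rule sum_mono)
      fix i assume "i \<in> {..<k}"
      then have i: "a \<le> l i" "l i \<le> r i" "r i \<le> b" using 2 by auto
      have "L * (r i - l i) \<le> (\<bar>L\<bar> + 1) * (r i - l i)" using i by (intro mult_right_mono) auto
      with L[OF i] show "norm (x (r i) - x (l i)) \<le> (\<bar>L\<bar> + 1) * (r i - l i)" by linarith
    qed
    also have "\<dots> = (\<bar>L\<bar> + 1) * (\<Sum>i<k. r i - l i)" by (simp add: sum_distrib_left)
    also have "\<dots> < \<epsilon>" using 2 by (simp add: field_simps add_nonneg_pos)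
    finally show ?case .
  qed
qed

text \<open>The gauge is dictated by the derivative outside the null set \<open>N\<close> and by an open set of small measure around \<open>N\<close>
  on it. The pieces tagged in \<open>N\<close> then have small total length, so absolute continuity bounds their increments.\<close>

lemma abs_continuous_has_integral:
  fixes x :: "real \<Rightarrow> 'a::euclidean_space"
  assumes AC: "abs_continuous_on a b x" and ab: "a \<le> b" and N: "negligible N"
    and der: "\<And>t. t \<in> {a..b} - N \<Longrightarrow> (x has_vector_derivative g t) (at t within {a..b})"
  shows "(g has_integral x b - x a) {a..b}"
proof -
  define g' where "g' = (\<lambda>t. if t \<in> N then 0 else g t)"
  have "(g' has_integral x b - x a) {a..b}"
    unfolding has_integral_real
  proof (intro allI impI)
    fix e :: real assume e: "e > 0"
    define e1 where "e1 = e / (2 * (b - a + 1))"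
    have e1: "e1 > 0" using e ab by (simp add: e1_def)
    obtain \<delta> where \<delta>: "\<delta> > 0" and H: "\<forall>(S :: (real \<times> real set) set) l r.
       finite S \<and> (\<forall>i\<in>S. a \<le> l i \<and> l i \<le> r i \<and> r i \<le> b) \<and>
       disjoint_family_on (\<lambda>i. {l i<..<r i}) S \<and> (\<Sum>i\<in>S. r i - l i) < \<delta>
       \<longrightarrow> (\<Sum>i\<in>S. norm (x (r i) - x (l i))) < e/2"
      using abs_continuous_on_finite_family[OF AC, of "e/2"] e by auto
    have AC': "(\<Sum>i\<in>S. norm (x (r i) - x (l i))) < e/2"
      if "finite S" "\<And>i. i \<in> S \<Longrightarrow> a \<le> l i \<and> l i \<le> r i \<and> r i \<le> b"
       "disjoint_family_on (\<lambda>i. {l i<..<r i}) S" "(\<Sum>i\<in>S. r i - l i) < \<delta>"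
      for S :: "(real \<times> real set) set" and l r
      using H that by blast
    obtain U where U: "open U" "N \<subseteq> U" "U \<in> lmeasurable" "measure lebesgue U < \<delta>"
    proof -
      have Ns: "N \<in> null_sets lebesgue" using N negligible_iff_null_sets by blast
      obtain T where T: "open T" "N \<subseteq> T" "(T - N) \<in> lmeasurable" "emeasure lebesgue (T - N) < ennreal \<delta>"
        using sets_lebesgue_outer_open[of N \<delta>] \<delta> Ns by blast
      have TN: "T = (T - N) \<union> N" using T by blast
      have "T \<in> lmeasurable" using T(3) N TN negligible_imp_measurable by (metis fmeasurable.Un)
      moreover have "emeasure lebesgue T < ennreal \<delta>"
        using emeasure_Un_null_set[of "T - N" lebesgue N] T Ns TN by (metis fmeasurableD)
      then have "measure lebesgue T < \<delta>"
        using \<delta> \<open>T \<in> lmeasurable\<close> by (simp add: emeasure_eq_measure2 ennreal_less_iff)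
      ultimately show ?thesis using that T by blast
    qed
    have "\<exists>d>0. \<forall>y\<in>{a..b}. norm (y - t) < d \<longrightarrow> norm (x y - x t - (y - t) *\<^sub>R g' t) \<le> e1 * norm (y - t)"
      if "t \<in> {a..b} - N" for t
      using der[OF that] e1 that unfolding has_vector_derivative_def has_derivative_within_alt g'_def by auto
    then obtain d where d: "\<And>t. t \<in> {a..b} - N \<Longrightarrow> d t > 0"
      "\<And>t y. t \<in> {a..b} - N \<Longrightarrow> y \<in> {a..b} \<Longrightarrow> norm (y - t) < d t \<Longrightarrow>
         norm (x y - x t - (y - t) *\<^sub>R g' t) \<le> e1 * norm (y - t)"
      by metis
    \<comment> \<open>Outside \<open>{a..b}\<close> any ball serves, as no tag lies there.\<close>
    define \<gamma> where "\<gamma> t = (if t \<in> N then U else if t \<in> {a..b} then ball t (d t) else ball t 1)" for t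
    have ga: "gauge \<gamma>" unfolding gauge_def \<gamma>_def using U d by auto
    show "\<exists>\<gamma>. gauge \<gamma> \<and>
      (\<forall>\<D>. \<D> tagged_division_of {a..b} \<and> \<gamma> fine \<D> \<longrightarrow>
        norm (sum (\<lambda>(x,k). measure lborel(k) *\<^sub>R g' x) \<D> - (x b - x a)) < e)"
    proof (intro exI[of _ \<gamma>] conjI ga allI impI)
      fix p assume p: "p tagged_division_of {a..b} \<and> \<gamma> fine p"
      have fp: "finite p" using p tagged_division_of_finite by blast
      have pD: "t \<in> k" "k = {Inf k..Sup k}" "Inf k \<le> t" "t \<le> Sup k" "a \<le> Inf k" "Sup k \<le> b" "k \<subseteq> {a..b}" "k \<subseteq> \<gamma> t"
        "measure lborel k = Sup k - Inf k"
        if "(t, k) \<in> p" for t k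
      proof -
        have 1: "t \<in> k" "k \<subseteq> {a..b}" "k \<subseteq> \<gamma> t" and "\<exists>c d. k = cbox c d"
          using p that unfolding tagged_division_of fine_def by auto
        then obtain c d where k: "k = {c..d}" by auto
        with 1 have "c \<le> d" by auto
        then have "Inf k = c" "Sup k = d" using k by auto
        then show "t \<in> k" "k = {Inf k..Sup k}" "Inf k \<le> t" "t \<le> Sup k" "a \<le> Inf k" "Sup k \<le> b" "k \<subseteq> {a..b}" "k \<subseteq> \<gamma> t"
        "measure lborel k = Sup k - Inf k"
          using 1 k \<open>c \<le> d\<close> by auto
      qed
      define pN where "pN = {i\<in>p. fst i \<in> N}"
      define pO where "pO = p - pN"
      have pp: "p = pN \<union> pO" "pN \<inter> pO = {}" "finite pN" "finite pO"
        using fp by (auto simp: pN_def pO_def)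
      have disj: "interior k1 \<inter> interior k2 = {}" if "(t1,k1) \<in> p" "(t2,k2) \<in> p" "(t1,k1) \<noteq> (t2,k2)" for t1 t2 k1 k2
        using p that unfolding tagged_division_of by blast
      have "(\<Sum>i\<in>pN. norm (x (Sup (snd i)) - x (Inf (snd i)))) < e/2"
      proof (rule AC'[OF pp(3)])
        show "a \<le> Inf (snd i) \<and> Inf (snd i) \<le> Sup (snd i) \<and> Sup (snd i) \<le> b" if "i \<in> pN" for i
          using that pD[of "fst i" "snd i"] unfolding pN_def by auto
        show "disjoint_family_on (\<lambda>i. {Inf (snd i)<..<Sup (snd i)}) pN"
          unfolding disjoint_family_on_def
        proof (intro ballI impI)
          fix i j assume ij: "i \<in> pN" "j \<in> pN" "i \<noteq> j"
          have "interior (snd i) \<inter> interior (snd j) = {}"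
            using ij disj[of "fst i" "snd i" "fst j" "snd j"] by (auto simp: pN_def)
          moreover have "interior (snd i) = {Inf (snd i)<..<Sup (snd i)}" if "i \<in> p" for i
            using pD(2)[of "fst i" "snd i"] that by (metis interior_atLeastAtMost_real prod.collapse)
          ultimately show "{Inf (snd i)<..<Sup (snd i)} \<inter> {Inf (snd j)<..<Sup (snd j)} = {}"
            using ij by (auto simp: pN_def)
        qed
        then have dj: "disjoint_family_on (\<lambda>i. {Inf (snd i)<..<Sup (snd i)}) pN" .
        have sub: "(\<Union>i\<in>pN. {Inf (snd i)<..<Sup (snd i)}) \<subseteq> U"
        proof safe
          fix i1 i2 y assume i: "(i1, i2) \<in> pN" "y \<in> {Inf (snd (i1, i2))<..<Sup (snd (i1, i2))}"
          then have "i1 \<in> N" "(i1,i2) \<in> p" by (auto simp: pN_def)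
          then show "y \<in> U" using pD(8)[of i1 i2] pD(2)[of i1 i2] i
            unfolding \<gamma>_def by auto
        qed
        have "(\<Sum>i\<in>pN. Sup (snd i) - Inf (snd i)) = (\<Sum>i\<in>pN. measure lebesgue {Inf (snd i)<..<Sup (snd i)})"
          by (rule sum.cong) (use order_trans[OF pD(3) pD(4)] in \<open>auto simp: pN_def\<close>)
        also have "\<dots> = measure lebesgue (\<Union>i\<in>pN. {Inf (snd i)<..<Sup (snd i)})"
          by (rule measure_UNION'[symmetric])
             (use pp dj in \<open>auto simp: pairwise_def disjnt_def disjoint_family_on_def\<close>)
        also have "\<dots> \<le> measure lebesgue U"
          by (rule measure_mono_fmeasurable[OF sub _ U(3)]) (use pp in auto)
        finally show "(\<Sum>i\<in>pN. Sup (snd i) - Inf (snd i)) < \<delta>" using U by simp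
      qed
      moreover have "norm (\<Sum>(t,k)\<in>pN. measure lborel k *\<^sub>R g' t - (x (Sup k) - x (Inf k)))
           \<le> (\<Sum>i\<in>pN. norm (x (Sup (snd i)) - x (Inf (snd i))))"
        by (rule sum_norm_le) (auto simp: pN_def g'_def norm_minus_commute)
      moreover have "norm (\<Sum>(t,k)\<in>pO. measure lborel k *\<^sub>R g' t - (x (Sup k) - x (Inf k))) \<le> e/2"
      proof -
        have "norm (\<Sum>(t,k)\<in>pO. measure lborel k *\<^sub>R g' t - (x (Sup k) - x (Inf k))) \<le> (\<Sum>i\<in>pO. e1 * measure lborel (snd i))"
        proof (rule sum_norm_le, clarsimp)
          fix t k assume tk: "(t, k) \<in> pO"
          then have tp: "(t, k) \<in> p" "t \<notin> N" by (auto simp: pO_def pN_def)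
          note P = pD[OF tp(1)]
          have t: "t \<in> {a..b} - N" using P tp by auto
          have "k \<subseteq> ball t (d t)" using P(8) t unfolding \<gamma>_def by auto
          moreover have "Sup k \<in> k" "Inf k \<in> k" using P by (metis atLeastAtMost_iff order_refl order_trans)+
          ultimately have n: "norm (Sup k - t) < d t" "norm (Inf k - t) < d t"
            by (auto simp: dist_real_def subset_iff abs_minus_commute)
          have "norm (x (Sup k) - x t - (Sup k - t) *\<^sub>R g' t) \<le> e1 * norm (Sup k - t)"
               "norm (x (Inf k) - x t - (Inf k - t) *\<^sub>R g' t) \<le> e1 * norm (Inf k - t)"
            using d(2)[OF t _ n(1)] d(2)[OF t _ n(2)] P by auto
          moreover have "measure lborel k *\<^sub>R g' t - (x (Sup k) - x (Inf k)) =
             (x (Inf k) - x t - (Inf k - t) *\<^sub>R g' t) - (x (Sup k) - x t - (Sup k - t) *\<^sub>R g' t)"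
            unfolding P(9) by (simp add: algebra_simps)
          ultimately have "norm (measure lborel k *\<^sub>R g' t - (x (Sup k) - x (Inf k))) \<le> e1 * norm (Sup k - t) + e1 * norm (Inf k - t)"
            by (smt (verit) norm_triangle_ineq4)
          also have "\<dots> = e1 * measure lborel k" unfolding P(9) using P(3,4) by (simp add: algebra_simps)
          finally show "norm (measure lborel k *\<^sub>R g' t - (x (Sup k) - x (Inf k))) \<le> e1 * measure lborel k" .
        qed
        also have "\<dots> \<le> (\<Sum>i\<in>p. e1 * measure lborel (snd i))"
          by (rule sum_mono2) (use fp e1 in \<open>auto simp: pO_def\<close>)
        also have "\<dots> = e1 * (\<Sum>(t,k)\<in>p. measure lborel k)" by (simp add: sum_distrib_left case_prod_unfold)
        also have "(\<Sum>(t,k)\<in>p. measure lborel k) = b - a"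
          using additive_content_tagged_division[of p a b] p ab by (simp add: box_real)
        also have "e1 * (b - a) \<le> e/2" unfolding e1_def using e ab by (simp add: field_simps)
        finally show ?thesis .
      qed
      moreover have "(\<Sum>(t,k)\<in>p. measure lborel k *\<^sub>R g' t) - (x b - x a) =
         (\<Sum>(t,k)\<in>p. measure lborel k *\<^sub>R g' t - (x (Sup k) - x (Inf k)))"
        using additive_tagged_division_1[OF ab, of p x] p
        by (simp add: case_prod_unfold sum_subtractf)
      moreover have "\<dots> = (\<Sum>(t,k)\<in>pN. measure lborel k *\<^sub>R g' t - (x (Sup k) - x (Inf k))) +
          (\<Sum>(t,k)\<in>pO. measure lborel k *\<^sub>R g' t - (x (Sup k) - x (Inf k)))"
        using pp by (subst pp(1)) (rule sum.union_disjoint, auto)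
      ultimately show "norm (sum (\<lambda>(x,k). measure lborel(k) *\<^sub>R g' x) p - (x b - x a)) < e"
        by (smt (verit) norm_triangle_ineq field_sum_of_halves)
    qed
  qed
  then show ?thesis
    by (rule has_integral_spike[OF N, rotated]) (auto simp: g'_def)
qed

lemma indefinite_integral_lipschitz:
  fixes g :: "real \<Rightarrow> 'a::euclidean_space"
  assumes "g integrable_on {a..b}" "\<And>t. t \<in> {a..b} \<Longrightarrow> norm (g t) \<le> C"
    and "\<And>t. t \<in> {a..b} \<Longrightarrow> x t = x a + integral {a..t} g"
    and st: "a \<le> s" "s \<le> t" "t \<le> b"
  shows "norm (x t - x s) \<le> C * (t - s)"
proof -
  have sub: "g integrable_on {c..d}" if "{c..d} \<subseteq> {a..b}" for c d
    using assms(1) that integrable_on_subinterval by blast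
  have "x t - x s = integral {s..t} g"
    using assms(3)[of t] assms(3)[of s] st Henstock_Kurzweil_Integration.integral_combine[of a s t g] sub[of a t]
    by (auto simp: algebra_simps)
  moreover have "norm (integral {s..t} g) \<le> C * measure lborel {s..t}"
  proof (rule has_integral_bound_real[where S = "{}"])
    show "0 \<le> C" using assms(2)[of s] st by (auto intro: order_trans[OF norm_ge_zero])
    show "(g has_integral integral {s..t} g) {s..t}" using sub[of s t] st by (simp add: integrable_integral)
  qed (use assms(2) st in auto)
  ultimately show ?thesis using st by simp
qed

text \<open>The bounds make \<open>p\<close> and \<open>x\<close>, hence \<open>p \<bullet> x\<close>, Lipschitz; the product rule holds outside two null sets.\<close>

lemma integral_by_parts_inner:
  fixes p x p' x' :: "real \<Rightarrow> 'a::euclidean_space"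
  assumes ab: "a \<le> b"
    and p': "p' integrable_on {a..b}" "\<And>t. t \<in> {a..b} \<Longrightarrow> norm (p' t) \<le> C"
    and x': "x' integrable_on {a..b}" "\<And>t. t \<in> {a..b} \<Longrightarrow> norm (x' t) \<le> D"
    and p: "\<And>t. t \<in> {a..b} \<Longrightarrow> p t = p a + integral {a..t} p'"
    and x: "\<And>t. t \<in> {a..b} \<Longrightarrow> x t = x a + integral {a..t} x'"
  shows "((\<lambda>t. p t \<bullet> x' t + p' t \<bullet> x t) has_integral p b \<bullet> x b - p a \<bullet> x a) {a..b}"
proof -
  have CD: "C \<ge> 0" "D \<ge> 0" using p'(2)[of a] x'(2)[of a] ab by (auto intro: order_trans[OF norm_ge_zero])
  have lp: "norm (p t - p s) \<le> C * (t - s)" if "a \<le> s" "s \<le> t" "t \<le> b" for s t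
    using indefinite_integral_lipschitz[of p' a b C p s t] p' p that by blast
  have lx: "norm (x t - x s) \<le> D * (t - s)" if "a \<le> s" "s \<le> t" "t \<le> b" for s t
    using indefinite_integral_lipschitz[of x' a b D x s t] x' x that by blast
  define P where "P = norm (p a) + C * (b - a)"
  define X where "X = norm (x a) + D * (b - a)"
  have P: "norm (p t) \<le> P" if t: "t \<in> {a..b}" for t
  proof -
    have "norm (p t - p a) \<le> C * (t - a)" using lp[of a t] t by auto
    also have "\<dots> \<le> C * (b - a)" using t CD by (intro mult_left_mono) auto
    finally show ?thesis unfolding P_def using norm_triangle_sub[of "p t" "p a"] by linarith
  qed
  have X: "norm (x t) \<le> X" if t: "t \<in> {a..b}" for t
  proof -
    have "norm (x t - x a) \<le> D * (t - a)" using lx[of a t] t by auto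
    also have "\<dots> \<le> D * (b - a)" using t CD by (intro mult_left_mono) auto
    finally show ?thesis unfolding X_def using norm_triangle_sub[of "x t" "x a"] by linarith
  qed
  have AC: "abs_continuous_on a b (\<lambda>t. p t \<bullet> x t)"
  proof (rule lipschitz_imp_abs_continuous_on[where L = "P * D + C * X"])
    fix s t assume st: "a \<le> s" "s \<le> t" "t \<le> b"
    have "p t \<bullet> x t - p s \<bullet> x s = p t \<bullet> (x t - x s) + (p t - p s) \<bullet> x s"
      by (simp add: inner_diff_left inner_diff_right)
    also have "norm \<dots> \<le> norm (p t) * norm (x t - x s) + norm (p t - p s) * norm (x s)"
      by (intro norm_triangle_le add_mono) (auto simp: Cauchy_Schwarz_ineq2)
    also have "\<dots> \<le> P * (D * (t - s)) + (C * (t - s)) * X"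
      by (intro add_mono mult_mono) (use P[of t] X[of s] lp[OF st] lx[OF st] st CD P[of a] X[of a] norm_ge_zero in \<open>auto intro: order_trans[OF norm_ge_zero]\<close>)
    finally show "norm (p t \<bullet> x t - p s \<bullet> x s) \<le> (P * D + C * X) * (t - s)"
      by (simp add: algebra_simps)
  qed
  obtain N1 where N1: "negligible N1"
    "\<And>t. t \<in> {a..b} - N1 \<Longrightarrow> ((\<lambda>t. integral {a..t} p') has_vector_derivative p' t) (at t within {a..b})"
    using indefinite_integral_has_vector_derivative[OF p'(1)] by blast
  obtain N2 where N2: "negligible N2"
    "\<And>t. t \<in> {a..b} - N2 \<Longrightarrow> ((\<lambda>t. integral {a..t} x') has_vector_derivative x' t) (at t within {a..b})"
    using indefinite_integral_has_vector_derivative[OF x'(1)] by blast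
  show ?thesis
  proof (rule abs_continuous_has_integral[OF AC ab])
    show "negligible (N1 \<union> N2)" using N1 N2 by simp
    fix t assume t: "t \<in> {a..b} - (N1 \<union> N2)"
    have "((\<lambda>t. p a + integral {a..t} p') has_vector_derivative p' t) (at t within {a..b})"
         "((\<lambda>t. x a + integral {a..t} x') has_vector_derivative x' t) (at t within {a..b})"
      using N1(2)[of t] N2(2)[of t] t by (auto intro!: derivative_eq_intros)
    note d = this
    have "(p has_vector_derivative p' t) (at t within {a..b})"
      by (rule has_vector_derivative_transform[OF _ _ d(1)]) (use t in simp, erule p)
    moreover have "(x has_vector_derivative x' t) (at t within {a..b})"
      by (rule has_vector_derivative_transform[OF _ _ d(2)]) (use t in simp, erule x)
    ultimately have "(p has_vector_derivative p' t) (at t within {a..b})"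
      "(x has_vector_derivative x' t) (at t within {a..b})" by auto
    from bounded_bilinear.has_vector_derivative[OF bounded_bilinear_inner this]
    show "((\<lambda>t. p t \<bullet> x t) has_vector_derivative p t \<bullet> x' t + p' t \<bullet> x t) (at t within {a..b})" .
  qed
qed

section \<open>Gronwall estimates and Caratheodory solutions\<close>

text \<open>The function \<open>exp (- K * (t - a)) * (C + K * integral {a..t} \<phi>)\<close> is nonincreasing.\<close>

lemma gronwall_forward:
  fixes \<phi> :: "real \<Rightarrow> real"
  assumes \<phi>: "continuous_on {a..b} \<phi>" and K: "K \<ge> 0"
    and le: "\<And>t. t \<in> {a..b} \<Longrightarrow> \<phi> t \<le> C + K * integral {a..t} \<phi>"
    and t: "t \<in> {a..b}"
  shows "\<phi> t \<le> C * exp (K * (t - a))"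
proof -
  have int: "\<phi> integrable_on {a..b}" using \<phi> by (rule integrable_continuous_real)
  define h where "h = (\<lambda>t. exp (- K * (t - a)) * (C + K * integral {a..t} \<phi>))"
  have "h t \<le> h a"
  proof (rule DERIV_nonpos_imp_decreasing_open[where f = h])
    show "a \<le> t" using t by simp
    show "continuous_on {a..t} h" unfolding h_def
      by (intro continuous_intros continuous_on_subset[OF indefinite_integral_continuous_1[OF int]]) (use t in auto)
    fix s assume s: "a < s" "s < t"
    have "((\<lambda>u. integral {a..u} \<phi>) has_real_derivative \<phi> s) (at s within {a..b})"
      using integral_has_real_derivative[OF \<phi>, of s] s t by auto
    then have d: "((\<lambda>u. integral {a..u} \<phi>) has_real_derivative \<phi> s) (at s)"
      using s t at_within_Icc_at[of a s b] by auto
    have "(h has_real_derivative exp (- K * (s - a)) * K * (\<phi> s - (C + K * integral {a..s} \<phi>))) (at s)"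
      unfolding h_def by (auto intro!: derivative_eq_intros d simp: algebra_simps)
    moreover have "exp (- K * (s - a)) * K * (\<phi> s - (C + K * integral {a..s} \<phi>)) \<le> 0"
      using le[of s] s t K by (intro mult_nonneg_nonpos) auto
    ultimately show "\<exists>y. DERIV h s :> y \<and> y \<le> 0" by blast
  qed
  then have "exp (- K * (t - a)) * (C + K * integral {a..t} \<phi>) \<le> C" by (simp add: h_def)
  then have "exp (K * (t - a)) * (exp (- K * (t - a)) * (C + K * integral {a..t} \<phi>)) \<le> exp (K * (t - a)) * C"
    by (intro mult_left_mono) auto
  moreover have "exp (K * (t - a)) * (exp (- K * (t - a)) * y) = y" for y
    by (simp only: mult.assoc[symmetric] exp_add[symmetric]) simp
  ultimately have "C + K * integral {a..t} \<phi> \<le> exp (K * (t - a)) * C" by (simp only:)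
  then show ?thesis using le[OF t] by (simp only: mult.commute)
qed

text \<open>The integral operator becomes a contraction in the supremum norm weighted by \<open>exp (- \<kappa> * (t - a))\<close> as soon as
  \<open>\<kappa>\<close> exceeds the Lipschitz constant, so no subdivision of the interval is required. The operator
  acts on bounded continuous functions on the whole line, with the time clamped to the interval, as these form a Banach
  space type.\<close>

lemma caratheodory_forward:
  fixes F :: "real \<Rightarrow> 'a::euclidean_space \<Rightarrow> 'a"
  assumes ab: "a \<le> b"
    and int: "\<And>x. continuous_on {a..b} x \<Longrightarrow> (\<lambda>t. F t (x t)) integrable_on {a..b}"
    and lip: "\<And>t y z. t \<in> {a..b} \<Longrightarrow> norm (F t y - F t z) \<le> K * norm (y - z)"
  obtains x where "continuous_on {a..b} x"
    "\<And>t. t \<in> {a..b} \<Longrightarrow> x t = x0 + integral {a..t} (\<lambda>s. F s (x s))"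
proof -
  define \<kappa> where "\<kappa> = 2 * \<bar>K\<bar> + 1"
  have \<kappa>: "\<kappa> > 0" by (simp add: \<kappa>_def)
  define cl where "cl t = max a (min b t)" for t
  have cl: "cl t \<in> {a..b}" for t using ab by (auto simp: cl_def)
  have cl_id: "cl t = t" if "t \<in> {a..b}" for t using that by (auto simp: cl_def)
  define I where "I z t = x0 + integral {a..t} (\<lambda>s. F s (exp (\<kappa> * (s - a)) *\<^sub>R apply_bcontfun z s))"
    for z :: "real \<Rightarrow>\<^sub>C 'a" and t
  have intz: "(\<lambda>s. F s (exp (\<kappa> * (s - a)) *\<^sub>R apply_bcontfun z s)) integrable_on {a..b}" for z :: "real \<Rightarrow>\<^sub>C 'a"
    by (rule int) (intro continuous_intros continuous_on_apply_bcontfun)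
  define g where "g z t = exp (- \<kappa> * (t - a)) *\<^sub>R I z t" for z t
  have contg: "continuous_on {a..b} (g z)" for z
    unfolding g_def I_def by (intro continuous_intros indefinite_integral_continuous_1 intz)
  have gb: "(\<lambda>t. g z (cl t)) \<in> bcontfun" for z
  proof -
    have "compact (g z ` {a..b})" using contg compact_continuous_image by blast
    then have "bounded (g z ` {a..b})" by (rule compact_imp_bounded)
    then have "bounded (range (\<lambda>t. g z (cl t)))"
      by (rule bounded_subset) (use cl in auto)
    moreover have "continuous_on UNIV (\<lambda>t. g z (cl t))"
      by (rule continuous_on_compose2[OF contg]) (use cl in \<open>auto simp: cl_def intro!: continuous_intros\<close>)
    ultimately show ?thesis by (simp add: bcontfun_def)
  qed
  define T where "T z = Bcontfun (\<lambda>t. g z (cl t))" for z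
  have T: "apply_bcontfun (T z) t = g z (cl t)" for z t
    unfolding T_def by (simp add: Bcontfun_inverse[OF gb])
  have contr: "dist (T z) (T w) \<le> (1/2) * dist z w" for z w
  proof (rule dist_bound)
    fix t
    define \<tau> where "\<tau> = cl t"
    have \<tau>: "\<tau> \<in> {a..b}" using cl \<tau>_def by simp
    define E where "E s = exp (\<kappa> * (s - a))" for s
    have subI: "(\<lambda>s. F s (E s *\<^sub>R apply_bcontfun z s)) integrable_on {a..\<tau>}" for z :: "real \<Rightarrow>\<^sub>C 'a"
      using integrable_on_subinterval[OF intz[of z], of a \<tau>] \<tau> by (auto simp: E_def)
    have hE: "(E has_integral (E \<tau> / \<kappa> - E a / \<kappa>)) {a..\<tau>}"
    proof (rule fundamental_theorem_of_calculus)
      show "((\<lambda>s. E s / \<kappa>) has_vector_derivative E s) (at s within {a..\<tau>})" for s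
        unfolding E_def using \<kappa>
        by (auto intro!: derivative_eq_intros simp: has_real_derivative_iff_has_vector_derivative[symmetric])
    qed (use \<tau> in auto)
    have "norm (integral {a..\<tau>} (\<lambda>s. F s (E s *\<^sub>R apply_bcontfun z s) - F s (E s *\<^sub>R apply_bcontfun w s)))
          \<le> integral {a..\<tau>} (\<lambda>s. (\<bar>K\<bar> * dist z w) * E s)"
    proof (rule Henstock_Kurzweil_Integration.integral_norm_bound_integral)
      show "(\<lambda>s. (\<bar>K\<bar> * dist z w) * E s) integrable_on {a..\<tau>}"
        using has_integral_mult_right[OF hE] by blast
      show "(\<lambda>s. F s (E s *\<^sub>R apply_bcontfun z s) - F s (E s *\<^sub>R apply_bcontfun w s)) integrable_on {a..\<tau>}"
        by (intro integrable_diff subI)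
      fix s assume s: "s \<in> {a..\<tau>}"
      have "norm (F s (E s *\<^sub>R apply_bcontfun z s) - F s (E s *\<^sub>R apply_bcontfun w s))
          \<le> K * norm (E s *\<^sub>R apply_bcontfun z s - E s *\<^sub>R apply_bcontfun w s)"
        by (rule lip) (use s \<tau> in auto)
      also have "\<dots> = K * (E s * dist (apply_bcontfun z s) (apply_bcontfun w s))"
        unfolding scaleR_diff_right[symmetric] by (simp add: E_def dist_norm)
      also have "\<dots> \<le> \<bar>K\<bar> * (E s * dist z w)"
        by (intro mult_mono dist_bounded) (auto simp: E_def)
      finally show "norm (F s (E s *\<^sub>R apply_bcontfun z s) - F s (E s *\<^sub>R apply_bcontfun w s)) \<le> (\<bar>K\<bar> * dist z w) * E s"
        by (simp add: algebra_simps)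
    qed
    also have "\<dots> = (\<bar>K\<bar> * dist z w) * (E \<tau> / \<kappa> - E a / \<kappa>)"
      by (rule integral_unique[OF has_integral_mult_right[OF hE]])
    also have "\<dots> \<le> (\<bar>K\<bar> * dist z w) * (E \<tau> / \<kappa>)"
      by (intro mult_left_mono) (use \<kappa> in \<open>auto simp: E_def\<close>)
    finally have 1: "norm (I z \<tau> - I w \<tau>) \<le> (\<bar>K\<bar> * dist z w) * (E \<tau> / \<kappa>)"
      unfolding I_def E_def[symmetric] by (simp add: integral_diff[OF subI subI])
    have "dist (g z \<tau>) (g w \<tau>) = exp (- \<kappa> * (\<tau> - a)) * norm (I z \<tau> - I w \<tau>)"
      unfolding g_def dist_norm scaleR_diff_right[symmetric] by simp
    also have "\<dots> \<le> exp (- \<kappa> * (\<tau> - a)) * ((\<bar>K\<bar> * dist z w) * (E \<tau> / \<kappa>))"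
      using 1 by (intro mult_left_mono) auto
    also have "\<dots> = (exp (- \<kappa> * (\<tau> - a)) * E \<tau>) * (\<bar>K\<bar> / \<kappa> * dist z w)" by simp
    also have "exp (- \<kappa> * (\<tau> - a)) * E \<tau> = 1" unfolding E_def by (simp flip: exp_add)
    also have "1 * (\<bar>K\<bar> / \<kappa> * dist z w) \<le> (1/2) * dist z w"
    proof -
      have "\<bar>K\<bar> / \<kappa> \<le> 1/2" using \<kappa> by (simp add: \<kappa>_def field_simps)
      then show ?thesis using mult_right_mono[of "\<bar>K\<bar> / \<kappa>" "1/2" "dist z w"] by simp
    qed
    finally show "dist (apply_bcontfun (T z) t) (apply_bcontfun (T w) t) \<le> 1/2 * dist z w"
      by (simp add: T \<tau>_def)
  qed
  obtain z where z: "T z = z"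
    using banach_fix_type[of "1/2" T] contr by auto
  define x where "x t = exp (\<kappa> * (t - a)) *\<^sub>R apply_bcontfun z t" for t
  show ?thesis
  proof
    show "continuous_on {a..b} x" unfolding x_def by (intro continuous_intros continuous_on_apply_bcontfun)
    fix t assume t: "t \<in> {a..b}"
    have "apply_bcontfun z t = g z t" using T[of z t] z cl_id[OF t] by simp
    then have "x t = (exp (\<kappa> * (t - a)) * exp (- \<kappa> * (t - a))) *\<^sub>R I z t"
      by (simp add: x_def g_def)
    also have "\<dots> = I z t" by (simp flip: exp_add)
    finally show "x t = x0 + integral {a..t} (\<lambda>s. F s (x s))"
      unfolding I_def x_def .
  qed
qed

lemma caratheodory_backward:
  fixes F :: "real \<Rightarrow> 'a::euclidean_space \<Rightarrow> 'a"
  assumes ab: "a \<le> b"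
    and int: "\<And>x. continuous_on {a..b} x \<Longrightarrow> (\<lambda>t. F t (x t)) integrable_on {a..b}"
    and lip: "\<And>t y z. t \<in> {a..b} \<Longrightarrow> norm (F t y - F t z) \<le> K * norm (y - z)"
  obtains x where "continuous_on {a..b} x"
    "\<And>t. t \<in> {a..b} \<Longrightarrow> x t = x1 + integral {t..b} (\<lambda>s. F s (x s))"
proof -
  have refl: "continuous_on {c..d} (\<lambda>t. y (- t))" if "continuous_on {- d..- c} y" for y :: "real \<Rightarrow> 'a" and c d
    by (rule continuous_on_compose2[OF that]) (auto intro!: continuous_intros)
  have int': "(\<lambda>t. F (- t) (y t)) integrable_on {- b..- a}" if y: "continuous_on {- b..- a} y" for y
  proof -
    have "(\<lambda>t. F t (y (- t))) integrable_on {a..b}" by (rule int) (rule refl, use y in simp)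
    then show ?thesis
      using Henstock_Kurzweil_Integration.integrable_reflect_real[where f = "\<lambda>t. F t (y (- t))" and b = b and a = a] by simp
  qed
  obtain y where y: "continuous_on {- b..- a} y"
    "\<And>t. t \<in> {- b..- a} \<Longrightarrow> y t = x1 + integral {- b..t} (\<lambda>s. F (- s) (y s))"
    using caratheodory_forward[of "- b" "- a" "\<lambda>t. F (- t)" K x1] int' lip ab by auto
  show ?thesis
  proof
    show "continuous_on {a..b} (\<lambda>t. y (- t))" by (rule refl) (use y in simp)
    fix t assume t: "t \<in> {a..b}"
    then show "y (- t) = x1 + integral {t..b} (\<lambda>s. F s (y (- s)))"
      using y(2)[of "- t"] Henstock_Kurzweil_Integration.integral_reflect_real[of b t "\<lambda>s. F s (y (- s))"] by auto
  qed
qed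

text \<open>The form in which the estimate is applied to the difference of two trajectories: \<open>h\<close> collects the difference of
  their data.\<close>

lemma norm_integral_le_gronwall_forward:
  fixes z :: "real \<Rightarrow> 'a::euclidean_space"
  assumes z: "continuous_on {a..b} z" and K: "K \<ge> 0" and g: "g integrable_on {a..b}"
    and eq: "\<And>t. t \<in> {a..b} \<Longrightarrow> z t = z0 + integral {a..t} g"
    and h: "h integrable_on {a..b}" "\<And>t. t \<in> {a..b} \<Longrightarrow> h t \<ge> 0"
    and le: "\<And>t. t \<in> {a..b} \<Longrightarrow> norm (g t) \<le> h t + K * norm (z t)"
    and t: "t \<in> {a..b}"
  shows "norm (z t) \<le> (norm z0 + integral {a..b} h) * exp (K * (b - a))"
proof -
  have nz: "continuous_on {a..b} (\<lambda>t. norm (z t))" using z by (intro continuous_intros)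
  have "norm (z t) \<le> (norm z0 + integral {a..b} h) * exp (K * (t - a))"
  proof (rule gronwall_forward[OF nz K _ t])
    fix s assume s: "s \<in> {a..b}"
    have sub: "f integrable_on {a..s}" if "f integrable_on {a..b}" for f :: "real \<Rightarrow> 'c::banach"
      using integrable_on_subinterval[OF that, of a s] s by auto
    have nzi: "(\<lambda>t. norm (z t)) integrable_on {a..s}" by (rule sub[OF integrable_continuous_real[OF nz]])
    have "norm (z s) \<le> norm z0 + norm (integral {a..s} g)" unfolding eq[OF s] by (rule norm_triangle_ineq)
    also have "norm (integral {a..s} g) \<le> integral {a..s} (\<lambda>t. h t + K * norm (z t))"
      by (rule Henstock_Kurzweil_Integration.integral_norm_bound_integral)
         (use s le in \<open>auto intro!: integrable_add sub g h nzi integrable_continuous_real[OF nz] integrable_on_mult_right\<close>)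
    also have "\<dots> = integral {a..s} h + K * integral {a..s} (\<lambda>t. norm (z t))"
      by (simp add: Henstock_Kurzweil_Integration.integral_add[OF sub[OF h(1)] integrable_on_mult_right[OF nzi]])
    also have "integral {a..s} h \<le> integral {a..b} h"
      by (rule integral_subset_le) (use s h sub in auto)
    finally show "norm (z s) \<le> (norm z0 + integral {a..b} h) + K * integral {a..s} (\<lambda>t. norm (z t))" by simp
  qed
  also have "\<dots> \<le> (norm z0 + integral {a..b} h) * exp (K * (b - a))"
    using t K h Henstock_Kurzweil_Integration.integral_nonneg[of h "{a..b}"] by (intro mult_left_mono) (auto intro!: mult_left_mono)
  finally show ?thesis .
qed

lemma norm_integral_le_gronwall_backward:
  fixes z :: "real \<Rightarrow> 'a::euclidean_space"
  assumes z: "continuous_on {a..b} z" and K: "K \<ge> 0" and g: "g integrable_on {a..b}"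
    and eq: "\<And>t. t \<in> {a..b} \<Longrightarrow> z t = z1 + integral {t..b} g"
    and h: "h integrable_on {a..b}" "\<And>t. t \<in> {a..b} \<Longrightarrow> h t \<ge> 0"
    and le: "\<And>t. t \<in> {a..b} \<Longrightarrow> norm (g t) \<le> h t + K * norm (z t)"
    and t: "t \<in> {a..b}"
  shows "norm (z t) \<le> (norm z1 + integral {a..b} h) * exp (K * (b - a))"
proof -
  have "norm (z (- (- t))) \<le> (norm z1 + integral {- b..- a} (\<lambda>s. h (- s))) * exp (K * (- a - (- b)))"
  proof (rule norm_integral_le_gronwall_forward[where z = "\<lambda>s. z (- s)" and g = "\<lambda>s. g (- s)" and t = "- t"])
    show "continuous_on {- b..- a} (\<lambda>s. z (- s))"
      by (rule continuous_on_compose2[OF z]) (auto intro!: continuous_intros)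
    show "z (- s) = z1 + integral {- b..s} (\<lambda>s. g (- s))" if "s \<in> {- b..- a}" for s
      using eq[of "- s"] Henstock_Kurzweil_Integration.integral_reflect_real[of b "- s" g] that by auto
    show "norm (g (- s)) \<le> h (- s) + K * norm (z (- s))" if "s \<in> {- b..- a}" for s
      using le[of "- s"] that by simp
  qed (use K t g h in auto)
  then show ?thesis by simp
qed

section \<open>Descent along a linearized trajectory\<close>

lemma bounded_measurable_on_interval:
  fixes g :: "real \<Rightarrow> 'a::euclidean_space"
  assumes g: "g \<in> borel_measurable (lebesgue_on {a..b})" and C: "\<And>t. t \<in> {a..b} \<Longrightarrow> norm (g t) \<le> C"
  shows integrable_lebesgue_on_bounded: "integrable (lebesgue_on {a..b}) g"
    and integrable_on_bounded: "g integrable_on {a..b}"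
    and lebesgue_on_integral_bounded: "integral\<^sup>L (lebesgue_on {a..b}) g = integral {a..b} g"
proof -
  interpret finite_measure "lebesgue_on {a..b}"
    by (rule finite_measure_lebesgue_on) simp
  show 1: "integrable (lebesgue_on {a..b}) g"
    by (rule integrable_const_bound[where B = C]) (use g C in \<open>auto intro!: AE_I2\<close>)
  then show "g integrable_on {a..b}"
    using has_integral_integral_lebesgue_on[OF 1] by (auto simp: integrable_on_def)
  show "integral\<^sup>L (lebesgue_on {a..b}) g = integral {a..b} g"
    by (rule lebesgue_integral_eq_integral[OF 1]) simp
qed

lemma continuous_on_interval_bound:
  fixes x :: "real \<Rightarrow> 'a::real_normed_vector"
  assumes "continuous_on {a..b} x"
  shows "\<exists>C\<ge>0. \<forall>t\<in>{a..b}. norm (x t) \<le> C"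
proof -
  have "bounded (x ` {a..b})"
    by (rule compact_imp_bounded, rule compact_continuous_image[OF assms]) simp
  then obtain C where "\<forall>t\<in>{a..b}. norm (x t) \<le> C" unfolding bounded_iff by auto
  then show ?thesis by (intro exI[of _ "\<bar>C\<bar>"]) force
qed

lemma continuous_on_interval_measurable:
  "continuous_on {a..b::real} x \<Longrightarrow> x \<in> borel_measurable (lebesgue_on {a..b})"
  by (rule continuous_imp_measurable_on_sets_lebesgue) auto

lemma measurable_along_process:
  fixes F :: "'a::euclidean_space \<times> 'b::euclidean_space \<Rightarrow> 'c::topological_space"
  assumes "continuous_on UNIV F"
    and "x \<in> borel_measurable M" "u \<in> borel_measurable M"
  shows "(\<lambda>t. F (x t, u t)) \<in> borel_measurable M"
  using measurable_compose[OF borel_measurable_Pair[OF assms(2,3)] borel_measurable_continuous_onI[OF assms(1)]] .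

lemma measurable_derivative_along_process:
  fixes F' :: "'a::euclidean_space \<times> 'b::euclidean_space \<Rightarrow> ('d::euclidean_space \<Rightarrow>\<^sub>L 'c::euclidean_space)"
  assumes F': "continuous_on UNIV F'"
    and "x \<in> borel_measurable M" "u \<in> borel_measurable M" "d \<in> borel_measurable M"
  shows "(\<lambda>t. F' (x t, u t) (d t)) \<in> borel_measurable M"
proof -
  have "continuous_on UNIV (\<lambda>(z, d). blinfun_apply (F' z) d)"
    unfolding case_prod_unfold by (intro continuous_intros continuous_on_compose2[OF F']) auto
  then have "(\<lambda>t. case ((x t, u t), d t) of (z, d) \<Rightarrow> blinfun_apply (F' z) d) \<in> borel_measurable M"
    by (rule measurable_along_process) (use assms in auto)
  then show ?thesis by simp
qed

text \<open>The mean value inequality for \<open>g - g' z\<close>, whose derivative near \<open>z\<close> is small by uniform continuity of \<open>g'\<close> on a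
  slightly larger ball.\<close>

lemma uniform_linear_approximation:
  fixes g :: "'a::euclidean_space \<Rightarrow> 'b::real_normed_vector"
  assumes der: "\<And>z. (g has_derivative blinfun_apply (g' z)) (at z)"
    and cont: "continuous_on UNIV g'" and \<eta>: "\<eta> > 0"
  obtains \<delta> where "\<delta> > 0"
    "\<And>z h. norm z \<le> R \<Longrightarrow> norm h < \<delta> \<Longrightarrow> norm (g (z + h) - g z - g' z h) \<le> \<eta> * norm h"
proof -
  have "uniformly_continuous_on (cball 0 (R + 1)) g'"
    by (rule compact_uniformly_continuous) (use continuous_on_subset[OF cont] in auto)
  then obtain \<delta> where \<delta>: "\<delta> > 0" "\<And>z w. z \<in> cball 0 (R + 1) \<Longrightarrow> w \<in> cball 0 (R + 1) \<Longrightarrow> dist w z < \<delta> \<Longrightarrow> dist (g' w) (g' z) < \<eta>"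
    using \<eta> unfolding uniformly_continuous_on_def by meson
  show ?thesis
  proof
    show "min \<delta> 1 > 0" using \<delta> by simp
    fix z h :: 'a assume z: "norm z \<le> R" and h: "norm h < min \<delta> 1"
    let ?S = "ball z (min \<delta> 1)"
    have "norm ((g (z + h) - g' z (z + h)) - (g z - g' z z)) \<le> \<eta> * norm ((z + h) - z)"
    proof (rule differentiable_bound[where S = ?S and f' = "\<lambda>w. blinfun_apply (g' w - g' z)"])
      fix w assume w: "w \<in> ?S"
      show "((\<lambda>w. g w - g' z w) has_derivative blinfun_apply (g' w - g' z)) (at w within ?S)"
        by (auto intro!: derivative_eq_intros has_derivative_at_withinI[OF der] simp: blinfun.diff_left)
      have "norm w \<le> R + 1"
        using w z norm_triangle_sub[of w z] by (auto simp: dist_norm norm_minus_commute)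
      then have "dist (g' w) (g' z) < \<eta>"
        using \<delta>(2)[of z w] z w by (auto simp: dist_commute)
      then show "onorm (blinfun_apply (g' w - g' z)) \<le> \<eta>"
        by (simp add: dist_norm norm_blinfun.rep_eq)
    qed (use h \<delta> in \<open>auto simp: dist_norm\<close>)
    then show "norm (g (z + h) - g z - g' z h) \<le> \<eta> * norm h"
      by (simp add: blinfun.add_right algebra_simps)
  qed
qed

lemma C1_lipschitz_on_ball:
  fixes g :: "'a::euclidean_space \<Rightarrow> 'b::real_normed_vector"
  assumes der: "\<And>z. (g has_derivative blinfun_apply (g' z)) (at z)"
    and cont: "continuous_on UNIV g'"
  obtains L where "L \<ge> 0" "\<And>z. norm z \<le> R \<Longrightarrow> norm (g' z) \<le> L"
    "\<And>z w. norm z \<le> R \<Longrightarrow> norm w \<le> R \<Longrightarrow> norm (g z - g w) \<le> L * norm (z - w)"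
proof -
  have "compact (g' ` cball 0 R)"
    by (intro compact_continuous_image continuous_on_subset[OF cont]) auto
  then obtain L where L: "\<And>z. z \<in> cball 0 R \<Longrightarrow> norm (g' z) \<le> L"
    using compact_imp_bounded[of "g' ` cball 0 R"] unfolding bounded_iff by blast
  show ?thesis
  proof
    show "\<bar>L\<bar> \<ge> 0" by simp
    show b: "norm (g' z) \<le> \<bar>L\<bar>" if "norm z \<le> R" for z using L[of z] that by simp
    show "norm (g z - g w) \<le> \<bar>L\<bar> * norm (z - w)" if "norm z \<le> R" "norm w \<le> R" for z w
    proof (rule differentiable_bound[where S = "cball 0 R" and f' = "\<lambda>w. blinfun_apply (g' w)"])
      show "(g has_derivative blinfun_apply (g' x)) (at x within cball 0 R)" for x
        by (rule has_derivative_at_withinI[OF der])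
      show "onorm (blinfun_apply (g' x)) \<le> \<bar>L\<bar>" if "x \<in> cball 0 R" for x
        using b[of x] that by (simp add: norm_blinfun.rep_eq)
    qed (use that in auto)
  qed
qed

text \<open>The control moves by \<open>\<theta> v\<close> and the trajectory is recomputed from the initial state \<open>x a + \<theta> y a\<close>; by Gronwall it
  stays within \<open>o(\<theta>)\<close> of \<open>x + \<theta> y\<close>. Then \<open>J\<close> changes by \<open>\<theta> J'(y a, y b) + o(\<theta>) < 0\<close>, while \<open>G\<close> becomes
  \<open>(1 - \<theta>) G + \<theta> (G + G'(y, v)) + o(\<theta>) \<le> - \<theta> c + o(\<theta>)\<close>.\<close>

lemma feasible_descent_from_linearization:
  fixes f :: "'a::euclidean_space \<times> 'b::euclidean_space \<Rightarrow> 'a"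
    and G :: "'a \<times> 'b \<Rightarrow> real" and J :: "'a \<times> 'a \<Rightarrow> real" and a b :: real
  assumes ab: "a < b"
    and f: "\<And>z. (f has_derivative blinfun_apply (f' z)) (at z)" "continuous_on UNIV f'"
    and G: "\<And>z. (G has_derivative blinfun_apply (G' z)) (at z)" "continuous_on UNIV G'"
    and J: "\<And>z. (J has_derivative blinfun_apply (J' z)) (at z)" "continuous_on UNIV J'"
    and x: "continuous_on {a..b} x" "\<And>t. t \<in> {a..b} \<Longrightarrow> x t = x a + integral {a..t} (\<lambda>s. f (x s, u s))"
    and u: "u \<in> borel_measurable (lebesgue_on {a..b})" "\<And>t. norm (u t) \<le> M"
    and Gle: "AE t in lebesgue_on {a..b}. G (x t, u t) \<le> 0"
    and v: "v \<in> borel_measurable (lebesgue_on {a..b})" "\<And>t. norm (v t) \<le> 1"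
    and y: "continuous_on {a..b} y"
      "\<And>t. t \<in> {a..b} \<Longrightarrow> y t = y a + integral {a..t} (\<lambda>s. f' (x s, u s) (y s, v s))"
    and Jneg: "J' (x a, x b) (y a, y b) < 0"
    and c: "c > 0" and Gneg: "AE t in lebesgue_on {a..b}. G (x t, u t) + G' (x t, u t) (y t, v t) \<le> - c"
    and \<epsilon>: "\<epsilon> > 0"
  obtains xx \<theta> where "0 < \<theta>" "\<theta> < \<epsilon>" "continuous_on {a..b} xx"
    "\<And>t. t \<in> {a..b} \<Longrightarrow> xx t = xx a + integral {a..t} (\<lambda>s. f (xx s, u s + \<theta> *\<^sub>R v s))"
    "\<And>t. t \<in> {a..b} \<Longrightarrow> norm (xx t - x t) < \<epsilon>"
    "AE t in lebesgue_on {a..b}. G (xx t, u t + \<theta> *\<^sub>R v t) \<le> 0"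
    "J (xx a, xx b) < J (x a, x b)"
proof -
  let ?L = "lebesgue_on {a..b}"
  have xm: "x \<in> borel_measurable ?L" and ym: "y \<in> borel_measurable ?L"
    using x(1) y(1) by (auto intro: continuous_on_interval_measurable)
  obtain X where X0: "X \<ge> 0" and X: "\<And>t. t \<in> {a..b} \<Longrightarrow> norm (x t) \<le> X"
    using continuous_on_interval_bound[OF x(1)] by blast
  define R where "R = 2 * X + M + 3"
  have M0: "M \<ge> 0" using u(2)[of a] norm_ge_zero order_trans by blast
  have normP: "norm (p, q) \<le> norm p + norm q" for p :: 'a and q :: "'d::real_normed_vector" by (rule norm_Pair_le)
  have xuR: "norm (x t + h, u t + k) \<le> R" if "t \<in> {a..b}" "norm h \<le> 1" "norm k \<le> 1" for t h k
    using normP[of "x t + h" "u t + k"] norm_triangle_ineq[of "x t" h] norm_triangle_ineq[of "u t" k]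
      X[OF that(1)] u(2)[of t] that X0 by (simp add: R_def)
  have xuR0: "norm (x t, u t) \<le> R" if "t \<in> {a..b}" for t
    using xuR[OF that, of 0 0] by simp
  have xiR: "norm (x a, x b) \<le> R"
    using normP[of "x a" "x b"] X[of a] X[of b] ab M0 by (simp add: R_def)
  obtain Lf where Lf: "Lf \<ge> 0" "\<And>z. norm z \<le> R \<Longrightarrow> norm (f' z) \<le> Lf"
    "\<And>z w. norm z \<le> R \<Longrightarrow> norm w \<le> R \<Longrightarrow> norm (f z - f w) \<le> Lf * norm (z - w)"
    using C1_lipschitz_on_ball[where R = R and g = f and g' = f', OF f] by metis
  obtain Lg where Lg: "Lg \<ge> 0" "\<And>z. norm z \<le> R \<Longrightarrow> norm (G' z) \<le> Lg"
    using C1_lipschitz_on_ball[where R = R and g = G and g' = G', OF G] by metis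
  define T where "T = b - a"
  have T: "T > 0" using ab by (simp add: T_def)
  define ex where "ex = exp (Lf * T)"
  have ex: "ex \<ge> 1" using Lf T by (simp add: ex_def)
  \<comment> \<open>The displacements of the state and of the process will be at most \<open>\<theta> * C1\<close> and \<open>\<theta> * C2\<close>,
    the deviation of the former from \<open>\<theta> *\<^sub>R y\<close> at most \<open>\<theta> * \<eta> * C3\<close>.\<close>
  define C1 where "C1 = (norm (y a) + Lf * T) * ex"
  define C2 where "C2 = C1 + 1"
  have C1: "C1 \<ge> 0" using Lf T ex by (simp add: C1_def)
  have C2: "C2 \<ge> 1" using C1 by (simp add: C2_def)
  define C3 where "C3 = C2 * T * ex"
  have C3: "C3 \<ge> 0" using C2 T ex by (simp add: C3_def)
  define d where "d = - J' (x a, x b) (y a, y b)"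
  have d: "d > 0" using Jneg by (simp add: d_def)
  \<comment> \<open>All errors of first order, divided by \<open>\<theta>\<close>, sum up to at most \<open>\<eta> * D\<close>, which \<open>\<eta>\<close> keeps below both margins.\<close>
  define D where "D = norm (J' (x a, x b)) * (2 * C3) + 2 * C1 + Lg * C3 + C2 + 1"
  have D: "D > 0" "norm (J' (x a, x b)) * (2 * C3) + 2 * C1 < D" "Lg * C3 + C2 \<le> D"
    using C1 C2 C3 Lg by (auto simp: D_def intro!: add_nonneg_pos add_nonneg_nonneg)
  define \<eta> where "\<eta> = min d c / D"
  have \<eta>: "\<eta> > 0" "\<eta> * D \<le> d" "\<eta> * D \<le> c" using d c D by (auto simp: \<eta>_def)
  obtain \<delta>f where \<delta>f: "\<delta>f > 0" "\<And>z h. norm z \<le> R \<Longrightarrow> norm h < \<delta>f \<Longrightarrow> norm (f (z + h) - f z - f' z h) \<le> \<eta> * norm h"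
    using uniform_linear_approximation[where R = R and g = f and g' = f', OF f \<eta>(1)] by metis
  obtain \<delta>G where \<delta>G: "\<delta>G > 0" "\<And>z h. norm z \<le> R \<Longrightarrow> norm h < \<delta>G \<Longrightarrow> norm (G (z + h) - G z - G' z h) \<le> \<eta> * norm h"
    using uniform_linear_approximation[where R = R and g = G and g' = G', OF G \<eta>(1)] by metis
  obtain \<delta>J where \<delta>J: "\<delta>J > 0" "\<And>z h. norm z \<le> R \<Longrightarrow> norm h < \<delta>J \<Longrightarrow> norm (J (z + h) - J z - J' z h) \<le> \<eta> * norm h"
    using uniform_linear_approximation[where R = R and g = J and g' = J', OF J \<eta>(1)] by metis
  define m where "m = min (min \<epsilon> 1) (min \<delta>f (min \<delta>G \<delta>J))"
  have m: "m > 0" using \<epsilon> \<delta>f \<delta>G \<delta>J by (simp add: m_def)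
  define \<theta> where "\<theta> = m / (3 * C2)"
  have \<theta>: "\<theta> > 0" using m C2 by (simp add: \<theta>_def)
  have \<theta>m: "\<theta> * C2 * 3 = m" using C2 by (simp add: \<theta>_def)
  have \<theta>C2: "\<theta> * C2 \<ge> \<theta>" using C2 \<theta> mult_left_mono[of 1 C2 \<theta>] by simp
  have "\<theta> * C1 \<le> \<theta> * C2" using \<theta> by (simp add: C2_def)
  then have \<theta>': "\<theta> < 1" "\<theta> < \<epsilon>" "\<theta> * C1 < \<epsilon>" "\<theta> * C1 \<le> 1" "\<theta> * C2 < \<delta>f" "\<theta> * C2 < \<delta>G" "2 * (\<theta> * C1) < \<delta>J"
    using \<theta>m \<theta>C2 m \<theta> unfolding m_def by linarith+

  \<comment> \<open>The right-hand side is evaluated only within distance \<open>1\<close> of \<open>x t\<close>, which makes it globally Lipschitz.\<close>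
  define P where "P = closest_point (cball (0::'a) 1)"
  have P1: "norm (P h) \<le> 1" for h using closest_point_in_set[of "cball (0::'a) 1" h] by (simp add: P_def)
  have Plip: "norm (P h - P k) \<le> norm (h - k)" for h k
    using closest_point_lipschitz[of "cball (0::'a) 1" h k] by (simp add: P_def dist_norm)
  have Pid: "P h = h" if "norm h \<le> 1" for h
    using closest_point_self[of h "cball (0::'a) 1"] that by (simp add: P_def)
  have P0: "P 0 = 0" using Pid[of 0] by simp
  have Pcont: "continuous_on S P" for S unfolding P_def by (rule continuous_on_closest_point) auto
  have vth: "norm (\<theta> *\<^sub>R v t) \<le> \<theta>" for t
    using v(2)[of t] \<theta> mult_left_le[of "norm (v t)" \<theta>] by auto
  have vth1: "norm (\<theta> *\<^sub>R v t) \<le> 1" for t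
    using vth[of t] \<theta>' by linarith
  define F where "F t z = f (x t + P (z - x t), u t + \<theta> *\<^sub>R v t)" for t z
  have fcont: "continuous_on UNIV f" using f(1) has_derivative_continuous by (blast intro: continuous_at_imp_continuous_on)
  have Gcont: "continuous_on UNIV G" using G(1) has_derivative_continuous by (blast intro: continuous_at_imp_continuous_on)
  have uth: "(\<lambda>t. u t + \<theta> *\<^sub>R v t) \<in> borel_measurable ?L" using u v by measurable
  have "compact (f ` cball 0 R)" by (intro compact_continuous_image continuous_on_subset[OF fcont]) auto
  then have "\<exists>C. \<forall>z. norm z \<le> R \<longrightarrow> norm (f z) \<le> C"
    using compact_imp_bounded[of "f ` cball 0 R"] unfolding bounded_iff by (metis image_eqI mem_cball_0)
  then obtain Cf where Cf: "\<And>z. norm z \<le> R \<Longrightarrow> norm (f z) \<le> Cf" by blast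
  have Fint: "(\<lambda>t. F t (z t)) integrable_on {a..b}" if z: "continuous_on {a..b} z" for z
  proof (rule integrable_on_bounded[where C = Cf])
    show "(\<lambda>t. F t (z t)) \<in> borel_measurable ?L"
      unfolding F_def
      by (intro measurable_along_process[OF fcont] uth continuous_on_interval_measurable)
         (auto intro!: continuous_intros continuous_on_compose2[OF Pcont[of UNIV]] x z)
    show "norm (F t (z t)) \<le> Cf" if "t \<in> {a..b}" for t
      unfolding F_def by (rule Cf, rule xuR) (use that P1 vth1 in auto)
  qed
  have Flip: "norm (F t z - F t w) \<le> Lf * norm (z - w)" if t: "t \<in> {a..b}" for t z w
  proof -
    have "norm (F t z - F t w) \<le> Lf * norm ((x t + P (z - x t), u t + \<theta> *\<^sub>R v t) - (x t + P (w - x t), u t + \<theta> *\<^sub>R v t))"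
      unfolding F_def by (rule Lf) (use t P1 vth1 in \<open>auto intro!: xuR\<close>)
    also have "\<dots> \<le> Lf * norm (z - w)"
      by (intro mult_left_mono Lf) (use Plip[of "z - x t" "w - x t"] in \<open>simp add: norm_Pair\<close>)
    finally show ?thesis .
  qed
  obtain xx where xx: "continuous_on {a..b} xx"
    "\<And>t. t \<in> {a..b} \<Longrightarrow> xx t = (x a + \<theta> *\<^sub>R y a) + integral {a..t} (\<lambda>s. F s (xx s))"
    using caratheodory_forward[of a b F Lf "x a + \<theta> *\<^sub>R y a"] ab Fint Flip by (metis less_imp_le)
  have xxa: "xx a = x a + \<theta> *\<^sub>R y a" using xx(2)[of a] ab by simp
  have sub: "g integrable_on {a..t}" if "g integrable_on {a..b}" "t \<in> {a..b}" for g :: "real \<Rightarrow> 'a" and t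
    using integrable_on_subinterval[OF that(1), of a t] that by auto
  have fint: "(\<lambda>t. f (x t, u t)) integrable_on {a..b}"
    by (rule integrable_on_bounded[where C = Cf]) (use measurable_along_process[OF fcont xm u(1)] xuR0 Cf in auto)
  have f'int: "(\<lambda>t. f' (x t, u t) (y t, v t)) integrable_on {a..b}"
  proof -
    obtain Y where "Y \<ge> 0" and Y: "\<And>t. t \<in> {a..b} \<Longrightarrow> norm (y t) \<le> Y"
      using continuous_on_interval_bound[OF y(1)] by blast
    show ?thesis
    proof (rule integrable_on_bounded[where C = "Lf * (Y + 1)"])
      show "(\<lambda>t. f' (x t, u t) (y t, v t)) \<in> borel_measurable ?L"
        by (intro measurable_derivative_along_process f xm u borel_measurable_Pair ym v)
      fix t assume t: "t \<in> {a..b}"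
      have "norm (f' (x t, u t) (y t, v t)) \<le> norm (f' (x t, u t)) * norm (y t, v t)" by (rule norm_blinfun)
      also have "\<dots> \<le> Lf * (Y + 1)"
        using Lf(2)[OF xuR0[OF t]] normP[of "y t" "v t"] Y[OF t] v(2)[of t] Lf(1) by (intro mult_mono) auto
      finally show "norm (f' (x t, u t) (y t, v t)) \<le> Lf * (Y + 1)" .
    qed
  qed

  \<comment> \<open>The displacement is of order \<open>\<theta>\<close>, hence the truncation \<open>P\<close> is never active.\<close>
  define Z1 where "Z1 t = xx t - x t" for t
  have Z1c: "continuous_on {a..b} Z1" unfolding Z1_def by (intro continuous_intros xx x)
  have Z1: "norm (Z1 t) \<le> \<theta> * C1" if t: "t \<in> {a..b}" for t
  proof -
    have "norm (Z1 t) \<le> (norm (\<theta> *\<^sub>R y a) + integral {a..b} (\<lambda>_. Lf * \<theta>)) * exp (Lf * (b - a))"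
    proof (rule norm_integral_le_gronwall_forward[OF Z1c Lf(1) _ _ _ _ _ t])
      show "(\<lambda>s. F s (xx s) - f (x s, u s)) integrable_on {a..b}"
        by (intro integrable_diff Fint xx fint)
      show "Z1 s = \<theta> *\<^sub>R y a + integral {a..s} (\<lambda>s. F s (xx s) - f (x s, u s))" if s: "s \<in> {a..b}" for s
        unfolding Z1_def using xx(2)[OF s] x(2)[OF s] integral_diff[OF sub[OF Fint[OF xx(1)] s] sub[OF fint s]]
        by (simp add: algebra_simps)
      fix s assume s: "s \<in> {a..b}"
      have "norm (F s (xx s) - f (x s, u s)) \<le> Lf * norm ((x s + P (xx s - x s), u s + \<theta> *\<^sub>R v s) - (x s, u s))"
        unfolding F_def by (rule Lf) (use s P1 vth1 xuR0 in \<open>auto intro!: xuR\<close>)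
      also have "\<dots> \<le> Lf * (norm (Z1 s) + \<theta>)"
        using normP[of "P (xx s - x s)" "\<theta> *\<^sub>R v s"] Plip[of "xx s - x s" 0] P0 vth[of s]
        by (intro mult_left_mono Lf) (simp add: Z1_def)
      finally show "norm (F s (xx s) - f (x s, u s)) \<le> Lf * \<theta> + Lf * norm (Z1 s)" by (simp add: algebra_simps)
    qed (use Lf \<theta> in auto)
    also have "\<dots> = \<theta> * C1" using ab \<theta> by (simp add: C1_def ex_def T_def algebra_simps)
    finally show ?thesis .
  qed
  have Z1': "norm (Z1 t) \<le> 1" if "t \<in> {a..b}" for t using Z1[OF that] \<theta>' by linarith
  have Feq: "F t (xx t) = f (xx t, u t + \<theta> *\<^sub>R v t)" if "t \<in> {a..b}" for t
    using Pid[OF Z1'[OF that]] by (simp add: F_def Z1_def)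
  have xx': "xx t = xx a + integral {a..t} (\<lambda>s. f (xx s, u s + \<theta> *\<^sub>R v s))" if t: "t \<in> {a..b}" for t
    using xx(2)[OF t] xxa t integral_cong[of "{a..t}" "\<lambda>s. F s (xx s)" "\<lambda>s. f (xx s, u s + \<theta> *\<^sub>R v s)"] Feq
    by auto
  have disp: "norm (Z1 t, \<theta> *\<^sub>R v t) \<le> \<theta> * C2" if t: "t \<in> {a..b}" for t
    using normP[of "Z1 t" "\<theta> *\<^sub>R v t"] Z1[OF t] vth[of t] by (simp add: C2_def algebra_simps)
  have xxu: "(xx t, u t + \<theta> *\<^sub>R v t) = (x t, u t) + (Z1 t, \<theta> *\<^sub>R v t)" for t by (simp add: Z1_def)

  \<comment> \<open>The displacement differs from its linear part by \<open>o(\<theta>)\<close>.\<close>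
  define Z where "Z t = Z1 t - \<theta> *\<^sub>R y t" for t
  have Zc: "continuous_on {a..b} Z" unfolding Z_def by (intro continuous_intros Z1c y)
  have Z: "norm (Z t) \<le> \<theta> * \<eta> * C3" if t: "t \<in> {a..b}" for t
  proof -
    let ?g = "\<lambda>s. F s (xx s) - f (x s, u s) - \<theta> *\<^sub>R f' (x s, u s) (y s, v s)"
    have "norm (Z t) \<le> (norm (0::'a) + integral {a..b} (\<lambda>_. \<eta> * (\<theta> * C2))) * exp (Lf * (b - a))"
    proof (rule norm_integral_le_gronwall_forward[OF Zc Lf(1) _ _ _ _ _ t])
      show "?g integrable_on {a..b}"
        by (intro integrable_diff Fint xx fint f'int integrable_cmul)
      show "Z s = 0 + integral {a..s} ?g" if s: "s \<in> {a..b}" for s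
      proof -
        have "integral {a..s} ?g = integral {a..s} (\<lambda>s. F s (xx s)) - integral {a..s} (\<lambda>s. f (x s, u s))
            - \<theta> *\<^sub>R integral {a..s} (\<lambda>s. f' (x s, u s) (y s, v s))"
          using integral_diff[OF integrable_diff[OF sub[OF Fint[OF xx(1)] s] sub[OF fint s]] integrable_cmul[OF sub[OF f'int s]]]
            integral_diff[OF sub[OF Fint[OF xx(1)] s] sub[OF fint s]] by simp
        then show ?thesis
          unfolding Z_def Z1_def using xx(2)[OF s] x(2)[OF s] y(2)[OF s] by (simp add: algebra_simps)
      qed
      fix s assume s: "s \<in> {a..b}"
      have "?g s = (f ((x s, u s) + (Z1 s, \<theta> *\<^sub>R v s)) - f (x s, u s) - f' (x s, u s) (Z1 s, \<theta> *\<^sub>R v s))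
          + f' (x s, u s) (Z s, 0)"
      proof -
        have "(Z s, 0) = (Z1 s, \<theta> *\<^sub>R v s) - \<theta> *\<^sub>R (y s, v s)" by (simp add: Z_def)
        then have "f' (x s, u s) (Z s, 0) = f' (x s, u s) (Z1 s, \<theta> *\<^sub>R v s) - \<theta> *\<^sub>R f' (x s, u s) (y s, v s)"
          by (simp only: blinfun.diff_right blinfun.scaleR_right)
        then show ?thesis using Feq[OF s] unfolding xxu by simp
      qed
      also have "norm \<dots> \<le> \<eta> * norm (Z1 s, \<theta> *\<^sub>R v s) + norm (f' (x s, u s)) * norm (Z s, 0::'b)"
        by (rule norm_triangle_mono[OF \<delta>f(2) norm_blinfun]) (use xuR0[OF s] disp[OF s] \<theta>' in auto)
      also have "\<dots> \<le> \<eta> * (\<theta> * C2) + Lf * norm (Z s)"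
        using disp[OF s] \<eta>(1) Lf(1) Lf(2)[OF xuR0[OF s]] by (intro add_mono mult_mono) (auto simp: norm_Pair)
      finally show "norm (?g s) \<le> \<eta> * (\<theta> * C2) + Lf * norm (Z s)" .
    qed (use \<eta> \<theta> C2 in auto)
    also have "\<dots> = \<theta> * \<eta> * C3" using ab by (simp add: C3_def ex_def T_def algebra_simps)
    finally show ?thesis .
  qed

  have Jdec: "J (xx a, xx b) < J (x a, x b)"
  proof -
    have aI: "a \<in> {a..b}" "b \<in> {a..b}" using ab by auto
    have n: "norm (Z1 a, Z1 b) \<le> 2 * (\<theta> * C1)" using normP[of "Z1 a" "Z1 b"] Z1[OF aI(1)] Z1[OF aI(2)] by simp
    have "(xx a, xx b) = (x a, x b) + (Z1 a, Z1 b)" by (simp add: Z1_def)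
    then have "norm (J (xx a, xx b) - J (x a, x b) - J' (x a, x b) (Z1 a, Z1 b)) \<le> \<eta> * norm (Z1 a, Z1 b)"
      using \<delta>J(2)[OF xiR, of "(Z1 a, Z1 b)"] n \<theta>' by simp
    also have "\<dots> \<le> \<eta> * (2 * (\<theta> * C1))" using n \<eta> by (intro mult_left_mono) auto
    finally have 1: "J (xx a, xx b) - J (x a, x b) \<le> J' (x a, x b) (Z1 a, Z1 b) + \<eta> * (2 * (\<theta> * C1))" by (simp add: abs_le_iff)
    have "(Z1 a, Z1 b) = (Z a, Z b) + \<theta> *\<^sub>R (y a, y b)" by (simp add: Z_def)
    then have "J' (x a, x b) (Z1 a, Z1 b) = J' (x a, x b) (Z a, Z b) - \<theta> * d"
      by (simp only: blinfun.add_right blinfun.scaleR_right) (simp add: d_def)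
    moreover have "J' (x a, x b) (Z a, Z b) \<le> norm (J' (x a, x b)) * (2 * (\<theta> * \<eta> * C3))"
    proof -
      have "J' (x a, x b) (Z a, Z b) \<le> norm (J' (x a, x b)) * norm (Z a, Z b)"
        using norm_blinfun[of "J' (x a, x b)" "(Z a, Z b)"] by simp
      also have "\<dots> \<le> norm (J' (x a, x b)) * (2 * (\<theta> * \<eta> * C3))"
        using normP[of "Z a" "Z b"] Z[OF aI(1)] Z[OF aI(2)] by (intro mult_left_mono) auto
      finally show ?thesis .
    qed
    ultimately have "J (xx a, xx b) - J (x a, x b) \<le> \<theta> * (\<eta> * (norm (J' (x a, x b)) * (2 * C3) + 2 * C1) - d)"
      using 1 by (simp add: algebra_simps)
    also have "\<dots> < 0"
    proof (rule mult_pos_neg[OF \<theta>])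
      have "\<eta> * (norm (J' (x a, x b)) * (2 * C3) + 2 * C1) < \<eta> * D" using D \<eta> by simp
      then show "\<eta> * (norm (J' (x a, x b)) * (2 * C3) + 2 * C1) - d < 0" using \<eta> by linarith
    qed
    finally show ?thesis by simp
  qed

  have "AE t in ?L. G (xx t, u t + \<theta> *\<^sub>R v t) \<le> 0"
    using Gle Gneg AE_space
  proof eventually_elim
    case (elim t)
    then have t: "t \<in> {a..b}" by simp
    have "norm (G ((x t, u t) + (Z1 t, \<theta> *\<^sub>R v t)) - G (x t, u t) - G' (x t, u t) (Z1 t, \<theta> *\<^sub>R v t)) \<le> \<eta> * norm (Z1 t, \<theta> *\<^sub>R v t)"
      by (rule \<delta>G(2)[OF xuR0[OF t]]) (use disp[OF t] \<theta>' in auto)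
    also have "\<dots> \<le> \<eta> * (\<theta> * C2)" using disp[OF t] \<eta> by (intro mult_left_mono) auto
    finally have 1: "G (xx t, u t + \<theta> *\<^sub>R v t) \<le> G (x t, u t) + G' (x t, u t) (Z1 t, \<theta> *\<^sub>R v t) + \<eta> * (\<theta> * C2)"
      unfolding xxu by (simp add: abs_le_iff)
    have "(Z1 t, \<theta> *\<^sub>R v t) = (Z t, 0) + \<theta> *\<^sub>R (y t, v t)" by (simp add: Z_def)
    then have 2: "G' (x t, u t) (Z1 t, \<theta> *\<^sub>R v t) = G' (x t, u t) (Z t, 0) + \<theta> * G' (x t, u t) (y t, v t)"
      by (simp only: blinfun.add_right blinfun.scaleR_right) simp
    have "G' (x t, u t) (Z t, 0) \<le> norm (G' (x t, u t)) * norm (Z t, 0::'b)"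
      using norm_blinfun[of "G' (x t, u t)" "(Z t, 0)"] by simp
    also have "\<dots> \<le> Lg * (\<theta> * \<eta> * C3)"
      using Lg(2)[OF xuR0[OF t]] Z[OF t] Lg(1) by (intro mult_mono) (auto simp: norm_Pair)
    finally have 3: "G' (x t, u t) (Z t, 0) \<le> Lg * (\<theta> * \<eta> * C3)" .
    have "(1 - \<theta>) * G (x t, u t) \<le> 0" using elim \<theta>' by (intro mult_nonneg_nonpos) auto
    moreover have "\<theta> * (G (x t, u t) + G' (x t, u t) (y t, v t)) \<le> \<theta> * (- c)"
      using elim \<theta> by (intro mult_left_mono) auto
    ultimately have "G (xx t, u t + \<theta> *\<^sub>R v t) \<le> \<theta> * (\<eta> * (Lg * C3 + C2) - c)"
      using 1 2 3 by (simp add: algebra_simps)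
    also have "\<dots> \<le> 0"
    proof (rule mult_nonneg_nonpos)
      have "\<eta> * (Lg * C3 + C2) \<le> \<eta> * D" using D \<eta> by (intro mult_left_mono) auto
      then show "\<eta> * (Lg * C3 + C2) - c \<le> 0" using \<eta> by linarith
    qed (use \<theta> in simp)
    finally show ?case .
  qed
  moreover have "norm (xx t - x t) < \<epsilon>" if "t \<in> {a..b}" for t
    using Z1[OF that] \<theta>' by (simp add: Z1_def)
  ultimately show ?thesis using that \<theta> \<theta>'(2) xx(1) xx' Jdec by blast
qed

section \<open>Minimization over a ball of processes\<close>

text \<open>Pairs of an initial state and a control. The bound on the control is imposed at every point, so that no exceptional
  null sets have to be carried along.\<close>

definition unit_processes :: "real measure \<Rightarrow> ('a::euclidean_space \<times> (real \<Rightarrow> 'b::euclidean_space)) set" where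
  "unit_processes M = {(e, v). norm e \<le> 1 \<and> v \<in> borel_measurable M \<and> (\<forall>t. norm (v t) \<le> 1)}"

lemma unit_processes_convex:
  assumes "(e, v) \<in> unit_processes M" "(e', v') \<in> unit_processes M" "0 \<le> \<theta>" "\<theta> \<le> 1"
  shows "((1 - \<theta>) *\<^sub>R e + \<theta> *\<^sub>R e', \<lambda>t. (1 - \<theta>) *\<^sub>R v t + \<theta> *\<^sub>R v' t) \<in> unit_processes M"
proof -
  have "norm ((1 - \<theta>) *\<^sub>R x + \<theta> *\<^sub>R y) \<le> 1" if "norm x \<le> 1" "norm y \<le> 1" for x y :: "'z::real_normed_vector"
    using convexD[OF convex_cball, of x "0::'z" 1 y "1 - \<theta>" \<theta>] that assms(3,4) by simp
  note c = this
  show ?thesis using assms unfolding unit_processes_def by (auto intro!: c)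
qed

text \<open>The direct method without weak topologies. Among processes that are nearly minimal for \<open>\<Theta>\<close> one picks those of nearly
  minimal \<open>L\<^sup>2\<close> norm. As the sublevel sets of \<open>\<Theta>\<close> are stable under midpoints, the parallelogram law makes such a
  sequence Cauchy in \<open>L\<^sup>2\<close>, so a subsequence converges almost everywhere, which is the convergence for which \<open>\<Theta>\<close>
  is assumed to be continuous.\<close>

lemma minimizer_on_unit_processes:
  fixes \<Theta> :: "'a::euclidean_space \<Rightarrow> (real \<Rightarrow> 'b::euclidean_space) \<Rightarrow> real" and M :: "real measure"
  assumes M: "finite_measure M"
    and nonneg: "\<And>e v. (e, v) \<in> unit_processes M \<Longrightarrow> \<Theta> e v \<ge> 0"
    and mid: "\<And>e v e' v'. (e, v) \<in> unit_processes M \<Longrightarrow> (e', v') \<in> unit_processes M \<Longrightarrow>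
       \<Theta> ((1 - 1/2) *\<^sub>R e + (1/2) *\<^sub>R e') (\<lambda>t. (1 - 1/2) *\<^sub>R v t + (1/2) *\<^sub>R v' t) \<le> max (\<Theta> e v) (\<Theta> e' v')"
    and cont: "\<And>E V e v. (\<And>n. (E n, V n) \<in> unit_processes M) \<Longrightarrow> (e, v) \<in> unit_processes M \<Longrightarrow>
       E \<longlonglongrightarrow> e \<Longrightarrow> (AE t in M. (\<lambda>n. V n t) \<longlonglongrightarrow> v t) \<Longrightarrow> (\<lambda>n. \<Theta> (E n) (V n)) \<longlonglongrightarrow> \<Theta> e v"
  obtains e v where "(e, v) \<in> unit_processes M"
    "\<And>e' v'. (e', v') \<in> unit_processes M \<Longrightarrow> \<Theta> e v \<le> \<Theta> e' v'"
proof -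
  interpret finite_measure M by (rule M)
  define W where "W = (unit_processes M :: ('a \<times> (real \<Rightarrow> 'b)) set)"
  have WI: "(0, \<lambda>_. 0) \<in> W" by (simp add: W_def unit_processes_def)
  define d where "d = (INF w\<in>W. \<Theta> (fst w) (snd w))"
  have bdd: "bdd_below ((\<lambda>w. \<Theta> (fst w) (snd w)) ` W)"
    by (rule bdd_belowI2[of _ 0]) (use nonneg in \<open>auto simp: W_def\<close>)
  have dle: "d \<le> \<Theta> e v" if "(e, v) \<in> W" for e v
    unfolding d_def using cINF_lower[OF bdd that] by simp
  define eps where "eps n = 1 / real (Suc n)" for n
  have eps: "eps n > 0" "n \<le> m \<Longrightarrow> eps m \<le> eps n" for n m by (auto simp: eps_def field_simps)
  have eps0: "eps \<longlonglongrightarrow> 0" unfolding eps_def by (rule LIMSEQ_Suc[OF lim_1_over_n])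
  define C where "C n = {w\<in>W. \<Theta> (fst w) (snd w) \<le> d + eps n}" for n
  have Cne: "C n \<noteq> {}" for n
  proof -
    have "\<exists>w\<in>W. \<Theta> (fst w) (snd w) < d + eps n"
      using cINF_less_iff[of W "\<lambda>w. \<Theta> (fst w) (snd w)" "d + eps n"] WI eps(1)[of n] bdd
      unfolding d_def[symmetric] by auto
    then show ?thesis by (force simp: C_def)
  qed
  have Cmono: "C m \<subseteq> C n" if "n \<le> m" for n m using eps(2)[OF that] by (auto simp: C_def)
  define N where "N w = (norm (fst w))\<^sup>2 + (\<integral>t. (norm (snd w t))\<^sup>2 \<partial>M)" for w :: "'a \<times> (real \<Rightarrow> 'b)"
  have N0: "N w \<ge> 0" for w by (simp add: N_def)
  have Wm: "snd w \<in> borel_measurable M" "norm (snd w t) \<le> 1" "norm (fst w) \<le> 1" if "w \<in> W" for w t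
    using that by (auto simp: W_def unit_processes_def)
  have int_le: "integrable M h" if "h \<in> borel_measurable M" "\<And>t. \<bar>h t\<bar> \<le> c" for h :: "real \<Rightarrow> real" and c
    by (rule integrable_const_bound[where B = c]) (use that in auto)
  have sq4: "(norm (x - y))\<^sup>2 \<le> 4" if "norm x \<le> 1" "norm y \<le> 1" for x y :: "'z::real_normed_vector"
    using norm_triangle_ineq4[of x y] that power_mono[of "norm (x - y)" 2 2] by simp
  have Nle: "N w \<le> 1 + measure M (space M)" if "w \<in> W" for w
  proof -
    have "(\<integral>t. (norm (snd w t))\<^sup>2 \<partial>M) \<le> (\<integral>t. 1 \<partial>M)"
      by (intro integral_mono int_le[where c = 1]) (use Wm[OF that] in \<open>auto intro!: power_le_one\<close>)
    then show ?thesis using Wm(3)[OF that] by (auto simp: N_def intro!: add_mono power_le_one)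
  qed
  define diff where "diff w w' = (fst w - fst w', \<lambda>t. snd w t - snd w' t)" for w w' :: "'a \<times> (real \<Rightarrow> 'b)"
  define midp where "midp w w' = ((1 - 1/2) *\<^sub>R fst w + (1/2) *\<^sub>R fst w', \<lambda>t. (1 - 1/2) *\<^sub>R snd w t + (1/2) *\<^sub>R snd w' t)"
    for w w' :: "'a \<times> (real \<Rightarrow> 'b)"
  have par: "N (diff w w') = 2 * N w + 2 * N w' - 4 * N (midp w w')" if w: "w \<in> W" "w' \<in> W" for w w'
  proof -
    have p: "(norm (x - y))\<^sup>2 = 2 * (norm x)\<^sup>2 + 2 * (norm y)\<^sup>2 - 4 * (norm ((1 - 1/2) *\<^sub>R x + (1/2) *\<^sub>R y))\<^sup>2"
      for x y :: "'z::real_inner"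
    proof -
      have "(1 - 1/2) *\<^sub>R x + (1/2) *\<^sub>R y = (1/2) *\<^sub>R (x + y)" by (simp add: scaleR_add_right)
      then show ?thesis
        by (simp add: power2_norm_eq_inner inner_simps inner_commute power_divide algebra_simps)
    qed
    have i1: "integrable M (\<lambda>t. (norm (snd w t))\<^sup>2)" if "w \<in> W" for w
      by (rule int_le[where c = 1]) (use Wm[OF that] in \<open>auto intro!: power_le_one\<close>)
    have mW: "midp w w' \<in> W"
      using unit_processes_convex[of "fst w" "snd w" M "fst w'" "snd w'" "1/2"] w by (simp add: W_def midp_def)
    have "(\<integral>t. (norm (snd w t - snd w' t))\<^sup>2 \<partial>M) = (\<integral>t. 2 * (norm (snd w t))\<^sup>2 + 2 * (norm (snd w' t))\<^sup>2 - 4 * (norm (snd (midp w w') t))\<^sup>2 \<partial>M)"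
      by (intro Bochner_Integration.integral_cong refl) (simp add: midp_def p)
    also have "\<dots> = 2 * (\<integral>t. (norm (snd w t))\<^sup>2 \<partial>M) + 2 * (\<integral>t. (norm (snd w' t))\<^sup>2 \<partial>M) - 4 * (\<integral>t. (norm (snd (midp w w') t))\<^sup>2 \<partial>M)"
      using i1[OF w(1)] i1[OF w(2)] i1[OF mW] by simp
    finally show ?thesis using p[of "fst w" "fst w'"] by (simp add: N_def diff_def midp_def algebra_simps)
  qed
  have midC: "midp w w' \<in> C n" if "w \<in> C n" "w' \<in> C n" for w w' n
    using that mid[of "fst w" "snd w" "fst w'" "snd w'"] unit_processes_convex[of "fst w" "snd w" M "fst w'" "snd w'" "1/2"]
    by (auto simp: C_def W_def midp_def)
  \<comment> \<open>The infima of \<open>N\<close> over the shrinking sets \<open>C n\<close> increase to a finite limit \<open>\<rho>\<close>; the gaps \<open>\<rho> - r n\<close> control the Cauchy estimate.\<close>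
  define r where "r n = (INF w\<in>C n. N w)" for n
  have bddN: "bdd_below (N ` C n)" for n by (rule bdd_belowI2[of _ 0]) (use N0 in auto)
  have rle: "r n \<le> N w" if "w \<in> C n" for w n unfolding r_def by (rule cINF_lower[OF bddN that])
  have rmono: "incseq r"
    by (rule incseq_SucI, unfold r_def, rule cINF_superset_mono[OF Cne bddN Cmono]) auto
  have rb: "r n \<le> 1 + measure M (space M)" for n
  proof -
    obtain w where w: "w \<in> C n" using Cne by blast
    then have "w \<in> W" by (simp add: C_def)
    then show ?thesis using rle[OF w] Nle[of w] by linarith
  qed
  obtain \<rho> where \<rho>: "r \<longlonglongrightarrow> \<rho>" "\<And>n. r n \<le> \<rho>" using incseq_convergent[OF rmono, of "1 + measure M (space M)"] rb by auto
  have "\<exists>w\<in>C n. N w < r n + eps n" for n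
    using cINF_less_iff[OF Cne[of n] bddN[of n], of "r n + eps n"] eps(1)[of n] unfolding r_def[symmetric] by auto
  then obtain w where w: "\<And>n. w n \<in> C n" "\<And>n. N (w n) < r n + eps n" by metis
  have wW: "w n \<in> W" for n using w by (auto simp: C_def)
  define q where "q n = 2 * (\<rho> - r n) + 4 * eps n" for n
  have q: "N (diff (w n) (w m)) \<le> q n" if "n \<le> m" for n m
  proof -
    have "midp (w n) (w m) \<in> C n" by (rule midC) (use w Cmono[OF that] in auto)
    then have "N (diff (w n) (w m)) \<le> 2 * N (w n) + 2 * N (w m) - 4 * r n"
      using par[OF wW wW, of n m] rle by fastforce
    also have "\<dots> \<le> q n" using w(2)[of n] w(2)[of m] eps(2)[OF that] \<rho>(2)[of m] unfolding q_def by (simp add: algebra_simps)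
    finally show ?thesis .
  qed
  have q0: "q \<longlonglongrightarrow> 0"
    unfolding q_def using tendsto_add[OF tendsto_mult[OF tendsto_const tendsto_diff[OF tendsto_const \<rho>(1)]] tendsto_mult[OF tendsto_const eps0], of 2 \<rho> 4]
    by simp
  have qsym: "\<exists>n0. \<forall>i\<ge>n0. \<forall>j\<ge>n0. N (diff (w i) (w j)) < \<eta>" if \<eta>: "\<eta> > 0" for \<eta>
  proof -
    obtain n0 where n0: "\<And>n. n \<ge> n0 \<Longrightarrow> q n < \<eta>"
      using order_tendstoD(2)[OF q0 \<eta>] by (auto simp: eventually_sequentially)
    have "N (diff (w i) (w j)) < \<eta>" if "i \<ge> n0" "j \<ge> n0" for i j
    proof (cases "i \<le> j")
      case True then show ?thesis using q[of i j] n0[of i] that by linarith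
    next
      case False
      moreover have "N (diff (w i) (w j)) = N (diff (w j) (w i))" by (simp add: N_def diff_def norm_minus_commute)
      ultimately show ?thesis using q[of j i] n0[of j] that by simp
    qed
    then show ?thesis by blast
  qed
  have dI: "integrable M (\<lambda>t. (norm (snd (w i) t - snd (w j) t))\<^sup>2)" for i j
    by (rule int_le[where c = 4]) (use Wm[OF wW] in \<open>auto intro!: sq4\<close>)
  have dI1: "integrable M (\<lambda>t. norm (snd (w i) t - snd (w j) t))" for i j
  proof (rule int_le[where c = 2])
    show "\<bar>norm (snd (w i) t - snd (w j) t)\<bar> \<le> 2" for t
      using norm_triangle_ineq4[of "snd (w i) t" "snd (w j) t"] Wm(2)[OF wW, of i t] Wm(2)[OF wW, of j t] by simp
  qed (use Wm(1)[OF wW] in auto)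
  have Ecauchy: "Cauchy (\<lambda>n. fst (w n))"
  proof (rule metric_CauchyI)
    fix \<eta> :: real assume \<eta>: "\<eta> > 0"
    obtain n0 where n0: "\<forall>i\<ge>n0. \<forall>j\<ge>n0. N (diff (w i) (w j)) < \<eta>\<^sup>2" using qsym[of "\<eta>\<^sup>2"] \<eta> by auto
    have "dist (fst (w i)) (fst (w j)) < \<eta>" if "i \<ge> n0" "j \<ge> n0" for i j
    proof -
      have "(norm (fst (w i) - fst (w j)))\<^sup>2 \<le> N (diff (w i) (w j))" by (simp add: N_def diff_def)
      also have "\<dots> < \<eta>\<^sup>2" using n0 that by blast
      finally show ?thesis using \<eta> by (simp add: dist_norm power_less_imp_less_base)
    qed
    then show "\<exists>n0. \<forall>i\<ge>n0. \<forall>j\<ge>n0. dist (fst (w i)) (fst (w j)) < \<eta>" by blast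
  qed
  then obtain e where e: "(\<lambda>n. fst (w n)) \<longlonglongrightarrow> e" using Cauchy_convergent_iff convergent_def by blast
  have vcauchy: "\<exists>n0. \<forall>i\<ge>n0. \<forall>j\<ge>n0. (\<integral>t. norm (snd (w i) t - snd (w j) t) \<partial>M) < \<eta>" if \<eta>: "\<eta> > 0" for \<eta>
  proof -
    define \<mu> where "\<mu> = measure M (space M) + 1"
    have \<mu>: "\<mu> > 0" by (simp add: \<mu>_def add_nonneg_pos)
    define \<delta> where "\<delta> = \<eta> / (2 * \<mu>)"
    have \<delta>: "\<delta> > 0" using \<eta> \<mu> by (simp add: \<delta>_def)
    obtain n0 where n0: "\<forall>i\<ge>n0. \<forall>j\<ge>n0. N (diff (w i) (w j)) < \<delta> * (\<eta> / 2)" using qsym[of "\<delta> * (\<eta> / 2)"] \<eta> \<delta> by auto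
    have "(\<integral>t. norm (snd (w i) t - snd (w j) t) \<partial>M) < \<eta>" if "i \<ge> n0" "j \<ge> n0" for i j
    proof -
      have "(\<integral>t. norm (snd (w i) t - snd (w j) t) \<partial>M) \<le> (\<integral>t. \<delta> + (norm (snd (w i) t - snd (w j) t))\<^sup>2 / \<delta> \<partial>M)"
      proof (intro integral_mono dI1 Bochner_Integration.integrable_add integrable_const integrable_divide dI)
        fix t
        define s where "s = norm (snd (w i) t - snd (w j) t)"
        have "0 \<le> (s - \<delta>)\<^sup>2 + s * \<delta>" using \<delta> by (simp add: s_def)
        then have "s * \<delta> \<le> \<delta> * \<delta> + s\<^sup>2" by (simp add: power2_eq_square algebra_simps)
        then show "norm (snd (w i) t - snd (w j) t) \<le> \<delta> + (norm (snd (w i) t - snd (w j) t))\<^sup>2 / \<delta>"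
          using \<delta> unfolding s_def by (simp add: field_simps)
      qed
      also have "\<dots> = \<delta> * measure M (space M) + (\<integral>t. (norm (snd (w i) t - snd (w j) t))\<^sup>2 \<partial>M) / \<delta>"
        using dI by (subst Bochner_Integration.integral_add) auto
      also have "(\<integral>t. (norm (snd (w i) t - snd (w j) t))\<^sup>2 \<partial>M) \<le> N (diff (w i) (w j))" by (simp add: N_def diff_def)
      also have "\<delta> * measure M (space M) \<le> \<delta> * \<mu>" using \<delta> by (simp add: \<mu>_def)
      also have "N (diff (w i) (w j)) / \<delta> < \<eta> / 2" using n0 that \<delta> by (auto simp: field_simps)
      also have "\<delta> * \<mu> = \<eta> / 2" using \<mu> by (simp add: \<delta>_def)
      finally show ?thesis using \<delta> by (simp add: divide_right_mono)
    qed
    then show ?thesis by blast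
  qed
  have vI: "integrable M (snd (w n))" for n
    by (rule integrable_const_bound[where B = 1]) (use Wm[OF wW] in auto)
  obtain k where k: "strict_mono k" "AE t in M. Cauchy (\<lambda>i. snd (w (k i)) t)"
    using cauchy_L1_AE_cauchy_subseq[of M "\<lambda>n. snd (w n)", OF vI vcauchy] by metis
  define l where "l t = lim (\<lambda>i. snd (w (k i)) t)" for t
  have lm: "l \<in> borel_measurable M"
    unfolding l_def by (rule borel_measurable_lim_metric) (use Wm[OF wW] in auto)
  \<comment> \<open>Where the sequence diverges \<open>lim\<close> is arbitrary, so the bound has to be restored by hand.\<close>
  define v where "v t = (if norm (l t) \<le> 1 then l t else 0)" for t
  have vm: "v \<in> borel_measurable M" unfolding v_def using lm by measurable
  have vlim: "AE t in M. (\<lambda>i. snd (w (k i)) t) \<longlonglongrightarrow> v t"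
    using k(2)
  proof eventually_elim
    case (elim t)
    then have L: "(\<lambda>i. snd (w (k i)) t) \<longlonglongrightarrow> l t"
      unfolding l_def using Cauchy_convergent_iff convergent_LIMSEQ_iff by blast
    have "norm (l t) \<le> 1"
      by (rule LIMSEQ_le_const2[OF tendsto_norm[OF L]]) (use Wm[OF wW] in auto)
    then show ?case using L by (simp add: v_def)
  qed
  have ek: "(\<lambda>i. fst (w (k i))) \<longlonglongrightarrow> e" using LIMSEQ_subseq_LIMSEQ[OF e k(1)] by (simp add: o_def)
  have "norm e \<le> 1" by (rule LIMSEQ_le_const2[OF tendsto_norm[OF e]]) (use Wm[OF wW] in auto)
  then have ev: "(e, v) \<in> unit_processes M" using vm by (simp add: unit_processes_def v_def)
  have "(\<lambda>i. \<Theta> (fst (w (k i))) (snd (w (k i)))) \<longlonglongrightarrow> \<Theta> e v"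
    by (rule cont[OF _ ev ek vlim]) (use wW in \<open>simp add: W_def\<close>)
  moreover have "(\<lambda>i. d + eps (k i)) \<longlonglongrightarrow> d + 0"
    by (intro tendsto_intros) (use LIMSEQ_subseq_LIMSEQ[OF eps0 k(1)] in \<open>simp add: o_def\<close>)
  ultimately have "\<Theta> e v \<le> d + 0"
    by (rule LIMSEQ_le) (use w(1) in \<open>auto simp: C_def\<close>)
  then show ?thesis using that[OF ev] dle by (force simp: W_def)
qed

section \<open>Multipliers with an error for the linearized problem\<close>

text \<open>The linearization along a process on \<open>{a..b}\<close>: \<open>A\<close> and \<open>B\<close> are the partial derivatives of the right-hand side of the
  state equation, \<open>g\<close>, \<open>gx\<close> and \<open>gu\<close> the value and the partial gradients of the mixed constraint, \<open>j0\<close> and \<open>j1\<close> the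
  partial gradients of the cost. A single constant \<open>K\<close> bounds all of them, since the process is bounded.\<close>

locale linear_system =
  fixes a b K :: real
    and A :: "real \<Rightarrow> 'a::euclidean_space \<Rightarrow> 'a" and B :: "real \<Rightarrow> 'b::euclidean_space \<Rightarrow> 'a"
    and gx :: "real \<Rightarrow> 'a" and gu :: "real \<Rightarrow> 'b" and g :: "real \<Rightarrow> real" and j0 j1 :: 'a
  assumes ab: "a < b"
    and linear_A: "\<And>t. linear (A t)" and linear_B: "\<And>t. linear (B t)"
    and A_bound: "\<And>t y. t \<in> {a..b} \<Longrightarrow> norm (A t y) \<le> K * norm y"
    and B_bound: "\<And>t v. t \<in> {a..b} \<Longrightarrow> norm (B t v) \<le> K * norm v"
    and gx_bound: "\<And>t. t \<in> {a..b} \<Longrightarrow> norm (gx t) \<le> K"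
    and gu_bound: "\<And>t. t \<in> {a..b} \<Longrightarrow> norm (gu t) \<le> K"
    and g_bound: "\<And>t. t \<in> {a..b} \<Longrightarrow> \<bar>g t\<bar> \<le> K"
    and A_measurable: "\<And>y. (\<lambda>t. A t y) \<in> borel_measurable (lebesgue_on {a..b})"
    and B_measurable: "\<And>v. (\<lambda>t. B t v) \<in> borel_measurable (lebesgue_on {a..b})"
    and gx_measurable [measurable]: "gx \<in> borel_measurable (lebesgue_on {a..b})"
    and gu_measurable [measurable]: "gu \<in> borel_measurable (lebesgue_on {a..b})"
    and g_measurable [measurable]: "g \<in> borel_measurable (lebesgue_on {a..b})"
    and g_le_0: "AE t in lebesgue_on {a..b}. g t \<le> 0"
begin

abbreviation L :: "real measure" where "L \<equiv> lebesgue_on {a..b}"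

abbreviation W :: "('a \<times> (real \<Rightarrow> 'b)) set" where "W \<equiv> unit_processes L"

lemma K_nonneg: "K \<ge> 0"
  using gx_bound[of a] ab norm_ge_zero[of "gx a"] by (auto simp del: norm_ge_zero)

lemma finite_L: "finite_measure L"
  by (rule finite_measure_lebesgue_on) simp

lemma linear_family_measurable:
  fixes T :: "real \<Rightarrow> 'c::euclidean_space \<Rightarrow> 'd::euclidean_space"
  assumes "\<And>t. linear (T t)" "\<And>y. (\<lambda>t. T t y) \<in> borel_measurable M" "y \<in> borel_measurable M"
  shows "(\<lambda>t. T t (y t)) \<in> borel_measurable M"
proof -
  have "T t (y t) = (\<Sum>i\<in>Basis. (y t \<bullet> i) *\<^sub>R T t i)" for t
  proof -
    have "T t (y t) = T t (\<Sum>i\<in>Basis. (y t \<bullet> i) *\<^sub>R i)" by (simp add: euclidean_representation)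
    also have "\<dots> = (\<Sum>i\<in>Basis. (y t \<bullet> i) *\<^sub>R T t i)"
      by (simp add: linear_sum[OF assms(1)] linear_cmul[OF assms(1)])
    finally show ?thesis .
  qed
  moreover have "(\<lambda>t. \<Sum>i\<in>Basis. (y t \<bullet> i) *\<^sub>R T t i) \<in> borel_measurable M"
    using assms(2,3) by (intro borel_measurable_sum borel_measurable_scaleR borel_measurable_inner) auto
  ultimately show ?thesis by simp
qed

lemma A_comp_measurable: "y \<in> borel_measurable L \<Longrightarrow> (\<lambda>t. A t (y t)) \<in> borel_measurable L"
  by (rule linear_family_measurable[OF linear_A A_measurable])

lemma B_comp_measurable: "v \<in> borel_measurable L \<Longrightarrow> (\<lambda>t. B t (v t)) \<in> borel_measurable L"
  by (rule linear_family_measurable[OF linear_B B_measurable])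

lemma dynamics_integrable:
  assumes x: "continuous_on {a..b} x" and v: "v \<in> borel_measurable L" "\<And>t. norm (v t) \<le> 1"
  shows "(\<lambda>t. A t (x t) + B t (v t)) integrable_on {a..b}"
proof -
  obtain C where C: "C \<ge> 0" "\<forall>t\<in>{a..b}. norm (x t) \<le> C" using continuous_on_interval_bound[OF x] by auto
  show ?thesis
  proof (rule integrable_on_bounded[where C = "K * C + K"])
    show "(\<lambda>t. A t (x t) + B t (v t)) \<in> borel_measurable L"
      using A_comp_measurable[OF continuous_on_interval_measurable[OF x]] B_comp_measurable[OF v(1)] by simp
    fix t assume t: "t \<in> {a..b}"
    have "K * norm (x t) \<le> K * C" "K * norm (v t) \<le> K"
      using K_nonneg C(2) t v(2)[of t] by (auto intro: mult_left_mono mult_left_le)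
    then show "norm (A t (x t) + B t (v t)) \<le> K * C + K"
      using norm_triangle_ineq[of "A t (x t)" "B t (v t)"] A_bound[OF t, of "x t"] B_bound[OF t, of "v t"] by linarith
  qed
qed

definition is_traj :: "'a \<Rightarrow> (real \<Rightarrow> 'b) \<Rightarrow> (real \<Rightarrow> 'a) \<Rightarrow> bool" where
  "is_traj e v x \<longleftrightarrow> continuous_on {a..b} x \<and>
     (\<forall>t\<in>{a..b}. x t = e + integral {a..t} (\<lambda>s. A s (x s) + B s (v s)))"

definition traj :: "'a \<Rightarrow> (real \<Rightarrow> 'b) \<Rightarrow> real \<Rightarrow> 'a" where
  "traj e v = (SOME x. is_traj e v x)"

lemma A_diff: "A t (x - y) = A t x - A t y" and A_scale: "A t (c *\<^sub>R x) = c *\<^sub>R A t x" and A_add: "A t (x + y) = A t x + A t y"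
  and B_diff: "B t (v - w) = B t v - B t w" and B_scale: "B t (c *\<^sub>R v) = c *\<^sub>R B t v" and B_add: "B t (v + w) = B t v + B t w"
  using linear_A linear_B by (simp_all add: linear_diff linear_cmul linear_add)

lemma is_traj_traj:
  assumes "(e, v) \<in> W"
  shows "is_traj e v (traj e v)"
proof -
  have v: "v \<in> borel_measurable L" "\<And>t. norm (v t) \<le> 1" using assms by (auto simp: unit_processes_def)
  obtain x where "continuous_on {a..b} x" "\<And>t. t \<in> {a..b} \<Longrightarrow> x t = e + integral {a..t} (\<lambda>s. A s (x s) + B s (v s))"
  proof (rule caratheodory_forward[of a b "\<lambda>t y. A t y + B t (v t)" K e])
    show "norm (A t y + B t (v t) - (A t z + B t (v t))) \<le> K * norm (y - z)" if "t \<in> {a..b}" for t y z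
      using A_bound[OF that, of "y - z"] by (simp add: A_diff)
  qed (use ab dynamics_integrable[OF _ v] in auto)
  then have "is_traj e v x" by (simp add: is_traj_def)
  then show ?thesis unfolding traj_def by (rule someI[of "is_traj e v" x])
qed

text \<open>This estimate yields uniqueness of trajectories, a uniform bound for them, and their continuous dependence on the
  process.\<close>

lemma is_traj_dist:
  assumes x: "is_traj e v x" and x': "is_traj e' v' x'" and W: "(e, v) \<in> W" "(e', v') \<in> W" and t: "t \<in> {a..b}"
  shows "norm (x t - x' t) \<le> (norm (e - e') + K * (\<integral>t. norm (v t - v' t) \<partial>L)) * exp (K * (b - a))"
proof -
  have v: "v \<in> borel_measurable L" "\<And>t. norm (v t) \<le> 1" "v' \<in> borel_measurable L" "\<And>t. norm (v' t) \<le> 1"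
    using W by (auto simp: unit_processes_def)
  have c: "continuous_on {a..b} x" "continuous_on {a..b} x'" using x x' by (auto simp: is_traj_def)
  let ?g = "\<lambda>t. (A t (x t) + B t (v t)) - (A t (x' t) + B t (v' t))"
  note I = dynamics_integrable[OF c(1) v(1,2)] dynamics_integrable[OF c(2) v(3,4)]
  have sub: "h integrable_on {a..s}" if "h integrable_on {a..b}" "s \<in> {a..b}" for h :: "real \<Rightarrow> 'a" and s
    using integrable_on_subinterval[OF that(1), of a s] that by auto
  have vd: "norm (v t - v' t) \<le> 2" for t using norm_triangle_ineq4[of "v t" "v' t"] v(2)[of t] v(4)[of t] by linarith
  have vdm: "(\<lambda>t. norm (v t - v' t)) \<in> borel_measurable L" using v by measurable
  have vdi: "(\<lambda>t. norm (v t - v' t)) integrable_on {a..b}" "integral\<^sup>L L (\<lambda>t. norm (v t - v' t)) = integral {a..b} (\<lambda>t. norm (v t - v' t))"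
    by (rule integrable_on_bounded[OF vdm, where C = 2], use vd in simp) (rule lebesgue_on_integral_bounded[OF vdm, where C = 2], use vd in simp)
  have "norm (x t - x' t) \<le> (norm (e - e') + integral {a..b} (\<lambda>t. K * norm (v t - v' t))) * exp (K * (b - a))"
  proof (rule norm_integral_le_gronwall_forward[where z = "\<lambda>t. x t - x' t" and g = ?g, OF _ K_nonneg _ _ _ _ _ t])
    show "continuous_on {a..b} (\<lambda>t. x t - x' t)" using c by (intro continuous_intros)
    show "?g integrable_on {a..b}" by (rule integrable_diff[OF I])
    show "x s - x' s = (e - e') + integral {a..s} ?g" if s: "s \<in> {a..b}" for s
    proof -
      have "x s = e + integral {a..s} (\<lambda>s. A s (x s) + B s (v s))" "x' s = e' + integral {a..s} (\<lambda>s. A s (x' s) + B s (v' s))"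
        using x x' s by (auto simp: is_traj_def)
      then show ?thesis using integral_diff[OF sub[OF I(1) s] sub[OF I(2) s]] by simp
    qed
    show "(\<lambda>t. K * norm (v t - v' t)) integrable_on {a..b}" by (intro integrable_on_mult_right vdi)
    show "K * norm (v t - v' t) \<ge> 0" for t using K_nonneg by simp
    fix s assume s: "s \<in> {a..b}"
    have "?g s = B s (v s - v' s) + A s (x s - x' s)" by (simp add: A_diff B_diff)
    also have "norm \<dots> \<le> K * norm (v s - v' s) + K * norm (x s - x' s)"
      by (rule norm_triangle_mono[OF B_bound[OF s] A_bound[OF s]])
    finally show "norm (?g s) \<le> K * norm (v s - v' s) + K * norm (x s - x' s)" .
  qed
  then show ?thesis by (simp add: vdi(2))
qed

lemma is_traj_unique:
  assumes "is_traj e v x" "(e, v) \<in> W" "t \<in> {a..b}"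
  shows "x t = traj e v t"
  using is_traj_dist[OF assms(1) is_traj_traj[OF assms(2)] assms(2) assms(2) assms(3)] by simp

lemma traj_convex:
  assumes W: "(e, v) \<in> W" "(e', v') \<in> W" and \<theta>: "0 \<le> \<theta>" "\<theta> \<le> 1" and t: "t \<in> {a..b}"
  shows "traj ((1 - \<theta>) *\<^sub>R e + \<theta> *\<^sub>R e') (\<lambda>t. (1 - \<theta>) *\<^sub>R v t + \<theta> *\<^sub>R v' t) t = (1 - \<theta>) *\<^sub>R traj e v t + \<theta> *\<^sub>R traj e' v' t"
proof -
  let ?x = "traj e v" and ?x' = "traj e' v'"
  have v: "v \<in> borel_measurable L" "\<And>t. norm (v t) \<le> 1" "v' \<in> borel_measurable L" "\<And>t. norm (v' t) \<le> 1"
    using W by (auto simp: unit_processes_def)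
  have x: "continuous_on {a..b} ?x" "\<And>t. t \<in> {a..b} \<Longrightarrow> ?x t = e + integral {a..t} (\<lambda>s. A s (?x s) + B s (v s))"
    using is_traj_traj[OF W(1)] by (auto simp: is_traj_def)
  have x': "continuous_on {a..b} ?x'" "\<And>t. t \<in> {a..b} \<Longrightarrow> ?x' t = e' + integral {a..t} (\<lambda>s. A s (?x' s) + B s (v' s))"
    using is_traj_traj[OF W(2)] by (auto simp: is_traj_def)
  note I = dynamics_integrable[OF x(1) v(1,2)] dynamics_integrable[OF x'(1) v(3,4)]
  have sub: "h integrable_on {a..s}" if "h integrable_on {a..b}" "s \<in> {a..b}" for h :: "real \<Rightarrow> 'a" and s
    using integrable_on_subinterval[OF that(1), of a s] that by auto
  have "is_traj ((1 - \<theta>) *\<^sub>R e + \<theta> *\<^sub>R e') (\<lambda>t. (1 - \<theta>) *\<^sub>R v t + \<theta> *\<^sub>R v' t) (\<lambda>t. (1 - \<theta>) *\<^sub>R ?x t + \<theta> *\<^sub>R ?x' t)"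
    unfolding is_traj_def
  proof (intro conjI ballI)
    show "continuous_on {a..b} (\<lambda>t. (1 - \<theta>) *\<^sub>R ?x t + \<theta> *\<^sub>R ?x' t)" by (intro continuous_intros x x')
    fix s assume s: "s \<in> {a..b}"
    have "integral {a..s} (\<lambda>s. A s ((1 - \<theta>) *\<^sub>R ?x s + \<theta> *\<^sub>R ?x' s) + B s ((1 - \<theta>) *\<^sub>R v s + \<theta> *\<^sub>R v' s))
        = integral {a..s} (\<lambda>s. (1 - \<theta>) *\<^sub>R (A s (?x s) + B s (v s)) + \<theta> *\<^sub>R (A s (?x' s) + B s (v' s)))"
      by (rule arg_cong[where f = "integral {a..s}"], rule ext) (simp add: A_add B_add A_scale B_scale scaleR_add_right)
    also have "\<dots> = (1 - \<theta>) *\<^sub>R integral {a..s} (\<lambda>s. A s (?x s) + B s (v s)) + \<theta> *\<^sub>R integral {a..s} (\<lambda>s. A s (?x' s) + B s (v' s))"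
      using Henstock_Kurzweil_Integration.integral_add[OF integrable_cmul[OF sub[OF I(1) s], of "1 - \<theta>"] integrable_cmul[OF sub[OF I(2) s], of \<theta>]]
      by simp
    also have "\<dots> = (1 - \<theta>) *\<^sub>R (?x s - e) + \<theta> *\<^sub>R (?x' s - e')" using x(2)[OF s] x'(2)[OF s] by simp
    finally show "(1 - \<theta>) *\<^sub>R ?x s + \<theta> *\<^sub>R ?x' s = ((1 - \<theta>) *\<^sub>R e + \<theta> *\<^sub>R e')
        + integral {a..s} (\<lambda>s. A s ((1 - \<theta>) *\<^sub>R ?x s + \<theta> *\<^sub>R ?x' s) + B s ((1 - \<theta>) *\<^sub>R v s + \<theta> *\<^sub>R v' s))"
      by (simp add: scaleR_diff_right)
  qed
  from is_traj_unique[OF this unit_processes_convex[OF W \<theta>] t] show ?thesis by simp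
qed

lemma traj_bounded:
  obtains C where "C \<ge> 0" "\<And>e v t. (e, v) \<in> W \<Longrightarrow> t \<in> {a..b} \<Longrightarrow> norm (traj e v t) \<le> C"
proof
  interpret finite_measure L by (rule finite_L)
  define \<mu> where "\<mu> = measure L (space L)"
  show "0 \<le> (1 + K * \<mu>) * exp (K * (b - a))" using K_nonneg by (simp add: \<mu>_def)
  fix e v t assume ev: "(e, v) \<in> W" and t: "t \<in> {a..b}"
  then have v: "v \<in> borel_measurable L" "\<And>t. norm (v t) \<le> 1" "norm e \<le> 1" by (auto simp: unit_processes_def)
  have W0: "(0, \<lambda>_. 0) \<in> W" by (simp add: unit_processes_def)
  have "is_traj 0 (\<lambda>_. 0) (\<lambda>_. 0)" using linear_0[OF linear_A] linear_0[OF linear_B] by (simp add: is_traj_def)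
  from is_traj_dist[OF is_traj_traj[OF ev] this ev W0 t]
  have 1: "norm (traj e v t) \<le> (norm e + K * (\<integral>t. norm (v t) \<partial>L)) * exp (K * (b - a))" by simp
  have "(\<integral>t. norm (v t) \<partial>L) \<le> (\<integral>t. 1 \<partial>L)"
    by (intro integral_mono integrable_const integrable_norm integrable_const_bound[where B = 1]) (use v in auto)
  then have "K * (\<integral>t. norm (v t) \<partial>L) \<le> K * \<mu>" using K_nonneg by (intro mult_left_mono) (auto simp: \<mu>_def)
  then have "norm e + K * (\<integral>t. norm (v t) \<partial>L) \<le> 1 + K * \<mu>" using v(3) by linarith
  from order_trans[OF 1 mult_right_mono[OF this exp_ge_zero]]
  show "norm (traj e v t) \<le> (1 + K * \<mu>) * exp (K * (b - a))" .
qed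

lemma traj_measurable: "(e, v) \<in> W \<Longrightarrow> traj e v \<in> borel_measurable L"
  using is_traj_traj unfolding is_traj_def by (blast intro: continuous_on_interval_measurable)

definition cost :: "'a \<Rightarrow> (real \<Rightarrow> 'b) \<Rightarrow> real" where
  "cost e v = j0 \<bullet> e + j1 \<bullet> traj e v b"

definition slack :: "'a \<Rightarrow> (real \<Rightarrow> 'b) \<Rightarrow> real \<Rightarrow> real" where
  "slack e v t = g t + gx t \<bullet> traj e v t + gu t \<bullet> v t"

lemma cost_convex:
  assumes W: "(e, v) \<in> W" "(e', v') \<in> W" and \<theta>: "0 \<le> \<theta>" "\<theta> \<le> 1"
  shows "cost ((1 - \<theta>) *\<^sub>R e + \<theta> *\<^sub>R e') (\<lambda>t. (1 - \<theta>) *\<^sub>R v t + \<theta> *\<^sub>R v' t) = cost e v + \<theta> * (cost e' v' - cost e v)"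
proof -
  have "b \<in> {a..b}" using ab by simp
  then show ?thesis unfolding cost_def traj_convex[OF W \<theta> \<open>b \<in> {a..b}\<close>] by (simp add: inner_add_right algebra_simps)
qed

lemma slack_convex:
  assumes W: "(e, v) \<in> W" "(e', v') \<in> W" and \<theta>: "0 \<le> \<theta>" "\<theta> \<le> 1" and t: "t \<in> {a..b}"
  shows "slack ((1 - \<theta>) *\<^sub>R e + \<theta> *\<^sub>R e') (\<lambda>t. (1 - \<theta>) *\<^sub>R v t + \<theta> *\<^sub>R v' t) t = slack e v t + \<theta> * (slack e' v' t - slack e v t)"
  unfolding slack_def traj_convex[OF W \<theta> t] by (simp add: inner_add_right algebra_simps)

lemma slack_measurable: "(e, v) \<in> W \<Longrightarrow> slack e v \<in> borel_measurable L"
  unfolding slack_def[abs_def]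
  by (intro borel_measurable_add borel_measurable_inner traj_measurable) (auto simp: unit_processes_def)

lemma slack_bounded:
  obtains C where "C \<ge> 0" "\<And>e v t. (e, v) \<in> W \<Longrightarrow> t \<in> {a..b} \<Longrightarrow> \<bar>slack e v t\<bar> \<le> C"
proof -
  obtain X where X: "X \<ge> 0" "\<And>e v t. (e, v) \<in> W \<Longrightarrow> t \<in> {a..b} \<Longrightarrow> norm (traj e v t) \<le> X"
    by (rule traj_bounded) auto
  show ?thesis
  proof
    show "0 \<le> K + K * X + K" using K_nonneg X by simp
    fix e v t assume ev: "(e, v) \<in> W" and t: "t \<in> {a..b}"
    have "\<bar>gx t \<bullet> traj e v t\<bar> \<le> norm (gx t) * norm (traj e v t)" by (rule Cauchy_Schwarz_ineq2)
    also have "\<dots> \<le> K * X" using gx_bound[OF t] X(2)[OF ev t] K_nonneg by (intro mult_mono) auto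
    finally have 1: "\<bar>gx t \<bullet> traj e v t\<bar> \<le> K * X" .
    have "\<bar>gu t \<bullet> v t\<bar> \<le> norm (gu t) * norm (v t)" by (rule Cauchy_Schwarz_ineq2)
    also have "\<dots> \<le> K * 1" using gu_bound[OF t] K_nonneg ev by (intro mult_mono) (auto simp: unit_processes_def)
    finally show "\<bar>slack e v t\<bar> \<le> K + K * X + K" using 1 g_bound[OF t] unfolding slack_def by linarith
  qed
qed

text \<open>It vanishes at a process exactly if the process has cost at most \<open>- c\<close> and slack at most \<open>- c\<close> almost everywhere.\<close>

definition penalty :: "real \<Rightarrow> 'a \<Rightarrow> (real \<Rightarrow> 'b) \<Rightarrow> real" where
  "penalty c e v = (max 0 (cost e v + c))\<^sup>2 + (\<integral>t. (max 0 (slack e v t + c))\<^sup>2 \<partial>L)"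

lemma slack_power_integrable:
  assumes "(e, v) \<in> W"
  shows "integrable L (\<lambda>t. (max 0 (slack e v t + c))\<^sup>2)"
proof -
  obtain C where C: "C \<ge> 0" "\<And>e v t. (e, v) \<in> W \<Longrightarrow> t \<in> {a..b} \<Longrightarrow> \<bar>slack e v t\<bar> \<le> C" by (rule slack_bounded) auto
  show ?thesis
  proof (rule integrable_lebesgue_on_bounded)
    show "(\<lambda>t. (max 0 (slack e v t + c))\<^sup>2) \<in> borel_measurable L" using slack_measurable[OF assms] by measurable
    fix t assume "t \<in> {a..b}"
    then have "\<bar>max 0 (slack e v t + c)\<bar> \<le> C + \<bar>c\<bar>" using C(2)[OF assms, of t] C(1) by linarith
    then have "\<bar>max 0 (slack e v t + c)\<bar>\<^sup>2 \<le> (C + \<bar>c\<bar>)\<^sup>2" by (rule power_mono) simp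
    then show "norm ((max 0 (slack e v t + c))\<^sup>2) \<le> (C + \<bar>c\<bar>)\<^sup>2" by simp
  qed
qed

text \<open>The square of the positive part is convex and nondecreasing, and cost and slack are affine in the process; continuity is
  dominated convergence.\<close>

lemma penalty_minimizer:
  obtains e v where "(e, v) \<in> W" "\<And>e' v'. (e', v') \<in> W \<Longrightarrow> penalty c e v \<le> penalty c e' v'"
proof (rule minimizer_on_unit_processes[OF finite_L, of "penalty c"])
  show "0 \<le> penalty c e v" for e v unfolding penalty_def by (intro add_nonneg_nonneg Bochner_Integration.integral_nonneg) auto
next
  fix e v e' v' assume W: "(e, v) \<in> W" "(e', v') \<in> W"
  let ?e = "(1 - 1/2) *\<^sub>R e + (1/2) *\<^sub>R e'" and ?v = "\<lambda>t. (1 - 1/2) *\<^sub>R v t + (1/2) *\<^sub>R v' t"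
  have sq: "(max 0 (r + (1/2) * (s - r) + c))\<^sup>2 \<le> (1/2) * (max 0 (r + c))\<^sup>2 + (1/2) * (max 0 (s + c))\<^sup>2" for r s :: real
  proof -
    have "max 0 (r + (1/2) * (s - r) + c) \<le> (max 0 (r + c) + max 0 (s + c)) / 2"
      by (simp add: max_def field_simps)
    then have "(max 0 (r + (1/2) * (s - r) + c))\<^sup>2 \<le> ((max 0 (r + c) + max 0 (s + c)) / 2)\<^sup>2"
      by (rule power_mono) simp
    also have "\<dots> \<le> (1/2) * (max 0 (r + c))\<^sup>2 + (1/2) * (max 0 (s + c))\<^sup>2"
      using zero_le_power2[of "max 0 (r + c) - max 0 (s + c)"]
      by (simp add: power2_eq_square field_simps)
    finally show ?thesis .
  qed
  have mW: "(?e, ?v) \<in> W" by (rule unit_processes_convex[OF W]) auto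
  have "(\<integral>t. (max 0 (slack ?e ?v t + c))\<^sup>2 \<partial>L) \<le> (\<integral>t. (1/2) * (max 0 (slack e v t + c))\<^sup>2 + (1/2) * (max 0 (slack e' v' t + c))\<^sup>2 \<partial>L)"
  proof (intro integral_mono Bochner_Integration.integrable_add integrable_mult_right slack_power_integrable mW W)
    fix t assume "t \<in> space L"
    then have t: "t \<in> {a..b}" by simp
    have "slack ?e ?v t = slack e v t + (1/2) * (slack e' v' t - slack e v t)"
      by (rule slack_convex[OF W _ _ t]) auto
    then show "(max 0 (slack ?e ?v t + c))\<^sup>2 \<le> (1/2) * (max 0 (slack e v t + c))\<^sup>2 + (1/2) * (max 0 (slack e' v' t + c))\<^sup>2"
      using sq[of "slack e v t" "slack e' v' t"] by simp
  qed
  also have "\<dots> = (1/2) * (\<integral>t. (max 0 (slack e v t + c))\<^sup>2 \<partial>L) + (1/2) * (\<integral>t. (max 0 (slack e' v' t + c))\<^sup>2 \<partial>L)"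
    using slack_power_integrable[OF W(1), of c] slack_power_integrable[OF W(2), of c]
    by (subst Bochner_Integration.integral_add) auto
  finally have 1: "(\<integral>t. (max 0 (slack ?e ?v t + c))\<^sup>2 \<partial>L) \<le> (1/2) * (\<integral>t. (max 0 (slack e v t + c))\<^sup>2 \<partial>L) + (1/2) * (\<integral>t. (max 0 (slack e' v' t + c))\<^sup>2 \<partial>L)" .
  have "cost ?e ?v = cost e v + (1/2) * (cost e' v' - cost e v)" by (rule cost_convex[OF W]) auto
  then have "penalty c ?e ?v \<le> (1/2) * penalty c e v + (1/2) * penalty c e' v'"
    using 1 sq[of "cost e v" "cost e' v'"] unfolding penalty_def by (simp add: algebra_simps)
  then show "penalty c ?e ?v \<le> max (penalty c e v) (penalty c e' v')" by linarith
next
  fix E V e v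
  assume EV: "\<And>n. (E n, V n) \<in> W" and ev: "(e, v) \<in> W" and E: "E \<longlonglongrightarrow> e" and V: "AE t in L. (\<lambda>n. V n t) \<longlonglongrightarrow> v t"
  interpret finite_measure L by (rule finite_L)
  have vm: "v \<in> borel_measurable L" "\<And>t. norm (v t) \<le> 1" and Vm: "\<And>n. V n \<in> borel_measurable L" "\<And>n t. norm (V n t) \<le> 1"
    using ev EV by (auto simp: unit_processes_def)
  have "(\<lambda>n. \<integral>t. norm (V n t - v t) \<partial>L) \<longlonglongrightarrow> (\<integral>t. 0 \<partial>L)"
  proof (rule integral_dominated_convergence[where w = "\<lambda>_. 2"])
    show "AE t in L. (\<lambda>n. norm (V n t - v t)) \<longlonglongrightarrow> 0"
      using V by eventually_elim (simp add: tendsto_norm_zero LIM_zero)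
    show "AE t in L. norm (norm (V n t - v t)) \<le> 2" for n
    proof (intro AE_I2)
      show "norm (norm (V n t - v t)) \<le> 2" for t
        using norm_triangle_ineq4[of "V n t" "v t"] vm(2)[of t] Vm(2)[of n t] by simp
    qed
  qed (use vm Vm in auto)
  then have v0: "(\<lambda>n. \<integral>t. norm (V n t - v t) \<partial>L) \<longlonglongrightarrow> 0" by simp
  have e0: "(\<lambda>n. norm (E n - e)) \<longlonglongrightarrow> 0" using E by (simp add: tendsto_norm_zero LIM_zero)
  have "(\<lambda>n. (norm (E n - e) + K * (\<integral>t. norm (V n t - v t) \<partial>L)) * exp (K * (b - a))) \<longlonglongrightarrow> (0 + K * 0) * exp (K * (b - a))"
    by (intro tendsto_intros v0 e0)
  then have d0: "(\<lambda>n. (norm (E n - e) + K * (\<integral>t. norm (V n t - v t) \<partial>L)) * exp (K * (b - a))) \<longlonglongrightarrow> 0" by simp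
  have tr: "(\<lambda>n. traj (E n) (V n) t) \<longlonglongrightarrow> traj e v t" if t: "t \<in> {a..b}" for t
  proof -
    have "(\<lambda>n. traj (E n) (V n) t - traj e v t) \<longlonglongrightarrow> 0"
      by (rule Lim_null_comparison[OF _ d0]) (use is_traj_dist[OF is_traj_traj[OF EV] is_traj_traj[OF ev] EV ev t] in auto)
    then show ?thesis by (rule LIM_zero_cancel)
  qed
  obtain C where C: "C \<ge> 0" "\<And>e v t. (e, v) \<in> W \<Longrightarrow> t \<in> {a..b} \<Longrightarrow> \<bar>slack e v t\<bar> \<le> C" by (rule slack_bounded) auto
  have "(\<lambda>n. \<integral>t. (max 0 (slack (E n) (V n) t + c))\<^sup>2 \<partial>L) \<longlonglongrightarrow> (\<integral>t. (max 0 (slack e v t + c))\<^sup>2 \<partial>L)"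
  proof (rule integral_dominated_convergence[where w = "\<lambda>_. (C + \<bar>c\<bar>)\<^sup>2"])
    show "(\<lambda>t. (max 0 (slack e v t + c))\<^sup>2) \<in> borel_measurable L" using slack_measurable[OF ev] by measurable
    show "(\<lambda>t. (max 0 (slack (E n) (V n) t + c))\<^sup>2) \<in> borel_measurable L" for n using slack_measurable[OF EV[of n]] by measurable
    show "AE t in L. (\<lambda>n. (max 0 (slack (E n) (V n) t + c))\<^sup>2) \<longlonglongrightarrow> (max 0 (slack e v t + c))\<^sup>2"
      using V AE_space
    proof eventually_elim
      case (elim t)
      then show ?case unfolding slack_def by (intro tendsto_intros tr) auto
    qed
    show "AE t in L. norm ((max 0 (slack (E n) (V n) t + c))\<^sup>2) \<le> (C + \<bar>c\<bar>)\<^sup>2" for n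
    proof (intro AE_I2)
      fix t assume "t \<in> space L"
      then have "\<bar>max 0 (slack (E n) (V n) t + c)\<bar> \<le> C + \<bar>c\<bar>" using C(2)[OF EV, of t n] C(1) by simp
      then have "\<bar>max 0 (slack (E n) (V n) t + c)\<bar>\<^sup>2 \<le> (C + \<bar>c\<bar>)\<^sup>2" by (rule power_mono) simp
      then show "norm ((max 0 (slack (E n) (V n) t + c))\<^sup>2) \<le> (C + \<bar>c\<bar>)\<^sup>2" by simp
    qed
  qed simp
  moreover have "(\<lambda>n. cost (E n) (V n)) \<longlonglongrightarrow> cost e v"
    unfolding cost_def by (intro tendsto_intros E tr) (use ab in auto)
  ultimately show "(\<lambda>n. penalty c (E n) (V n)) \<longlonglongrightarrow> penalty c e v"
    unfolding penalty_def by (intro tendsto_intros)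
qed (use that in blast)

text \<open>At a minimizer the derivative of the penalty towards any other process is nonnegative. Its coefficients, the positive
  parts of \<open>cost + c\<close> and \<open>slack + c\<close>, are the multipliers; they do not all vanish, as otherwise the minimizer would be
  a descent direction, so they can be normalized.\<close>

lemma approximate_multipliers:
  assumes c: "c > 0"
    and no_descent: "\<And>e v. (e, v) \<in> W \<Longrightarrow> cost e v \<le> - c \<Longrightarrow> \<not> (AE t in L. slack e v t \<le> - c)"
  obtains \<alpha> lam C where "\<alpha> \<ge> 0" "lam \<in> borel_measurable L" "\<And>t. 0 \<le> lam t" "\<And>t. lam t \<le> C"
    "\<alpha> + (\<integral>t. lam t \<partial>L) = 1"
    "\<And>e v. (e, v) \<in> W \<Longrightarrow> \<alpha> * cost e v + (\<integral>t. lam t * slack e v t \<partial>L) \<ge> - c"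
proof -
  interpret finite_measure L by (rule finite_L)
  obtain e v where ev: "(e, v) \<in> W" and min: "\<And>e' v'. (e', v') \<in> W \<Longrightarrow> penalty c e v \<le> penalty c e' v'"
    by (rule penalty_minimizer[of c]) auto
  obtain C where C: "C \<ge> 0" "\<And>e v t. (e, v) \<in> W \<Longrightarrow> t \<in> {a..b} \<Longrightarrow> \<bar>slack e v t\<bar> \<le> C" by (rule slack_bounded) auto
  define \<alpha>1 where "\<alpha>1 = max 0 (cost e v + c)"
  define lam1 where "lam1 t = (if t \<in> {a..b} then max 0 (slack e v t + c) else 0)" for t
  have lam1m: "lam1 \<in> borel_measurable L"
  proof -
    have "(\<lambda>t. max 0 (slack e v t + c)) \<in> borel_measurable L" using slack_measurable[OF ev] by measurable
    then show ?thesis by (rule measurable_cong[THEN iffD1, rotated]) (simp add: lam1_def)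
  qed
  have lam1b: "0 \<le> lam1 t" "lam1 t \<le> C + c" for t
    using C(2)[OF ev, of t] C(1) c by (auto simp: lam1_def)
  have bI: "integrable L h" if "h \<in> borel_measurable L" "\<And>t. t \<in> {a..b} \<Longrightarrow> \<bar>h t\<bar> \<le> D" for h :: "real \<Rightarrow> real" and D
    by (rule integrable_lebesgue_on_bounded[OF that(1), of D]) (use that(2) in simp)
  have lamI: "integrable L (\<lambda>t. lam1 t * h t)" if "h \<in> borel_measurable L" "\<And>t. t \<in> {a..b} \<Longrightarrow> \<bar>h t\<bar> \<le> D" for h :: "real \<Rightarrow> real" and D
  proof (rule bI[where D = "(C + c) * D"])
    show "\<bar>lam1 t * h t\<bar> \<le> (C + c) * D" if "t \<in> {a..b}" for t
      unfolding abs_mult using lam1b[of t] \<open>\<And>t. t \<in> {a..b} \<Longrightarrow> \<bar>h t\<bar> \<le> D\<close>[OF that] by (intro mult_mono) auto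
  qed (use lam1m that in auto)
  have lam1I: "integrable L lam1" by (rule bI[where D = "C + c"]) (use lam1m lam1b in auto)
  have lam1sq: "integrable L (\<lambda>t. (lam1 t)\<^sup>2)"
    using lamI[OF lam1m, of "C + c"] lam1b by (simp add: power2_eq_square)
  have penL: "penalty c e v = \<alpha>1\<^sup>2 + (\<integral>t. (lam1 t)\<^sup>2 \<partial>L)"
    unfolding penalty_def \<alpha>1_def by (intro arg_cong2[where f = "(+)"] Bochner_Integration.integral_cong refl) (simp add: lam1_def)

  \<comment> \<open>The minimum is positive, since a process of penalty zero would be a descent direction.\<close>
  have pos: "\<alpha>1 + (\<integral>t. lam1 t \<partial>L) > 0"
  proof (rule ccontr)
    assume "\<not> ?thesis"
    moreover have "\<alpha>1 \<ge> 0" "(\<integral>t. lam1 t \<partial>L) \<ge> 0" using lam1b by (auto simp: \<alpha>1_def)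
    ultimately have z: "\<alpha>1 = 0" "(\<integral>t. lam1 t \<partial>L) = 0" by linarith+
    have "AE t in L. lam1 t = 0"
      using integral_nonneg_eq_0_iff_AE[OF lam1I] lam1b z(2) by simp
    then have "AE t in L. slack e v t \<le> - c"
      using AE_space by eventually_elim (auto simp: lam1_def max_def split: if_splits)
    moreover have "cost e v \<le> - c" using z(1) by (simp add: \<alpha>1_def max_def split: if_splits)
    ultimately show False using no_descent[OF ev] by blast
  qed

  \<comment> \<open>A negative derivative towards \<open>(e', v')\<close> would let a short convex step lower the penalty.\<close>
  have first_order: "\<alpha>1 * (cost e' v' - cost e v) + (\<integral>t. lam1 t * (slack e' v' t - slack e v t) \<partial>L) \<ge> 0"
    if ev': "(e', v') \<in> W" for e' v'
  proof (rule ccontr)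
    define d0 where "d0 = cost e' v' - cost e v"
    define d where "d t = slack e' v' t - slack e v t" for t
    define Q where "Q = \<alpha>1 * d0 + (\<integral>t. lam1 t * d t \<partial>L)"
    define S where "S = d0\<^sup>2 + (\<integral>t. (d t)\<^sup>2 \<partial>L)"
    assume "\<not> ?thesis"
    then have Q: "Q < 0" by (simp add: Q_def d0_def d_def)
    have dm: "d \<in> borel_measurable L" unfolding d_def[abs_def] using slack_measurable[OF ev] slack_measurable[OF ev'] by measurable
    have db: "\<bar>d t\<bar> \<le> 2 * C" if "t \<in> {a..b}" for t
      using C(2)[OF ev that] C(2)[OF ev' that] by (simp add: d_def)
    have dsq: "integrable L (\<lambda>t. (d t)\<^sup>2)"
    proof (rule bI[where D = "(2 * C)\<^sup>2"])
      show "\<bar>(d t)\<^sup>2\<bar> \<le> (2 * C)\<^sup>2" if "t \<in> {a..b}" for t using power_mono[OF db[OF that], of 2] by simp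
    qed (use dm in measurable)
    have S: "S \<ge> 0" by (simp add: S_def)
    have sq: "(max 0 (r + h))\<^sup>2 \<le> (max 0 r)\<^sup>2 + 2 * max 0 r * h + h\<^sup>2" for r h :: real
    proof (cases "r \<ge> 0")
      case True
      have "(max 0 (r + h))\<^sup>2 \<le> (r + h)\<^sup>2" by (simp add: max_def)
      then show ?thesis using True by (simp add: max_def power2_eq_square algebra_simps)
    next
      case False
      then have "max 0 (r + h) \<le> \<bar>h\<bar>" by simp
      then have "(max 0 (r + h))\<^sup>2 \<le> \<bar>h\<bar>\<^sup>2" by (rule power_mono) simp
      then show ?thesis using False by (simp add: max_def)
    qed
    have key: "0 \<le> 2 * \<theta> * Q + \<theta>\<^sup>2 * S" if \<theta>: "0 \<le> \<theta>" "\<theta> \<le> 1" for \<theta>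
    proof -
      let ?e = "(1 - \<theta>) *\<^sub>R e + \<theta> *\<^sub>R e'" and ?v = "\<lambda>t. (1 - \<theta>) *\<^sub>R v t + \<theta> *\<^sub>R v' t"
      have mW: "(?e, ?v) \<in> W" by (rule unit_processes_convex[OF ev ev' \<theta>])
      have "(\<integral>t. (max 0 (slack ?e ?v t + c))\<^sup>2 \<partial>L) \<le> (\<integral>t. (lam1 t)\<^sup>2 + (2 * \<theta>) * (lam1 t * d t) + \<theta>\<^sup>2 * (d t)\<^sup>2 \<partial>L)"
      proof (intro integral_mono Bochner_Integration.integrable_add integrable_mult_right slack_power_integrable mW lam1sq dsq lamI[OF dm db])
        fix t assume "t \<in> space L"
        then have t: "t \<in> {a..b}" by simp
        show "(max 0 (slack ?e ?v t + c))\<^sup>2 \<le> (lam1 t)\<^sup>2 + (2 * \<theta>) * (lam1 t * d t) + \<theta>\<^sup>2 * (d t)\<^sup>2"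
        proof -
          have "slack ?e ?v t + c = (slack e v t + c) + \<theta> * d t"
            unfolding slack_convex[OF ev ev' \<theta> t] d_def by simp
          then show ?thesis
            using sq[of "slack e v t + c" "\<theta> * d t"] t by (simp only: lam1_def if_True power_mult_distrib mult_ac)
        qed
      qed
      also have "\<dots> = (\<integral>t. (lam1 t)\<^sup>2 \<partial>L) + (2 * \<theta>) * (\<integral>t. lam1 t * d t \<partial>L) + \<theta>\<^sup>2 * (\<integral>t. (d t)\<^sup>2 \<partial>L)"
        using lam1sq dsq lamI[OF dm db] by simp
      finally have 1: "(\<integral>t. (max 0 (slack ?e ?v t + c))\<^sup>2 \<partial>L) \<le> \<dots>" .
      have "(max 0 (cost ?e ?v + c))\<^sup>2 \<le> \<alpha>1\<^sup>2 + (2 * \<theta>) * (\<alpha>1 * d0) + \<theta>\<^sup>2 * d0\<^sup>2"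
      proof -
        have "cost ?e ?v + c = (cost e v + c) + \<theta> * d0"
          unfolding cost_convex[OF ev ev' \<theta>] d0_def by simp
        then show ?thesis
          using sq[of "cost e v + c" "\<theta> * d0"] by (simp only: \<alpha>1_def power_mult_distrib mult_ac)
      qed
      then have "penalty c ?e ?v \<le> penalty c e v + 2 * \<theta> * Q + \<theta>\<^sup>2 * S"
        using 1 unfolding penL Q_def S_def by (simp add: penalty_def algebra_simps)
      then show ?thesis using min[OF mW] by linarith
    qed
    define \<theta> where "\<theta> = min 1 (- Q / (S + 1))"
    have \<theta>: "0 < \<theta>" "\<theta> \<le> 1" using Q S by (auto simp: \<theta>_def intro!: divide_neg_pos)
    have "\<theta> * S \<le> - Q"
    proof -
      have "\<theta> * S \<le> (- Q / (S + 1)) * (S + 1)" using \<theta> S by (intro mult_mono) (auto simp: \<theta>_def)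
      then show ?thesis using S by simp
    qed
    then have "2 * Q + \<theta> * S < 0" using Q by linarith
    then have "\<theta> * (2 * Q + \<theta> * S) < 0" using \<theta> by (simp add: mult_pos_neg)
    moreover have "0 \<le> \<theta> * (2 * Q + \<theta> * S)" using key[of \<theta>] \<theta> by (simp add: power2_eq_square algebra_simps)
    ultimately show False by linarith
  qed

  \<comment> \<open>At the minimizer \<open>\<alpha>1 * cost\<close> is \<open>\<alpha>1\<^sup>2 - c * \<alpha>1\<close>, likewise for the slack; the squares may be dropped.\<close>
  have bound: "\<alpha>1 * cost e' v' + (\<integral>t. lam1 t * slack e' v' t \<partial>L) \<ge> - c * (\<alpha>1 + (\<integral>t. lam1 t \<partial>L))"
    if ev': "(e', v') \<in> W" for e' v'
  proof -
    note i = lamI[OF slack_measurable[OF ev] C(2)[OF ev]] lamI[OF slack_measurable[OF ev'] C(2)[OF ev']]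
    have "(\<integral>t. lam1 t * (slack e' v' t - slack e v t) \<partial>L) = (\<integral>t. lam1 t * slack e' v' t \<partial>L) - (\<integral>t. lam1 t * slack e v t \<partial>L)"
      using i by (simp add: right_diff_distrib)
    moreover have "\<alpha>1 * cost e v = \<alpha>1\<^sup>2 - c * \<alpha>1" by (simp add: \<alpha>1_def max_def power2_eq_square algebra_simps)
    moreover have "(\<integral>t. lam1 t * slack e v t \<partial>L) = (\<integral>t. (lam1 t)\<^sup>2 - c * lam1 t \<partial>L)"
      by (intro Bochner_Integration.integral_cong refl) (simp add: lam1_def max_def power2_eq_square algebra_simps)
    moreover have "\<dots> = (\<integral>t. (lam1 t)\<^sup>2 \<partial>L) - c * (\<integral>t. lam1 t \<partial>L)" using lam1sq lam1I by simp
    moreover have "\<alpha>1\<^sup>2 \<ge> 0" "(\<integral>t. (lam1 t)\<^sup>2 \<partial>L) \<ge> 0" by auto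
    moreover have "\<alpha>1 * (cost e' v' - cost e v) = \<alpha>1 * cost e' v' - \<alpha>1 * cost e v" by (rule right_diff_distrib)
    moreover have "- c * (\<alpha>1 + (\<integral>t. lam1 t \<partial>L)) = - (c * \<alpha>1) - c * (\<integral>t. lam1 t \<partial>L)" by (simp add: algebra_simps)
    ultimately show ?thesis using first_order[OF ev'] by linarith
  qed

  define m where "m = \<alpha>1 + (\<integral>t. lam1 t \<partial>L)"
  have m: "m > 0" using pos by (simp add: m_def)
  show ?thesis
  proof
    show "0 \<le> \<alpha>1 / m" using m by (simp add: \<alpha>1_def)
    show "(\<lambda>t. lam1 t / m) \<in> borel_measurable L" using lam1m by measurable
    show "0 \<le> lam1 t / m" "lam1 t / m \<le> (C + c) / m" for t using m lam1b[of t] by (auto simp: divide_right_mono)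
    show "\<alpha>1 / m + (\<integral>t. lam1 t / m \<partial>L) = 1" using m by (simp add: m_def add_divide_distrib[symmetric])
    fix e' v' assume "(e', v') \<in> W"
    from bound[OF this] have "(- c * m) / m \<le> (\<alpha>1 * cost e' v' + (\<integral>t. lam1 t * slack e' v' t \<partial>L)) / m"
      using m by (intro divide_right_mono) (auto simp: m_def)
    then show "\<alpha>1 / m * cost e' v' + (\<integral>t. lam1 t / m * slack e' v' t \<partial>L) \<ge> - c"
      using m by (simp add: add_divide_distrib)
  qed
qed

end

section \<open>Weak limits of nonnegative densities\<close>

text \<open>The primitive of \<open>h\<close> that vanishes at \<open>a\<close>, extended by constants: for nonnegative \<open>h\<close> the distribution function of the
  measure with density \<open>h\<close> on \<open>{a..b}\<close>.\<close>

definition cumul :: "real \<Rightarrow> real \<Rightarrow> (real \<Rightarrow> 'a::euclidean_space) \<Rightarrow> real \<Rightarrow> 'a" where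
  "cumul a b h t = (\<integral>s. indicator {..t} s *\<^sub>R h s \<partial>lebesgue_on {a..b})"

lemma integrable_indicator_lebesgue_on:
  assumes h: "integrable (lebesgue_on {a..b}) (h :: real \<Rightarrow> 'a::euclidean_space)" and B: "B \<in> sets borel"
  shows "integrable (lebesgue_on {a..b}) (\<lambda>s. indicator B s *\<^sub>R h s)"
proof -
  have "B \<inter> {a..b} \<in> sets lebesgue" using B by (intro sets.Int sets_completionI_sets) auto
  then have "B \<inter> {a..b} \<in> sets (lebesgue_on {a..b})" by (simp add: sets_restrict_space_iff)
  from integrable_mult_indicator[OF this h]
  have "integrable (lebesgue_on {a..b}) (\<lambda>s. indicator (B \<inter> {a..b}) s *\<^sub>R h s)" .
  moreover have "integrable (lebesgue_on {a..b}) (\<lambda>s. indicator (B \<inter> {a..b}) s *\<^sub>R h s) =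
      integrable (lebesgue_on {a..b}) (\<lambda>s. indicator B s *\<^sub>R h s)"
    by (rule Bochner_Integration.integrable_cong) (auto simp: indicator_def)
  ultimately show ?thesis by simp
qed

lemma cumul_eq_integral:
  assumes h: "integrable (lebesgue_on {a..b}) (h :: real \<Rightarrow> 'a::euclidean_space)" and ab: "a \<le> b"
  shows "cumul a b h t = integral {a..max a (min b t)} h"
proof -
  have "cumul a b h t = integral {a..b} (\<lambda>s. indicator {..t} s *\<^sub>R h s)"
    unfolding cumul_def by (rule lebesgue_integral_eq_integral[OF integrable_indicator_lebesgue_on[OF h]]) auto
  also have "\<dots> = integral {a..b} (\<lambda>s. if s \<in> {..t} then h s else 0)"
    by (rule integral_cong) auto
  also have "\<dots> = integral ({a..b} \<inter> {..t}) h"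
    by (subst Int_commute) (rule Henstock_Kurzweil_Integration.integral_restrict_Int)
  also have "\<dots> = integral {a..max a (min b t)} h"
  proof (cases "t < a")
    case True
    then have "{a..b} \<inter> {..t} = {}" "max a (min b t) = a" using ab by auto
    then show ?thesis by (simp add: Henstock_Kurzweil_Integration.integral_empty)
  next
    case False
    then have "{a..b} \<inter> {..t} = {a..max a (min b t)}" using ab by auto
    then show ?thesis by simp
  qed
  finally show ?thesis .
qed

lemma cumul_continuous:
  assumes h: "integrable (lebesgue_on {a..b}) (h :: real \<Rightarrow> 'a::euclidean_space)" and ab: "a \<le> b"
  shows "continuous_on UNIV (cumul a b h)"
proof -
  have "h integrable_on {a..b}" using has_integral_integral_lebesgue_on[OF h] by (auto simp: integrable_on_def)
  then have "continuous_on {a..b} (\<lambda>t. integral {a..t} h)" by (rule indefinite_integral_continuous_1)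
  then have "continuous_on UNIV (\<lambda>t. integral {a..max a (min b t)} h)"
    by (rule continuous_on_compose2) (use ab in \<open>auto intro!: continuous_intros\<close>)
  then show ?thesis by (simp add: cumul_eq_integral[OF h ab, abs_def])
qed

lemma cumul_diff:
  assumes h: "integrable (lebesgue_on {a..b}) (h :: real \<Rightarrow> 'a::euclidean_space)" and st: "s \<le> t"
  shows "cumul a b h t - cumul a b h s = (\<integral>x. indicator {s<..t} x *\<^sub>R h x \<partial>lebesgue_on {a..b})"
proof -
  have "cumul a b h t - cumul a b h s = (\<integral>x. indicator {..t} x *\<^sub>R h x - indicator {..s} x *\<^sub>R h x \<partial>lebesgue_on {a..b})"
    unfolding cumul_def by (rule Bochner_Integration.integral_diff[symmetric]) (auto intro!: integrable_indicator_lebesgue_on h)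
  also have "\<dots> = (\<integral>x. indicator {s<..t} x *\<^sub>R h x \<partial>lebesgue_on {a..b})"
    by (rule Bochner_Integration.integral_cong) (use st in \<open>auto simp: indicator_def\<close>)
  finally show ?thesis .
qed

lemma cumul_mono:
  assumes h: "integrable (lebesgue_on {a..b}) (h :: real \<Rightarrow> real)" and nonneg: "\<And>t. t \<in> {a..b} \<Longrightarrow> h t \<ge> 0"
  shows "mono (cumul a b h)"
proof (rule monoI)
  fix s t :: real assume st: "s \<le> t"
  have "0 \<le> (\<integral>x. indicator {s<..t} x *\<^sub>R h x \<partial>lebesgue_on {a..b})"
    by (rule integral_nonneg_AE) (use nonneg in \<open>auto intro!: AE_I2\<close>)
  then show "cumul a b h s \<le> cumul a b h t" using cumul_diff[OF h st] by simp
qed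

lemma cumul_outside:
  shows "t < a \<Longrightarrow> cumul a b h t = 0"
    and "b \<le> t \<Longrightarrow> cumul a b h t = integral\<^sup>L (lebesgue_on {a..b}) h"
proof -
  show "cumul a b h t = 0" if "t < a"
  proof -
    have "cumul a b h t = (\<integral>s. 0 \<partial>lebesgue_on {a..b})"
      unfolding cumul_def by (rule Bochner_Integration.integral_cong) (use that in auto)
    then show ?thesis by simp
  qed
  show "cumul a b h t = integral\<^sup>L (lebesgue_on {a..b}) h" if "b \<le> t"
    unfolding cumul_def by (rule Bochner_Integration.integral_cong) (use that in auto)
qed

text \<open>Weak convergence of the densities \<open>h k\<close> to \<open>\<mu>\<close>, expressed by distribution functions. The limit may have atoms, also
  at the two endpoints.\<close>

definition limit_measure :: "real \<Rightarrow> real \<Rightarrow> (nat \<Rightarrow> real \<Rightarrow> real) \<Rightarrow> real measure \<Rightarrow> bool" where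
  "limit_measure a b h \<mu> \<longleftrightarrow> finite_borel_measure \<mu> \<and> measure \<mu> (- {a..b}) = 0 \<and>
     (\<exists>D. countable D \<and> (\<forall>t. t \<notin> D \<longrightarrow> (\<lambda>k. cumul a b (h k) t) \<longlonglongrightarrow> measure \<mu> {..t})) \<and>
     (\<lambda>k. integral\<^sup>L (lebesgue_on {a..b}) (h k)) \<longlonglongrightarrow> measure \<mu> UNIV"

lemma limit_measure_subseq:
  assumes "limit_measure a b h \<mu>" "strict_mono r"
  shows "limit_measure a b (\<lambda>k. h (r k)) \<mu>"
proof -
  have S: "(\<lambda>k. X (r k)) \<longlonglongrightarrow> l" if "X \<longlonglongrightarrow> l" for X :: "nat \<Rightarrow> real" and l
    using LIMSEQ_subseq_LIMSEQ[OF that assms(2)] by (simp add: o_def)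
  obtain D where D: "countable D" "\<And>t. t \<notin> D \<Longrightarrow> (\<lambda>k. cumul a b (h k) t) \<longlonglongrightarrow> measure \<mu> {..t}"
    using assms(1) unfolding limit_measure_def by blast
  have "\<forall>t. t \<notin> D \<longrightarrow> (\<lambda>k. cumul a b (h (r k)) t) \<longlonglongrightarrow> measure \<mu> {..t}"
    using S[OF D(2)] by blast
  then show ?thesis
    using assms(1) D(1) S[of "\<lambda>k. integral\<^sup>L (lebesgue_on {a..b}) (h k)" "measure \<mu> UNIV"]
    unfolding limit_measure_def by blast
qed

text \<open>Helly's theorem provides a limit \<open>F\<close> of the distribution functions. It vanishes to the left of \<open>a\<close> and is constant from
  \<open>b\<close> on, so no mass escapes and \<open>F\<close> is the distribution function of a finite measure carried by \<open>{a..b}\<close>.\<close>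

lemma helly_densities:
  fixes h :: "nat \<Rightarrow> real \<Rightarrow> real"
  assumes ab: "a \<le> b" and int: "\<And>k. integrable (lebesgue_on {a..b}) (h k)"
    and nonneg: "\<And>k t. t \<in> {a..b} \<Longrightarrow> h k t \<ge> 0"
    and bound: "\<And>k. integral\<^sup>L (lebesgue_on {a..b}) (h k) \<le> M"
  obtains r \<mu> where "strict_mono r" "limit_measure a b (\<lambda>k. h (r k)) \<mu>"
proof -
  let ?L = "lebesgue_on {a..b}"
  define f where "f k = cumul a b (h k)" for k
  have fm: "mono (f k)" for k unfolding f_def by (rule cumul_mono[OF int nonneg])
  have f0: "f k t = 0" if "t < a" for k t unfolding f_def by (rule cumul_outside(1)[OF that])
  have f1: "f k t = integral\<^sup>L ?L (h k)" if "b \<le> t" for k t unfolding f_def by (rule cumul_outside(2)[OF that])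
  have fb: "\<bar>f k t\<bar> \<le> M" for k t
  proof -
    have "f k (min t (a - 1)) \<le> f k t" "f k t \<le> f k (max t b)" by (rule monoD[OF fm], simp)+
    moreover have "f k (min t (a - 1)) = 0" by (rule f0) auto
    moreover have "f k (max t b) \<le> M" using f1[of "max t b" k] bound[of k] by auto
    ultimately show ?thesis by linarith
  qed
  have fc: "continuous (at_right x) (f k)" for k x
  proof -
    have "isCont (cumul a b (h k)) x"
      using cumul_continuous[OF int ab, of k] continuous_on_eq_continuous_at[OF open_UNIV] by blast
    then show ?thesis unfolding f_def by (rule continuous_at_imp_continuous_at_within)
  qed
  obtain r F where r: "strict_mono r" and F: "\<And>x. continuous (at_right x) F" "mono F" "\<And>x. \<bar>F x\<bar> \<le> M"
    and lim: "\<And>x. continuous (at x) F \<Longrightarrow> (\<lambda>n. f (r n) x) \<longlonglongrightarrow> F x"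
    using Helly_selection[of f M, OF fc fm fb] by blast
  define D where "D = {x. \<not> isCont F x}"
  have D: "countable D" unfolding D_def by (rule mono_ctble_discont[OF F(2)])
  have ex: "\<exists>x. s < x \<and> x < t \<and> x \<notin> D" if "s < t" for s t :: real
  proof -
    have "uncountable ({s<..<t} - D)" using D that by (simp add: uncountable_open_interval uncountable_minus_countable)
    then have "{s<..<t} - D \<noteq> {}" by fastforce
    then show ?thesis by auto
  qed
  have limD: "(\<lambda>n. f (r n) x) \<longlonglongrightarrow> F x" if "x \<notin> D" for x using lim that by (simp add: D_def)
  have F0': "F x = 0" if "x < a" "x \<notin> D" for x
    using limD[OF that(2)] f0[OF that(1)] by (simp add: LIMSEQ_const_iff)
  \<comment> \<open>Values outside \<open>D\<close> determine all others by monotonicity.\<close>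
  have F0: "F x = 0" if x: "x < a" for x
  proof -
    obtain y z where "x < y" "y < a" "y \<notin> D" "x - 1 < z" "z < x" "z \<notin> D" using ex[OF x] ex[of "x - 1" x] by auto
    then have "F y = 0" "F z = 0" "F x \<le> F y" "F z \<le> F x" using F0' x monoD[OF F(2), of x y] monoD[OF F(2), of z x] by auto
    then show ?thesis by simp
  qed
  obtain x1 where x1: "b < x1" "x1 < b + 1" "x1 \<notin> D" using ex[of b "b + 1"] by auto
  define c where "c = F x1"
  have limc: "(\<lambda>n. integral\<^sup>L ?L (h (r n))) \<longlonglongrightarrow> c"
    using limD[OF x1(3)] f1[OF less_imp_le[OF x1(1)]] by (simp add: c_def)
  have Fc': "F x = c" if "b < x" "x \<notin> D" for x
    using LIMSEQ_unique[OF limD[OF that(2)]] f1[OF less_imp_le[OF that(1)]] limc by simp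
  have Fc1: "F x = c" if x: "b < x" for x
  proof -
    obtain y z where "x < y" "y < x + 1" "y \<notin> D" "b < z" "z < x" "z \<notin> D" using ex[OF x] ex[of x "x + 1"] by auto
    then have "F y = c" "F z = c" "F x \<le> F y" "F z \<le> F x" using Fc' x monoD[OF F(2), of x y] monoD[OF F(2), of z x] by auto
    then show ?thesis by simp
  qed
  have Fb: "F b = c"
  proof -
    have "(F \<longlongrightarrow> F b) (at_right b)" using F(1)[of b] by (simp add: continuous_within)
    moreover have "(F \<longlongrightarrow> c) (at_right b)"
      by (rule tendsto_eventually) (auto simp: eventually_at_right_field intro!: exI[of _ "b + 1"] Fc1)
    ultimately show ?thesis by (rule tendsto_unique[rotated]) simp
  qed
  have bot: "(F \<longlongrightarrow> 0) at_bot"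
    by (rule tendsto_eventually) (auto simp: eventually_at_bot_dense intro!: exI[of _ a] F0)
  have Fm: "F x \<le> F y" if "x \<le> y" for x y using monoD[OF F(2) that] .
  define \<mu> where "\<mu> = interval_measure F"
  have Iic: "emeasure \<mu> {..x} = F x" for x
    unfolding \<mu>_def by (rule emeasure_interval_measure_Iic[OF Fm F(1) bot])
  have mIic: "measure \<mu> {..x} = F x" for x
    unfolding \<mu>_def by (rule measure_interval_measure_Iic[OF Fm F(1) bot])
  have c0: "c \<ge> 0" using F0[of "a - 1"] Fm[of "a - 1" b] Fb ab by simp
  have right: "emeasure \<mu> {b<..} = 0"
  proof -
    have "emeasure \<mu> {b<..b + real n} = 0" for n
    proof -
      have "F (b + real n) = c" by (cases "n = 0") (auto simp: Fb intro!: Fc1)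
      then show ?thesis unfolding \<mu>_def by (subst emeasure_interval_measure_Ioc_eq[OF Fm F(1)]) (simp_all add: Fb)
    qed
    then have "emeasure \<mu> (\<Union>n::nat. {b<..b + real n}) = 0"
      by (intro emeasure_UN_eq_0) (auto simp: \<mu>_def)
    moreover have "(\<Union>n::nat. {b<..b + real n}) = {b<..}"
      by (auto, metis add.commute le_add_diff_inverse less_imp_le diff_le_eq real_arch_simple)
    ultimately show ?thesis by simp
  qed
  have left: "emeasure \<mu> {..<a} = 0"
  proof -
    have "emeasure \<mu> (\<Union>n::nat. {..a - 1 / real (Suc n)}) = 0"
      by (intro emeasure_UN_eq_0) (auto simp: \<mu>_def[symmetric] Iic F0, simp add: \<mu>_def)
    moreover have "(\<Union>n::nat. {..a - 1 / real (Suc n)}) = {..<a}"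
    proof (intro set_eqI iffI)
      fix x assume "x \<in> {..<a}"
      then obtain n where "1 / real (Suc n) < a - x" using nat_approx_posE[of "a - x"] by auto
      then show "x \<in> (\<Union>n::nat. {..a - 1 / real (Suc n)})" by (intro UN_I[of n]) auto
    next
      fix x assume "x \<in> (\<Union>n::nat. {..a - 1 / real (Suc n)})"
      then obtain n :: nat where "x \<le> a - 1 / real (Suc n)" by auto
      moreover have "1 / real (Suc n) > 0" by simp
      ultimately have "x < a" by linarith
      then show "x \<in> {..<a}" by simp
    qed
    ultimately show ?thesis by simp
  qed
  have sets: "sets \<mu> = sets borel" by (simp add: \<mu>_def)
  have UN: "emeasure \<mu> UNIV = ennreal c"
  proof -
    have "emeasure \<mu> ({..b} \<union> {b<..}) = emeasure \<mu> {..b} + emeasure \<mu> {b<..}"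
      by (rule plus_emeasure[symmetric]) (auto simp: sets)
    moreover have "{..b} \<union> {b<..} = UNIV" by auto
    ultimately show ?thesis using right Iic[of b] Fb by simp
  qed
  have fin: "finite_borel_measure \<mu>"
  proof (intro finite_borel_measure.intro finite_borel_measure_axioms.intro finite_measureI)
    have "space \<mu> = UNIV" by (simp add: \<mu>_def)
    then show "emeasure \<mu> (space \<mu>) \<noteq> \<infinity>" by (simp add: UN)
  qed (rule sets)
  have out: "measure \<mu> (- {a..b}) = 0"
  proof -
    have "emeasure \<mu> ({..<a} \<union> {b<..}) \<le> emeasure \<mu> {..<a} + emeasure \<mu> {b<..}"
      by (rule emeasure_subadditive) (auto simp: sets)
    moreover have "{..<a} \<union> {b<..} = - {a..b}" using ab by auto
    ultimately show ?thesis using left right by (simp add: measure_def)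
  qed
  have "limit_measure a b (\<lambda>k. h (r k)) \<mu>"
    unfolding limit_measure_def
  proof (intro conjI fin out exI[of _ D] D)
    show "\<forall>t. t \<notin> D \<longrightarrow> (\<lambda>k. cumul a b (h (r k)) t) \<longlonglongrightarrow> measure \<mu> {..t}"
      using limD by (simp add: mIic f_def)
    show "(\<lambda>k. integral\<^sup>L ?L (h (r k))) \<longlonglongrightarrow> measure \<mu> UNIV"
      using limc UN c0 by (simp add: measure_def)
  qed
  then show ?thesis using that r by blast
qed

lemma helly_densities_finite:
  fixes h :: "'i \<Rightarrow> nat \<Rightarrow> real \<Rightarrow> real"
  assumes "finite I" and ab: "a \<le> b" and int: "\<And>i k. i \<in> I \<Longrightarrow> integrable (lebesgue_on {a..b}) (h i k)"
    and nonneg: "\<And>i k t. i \<in> I \<Longrightarrow> t \<in> {a..b} \<Longrightarrow> h i k t \<ge> 0"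
    and bound: "\<And>i k. i \<in> I \<Longrightarrow> integral\<^sup>L (lebesgue_on {a..b}) (h i k) \<le> M"
  shows "\<exists>r. strict_mono r \<and> (\<forall>i\<in>I. \<exists>\<mu>. limit_measure a b (\<lambda>k. h i (r k)) \<mu>)"
  using assms(1) int nonneg bound
proof (induction I rule: finite_induct)
  case empty
  then show ?case by (intro exI[of _ id]) (simp add: strict_mono_def)
next
  case (insert i I)
  then obtain r where r: "strict_mono r" "\<forall>i\<in>I. \<exists>\<mu>. limit_measure a b (\<lambda>k. h i (r k)) \<mu>" by auto
  obtain r' \<mu> where r': "strict_mono r'" "limit_measure a b (\<lambda>k. h i (r (r' k))) \<mu>"
    by (rule helly_densities[OF ab, of "\<lambda>k. h i (r k)" M]) (use insert.prems in auto)
  show ?case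
  proof (intro exI[of _ "r \<circ> r'"] conjI ballI)
    show "strict_mono (r \<circ> r')" by (rule strict_mono_o[OF r(1) r'(1)])
    fix j assume "j \<in> insert i I"
    then show "\<exists>\<mu>. limit_measure a b (\<lambda>k. h j ((r \<circ> r') k)) \<mu>"
    proof (cases "j = i")
      case True
      then show ?thesis using r'(2) by auto
    next
      case False
      then obtain \<mu> where "limit_measure a b (\<lambda>k. h j (r k)) \<mu>" using r(2) \<open>j \<in> insert i I\<close> by auto
      from limit_measure_subseq[OF this r'(1)] show ?thesis by auto
    qed
  qed
qed

section \<open>The adjoint equation and the limit of the multipliers\<close>

lemma norm_adjoint_le:
  fixes T :: "'a::euclidean_space \<Rightarrow> 'b::euclidean_space"
  assumes T: "linear T" and K: "\<And>y. norm (T y) \<le> K * norm y"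
  shows "norm (adjoint T p) \<le> K * norm p"
proof (cases "adjoint T p = 0")
  case True
  have "0 \<le> K * norm p"
  proof (cases "p = 0")
    case False
    obtain i :: 'a where "i \<in> Basis" by (rule nonempty_Basis[THEN ex_in_conv[THEN iffD2], THEN exE])
    then have "0 \<le> K" using K[of i] norm_ge_zero[of "T i"] by (simp add: norm_Basis del: norm_ge_zero)
    then show ?thesis by simp
  qed simp
  then show ?thesis using True by simp
next
  case False
  have "norm (adjoint T p) * norm (adjoint T p) = p \<bullet> T (adjoint T p)"
    using adjoint_works[OF T, of "adjoint T p" p] by (simp add: power2_norm_eq_inner[symmetric] power2_eq_square inner_commute)
  also have "\<dots> \<le> norm p * (K * norm (adjoint T p))"
    using norm_cauchy_schwarz[of p "T (adjoint T p)"] mult_left_mono[OF K[of "adjoint T p"], of "norm p"] by simp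
  finally have "norm (adjoint T p) * norm (adjoint T p) \<le> (K * norm p) * norm (adjoint T p)" by (simp add: mult_ac)
  then show ?thesis using False by simp
qed

lemma AE_lebesgue_on_not_in_countable:
  assumes "countable (D :: real set)"
  shows "AE t in lebesgue_on {a..b}. t \<notin> D"
proof -
  have "D \<in> null_sets lebesgue"
    using null_sets_completionI[OF countable_imp_null_set_lborel[OF assms]] .
  then have "AE t in lebesgue. t \<notin> D" by (rule AE_not_in)
  then have "AE t in lebesgue. t \<in> {a..b} \<longrightarrow> t \<notin> D" by eventually_elim simp
  then show ?thesis by (subst AE_restrict_space_iff) auto
qed

lemma abs_inner_le:
  fixes x y :: "'a::real_inner"
  assumes "norm x \<le> c" "norm y \<le> d"
  shows "\<bar>x \<bullet> y\<bar> \<le> c * d"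
proof -
  have "c \<ge> 0" using assms(1) norm_ge_zero order_trans by blast
  then have "norm x * norm y \<le> c * d" using assms by (intro mult_mono) auto
  then show ?thesis using Cauchy_Schwarz_ineq2[of x y] by linarith
qed

context linear_system
begin

definition AT :: "real \<Rightarrow> 'a \<Rightarrow> 'a" where "AT t = adjoint (A t)"
definition BT :: "real \<Rightarrow> 'a \<Rightarrow> 'b" where "BT t = adjoint (B t)"

lemma AT_inner: "AT t p \<bullet> y = p \<bullet> A t y" and BT_inner: "BT t p \<bullet> v = p \<bullet> B t v"
  using adjoint_works[OF linear_A[of t], of y p] adjoint_works[OF linear_B[of t], of v p]
  by (simp_all add: AT_def BT_def inner_commute)

lemma linear_AT: "linear (AT t)" and linear_BT: "linear (BT t)"
  unfolding AT_def BT_def by (rule adjoint_linear[OF linear_A], rule adjoint_linear[OF linear_B])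

lemma AT_bound: "t \<in> {a..b} \<Longrightarrow> norm (AT t p) \<le> K * norm p"
  unfolding AT_def by (rule norm_adjoint_le[OF linear_A A_bound])

lemma BT_bound: "t \<in> {a..b} \<Longrightarrow> norm (BT t p) \<le> K * norm p"
  unfolding BT_def by (rule norm_adjoint_le[OF linear_B B_bound])

lemma AT_comp_measurable: "p \<in> borel_measurable L \<Longrightarrow> (\<lambda>t. AT t (p t)) \<in> borel_measurable L"
proof (rule linear_family_measurable[OF linear_AT])
  fix y
  have "(\<lambda>t. AT t y \<bullet> i) \<in> borel_measurable L" for i
    unfolding AT_inner using A_measurable[of i] by measurable
  then show "(\<lambda>t. AT t y) \<in> borel_measurable L" by (subst borel_measurable_euclidean_space) auto
qed

lemma BT_comp_measurable: "p \<in> borel_measurable L \<Longrightarrow> (\<lambda>t. BT t (p t)) \<in> borel_measurable L"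
proof (rule linear_family_measurable[OF linear_BT])
  fix y
  have "(\<lambda>t. BT t y \<bullet> i) \<in> borel_measurable L" for i
    unfolding BT_inner using B_measurable[of i] by measurable
  then show "(\<lambda>t. BT t y) \<in> borel_measurable L" by (subst borel_measurable_euclidean_space) auto
qed

lemma AT_diff: "AT t (x - y) = AT t x - AT t y" and AT_add: "AT t (x + y) = AT t x + AT t y"
  and BT_diff: "BT t (x - y) = BT t x - BT t y"
  using linear_AT linear_BT by (simp_all add: linear_diff linear_add)

text \<open>The multiplier rule for the linear system with error \<open>c\<close>: normalization, adjoint equation and terminal condition hold
  exactly; the initial condition, stationarity in the control and complementary slackness hold up to \<open>c\<close>.\<close>

definition approx_multiplier :: "real \<Rightarrow> real \<Rightarrow> (real \<Rightarrow> real) \<Rightarrow> (real \<Rightarrow> 'a) \<Rightarrow> bool" where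
  "approx_multiplier c \<alpha> lam p \<longleftrightarrow> \<alpha> \<ge> 0 \<and> lam \<in> borel_measurable L \<and> (\<forall>t. 0 \<le> lam t) \<and> (\<exists>C. \<forall>t. lam t \<le> C) \<and>
     \<alpha> + (\<integral>t. lam t \<partial>L) = 1 \<and> continuous_on {a..b} p \<and>
     (\<forall>t\<in>{a..b}. p t = \<alpha> *\<^sub>R j1 + integral {t..b} (\<lambda>s. AT s (p s) + lam s *\<^sub>R gx s)) \<and>
     norm (\<alpha> *\<^sub>R j0 + p a) \<le> c \<and>
     (\<integral>t. norm (BT t (p t) + lam t *\<^sub>R gu t) \<partial>L) \<le> c \<and>
     (\<integral>t. lam t * \<bar>g t\<bar> \<partial>L) \<le> c"

lemma bounded_mult_integrable:
  fixes h :: "real \<Rightarrow> 'c::euclidean_space"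
  assumes "lam \<in> borel_measurable L" "\<And>t. 0 \<le> lam t" "\<And>t. lam t \<le> C"
    and "h \<in> borel_measurable L" "\<And>t. t \<in> {a..b} \<Longrightarrow> norm (h t) \<le> D"
  shows "integrable L (\<lambda>t. lam t *\<^sub>R h t)"
proof (rule integrable_lebesgue_on_bounded[where C = "C * D"])
  show "(\<lambda>t. lam t *\<^sub>R h t) \<in> borel_measurable L" using assms by measurable
  show "norm (lam t *\<^sub>R h t) \<le> C * D" if "t \<in> {a..b}" for t
    using assms(2,3)[of t] assms(5)[OF that] by (auto intro!: mult_mono order_trans[OF norm_ge_zero assms(5)[OF that]])
qed

text \<open>With the adjoint variable, integration by parts turns the Lagrange functional into a functional of the free data
  \<open>(e, v)\<close> alone. Its lower bound \<open>- c\<close>, tested with data pointing opposite to the residuals, bounds the residuals.\<close>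

lemma approx_multiplier_exists:
  assumes c: "c > 0"
    and no_descent: "\<And>e v. (e, v) \<in> W \<Longrightarrow> cost e v \<le> - c \<Longrightarrow> \<not> (AE t in L. slack e v t \<le> - c)"
  shows "\<exists>\<alpha> lam p. approx_multiplier c \<alpha> lam p"
proof -
  obtain \<alpha> lam C where \<alpha>: "\<alpha> \<ge> 0" and lam: "lam \<in> borel_measurable L" "\<And>t. 0 \<le> lam t" "\<And>t. lam t \<le> C"
    and one: "\<alpha> + (\<integral>t. lam t \<partial>L) = 1"
    and ineq: "\<And>e v. (e, v) \<in> W \<Longrightarrow> \<alpha> * cost e v + (\<integral>t. lam t * slack e v t \<partial>L) \<ge> - c"
    using approximate_multipliers[OF c no_descent] by blast
  have C0: "C \<ge> 0" using lam(2,3)[of a] by linarith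
  have gxm: "(\<lambda>t. lam t *\<^sub>R gx t) \<in> borel_measurable L" using lam by measurable
  have lgx: "norm (lam t *\<^sub>R gx t) \<le> C * K" if "t \<in> {a..b}" for t
    using lam(2,3)[of t] gx_bound[OF that] by (auto intro!: mult_mono C0)
  have adjm: "(\<lambda>t. AT t (p t) + lam t *\<^sub>R gx t) \<in> borel_measurable L" if "continuous_on {a..b} p" for p
    using AT_comp_measurable[OF continuous_on_interval_measurable[OF that]] gxm by measurable
  have adjb: "\<exists>D. \<forall>t\<in>{a..b}. norm (AT t (p t) + lam t *\<^sub>R gx t) \<le> D" if p: "continuous_on {a..b} p" for p
  proof -
    obtain E where E: "E \<ge> 0" "\<forall>t\<in>{a..b}. norm (p t) \<le> E" using continuous_on_interval_bound[OF p] by auto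
    have "norm (AT t (p t) + lam t *\<^sub>R gx t) \<le> K * E + C * K" if t: "t \<in> {a..b}" for t
    proof -
      have "K * norm (p t) \<le> K * E" using E t K_nonneg by (intro mult_left_mono) auto
      then show ?thesis using norm_triangle_ineq[of "AT t (p t)" "lam t *\<^sub>R gx t"] AT_bound[OF t, of "p t"] lgx[OF t] by linarith
    qed
    then show ?thesis by blast
  qed
  have adji: "(\<lambda>t. AT t (p t) + lam t *\<^sub>R gx t) integrable_on {a..b}" if p: "continuous_on {a..b} p" for p
    using adjb[OF p] integrable_on_bounded[OF adjm[OF p]] by blast
  obtain p where p: "continuous_on {a..b} p"
    "\<And>t. t \<in> {a..b} \<Longrightarrow> p t = \<alpha> *\<^sub>R j1 + integral {t..b} (\<lambda>s. AT s (p s) + lam s *\<^sub>R gx s)"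
  proof (rule caratheodory_backward[of a b "\<lambda>s y. AT s y + lam s *\<^sub>R gx s" K "\<alpha> *\<^sub>R j1"])
    show "norm (AT t y + lam t *\<^sub>R gx t - (AT t z + lam t *\<^sub>R gx t)) \<le> K * norm (y - z)" if "t \<in> {a..b}" for t y z
      using AT_bound[OF that, of "y - z"] by (simp add: AT_diff)
  qed (use ab adji in auto)
  obtain E where E: "E \<ge> 0" "\<forall>t\<in>{a..b}. norm (p t) \<le> E" using continuous_on_interval_bound[OF p(1)] by auto
  obtain D where D: "\<And>t. t \<in> {a..b} \<Longrightarrow> norm (AT t (p t) + lam t *\<^sub>R gx t) \<le> D" using adjb[OF p(1)] by blast
  define q where "q t = BT t (p t) + lam t *\<^sub>R gu t" for t
  have pm: "p \<in> borel_measurable L" by (rule continuous_on_interval_measurable[OF p(1)])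
  have qm: "q \<in> borel_measurable L" unfolding q_def[abs_def] using BT_comp_measurable[OF pm] lam by measurable
  have qb: "norm (q t) \<le> K * E + C * K" if t: "t \<in> {a..b}" for t
  proof -
    have "K * norm (p t) \<le> K * E" using E t K_nonneg by (intro mult_left_mono) auto
    moreover have "norm (lam t *\<^sub>R gu t) \<le> C * K"
      using lam(2,3)[of t] gu_bound[OF t] by (auto intro!: mult_mono C0)
    ultimately show ?thesis unfolding q_def using norm_triangle_ineq[of "BT t (p t)" "lam t *\<^sub>R gu t"] BT_bound[OF t, of "p t"] by linarith
  qed

  \<comment> \<open>Integration by parts removes the trajectory from the Lagrange functional.\<close>
  have duality: "\<alpha> * cost e v + (\<integral>t. lam t * slack e v t \<partial>L) =
      (\<alpha> *\<^sub>R j0 + p a) \<bullet> e + (\<integral>t. q t \<bullet> v t \<partial>L) + (\<integral>t. lam t * g t \<partial>L)" if ev: "(e, v) \<in> W" for e v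
  proof -
    let ?x = "traj e v"
    have v: "v \<in> borel_measurable L" "\<And>t. norm (v t) \<le> 1" using ev by (auto simp: unit_processes_def)
    have x: "continuous_on {a..b} ?x" "\<And>t. t \<in> {a..b} \<Longrightarrow> ?x t = e + integral {a..t} (\<lambda>s. A s (?x s) + B s (v s))"
      using is_traj_traj[OF ev] by (auto simp: is_traj_def)
    have xm: "?x \<in> borel_measurable L" by (rule traj_measurable[OF ev])
    obtain X where X: "X \<ge> 0" "\<forall>t\<in>{a..b}. norm (?x t) \<le> X" using continuous_on_interval_bound[OF x(1)] by auto
    have xa: "?x a = e" using x(2)[of a] ab by simp
    have pb: "p b = \<alpha> *\<^sub>R j1" using p(2)[of b] ab by simp
    let ?x' = "\<lambda>s. A s (?x s) + B s (v s)" and ?p' = "\<lambda>s. - (AT s (p s) + lam s *\<^sub>R gx s)"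
    have "((\<lambda>t. p t \<bullet> ?x' t + ?p' t \<bullet> ?x t) has_integral p b \<bullet> ?x b - p a \<bullet> ?x a) {a..b}"
    proof (rule integral_by_parts_inner)
      show "a \<le> b" using ab by simp
      show "?p' integrable_on {a..b}" by (intro integrable_neg adji p)
      show "norm (?p' t) \<le> D" if "t \<in> {a..b}" for t unfolding norm_minus_cancel by (rule D[OF that])
      show "?x' integrable_on {a..b}" by (rule dynamics_integrable[OF x(1) v])
      show "norm (?x' t) \<le> K * X + K" if t: "t \<in> {a..b}" for t
      proof -
        have "K * norm (?x t) \<le> K * X" "K * norm (v t) \<le> K"
          using K_nonneg X t v(2)[of t] by (auto intro: mult_left_mono mult_left_le)
        then show ?thesis
          using norm_triangle_ineq[of "A t (?x t)" "B t (v t)"] A_bound[OF t, of "?x t"] B_bound[OF t, of "v t"] by linarith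
      qed
      show "?x t = ?x a + integral {a..t} ?x'" if "t \<in> {a..b}" for t using x(2)[OF that] xa by simp
      show "p t = p a + integral {a..t} ?p'" if t: "t \<in> {a..b}" for t
      proof -
        have "integral {a..t} (\<lambda>s. AT s (p s) + lam s *\<^sub>R gx s) + integral {t..b} (\<lambda>s. AT s (p s) + lam s *\<^sub>R gx s)
            = integral {a..b} (\<lambda>s. AT s (p s) + lam s *\<^sub>R gx s)"
          by (rule Henstock_Kurzweil_Integration.integral_combine) (use t adji[OF p(1)] in auto)
        then show ?thesis using p(2)[OF t] p(2)[of a] ab
          by (simp only: Henstock_Kurzweil_Integration.integral_neg) (simp add: algebra_simps)
      qed
    qed
    moreover have "p t \<bullet> ?x' t + ?p' t \<bullet> ?x t = BT t (p t) \<bullet> v t - lam t * (gx t \<bullet> ?x t)" for t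
      by (simp add: inner_add_left inner_add_right AT_inner BT_inner inner_diff_left)
    ultimately have hi: "((\<lambda>t. BT t (p t) \<bullet> v t - lam t * (gx t \<bullet> ?x t)) has_integral \<alpha> * (j1 \<bullet> ?x b) - p a \<bullet> e) {a..b}"
      by (simp add: xa pb)
    have i1: "integrable L (\<lambda>t. lam t * (gx t \<bullet> ?x t))"
      using bounded_mult_integrable[OF lam, of "\<lambda>t. gx t \<bullet> ?x t" "K * X"] xm X(2) gx_bound
      by (simp add: abs_inner_le)
    have i2: "integrable L (\<lambda>t. lam t * (gu t \<bullet> v t))"
    proof -
      have "\<bar>gu t \<bullet> v t\<bar> \<le> K * 1" if "t \<in> {a..b}" for t by (rule abs_inner_le[OF gu_bound[OF that] v(2)])
      then show ?thesis using bounded_mult_integrable[OF lam, of "\<lambda>t. gu t \<bullet> v t" "K * 1"] v(1) by simp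
    qed
    have i3: "integrable L (\<lambda>t. lam t * g t)"
      using bounded_mult_integrable[OF lam g_measurable, of K] g_bound by auto
    have i4: "integrable L (\<lambda>t. BT t (p t) \<bullet> v t)"
    proof (rule integrable_lebesgue_on_bounded[where C = "(K * E) * 1"])
      show "(\<lambda>t. BT t (p t) \<bullet> v t) \<in> borel_measurable L" using BT_comp_measurable[OF pm] v by measurable
      fix t assume t: "t \<in> {a..b}"
      have "K * norm (p t) \<le> K * E" using E t K_nonneg by (intro mult_left_mono) auto
      then have "norm (BT t (p t)) \<le> K * E" using BT_bound[OF t, of "p t"] by linarith
      then have "norm (BT t (p t)) * norm (v t) \<le> (K * E) * 1" using v(2)[of t] K_nonneg E by (intro mult_mono) auto
      then show "norm (BT t (p t) \<bullet> v t) \<le> (K * E) * 1" using Cauchy_Schwarz_ineq2[of "BT t (p t)" "v t"] by simp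
    qed
    have "(\<integral>t. BT t (p t) \<bullet> v t - lam t * (gx t \<bullet> ?x t) \<partial>L) = \<alpha> * (j1 \<bullet> ?x b) - p a \<bullet> e"
      using has_integral_integral_lebesgue_on[OF Bochner_Integration.integrable_diff[OF i4 i1]] hi has_integral_unique by auto
    then have e1: "(\<integral>t. BT t (p t) \<bullet> v t \<partial>L) - (\<integral>t. lam t * (gx t \<bullet> ?x t) \<partial>L) = \<alpha> * (j1 \<bullet> ?x b) - p a \<bullet> e"
      using i4 i1 by simp
    have e2: "(\<integral>t. q t \<bullet> v t \<partial>L) = (\<integral>t. BT t (p t) \<bullet> v t \<partial>L) + (\<integral>t. lam t * (gu t \<bullet> v t) \<partial>L)"
      using i4 i2 by (simp add: q_def inner_add_left)
    have e3: "(\<integral>t. lam t * slack e v t \<partial>L) = (\<integral>t. lam t * g t \<partial>L) + (\<integral>t. lam t * (gx t \<bullet> ?x t) \<partial>L) + (\<integral>t. lam t * (gu t \<bullet> v t) \<partial>L)"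
      using i1 i2 i3 by (simp add: slack_def distrib_left)
    show ?thesis using e1 unfolding e2 e3 cost_def by (simp add: inner_add_left algebra_simps)
  qed

  have lg: "integrable L (\<lambda>t. lam t * g t)"
    using bounded_mult_integrable[OF lam g_measurable, of K] g_bound by auto
  have labs: "(\<integral>t. lam t * \<bar>g t\<bar> \<partial>L) = - (\<integral>t. lam t * g t \<partial>L)"
  proof -
    have "(\<integral>t. lam t * \<bar>g t\<bar> \<partial>L) = (\<integral>t. - (lam t * g t) \<partial>L)"
    proof (rule integral_cong_AE)
      show "AE t in L. lam t * \<bar>g t\<bar> = - (lam t * g t)" using g_le_0 by eventually_elim simp
    qed (use lam in auto)
    then show ?thesis by simp
  qed
  have labs0: "0 \<le> (\<integral>t. lam t * \<bar>g t\<bar> \<partial>L)" by (rule Bochner_Integration.integral_nonneg) (use lam in auto)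
  \<comment> \<open>The steepest admissible control; where \<open>q t = 0\<close> it is \<open>0\<close> because of \<open>1 / 0 = 0\<close>.\<close>
  define v0 where "v0 t = - (1 / norm (q t)) *\<^sub>R q t" for t
  have v0: "v0 \<in> borel_measurable L" "\<And>t. norm (v0 t) \<le> 1" "\<And>t. q t \<bullet> v0 t = - norm (q t)"
  proof -
    show "v0 \<in> borel_measurable L" unfolding v0_def[abs_def] using qm by measurable
    show "norm (v0 t) \<le> 1" for t by (cases "q t = 0") (auto simp: v0_def)
    show "q t \<bullet> v0 t = - norm (q t)" for t
      by (cases "q t = 0") (auto simp: v0_def power2_norm_eq_inner[symmetric] power2_eq_square)
  qed
  have "(0, v0) \<in> W" using v0 by (simp add: unit_processes_def)
  from ineq[OF this] duality[OF this] have 1: "(\<integral>t. norm (q t) \<partial>L) + (\<integral>t. lam t * \<bar>g t\<bar> \<partial>L) \<le> c"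
    by (simp add: v0(3) labs)
  define w where "w = \<alpha> *\<^sub>R j0 + p a"
  define e0 where "e0 = - (1 / norm w) *\<^sub>R w"
  have "norm e0 \<le> 1" by (cases "w = 0") (auto simp: e0_def)
  then have eW: "(e0, \<lambda>_. 0) \<in> W" by (simp add: unit_processes_def)
  have we0: "w \<bullet> e0 = - norm w"
    by (cases "w = 0") (auto simp: e0_def power2_norm_eq_inner[symmetric] power2_eq_square)
  from ineq[OF eW] duality[OF eW] have 2: "norm w + (\<integral>t. lam t * \<bar>g t\<bar> \<partial>L) \<le> c"
    using we0 by (simp add: labs w_def)
  have q0: "0 \<le> (\<integral>t. norm (q t) \<partial>L)" by (rule Bochner_Integration.integral_nonneg) simp
  have 3: "norm w \<le> c" "(\<integral>t. norm (q t) \<partial>L) \<le> c" "(\<integral>t. lam t * \<bar>g t\<bar> \<partial>L) \<le> c"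
    using 1 2 q0 labs0 norm_ge_zero[of w] by linarith+
  have "approx_multiplier c \<alpha> lam p"
    unfolding approx_multiplier_def q_def[symmetric] w_def[symmetric]
    using \<alpha> lam one p 3 by blast
  then show ?thesis by blast
qed

text \<open>The densities \<open>lams n\<close> are bounded in \<open>L\<^sup>1\<close> and may concentrate. Helly's theorem is applied to them and to the weighted
  densities \<open>lams n t * (K + gx t \<bullet> i)\<close>, which are nonnegative by the bound \<open>K\<close> on \<open>gx\<close> and determine the components of
  \<open>lams n t *\<^sub>R gx t\<close>. After subtraction of the primitives of the latter the adjoint variables solve an equation with
  convergent data, so they converge outside a countable set.

  Stationarity then makes \<open>lams n t *\<^sub>R gu t\<close> converge to \<open>- BT t (p t)\<close>, which determines the limit density
  where \<open>gu t \<noteq> 0\<close> and gives convergence in mean with weight \<open>norm (gu t)\<close>; slackness adds the weight \<open>\<bar>g t\<bar>\<close>. Where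
  \<open>gu t = 0\<close> the limit density is put to \<open>0\<close>; whatever mass accumulates there remains in \<open>\<mu>0\<close>.\<close>

lemma limit_multipliers:
  assumes no_descent: "\<And>c e v. c > 0 \<Longrightarrow> (e, v) \<in> W \<Longrightarrow> cost e v \<le> - c \<Longrightarrow> \<not> (AE t in L. slack e v t \<le> - c)"
  obtains lams C lam \<mu>0 \<mu> \<alpha> p y where
    "\<And>n. lams n \<in> borel_measurable L" "\<And>n t. 0 \<le> lams n t" "\<And>n t. lams n t \<le> C n"
    "integrable L lam" "AE t in L. 0 \<le> lam t" "AE t in L. lam t * g t = 0" "\<And>t. gu t = 0 \<Longrightarrow> lam t = 0"
    "(\<lambda>n. \<integral>t. \<bar>lams n t - lam t\<bar> * (\<bar>g t\<bar> + norm (gu t)) \<partial>L) \<longlonglongrightarrow> 0"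
    "limit_measure a b lams \<mu>0" "\<And>i. i \<in> Basis \<Longrightarrow> limit_measure a b (\<lambda>n t. lams n t * (K + gx t \<bullet> i)) (\<mu> i)"
    "\<alpha> \<ge> 0" "\<alpha> + measure \<mu>0 UNIV = 1"
    "continuous_on {a..b} y" "\<And>t. t \<in> {a..b} \<Longrightarrow> y t = integral {t..b} (\<lambda>s. AT s (p s))"
    "\<And>t. p t = y (max a (min b t)) + (\<Sum>i\<in>Basis. ((measure (\<mu> i) UNIV - measure (\<mu> i) {..<t}) - K * (measure \<mu>0 UNIV - measure \<mu>0 {..<t})) *\<^sub>R i) + \<alpha> *\<^sub>R j1"
    "p \<in> borel_measurable borel" "bounded (range p)" "\<alpha> *\<^sub>R j0 + p a = 0"
    "AE t in L. BT t (p t) + lam t *\<^sub>R gu t = 0"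
proof -
  interpret finite_measure L by (rule finite_L)
  have "\<exists>\<alpha> lam p. approx_multiplier (1 / real (Suc n)) \<alpha> lam p" for n
    by (rule approx_multiplier_exists) (use no_descent[of "1 / real (Suc n)"] in auto)
  then obtain \<alpha>1 l1 p1 where ap1: "\<And>n. approx_multiplier (1 / real (Suc n)) (\<alpha>1 n) (l1 n) (p1 n)" by metis
  have wt_pos: "K + gx t \<bullet> i \<ge> 0" "K + gx t \<bullet> i \<le> 2 * K" if "i \<in> Basis" "t \<in> {a..b}" for i t
    using abs_inner_le[OF gx_bound[OF that(2)], of i 1] that(1) by auto

  \<comment> \<open>The index \<open>None\<close> stands for the multiplier density itself, \<open>Some i\<close> for its nonnegative weighting in the direction \<open>i\<close>.\<close>
  define wt where "wt ix t = (case ix of None \<Rightarrow> 1 | Some i \<Rightarrow> K + gx t \<bullet> i)" for ix t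
  define I where "I = insert None (Some ` (Basis :: 'a set))"
  have finI: "finite I" by (simp add: I_def)
  have wtm: "wt ix \<in> borel_measurable L" for ix
    unfolding wt_def[abs_def] by (cases ix) auto
  have wtb: "0 \<le> wt ix t" "wt ix t \<le> 1 + 2 * K" if "ix \<in> I" "t \<in> {a..b}" for ix t
  proof -
    show "0 \<le> wt ix t" using that wt_pos(1) K_nonneg by (auto simp: I_def wt_def)
    show "wt ix t \<le> 1 + 2 * K"
    proof (cases ix)
      case None then show ?thesis using K_nonneg by (simp add: wt_def)
    next
      case (Some i)
      then have "K + gx t \<bullet> i \<le> 2 * K" using that by (intro wt_pos) (auto simp: I_def)
      then show ?thesis using Some by (simp add: wt_def)
    qed
  qed
  have l1: "l1 n \<in> borel_measurable L" "\<And>t. 0 \<le> l1 n t" "\<exists>C. \<forall>t. l1 n t \<le> C" "\<alpha>1 n \<ge> 0" "\<alpha>1 n + (\<integral>t. l1 n t \<partial>L) = 1" for n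
    using ap1[of n] by (auto simp: approx_multiplier_def)
  have l1w: "integrable L (\<lambda>t. l1 n t * wt ix t)" if "ix \<in> I" for n ix
  proof -
    obtain C where "\<And>t. l1 n t \<le> C" using l1(3)[of n] by blast
    from bounded_mult_integrable[OF l1(1) l1(2) this wtm, of ix "1 + 2 * K"] wtb[OF that] show ?thesis by auto
  qed
  have l1i: "integrable L (l1 n)" for n using l1w[of None n] by (simp add: I_def wt_def)
  have "(\<integral>t. l1 n t * wt ix t \<partial>L) \<le> 1 + 2 * K" if "ix \<in> I" for n ix
  proof -
    have "(\<integral>t. l1 n t * wt ix t \<partial>L) \<le> (\<integral>t. l1 n t * (1 + 2 * K) \<partial>L)"
      by (intro integral_mono l1w that integrable_mult_left l1i mult_left_mono l1) (use wtb[OF that] in auto)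
    also have "\<dots> = (\<integral>t. l1 n t \<partial>L) * (1 + 2 * K)" by simp
    also have "\<dots> \<le> 1 * (1 + 2 * K)" using l1(4,5)[of n] K_nonneg by (intro mult_right_mono) auto
    finally show ?thesis by simp
  qed
  then have "\<exists>r. strict_mono r \<and> (\<forall>ix\<in>I. \<exists>\<mu>. limit_measure a b (\<lambda>n t. l1 (r n) t * wt ix t) \<mu>)"
    using helly_densities_finite[OF finI, of a b "\<lambda>ix n t. l1 n t * wt ix t" "1 + 2 * K"] ab l1w wtb l1(2) by auto
  then obtain r where r: "strict_mono r" and "\<forall>ix\<in>I. \<exists>\<mu>. limit_measure a b (\<lambda>n t. l1 (r n) t * wt ix t) \<mu>" by blast
  then obtain M where M: "\<And>ix. ix \<in> I \<Longrightarrow> limit_measure a b (\<lambda>n t. l1 (r n) t * wt ix t) (M ix)" by metis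
  define \<mu>0 where "\<mu>0 = M None"
  define \<mu> where "\<mu> i = M (Some i)" for i
  define ls where "ls n = l1 (r n)" for n
  define \<alpha>s where "\<alpha>s n = \<alpha>1 (r n)" for n
  define ps where "ps n = p1 (r n)" for n
  define c where "c n = 1 / real (Suc (r n))" for n
  have lim0: "limit_measure a b ls \<mu>0" using M[of None] by (simp add: I_def \<mu>0_def wt_def ls_def[abs_def])
  have limi: "limit_measure a b (\<lambda>n t. ls n t * (K + gx t \<bullet> i)) (\<mu> i)" if "i \<in> Basis" for i
    using M[of "Some i"] that by (simp add: I_def \<mu>_def wt_def ls_def)
  have c0: "c \<longlonglongrightarrow> 0"
    using LIMSEQ_subseq_LIMSEQ[OF LIMSEQ_Suc[OF lim_1_over_n] r] by (simp add: c_def[abs_def] o_def)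
  have ls: "ls n \<in> borel_measurable L" "\<And>t. 0 \<le> ls n t" "\<exists>C. \<forall>t. ls n t \<le> C" and \<alpha>s: "\<alpha>s n \<ge> 0" "\<alpha>s n + (\<integral>t. ls n t \<partial>L) = 1" for n
    unfolding ls_def \<alpha>s_def by (rule l1)+
  have lsi: "integrable L (ls n)" for n unfolding ls_def by (rule l1i)
  obtain C where C: "\<And>n t. ls n t \<le> C n" using ls(3) by metis
  have ls1: "(\<integral>t. ls n t \<partial>L) \<le> 1" for n using \<alpha>s[of n] by linarith
  have ps: "continuous_on {a..b} (ps n)"
    "\<And>t. t \<in> {a..b} \<Longrightarrow> ps n t = \<alpha>s n *\<^sub>R j1 + integral {t..b} (\<lambda>s. AT s (ps n s) + ls n s *\<^sub>R gx s)"
    "norm (\<alpha>s n *\<^sub>R j0 + ps n a) \<le> c n"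
    "(\<integral>t. norm (BT t (ps n t) + ls n t *\<^sub>R gu t) \<partial>L) \<le> c n"
    "(\<integral>t. ls n t * \<bar>g t\<bar> \<partial>L) \<le> c n" for n
    using ap1[of "r n"] by (auto simp: approx_multiplier_def ls_def \<alpha>s_def ps_def c_def)
  have psm: "ps n \<in> borel_measurable L" for n by (rule continuous_on_interval_measurable[OF ps(1)])
  have fin0: "finite_borel_measure \<mu>0" and fini: "\<And>i. i \<in> Basis \<Longrightarrow> finite_borel_measure (\<mu> i)"
    using lim0 limi by (auto simp: limit_measure_def)

  define \<alpha> where "\<alpha> = 1 - measure \<mu>0 UNIV"
  have "(\<lambda>n. 1 - (\<integral>t. ls n t \<partial>L)) \<longlonglongrightarrow> 1 - measure \<mu>0 UNIV"
    using lim0 by (intro tendsto_intros) (simp add: limit_measure_def)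
  moreover have "1 - (\<integral>t. ls n t \<partial>L) = \<alpha>s n" for n using \<alpha>s(2)[of n] by linarith
  ultimately have \<alpha>lim: "\<alpha>s \<longlonglongrightarrow> \<alpha>" by (simp add: \<alpha>_def)
  have \<alpha>0: "\<alpha> \<ge> 0" by (rule LIMSEQ_le_const[OF \<alpha>lim]) (use \<alpha>s in auto)

  \<comment> \<open>Convergence of the primitives \<open>V n\<close> of the densities \<open>ls n *\<^sub>R gx\<close> outside a countable set.\<close>
  define vm where "vm S = (\<Sum>i\<in>Basis. (measure (\<mu> i) S - K * measure \<mu>0 S) *\<^sub>R i)" for S
  have vm_inner: "vm S \<bullet> i = measure (\<mu> i) S - K * measure \<mu>0 S" if "i \<in> Basis" for S i
    unfolding vm_def using that by (simp add: inner_sum_left_Basis)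
  have lgi: "integrable L (\<lambda>t. ls n t *\<^sub>R gx t)" for n
    by (rule bounded_mult_integrable[OF ls(1) ls(2) C gx_measurable gx_bound])
  define V where "V n = cumul a b (\<lambda>t. ls n t *\<^sub>R gx t)" for n
  have V_inner: "V n t \<bullet> i = cumul a b (\<lambda>t. ls n t * (K + gx t \<bullet> i)) t - K * cumul a b (ls n) t" if i: "i \<in> Basis" for n t i
  proof -
    have lw: "integrable L (\<lambda>t. ls n t * (K + gx t \<bullet> i))" using l1w[of "Some i" "r n"] i by (simp add: I_def wt_def ls_def)
    note J = integrable_indicator_lebesgue_on[OF lgi[of n], of "{..t}", simplified] integrable_indicator_lebesgue_on[OF lw, of "{..t}", simplified]
      integrable_indicator_lebesgue_on[OF lsi[of n], of "{..t}", simplified]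
    have "V n t \<bullet> i = (\<integral>s. (indicator {..t} s *\<^sub>R (ls n s *\<^sub>R gx s)) \<bullet> i \<partial>L)"
      unfolding V_def cumul_def by (rule integral_inner_left[symmetric]) (use J in simp)
    also have "\<dots> = (\<integral>s. indicator {..t} s *\<^sub>R (ls n s * (K + gx s \<bullet> i)) - K * (indicator {..t} s *\<^sub>R ls n s) \<partial>L)"
      by (rule Bochner_Integration.integral_cong) (auto simp: algebra_simps)
    also have "\<dots> = cumul a b (\<lambda>t. ls n t * (K + gx t \<bullet> i)) t - K * cumul a b (ls n) t"
      unfolding cumul_def using J by simp
    finally show ?thesis .
  qed
  have V_limit: "(\<lambda>n. V n t) \<longlonglongrightarrow> vm S"
    if "(\<lambda>n. cumul a b (ls n) t) \<longlonglongrightarrow> measure \<mu>0 S"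
      "\<And>i. i \<in> Basis \<Longrightarrow> (\<lambda>n. cumul a b (\<lambda>t. ls n t * (K + gx t \<bullet> i)) t) \<longlonglongrightarrow> measure (\<mu> i) S" for t S
  proof (subst tendsto_componentwise_iff, rule ballI)
    fix i :: 'a assume i: "i \<in> Basis"
    show "(\<lambda>n. V n t \<bullet> i) \<longlonglongrightarrow> vm S \<bullet> i"
      unfolding V_inner[OF i] vm_inner[OF i] by (intro tendsto_intros that i)
  qed
  obtain D0 where D0: "countable D0" "\<And>t. t \<notin> D0 \<Longrightarrow> (\<lambda>n. cumul a b (ls n) t) \<longlonglongrightarrow> measure \<mu>0 {..t}"
    using lim0 unfolding limit_measure_def by blast
  have "\<forall>i\<in>Basis. \<exists>D. countable D \<and> (\<forall>t. t \<notin> D \<longrightarrow> (\<lambda>n. cumul a b (\<lambda>t. ls n t * (K + gx t \<bullet> i)) t) \<longlonglongrightarrow> measure (\<mu> i) {..t})"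
    using limi unfolding limit_measure_def by blast
  from bchoice[OF this] obtain Di where Di': "\<forall>i\<in>Basis. countable (Di i) \<and>
     (\<forall>t. t \<notin> Di i \<longrightarrow> (\<lambda>n. cumul a b (\<lambda>t. ls n t * (K + gx t \<bullet> i)) t) \<longlonglongrightarrow> measure (\<mu> i) {..t})" ..
  note Di = Di'[rule_format, THEN conjunct1] Di'[rule_format, THEN conjunct2, rule_format]
  \<comment> \<open>Outside the atoms open and closed half-lines have the same measure.\<close>
  define atoms where "atoms = {t. measure \<mu>0 {t} > 0} \<union> (\<Union>i\<in>Basis. {t. measure (\<mu> i) {t} > 0})"
  define D where "D = D0 \<union> (\<Union>i\<in>Basis. Di i) \<union> atoms"
  have Dc: "countable D"
    unfolding D_def atoms_def
    by (intro countable_Un countable_UN D0 Di countable_finite[OF finite_Basis]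
        finite_borel_measure.countable_atoms[OF fin0] finite_borel_measure.countable_atoms[OF fini])
  have V_lim: "(\<lambda>n. V n t) \<longlonglongrightarrow> vm {..t}" if "t \<notin> D" for t
    by (rule V_limit) (use that D0 Di in \<open>auto simp: D_def\<close>)
  have V_limb: "(\<lambda>n. V n b) \<longlonglongrightarrow> vm UNIV"
    by (rule V_limit) (use lim0 limi in \<open>auto simp: limit_measure_def cumul_outside(2)\<close>)
  have vm_lt: "vm {..<t} = vm {..t}" if "t \<notin> D" for t
  proof -
    have eq: "measure m {..t} = measure m {..<t}" if "finite_borel_measure m" "\<not> measure m {t} > 0" for m
    proof -
      interpret m: finite_borel_measure m by (rule that(1))
      have "{..t} = {..<t} \<union> {t}" by auto
      moreover have "measure m ({..<t} \<union> {t}) = measure m {..<t} + measure m {t}"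
        by (rule m.finite_measure_Union) (auto simp: m.M_is_borel)
      moreover have "measure m {t} = 0" using that(2) measure_nonneg[of m "{t}"] by linarith
      ultimately show ?thesis by simp
    qed
    have "measure \<mu>0 {..t} = measure \<mu>0 {..<t}" by (rule eq[OF fin0]) (use that in \<open>auto simp: D_def atoms_def\<close>)
    moreover have "measure (\<mu> i) {..t} = measure (\<mu> i) {..<t}" if "i \<in> Basis" for i
      by (rule eq[OF fini[OF that]]) (use \<open>t \<notin> D\<close> that in \<open>auto simp: D_def atoms_def\<close>)
    ultimately show ?thesis unfolding vm_def by simp
  qed
  have vm_meas: "(\<lambda>t. vm {..<t}) \<in> borel_measurable borel"
  proof -
    have mm: "(\<lambda>t. measure m {..<t}) \<in> borel_measurable borel" if "finite_borel_measure m" for m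
    proof (rule borel_measurable_mono, rule monoI)
      interpret m: finite_borel_measure m by (rule that)
      show "measure m {..<s} \<le> measure m {..<t}" if "s \<le> t" for s t
        by (rule m.finite_measure_mono) (use that in \<open>auto simp: m.M_is_borel\<close>)
    qed
    show ?thesis unfolding vm_def
      by (intro borel_measurable_sum borel_measurable_scaleR borel_measurable_diff borel_measurable_times mm fin0 fini) auto
  qed
  have vm_bound: "\<exists>B. \<forall>S\<in>sets borel. norm (vm S) \<le> B"
  proof (intro exI ballI)
    fix S :: "real set" assume S: "S \<in> sets borel"
    have mb: "measure m S \<le> measure m UNIV" if "finite_borel_measure m" for m
    proof -
      interpret m: finite_borel_measure m by (rule that)
      show ?thesis by (rule m.finite_measure_mono) (auto simp: m.M_is_borel)
    qed
    show "norm (vm S) \<le> (\<Sum>i\<in>(Basis :: 'a set). measure (\<mu> i) UNIV + K * measure \<mu>0 UNIV)"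
      unfolding vm_def
    proof (rule sum_norm_le)
      fix i :: 'a assume i: "i \<in> Basis"
      have "K * measure \<mu>0 S \<le> K * measure \<mu>0 UNIV" using mb[OF fin0] K_nonneg by (rule mult_left_mono)
      moreover have "0 \<le> K * measure \<mu>0 S" using K_nonneg by simp
      moreover have "0 \<le> measure (\<mu> i) S" by simp
      ultimately have "\<bar>measure (\<mu> i) S - K * measure \<mu>0 S\<bar> \<le> measure (\<mu> i) UNIV + K * measure \<mu>0 UNIV"
        using mb[OF fini[OF i]] by linarith
      then show "norm ((measure (\<mu> i) S - K * measure \<mu>0 S) *\<^sub>R i) \<le> measure (\<mu> i) UNIV + K * measure \<mu>0 UNIV"
        using i by simp
    qed
  qed
  then obtain Bv where Bv: "\<And>S. S \<in> sets borel \<Longrightarrow> norm (vm S) \<le> Bv" by blast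

  \<comment> \<open>The open half-line makes \<open>\<pi>\<close> left-continuous, with an atom at \<open>a\<close> counted in \<open>\<pi> a\<close>.\<close>
  define \<pi> where "\<pi> t = vm UNIV - vm {..<t} + \<alpha> *\<^sub>R j1" for t
  have \<pi>m: "\<pi> \<in> borel_measurable borel" unfolding \<pi>_def[abs_def] using vm_meas by measurable
  have borelL: "h \<in> borel_measurable L" if "h \<in> borel_measurable borel" for h :: "real \<Rightarrow> 'c::topological_space"
    using that by (intro measurable_restrict_space1 measurable_completion) simp
  have \<pi>b: "norm (\<pi> t) \<le> 2 * Bv + norm (\<alpha> *\<^sub>R j1)" for t
    using norm_triangle_ineq[of "vm UNIV - vm {..<t}" "\<alpha> *\<^sub>R j1"] norm_triangle_ineq4[of "vm UNIV" "vm {..<t}"] Bv[of UNIV] Bv[of "{..<t}"]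
    unfolding \<pi>_def by auto
  define \<pi>s where "\<pi>s n t = V n b - V n t + \<alpha>s n *\<^sub>R j1" for n t
  have \<pi>lim: "(\<lambda>n. \<pi>s n t) \<longlonglongrightarrow> \<pi> t" if "t \<notin> D" for t
    unfolding \<pi>s_def \<pi>_def vm_lt[OF that] by (intro tendsto_intros V_lim V_limb \<alpha>lim that)
  have Vb: "norm (V n t) \<le> K" for n t
  proof -
    have "norm (V n t) \<le> (\<integral>s. ls n s * K \<partial>L)"
      unfolding V_def cumul_def
    proof (rule Bochner_Integration.integral_norm_bound_integral)
      show "integrable L (\<lambda>s. indicator {..t} s *\<^sub>R ls n s *\<^sub>R gx s)" by (rule integrable_indicator_lebesgue_on[OF lgi]) simp
      show "norm (indicator {..t} s *\<^sub>R ls n s *\<^sub>R gx s) \<le> ls n s * K" if "s \<in> space L" for s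
        using that gx_bound[of s] ls(2)[of n s] K_nonneg by (auto simp: indicator_def intro!: mult_left_mono)
    qed (use lsi in simp)
    also have "\<dots> \<le> 1 * K" using mult_right_mono[OF ls1[of n] K_nonneg] by simp
    finally show ?thesis by simp
  qed
  have \<pi>sb: "norm (\<pi>s n t) \<le> 2 * K + norm j1" for n t
  proof -
    have "0 \<le> (\<integral>t. ls n t \<partial>L)" by (rule Bochner_Integration.integral_nonneg) (use ls(2) in auto)
    then have "\<alpha>s n \<le> 1" using \<alpha>s(2)[of n] by linarith
    then have "norm (\<alpha>s n *\<^sub>R j1) \<le> norm j1" using \<alpha>s(1)[of n] by (simp add: mult_left_le_one_le)
    then show ?thesis
      using norm_triangle_ineq[of "V n b - V n t" "\<alpha>s n *\<^sub>R j1"] norm_triangle_ineq4[of "V n b" "V n t"] Vb[of n b] Vb[of n t]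
      unfolding \<pi>s_def by linarith
  qed
  have Vc: "continuous_on S (V n)" for S n
    unfolding V_def by (rule continuous_on_subset[OF cumul_continuous[OF lgi less_imp_le[OF ab]]]) simp
  have \<pi>sm: "\<pi>s n \<in> borel_measurable L" for n
    unfolding \<pi>s_def[abs_def] by (intro continuous_on_interval_measurable continuous_intros Vc)
  define B\<pi> where "B\<pi> = (2 * Bv + norm (\<alpha> *\<^sub>R j1)) + (2 * K + norm j1)"
  have diffb: "norm (\<pi>s n t - \<pi> t) \<le> B\<pi>" for n t
    using norm_triangle_ineq4[of "\<pi>s n t" "\<pi> t"] \<pi>b[of t] \<pi>sb[of n t] unfolding B\<pi>_def by linarith
  have \<pi>L1: "(\<lambda>n. \<integral>t. norm (\<pi>s n t - \<pi> t) \<partial>L) \<longlonglongrightarrow> (\<integral>t. 0 \<partial>L)"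
  proof (rule integral_dominated_convergence[where w = "\<lambda>_. B\<pi>"])
    show "AE t in L. (\<lambda>n. norm (\<pi>s n t - \<pi> t)) \<longlonglongrightarrow> 0"
      using AE_lebesgue_on_not_in_countable[OF Dc] by eventually_elim (simp add: tendsto_norm_zero LIM_zero \<pi>lim)
    show "AE t in L. norm (norm (\<pi>s n t - \<pi> t)) \<le> B\<pi>" for n using diffb by simp
    show "(\<lambda>t. norm (\<pi>s n t - \<pi> t)) \<in> borel_measurable L" for n using \<pi>sm[of n] borelL[OF \<pi>m] by measurable
  qed auto

  \<comment> \<open>The remainder \<open>ps n - \<pi>s n\<close> solves an equation with integrable right-hand side and converges uniformly.\<close>
  have ATm: "(\<lambda>t. AT t (z t + \<pi> t)) \<in> borel_measurable L" if "continuous_on {a..b} z" for z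
    using AT_comp_measurable[OF borel_measurable_add[OF continuous_on_interval_measurable[OF that] borelL[OF \<pi>m]]] .
  have ATi: "(\<lambda>t. AT t (z t + \<pi> t)) integrable_on {a..b}" if z: "continuous_on {a..b} z" for z
  proof -
    obtain E where E: "E \<ge> 0" "\<forall>t\<in>{a..b}. norm (z t) \<le> E" using continuous_on_interval_bound[OF z] by auto
    show ?thesis
    proof (rule integrable_on_bounded[OF ATm[OF z], where C = "K * (E + (2 * Bv + norm (\<alpha> *\<^sub>R j1)))"])
      fix t assume t: "t \<in> {a..b}"
      have "norm (z t + \<pi> t) \<le> E + (2 * Bv + norm (\<alpha> *\<^sub>R j1))"
        using norm_triangle_ineq[of "z t" "\<pi> t"] E t \<pi>b[of t] by fastforce
      then show "norm (AT t (z t + \<pi> t)) \<le> K * (E + (2 * Bv + norm (\<alpha> *\<^sub>R j1)))"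
        using AT_bound[OF t, of "z t + \<pi> t"] mult_left_mono[OF _ K_nonneg] by (meson order_trans)
    qed
  qed
  obtain y where y: "continuous_on {a..b} y" "\<And>t. t \<in> {a..b} \<Longrightarrow> y t = 0 + integral {t..b} (\<lambda>s. AT s (y s + \<pi> s))"
  proof (rule caratheodory_backward[of a b "\<lambda>s z. AT s (z + \<pi> s)" K 0])
    show "norm (AT t (z + \<pi> t) - AT t (w + \<pi> t)) \<le> K * norm (z - w)" if "t \<in> {a..b}" for t z w
      using AT_bound[OF that, of "z - w"] by (simp add: AT_diff AT_add)
  qed (use ab ATi in auto)
  have ATps: "(\<lambda>t. AT t (ps n t)) integrable_on {a..b}" for n
  proof -
    obtain E where E: "E \<ge> 0" "\<forall>t\<in>{a..b}. norm (ps n t) \<le> E" using continuous_on_interval_bound[OF ps(1)[of n]] by auto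
    show ?thesis
    proof (rule integrable_on_bounded[OF AT_comp_measurable[OF psm], where C = "K * E"])
      fix t assume t: "t \<in> {a..b}"
      then show "norm (AT t (ps n t)) \<le> K * E"
        using AT_bound[OF t, of "ps n t"] mult_left_mono[OF _ K_nonneg, of "norm (ps n t)" E] E by force
    qed
  qed
  have lgh: "(\<lambda>t. ls n t *\<^sub>R gx t) integrable_on {a..b}" for n
    using has_integral_integral_lebesgue_on[OF lgi] by (auto simp: integrable_on_def)
  define ys where "ys n t = ps n t - \<pi>s n t" for n t
  have ysc: "continuous_on {a..b} (ys n)" for n
    unfolding ys_def \<pi>s_def by (intro continuous_intros ps Vc)
  have ys: "ys n t = integral {t..b} (\<lambda>s. AT s (ps n s))" if t: "t \<in> {a..b}" for n t
  proof -
    have sub: "h integrable_on {t..b}" if "h integrable_on {a..b}" for h :: "real \<Rightarrow> 'a"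
      using integrable_on_subinterval[OF that, of t b] t by auto
    have "V n t = integral {a..t} (\<lambda>t. ls n t *\<^sub>R gx t)" "V n b = integral {a..b} (\<lambda>t. ls n t *\<^sub>R gx t)"
      unfolding V_def cumul_eq_integral[OF lgi less_imp_le[OF ab]] using t ab by (auto simp: max_def min_def)
    moreover have "integral {a..t} (\<lambda>t. ls n t *\<^sub>R gx t) + integral {t..b} (\<lambda>t. ls n t *\<^sub>R gx t) = integral {a..b} (\<lambda>t. ls n t *\<^sub>R gx t)"
      by (rule Henstock_Kurzweil_Integration.integral_combine) (use t lgh in auto)
    moreover have "integral {t..b} (\<lambda>s. AT s (ps n s) + ls n s *\<^sub>R gx s) = integral {t..b} (\<lambda>s. AT s (ps n s)) + integral {t..b} (\<lambda>s. ls n s *\<^sub>R gx s)"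
      by (rule Henstock_Kurzweil_Integration.integral_add[OF sub[OF ATps] sub[OF lgh]])
    ultimately show ?thesis unfolding ys_def \<pi>s_def using ps(2)[OF t, of n] by (simp add: algebra_simps)
  qed
  have ydist: "norm (ys n t - y t) \<le> K * (\<integral>t. norm (\<pi>s n t - \<pi> t) \<partial>L) * exp (K * (b - a))" if t: "t \<in> {a..b}" for n t
  proof -
    have dm: "(\<lambda>t. norm (\<pi>s n t - \<pi> t)) \<in> borel_measurable L" using \<pi>sm[of n] borelL[OF \<pi>m] by measurable
    have di: "(\<lambda>t. norm (\<pi>s n t - \<pi> t)) integrable_on {a..b}"
      "integral\<^sup>L L (\<lambda>t. norm (\<pi>s n t - \<pi> t)) = integral {a..b} (\<lambda>t. norm (\<pi>s n t - \<pi> t))"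
      by (rule integrable_on_bounded[OF dm, where C = B\<pi>], use diffb in simp)
        (rule lebesgue_on_integral_bounded[OF dm, where C = B\<pi>], use diffb in simp)
    let ?g = "\<lambda>s. AT s (ps n s) - AT s (y s + \<pi> s)"
    have "norm (ys n t - y t) \<le> (norm (0::'a) + integral {a..b} (\<lambda>t. K * norm (\<pi>s n t - \<pi> t))) * exp (K * (b - a))"
    proof (rule norm_integral_le_gronwall_backward[where z = "\<lambda>t. ys n t - y t" and g = ?g, OF _ K_nonneg _ _ _ _ _ t])
      show "continuous_on {a..b} (\<lambda>t. ys n t - y t)" by (intro continuous_intros ysc y)
      show "?g integrable_on {a..b}" by (intro integrable_diff ATps ATi y)
      show "ys n s - y s = 0 + integral {s..b} ?g" if s: "s \<in> {a..b}" for s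
      proof -
        have sub: "h integrable_on {s..b}" if "h integrable_on {a..b}" for h :: "real \<Rightarrow> 'a"
          using integrable_on_subinterval[OF that, of s b] s by auto
        show ?thesis using ys[OF s, of n] y(2)[OF s] integral_diff[OF sub[OF ATps[of n]] sub[OF ATi[OF y(1)]]] by simp
      qed
      show "(\<lambda>t. K * norm (\<pi>s n t - \<pi> t)) integrable_on {a..b}" by (intro integrable_on_mult_right di)
      show "0 \<le> K * norm (\<pi>s n s - \<pi> s)" for s using K_nonneg by simp
      fix s assume s: "s \<in> {a..b}"
      have "?g s = AT s (\<pi>s n s - \<pi> s) + AT s (ys n s - y s)"
        by (simp add: AT_diff AT_add ys_def)
      also have "norm \<dots> \<le> K * norm (\<pi>s n s - \<pi> s) + K * norm (ys n s - y s)"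
        by (rule norm_triangle_mono[OF AT_bound[OF s] AT_bound[OF s]])
      finally show "norm (?g s) \<le> K * norm (\<pi>s n s - \<pi> s) + K * norm (ys n s - y s)" .
    qed
    then show ?thesis by (simp add: di(2))
  qed
  have ylim: "(\<lambda>n. ys n t) \<longlonglongrightarrow> y t" if t: "t \<in> {a..b}" for t
  proof -
    have "(\<lambda>n. K * (\<integral>t. norm (\<pi>s n t - \<pi> t) \<partial>L) * exp (K * (b - a))) \<longlonglongrightarrow> K * 0 * exp (K * (b - a))"
      by (intro tendsto_intros) (use \<pi>L1 in simp)
    then have z: "(\<lambda>n. K * (\<integral>t. norm (\<pi>s n t - \<pi> t) \<partial>L) * exp (K * (b - a))) \<longlonglongrightarrow> 0" by simp
    have "(\<lambda>n. ys n t - y t) \<longlonglongrightarrow> 0" by (rule Lim_null_comparison[OF _ z]) (use ydist[OF t] in auto)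
    then show ?thesis by (rule LIM_zero_cancel)
  qed

  define p where "p t = y (max a (min b t)) + \<pi> t" for t
  have p_eq: "p t = y t + \<pi> t" if "t \<in> {a..b}" for t using that by (simp add: p_def min_absorb2 max_absorb2)
  have pm: "p \<in> borel_measurable borel"
  proof -
    have "continuous_on UNIV (\<lambda>t. y (max a (min b t)))"
      by (rule continuous_on_compose2[OF y(1)]) (use ab in \<open>auto intro!: continuous_intros\<close>)
    then have "(\<lambda>t. y (max a (min b t))) \<in> borel_measurable borel" by (rule borel_measurable_continuous_onI)
    then show ?thesis unfolding p_def[abs_def] using \<pi>m by measurable
  qed
  have plim: "(\<lambda>n. ps n t) \<longlonglongrightarrow> p t" if "t \<in> {a..b}" "t \<notin> D" for t
  proof -
    have "(\<lambda>n. ys n t + \<pi>s n t) \<longlonglongrightarrow> y t + \<pi> t" by (intro tendsto_intros ylim \<pi>lim that)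
    then show ?thesis by (simp add: ys_def p_eq[OF that(1)])
  qed
  have yint: "y t = integral {t..b} (\<lambda>s. AT s (p s))" if t: "t \<in> {a..b}" for t
    using y(2)[OF t] t integral_cong[of "{t..b}" "\<lambda>s. AT s (y s + \<pi> s)" "\<lambda>s. AT s (p s)"] p_eq by auto
  obtain Ey where Ey: "Ey \<ge> 0" "\<forall>t\<in>{a..b}. norm (y t) \<le> Ey" using continuous_on_interval_bound[OF y(1)] by auto
  define \<kappa> where "\<kappa> n = K * (\<integral>t. norm (\<pi>s n t - \<pi> t) \<partial>L) * exp (K * (b - a))" for n

  have trans: "\<alpha> *\<^sub>R j0 + p a = 0"
  proof -
    have aI: "a \<in> {a..b}" using ab by simp
    have Va: "V n a = 0" for n
      unfolding V_def cumul_eq_integral[OF lgi less_imp_le[OF ab]] using ab by (simp add: max_def min_def)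
    have vma: "vm {..<a} = 0"
    proof -
      have "measure m {..<a} = 0" if "finite_borel_measure m" "measure m (- {a..b}) = 0" for m
      proof -
        interpret m: finite_borel_measure m by (rule that(1))
        have "measure m {..<a} \<le> measure m (- {a..b})" by (rule m.finite_measure_mono) (auto simp: m.M_is_borel)
        then show ?thesis using that(2) measure_nonneg[of m "{..<a}"] by linarith
      qed
      then show ?thesis using lim0 limi by (simp add: vm_def limit_measure_def)
    qed
    have "(\<lambda>n. ys n a + (V n b - V n a + \<alpha>s n *\<^sub>R j1)) \<longlonglongrightarrow> y a + (vm UNIV - 0 + \<alpha> *\<^sub>R j1)"
      unfolding Va by (intro tendsto_intros ylim aI V_limb \<alpha>lim)
    moreover have "ys n a + (V n b - V n a + \<alpha>s n *\<^sub>R j1) = ps n a" for n by (simp add: ys_def \<pi>s_def)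
    moreover have "y a + (vm UNIV - 0 + \<alpha> *\<^sub>R j1) = p a" by (simp add: p_eq[OF aI] \<pi>_def vma)
    ultimately have "(\<lambda>n. \<alpha>s n *\<^sub>R j0 + ps n a) \<longlonglongrightarrow> \<alpha> *\<^sub>R j0 + p a" by (intro tendsto_intros \<alpha>lim) simp
    moreover have "(\<lambda>n. \<alpha>s n *\<^sub>R j0 + ps n a) \<longlonglongrightarrow> 0"
      by (rule Lim_null_comparison[OF _ c0]) (use ps(3) in auto)
    ultimately show ?thesis by (rule LIMSEQ_unique)
  qed

  \<comment> \<open>Strong convergence of the densities away from the zeros of \<open>g\<close> and \<open>gu\<close>.\<close>
  define Bp where "Bp = (Ey + (2 * Bv + norm (\<alpha> *\<^sub>R j1)))"
  have pb: "norm (p t) \<le> Bp" if t: "t \<in> {a..b}" for t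
    using norm_triangle_ineq[of "y t" "\<pi> t"] Ey t \<pi>b[of t] unfolding p_eq[OF t] Bp_def by fastforce
  have pbd: "bounded (range p)"
  proof (rule boundedI[of _ Bp], elim rangeE)
    fix x t assume "x = p t"
    moreover have "max a (min b t) \<in> {a..b}" using ab by auto
    ultimately show "norm x \<le> Bp"
      using norm_triangle_ineq[of "y (max a (min b t))" "\<pi> t"] Ey \<pi>b[of t] unfolding p_def Bp_def by fastforce
  qed
  have pL: "p \<in> borel_measurable L" by (rule borelL[OF pm])
  have psd: "(\<lambda>n. \<integral>t. norm (ps n t - p t) \<partial>L) \<longlonglongrightarrow> 0"
  proof -
    have \<kappa>0: "\<kappa> \<longlonglongrightarrow> K * 0 * exp (K * (b - a))"
      unfolding \<kappa>_def by (intro tendsto_intros) (use \<pi>L1 in simp)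
    have di: "integrable L (\<lambda>t. norm (\<pi>s n t - \<pi> t))" for n
      by (rule integrable_lebesgue_on_bounded[where C = B\<pi>]) (use \<pi>sm[of n] borelL[OF \<pi>m] diffb in auto)
    have le: "(\<integral>t. norm (ps n t - p t) \<partial>L) \<le> \<kappa> n * measure L (space L) + (\<integral>t. norm (\<pi>s n t - \<pi> t) \<partial>L)" for n
    proof -
      have "(\<integral>t. norm (ps n t - p t) \<partial>L) \<le> (\<integral>t. \<kappa> n + norm (\<pi>s n t - \<pi> t) \<partial>L)"
      proof (rule integral_mono_AE')
        show "integrable L (\<lambda>t. \<kappa> n + norm (\<pi>s n t - \<pi> t))" using di by simp
        show "AE t in L. norm (ps n t - p t) \<le> \<kappa> n + norm (\<pi>s n t - \<pi> t)"
        proof (rule AE_I2)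
          fix t assume "t \<in> space L"
          then have t: "t \<in> {a..b}" by simp
          have "ps n t - p t = (ys n t - y t) + (\<pi>s n t - \<pi> t)" by (simp add: ys_def p_eq[OF t])
          then show "norm (ps n t - p t) \<le> \<kappa> n + norm (\<pi>s n t - \<pi> t)"
            using norm_triangle_ineq[of "ys n t - y t" "\<pi>s n t - \<pi> t"] ydist[OF t, of n] unfolding \<kappa>_def by simp
        qed
        show "AE t in L. 0 \<le> \<kappa> n + norm (\<pi>s n t - \<pi> t)" using K_nonneg by (simp add: \<kappa>_def)
      qed
      also have "\<dots> = \<kappa> n * measure L (space L) + (\<integral>t. norm (\<pi>s n t - \<pi> t) \<partial>L)"
        using di by (subst Bochner_Integration.integral_add) auto
      finally show ?thesis .
    qed
    have "(\<lambda>n. \<kappa> n * measure L (space L) + (\<integral>t. norm (\<pi>s n t - \<pi> t) \<partial>L)) \<longlonglongrightarrow> 0 * measure L (space L) + 0"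
      by (intro tendsto_intros) (use \<kappa>0 \<pi>L1 in auto)
    then have z: "(\<lambda>n. \<kappa> n * measure L (space L) + (\<integral>t. norm (\<pi>s n t - \<pi> t) \<partial>L)) \<longlonglongrightarrow> 0" by simp
    show ?thesis by (rule Lim_null_comparison[OF _ z]) (use le in auto)
  qed
  have psdi: "integrable L (\<lambda>t. norm (ps n t - p t))" for n
  proof -
    obtain E where E: "E \<ge> 0" "\<forall>t\<in>{a..b}. norm (ps n t) \<le> E" using continuous_on_interval_bound[OF ps(1)[of n]] by auto
    show ?thesis
    proof (rule integrable_lebesgue_on_bounded[where C = "E + Bp"])
      show "(\<lambda>t. norm (ps n t - p t)) \<in> borel_measurable L" using psm[of n] pL by measurable
      show "norm (norm (ps n t - p t)) \<le> E + Bp" if "t \<in> {a..b}" for t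
        using norm_triangle_ineq4[of "ps n t" "p t"] E(2) pb[OF that] that by fastforce
    qed
  qed
  define q where "q n t = BT t (ps n t) + ls n t *\<^sub>R gu t" for n t
  have lgui: "integrable L (\<lambda>t. ls n t *\<^sub>R gu t)" for n
    by (rule bounded_mult_integrable[OF ls(1) ls(2) C gu_measurable gu_bound])
  have lggi: "integrable L (\<lambda>t. ls n t * \<bar>g t\<bar>)" for n
    using bounded_mult_integrable[OF ls(1) ls(2) C, of "\<lambda>t. \<bar>g t\<bar>" K] g_bound by auto
  have qi: "integrable L (q n)" for n
  proof -
    obtain E where E: "E \<ge> 0" "\<forall>t\<in>{a..b}. norm (ps n t) \<le> E" using continuous_on_interval_bound[OF ps(1)[of n]] by auto
    have "integrable L (\<lambda>t. BT t (ps n t))"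
    proof (rule integrable_lebesgue_on_bounded[OF BT_comp_measurable[OF psm], where C = "K * E"])
      fix t assume t: "t \<in> {a..b}"
      then show "norm (BT t (ps n t)) \<le> K * E"
        using BT_bound[OF t, of "ps n t"] mult_left_mono[OF _ K_nonneg, of "norm (ps n t)" E] E by force
    qed
    then show ?thesis unfolding q_def[abs_def] using lgui by (rule Bochner_Integration.integrable_add)
  qed
  define w where "w n t = norm (q n t) + ls n t * \<bar>g t\<bar>" for n t
  have wi: "integrable L (w n)" for n unfolding w_def[abs_def] using qi lggi by simp
  have w0: "w n t \<ge> 0" for n t using ls(2)[of n t] by (simp add: w_def)
  have wle: "(\<integral>t. w n t \<partial>L) \<le> 2 * c n" for n
    unfolding w_def using qi[of n] lggi[of n] ps(4,5)[of n] by (simp add: q_def[symmetric])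
  have wlim: "(\<lambda>n. \<integral>t. w n t \<partial>L) \<longlonglongrightarrow> 0"
  proof -
    have z: "(\<lambda>n. 2 * c n) \<longlonglongrightarrow> 0" using tendsto_mult_right_zero[OF c0, of 2] .
    show ?thesis by (rule Lim_null_comparison[OF _ z]) (use wle Bochner_Integration.integral_nonneg[of L "w _"] w0 in auto)
  qed
  define lam where "lam t = (if gu t = 0 then 0 else - (BT t (p t) \<bullet> gu t) / (gu t \<bullet> gu t))" for t
  have lamm: "lam \<in> borel_measurable L"
    unfolding lam_def[abs_def] using BT_comp_measurable[OF pL] by measurable
  have "(\<lambda>n. \<integral>t. norm (w n t) \<partial>L) \<longlonglongrightarrow> 0" using wlim w0 by simp
  then obtain k where k: "strict_mono k" "AE t in L. (\<lambda>n. w (k n) t) \<longlonglongrightarrow> 0"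
    using tendsto_L1_AE_subseq[of L w, OF wi] by blast
  have main: "AE t in L. (gu t \<noteq> 0 \<longrightarrow> (\<lambda>n. ls (k n) t) \<longlonglongrightarrow> lam t) \<and> 0 \<le> lam t \<and> lam t * g t = 0 \<and> BT t (p t) + lam t *\<^sub>R gu t = 0"
    using k(2) AE_lebesgue_on_not_in_countable[OF Dc] AE_space
  proof eventually_elim
    case (elim t)
    then have t: "t \<in> {a..b}" by simp
    have q0: "(\<lambda>n. q (k n) t) \<longlonglongrightarrow> 0" and g0: "(\<lambda>n. ls (k n) t * \<bar>g t\<bar>) \<longlonglongrightarrow> 0"
      by (rule Lim_null_comparison[OF _ elim(1)], use ls(2) in \<open>auto simp: w_def\<close>)+
    have pk: "(\<lambda>n. ps (k n) t) \<longlonglongrightarrow> p t" using LIMSEQ_subseq_LIMSEQ[OF plim[OF t elim(2)] k(1)] by (simp add: o_def)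
    have "(\<lambda>n. BT t (ps (k n) t)) \<longlonglongrightarrow> BT t (p t)"
      by (rule bounded_linear.tendsto[OF _ pk]) (simp add: linear_BT linear_conv_bounded_linear[symmetric])
    from tendsto_diff[OF q0 this] have lg: "(\<lambda>n. ls (k n) t *\<^sub>R gu t) \<longlonglongrightarrow> - BT t (p t)" by (simp add: q_def)
    show ?case
    proof (cases "gu t = 0")
      case True
      then have "BT t (p t) = 0" using lg by (simp add: LIMSEQ_const_iff)
      then show ?thesis using True by (simp add: lam_def)
    next
      case False
      then have gg: "gu t \<bullet> gu t \<noteq> 0" by simp
      have "(\<lambda>n. ((ls (k n) t *\<^sub>R gu t) \<bullet> gu t) / (gu t \<bullet> gu t)) \<longlonglongrightarrow> ((- BT t (p t)) \<bullet> gu t) / (gu t \<bullet> gu t)"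
        by (intro tendsto_intros lg gg)
      then have L: "(\<lambda>n. ls (k n) t) \<longlonglongrightarrow> lam t" using False by (simp add: lam_def)
      have "0 \<le> lam t" by (rule LIMSEQ_le_const[OF L]) (use ls in auto)
      moreover have "lam t * \<bar>g t\<bar> = 0" by (rule LIMSEQ_unique[OF tendsto_mult_right[OF L] g0])
      moreover have "lam t *\<^sub>R gu t = - BT t (p t)" by (rule LIMSEQ_unique[OF tendsto_scaleR[OF L tendsto_const] lg])
      ultimately show ?thesis using L by auto
    qed
  qed
  \<comment> \<open>Fatou's lemma along the subsequence; the integrals of the densities are at most \<open>1\<close>.\<close>
  have lami: "integrable L lam"
  proof (rule integrableI_bounded[OF lamm])
    define f where "f n t = ennreal (if gu t = 0 then 0 else ls (k n) t)" for n t
    have fm: "f n \<in> borel_measurable L" for n unfolding f_def[abs_def] using ls(1)[of "k n"] by measurable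
    have "(\<integral>\<^sup>+ t. ennreal (norm (lam t)) \<partial>L) = (\<integral>\<^sup>+ t. liminf (\<lambda>n. f n t) \<partial>L)"
    proof (rule nn_integral_cong_AE)
      show "AE t in L. ennreal (norm (lam t)) = liminf (\<lambda>n. f n t)"
        using main
      proof eventually_elim
        case (elim t)
        have "(\<lambda>n. f n t) \<longlonglongrightarrow> ennreal (lam t)"
          unfolding f_def using elim by (cases "gu t = 0") (auto simp: lam_def intro!: tendsto_ennrealI)
        then show ?case using elim lim_imp_Liminf[of sequentially "\<lambda>n. f n t"] by simp
      qed
    qed
    also have "\<dots> \<le> liminf (\<lambda>n. \<integral>\<^sup>+ t. f n t \<partial>L)" by (rule nn_integral_liminf[OF fm])
    also have "\<dots> \<le> 1"
    proof -
      have "(\<integral>\<^sup>+ t. f n t \<partial>L) \<le> 1" for n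
      proof -
        have "(\<integral>\<^sup>+ t. f n t \<partial>L) \<le> (\<integral>\<^sup>+ t. ennreal (ls (k n) t) \<partial>L)" by (rule nn_integral_mono) (use ls(2) in \<open>auto simp: f_def\<close>)
        also have "\<dots> = ennreal (\<integral>t. ls (k n) t \<partial>L)" by (rule nn_integral_eq_integral[OF lsi]) (use ls(2) in auto)
        also have "\<dots> \<le> 1" using ls1[of "k n"] by (metis ennreal_1 ennreal_leI)
        finally show ?thesis .
      qed
      then show ?thesis by (intro Liminf_le) (auto intro!: eventuallyI)
    qed
    finally show "(\<integral>\<^sup>+ t. ennreal (norm (lam t)) \<partial>L) < \<infinity>" by (simp add: order.strict_trans1)
  qed
  \<comment> \<open>As \<open>BT t (p t) = - lam t *\<^sub>R gu t\<close>, the residual \<open>q n t\<close> is \<open>(ls n t - lam t) *\<^sub>R gu t\<close> up to \<open>BT t (ps n t - p t)\<close>.\<close>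
  have L1: "(\<lambda>n. \<integral>t. \<bar>ls n t - lam t\<bar> * (\<bar>g t\<bar> + norm (gu t)) \<partial>L) \<longlonglongrightarrow> 0"
  proof -
    have le: "(\<integral>t. \<bar>ls n t - lam t\<bar> * (\<bar>g t\<bar> + norm (gu t)) \<partial>L) \<le> (\<integral>t. w n t \<partial>L) + K * (\<integral>t. norm (ps n t - p t) \<partial>L)" for n
    proof -
      have "(\<integral>t. \<bar>ls n t - lam t\<bar> * (\<bar>g t\<bar> + norm (gu t)) \<partial>L) \<le> (\<integral>t. w n t + K * norm (ps n t - p t) \<partial>L)"
      proof (rule integral_mono_AE')
        show "integrable L (\<lambda>t. w n t + K * norm (ps n t - p t))" using wi psdi by simp
        show "AE t in L. 0 \<le> w n t + K * norm (ps n t - p t)" using w0 K_nonneg by simp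
        show "AE t in L. \<bar>ls n t - lam t\<bar> * (\<bar>g t\<bar> + norm (gu t)) \<le> w n t + K * norm (ps n t - p t)"
          using main AE_space
        proof eventually_elim
          case (elim t)
          then have t: "t \<in> {a..b}" by simp
          have l0: "lam t \<ge> 0" and lg: "lam t * g t = 0" and st: "BT t (p t) = - lam t *\<^sub>R gu t" using elim by (auto simp: add_eq_0_iff2)
          have "\<bar>ls n t - lam t\<bar> * norm (gu t) = norm ((ls n t - lam t) *\<^sub>R gu t)" by simp
          also have "(ls n t - lam t) *\<^sub>R gu t = q n t - BT t (ps n t - p t)" by (simp add: q_def BT_diff st algebra_simps)
          also have "norm \<dots> \<le> norm (q n t) + K * norm (ps n t - p t)"
            using norm_triangle_ineq4[of "q n t" "BT t (ps n t - p t)"] BT_bound[OF t, of "ps n t - p t"] by linarith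
          finally have 1: "\<bar>ls n t - lam t\<bar> * norm (gu t) \<le> norm (q n t) + K * norm (ps n t - p t)" .
          have "\<bar>ls n t - lam t\<bar> * \<bar>g t\<bar> \<le> (ls n t + lam t) * \<bar>g t\<bar>"
            using ls(2)[of n t] l0 by (intro mult_right_mono) auto
          also have "\<dots> = ls n t * \<bar>g t\<bar>" using lg by (auto simp: algebra_simps)
          finally show ?case using 1 by (simp add: w_def algebra_simps)
        qed
      qed
      also have "\<dots> = (\<integral>t. w n t \<partial>L) + K * (\<integral>t. norm (ps n t - p t) \<partial>L)" using wi psdi by simp
      finally show ?thesis .
    qed
    have "(\<lambda>n. (\<integral>t. w n t \<partial>L) + K * (\<integral>t. norm (ps n t - p t) \<partial>L)) \<longlonglongrightarrow> 0 + K * 0"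
      by (intro tendsto_intros wlim psd)
    then have z: "(\<lambda>n. (\<integral>t. w n t \<partial>L) + K * (\<integral>t. norm (ps n t - p t) \<partial>L)) \<longlonglongrightarrow> 0" by simp
    have nn: "0 \<le> (\<integral>t. \<bar>ls n t - lam t\<bar> * (\<bar>g t\<bar> + norm (gu t)) \<partial>L)" for n
      by (rule Bochner_Integration.integral_nonneg) simp
    show ?thesis by (rule Lim_null_comparison[OF _ z]) (use le nn in auto)
  qed
  have pform: "p t = y (max a (min b t)) + (\<Sum>i\<in>Basis. ((measure (\<mu> i) UNIV - measure (\<mu> i) {..<t}) - K * (measure \<mu>0 UNIV - measure \<mu>0 {..<t})) *\<^sub>R i) + \<alpha> *\<^sub>R j1" for t
  proof -
    have "vm UNIV - vm {..<t} = (\<Sum>i\<in>Basis. ((measure (\<mu> i) UNIV - measure (\<mu> i) {..<t}) - K * (measure \<mu>0 UNIV - measure \<mu>0 {..<t})) *\<^sub>R i)"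
      unfolding vm_def sum_subtractf[symmetric] by (rule sum.cong) (auto simp: algebra_simps)
    then show ?thesis by (simp add: p_def \<pi>_def)
  qed
  show ?thesis
  proof (rule that[of ls C lam \<mu>0 \<mu> \<alpha> y p])
    show "AE t in L. 0 \<le> lam t" "AE t in L. lam t * g t = 0" "AE t in L. BT t (p t) + lam t *\<^sub>R gu t = 0"
      using main by (eventually_elim, simp)+
    show "gu t = 0 \<Longrightarrow> lam t = 0" for t by (simp add: lam_def)
    show "\<alpha> + measure \<mu>0 UNIV = 1" by (simp add: \<alpha>_def)
  qed (fact ls(1) ls(2) C lami L1 lim0 limi \<alpha>0 y(1) yint pform pm pbd trans)+
qed

end

section \<open>Comparison of finite Borel measures on the line\<close>

text \<open>The difference of the two distribution functions is nondecreasing and right-continuous, hence itself a distribution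
  function.\<close>

lemma finite_borel_measure_difference:
  assumes \<mu>: "finite_borel_measure \<mu>" and \<nu>: "finite_borel_measure \<nu>"
    and le: "\<And>s t. s < t \<Longrightarrow> measure \<nu> {s<..t} \<le> measure \<mu> {s<..t}"
  obtains \<kappa> where "finite_borel_measure \<kappa>" "\<And>B. B \<in> sets borel \<Longrightarrow> measure \<mu> B = measure \<nu> B + measure \<kappa> B"
proof -
  interpret m: finite_borel_measure \<mu> by (rule \<mu>)
  interpret n: finite_borel_measure \<nu> by (rule \<nu>)
  define F where "F t = cdf \<mu> t - cdf \<nu> t" for t
  have Fm: "F s \<le> F t" if "s \<le> t" for s t
  proof (cases "s = t")
    case False
    then have "s < t" using that by simp
    then show ?thesis using le[of s t] m.cdf_diff_eq[of s t] n.cdf_diff_eq[of s t] by (simp add: F_def)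
  qed simp
  have Fr: "continuous (at_right t) F" for t
    unfolding F_def using m.cdf_is_right_cont[of t] n.cdf_is_right_cont[of t] by (rule continuous_diff)
  have Fb: "(F \<longlongrightarrow> 0) at_bot"
    unfolding F_def using tendsto_diff[OF m.cdf_lim_at_bot n.cdf_lim_at_bot] by simp
  define \<kappa> where "\<kappa> = interval_measure F"
  have sk: "sets \<kappa> = sets borel" "space \<kappa> = UNIV" by (simp_all add: \<kappa>_def)
  have Iic: "emeasure \<kappa> {..t} = F t" "measure \<kappa> {..t} = F t" for t
    using emeasure_interval_measure_Iic[OF Fm Fr Fb] measure_interval_measure_Iic[OF Fm Fr Fb] by (auto simp: \<kappa>_def)
  have F_le: "F t \<le> measure \<mu> UNIV" for t
    using m.cdf_bounded[of t] n.cdf_nonneg[of t] by (simp add: F_def m.borel_UNIV)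
  have "emeasure \<kappa> UNIV \<le> ennreal (measure \<mu> UNIV)"
  proof -
    have "(\<Union>n::nat. {..real n}) = UNIV" using real_arch_simple by auto
    moreover have "(SUP n::nat. emeasure \<kappa> {..real n}) = emeasure \<kappa> (\<Union>n::nat. {..real n})"
      by (rule SUP_emeasure_incseq) (auto simp: sk incseq_def)
    moreover have "(SUP n::nat. emeasure \<kappa> {..real n}) \<le> ennreal (measure \<mu> UNIV)"
      by (rule SUP_least) (use F_le Iic in \<open>auto intro!: ennreal_leI\<close>)
    ultimately show ?thesis by simp
  qed
  then have k: "finite_borel_measure \<kappa>"
    by (intro finite_borel_measure.intro finite_borel_measure_axioms.intro finite_measureI)
       (auto simp: sk top_unique)
  interpret k: finite_borel_measure \<kappa> by (rule k)
  have cdfk: "cdf \<kappa> t = F t" for t using Iic by (simp add: cdf_def)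
  have top: "measure \<mu> UNIV = measure \<nu> UNIV + measure \<kappa> UNIV"
  proof -
    have "(F \<longlongrightarrow> measure \<mu> UNIV - measure \<nu> UNIV) at_top"
      unfolding F_def using tendsto_diff[OF m.cdf_lim_at_top n.cdf_lim_at_top] by (simp add: m.borel_UNIV n.borel_UNIV)
    moreover have "(F \<longlongrightarrow> measure \<kappa> UNIV) at_top"
      using k.cdf_lim_at_top by (simp add: sk cdfk[abs_def])
    ultimately have "measure \<mu> UNIV - measure \<nu> UNIV = measure \<kappa> UNIV" by (rule tendsto_unique[rotated]) simp
    then show ?thesis by simp
  qed
  have "measure \<mu> B = measure \<nu> B + measure \<kappa> B" if B: "B \<in> sets borel" for B
  proof -
    have "Int_stable (range (\<lambda>(a, b). {a<..b::real}))" by (auto simp: Int_stable_def)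
    moreover have "range (\<lambda>(a, b). {a<..b::real}) \<subseteq> Pow UNIV" by simp
    moreover have "B \<in> sigma_sets UNIV (range (\<lambda>(a, b). {a<..b::real}))"
      using B by (simp add: borel_sigma_sets_Ioc)
    ultimately show ?thesis
    proof (induction rule: sigma_sets_induct_disjoint)
      case (basic A)
      then obtain s t where A: "A = {s<..t}" by auto
      show ?case
      proof (cases "s < t")
        case True
        then show ?thesis
          using m.cdf_diff_eq[OF True] n.cdf_diff_eq[OF True] k.cdf_diff_eq[OF True] cdfk by (simp add: A F_def)
      qed (simp add: A)
    next
      case empty
      show ?case by simp
    next
      case (compl A)
      then have "A \<in> sets borel" by (simp add: borel_sigma_sets_Ioc)
      then show ?case
        using compl top m.finite_measure_compl[of A] n.finite_measure_compl[of A] k.finite_measure_compl[of A]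
        by (simp add: m.M_is_borel n.M_is_borel k.M_is_borel m.borel_UNIV n.borel_UNIV k.borel_UNIV)
    next
      case (union A)
      then have A: "range A \<subseteq> sets borel" by (simp add: borel_sigma_sets_Ioc)
      have "(\<lambda>i. measure \<nu> (A i) + measure \<kappa> (A i)) sums (measure \<nu> (\<Union>i. A i) + measure \<kappa> (\<Union>i. A i))"
        by (intro sums_add n.finite_measure_UNION k.finite_measure_UNION) (use A union in \<open>auto simp: n.M_is_borel k.M_is_borel\<close>)
      moreover have "(\<lambda>i. measure \<mu> (A i)) sums measure \<mu> (\<Union>i. A i)"
        by (intro m.finite_measure_UNION) (use A union in \<open>auto simp: m.M_is_borel\<close>)
      ultimately show ?case using union.IH sums_unique2 by (metis (no_types, lifting) sums_cong)
    qed
  qed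
  then show ?thesis using that k by blast
qed

text \<open>The \<open>\<sigma>\<close>-algebra of \<open>M\<close> may be finer than the Borel sets, as for Lebesgue measure; transport along the identity makes
  the density measure a Borel measure.\<close>

lemma borel_measure_of_density:
  fixes h :: "real \<Rightarrow> real"
  assumes id: "(\<lambda>x. x) \<in> measurable M borel" and h: "integrable M h" and nonneg: "AE x in M. 0 \<le> h x"
  obtains \<nu> where "finite_borel_measure \<nu>" "\<And>B. B \<in> sets borel \<Longrightarrow> measure \<nu> B = (\<integral>x. indicator B x * h x \<partial>M)"
proof -
  define \<nu> where "\<nu> = distr (density M (\<lambda>x. ennreal (h x))) borel (\<lambda>x. x)"
  have hm: "h \<in> borel_measurable M" using h by auto
  have em: "emeasure \<nu> B = ennreal (\<integral>x. indicator B x * h x \<partial>M)" if B: "B \<in> sets borel" for B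
  proof -
    have Bm: "B \<inter> space M \<in> sets M" using measurable_sets[OF id B] by simp
    have ind: "(indicator B :: real \<Rightarrow> real) \<in> borel_measurable M"
      using measurable_compose[OF id borel_measurable_indicator[OF B]] by simp
    have int: "integrable M (\<lambda>x. indicator B x * h x)"
      by (rule Bochner_Integration.integrable_bound[OF h borel_measurable_times[OF ind hm]]) (auto simp: indicator_def)
    have "emeasure \<nu> B = (\<integral>\<^sup>+x. ennreal (h x) * indicator (B \<inter> space M) x \<partial>M)"
      unfolding \<nu>_def using id B Bm hm by (simp add: emeasure_distr emeasure_density)
    also have "\<dots> = (\<integral>\<^sup>+x. ennreal (indicator B x * h x) \<partial>M)"
      by (rule nn_integral_cong) (auto simp: indicator_def)
    also have "\<dots> = ennreal (\<integral>x. indicator B x * h x \<partial>M)"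
      by (rule nn_integral_eq_integral[OF int]) (use nonneg in \<open>eventually_elim, simp\<close>)
    finally show ?thesis .
  qed
  show ?thesis
  proof
    show "finite_borel_measure \<nu>"
      by (intro finite_borel_measure.intro finite_borel_measure_axioms.intro finite_measureI)
         (use em[of UNIV] in \<open>auto simp: \<nu>_def\<close>)
    show "measure \<nu> B = (\<integral>x. indicator B x * h x \<partial>M)" if "B \<in> sets borel" for B
    proof -
      have "0 \<le> (\<integral>x. indicator B x * h x \<partial>M)" by (rule integral_nonneg_AE) (use nonneg in \<open>eventually_elim, simp\<close>)
      then show ?thesis using em[OF that] by (simp add: measure_def)
    qed
  qed
qed

text \<open>The measures with densities the positive and the negative part of \<open>k\<close> are comparable on half-open intervals, hence on all
  Borel sets, in particular on the set where \<open>k\<close> is negative.\<close>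

lemma density_nonneg_if_nonneg_on_intervals:
  fixes k :: "real \<Rightarrow> real"
  assumes \<kappa>: "finite_borel_measure \<kappa>" and k: "integrable \<kappa> k"
    and pos: "\<And>s t. s1 \<le> s \<Longrightarrow> s < t \<Longrightarrow> t \<le> t1 \<Longrightarrow> 0 \<le> (\<integral>x. indicator {s<..t} x * k x \<partial>\<kappa>)"
  shows "AE x in \<kappa>. x \<in> {s1<..t1} \<longrightarrow> 0 \<le> k x"
proof -
  interpret finite_borel_measure \<kappa> by (rule \<kappa>)
  define J where "J = {s1<..t1}"
  have km: "k \<in> borel_measurable \<kappa>" using k by auto
  have id: "(\<lambda>x. x) \<in> measurable \<kappa> borel" by (simp add: measurable_def borel_UNIV M_is_borel)
  have J: "J \<in> sets \<kappa>" by (simp add: J_def M_is_borel)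
  have ip: "integrable \<kappa> (\<lambda>x. indicator J x * max 0 (k x))" and im: "integrable \<kappa> (\<lambda>x. indicator J x * max 0 (- k x))"
    by (rule Bochner_Integration.integrable_bound[OF k]; use km J in \<open>auto simp: indicator_def\<close>)+
  obtain P where P: "finite_borel_measure P" "\<And>B. B \<in> sets borel \<Longrightarrow> measure P B = (\<integral>x. indicator B x * (indicator J x * max 0 (k x)) \<partial>\<kappa>)"
    by (rule borel_measure_of_density[OF id ip]) auto
  obtain N where N: "finite_borel_measure N" "\<And>B. B \<in> sets borel \<Longrightarrow> measure N B = (\<integral>x. indicator B x * (indicator J x * max 0 (- k x)) \<partial>\<kappa>)"
    by (rule borel_measure_of_density[OF id im]) auto
  have bi: "integrable \<kappa> (\<lambda>x. indicator B x * h x)" if "integrable \<kappa> h" "B \<in> sets borel" for B and h :: "real \<Rightarrow> real"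
    using integrable_real_mult_indicator[of B \<kappa> h] that by (simp add: M_is_borel mult.commute)
  have "measure N {s<..t} \<le> measure P {s<..t}" if "s < t" for s t
  proof -
    have "measure P {s<..t} - measure N {s<..t} = (\<integral>x. indicator {s<..t} x * (indicator J x * max 0 (k x)) - indicator {s<..t} x * (indicator J x * max 0 (- k x)) \<partial>\<kappa>)"
      unfolding P(2)[of "{s<..t}", simplified] N(2)[of "{s<..t}", simplified]
      by (rule Bochner_Integration.integral_diff[symmetric]) (auto intro!: bi ip im)
    also have "\<dots> = (\<integral>x. indicator {max s s1<..min t t1} x * k x \<partial>\<kappa>)"
      by (rule Bochner_Integration.integral_cong) (auto simp: J_def indicator_def max_def)
    also have "\<dots> \<ge> 0"
    proof (cases "max s s1 < min t t1")
      case True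
      then show ?thesis by (intro pos) auto
    next
      case False
      then have e: "{max s s1<..min t t1} = {}" by auto
      show ?thesis unfolding e by simp
    qed
    finally show ?thesis by simp
  qed
  then obtain Q where Q: "finite_borel_measure Q" "\<And>B. B \<in> sets borel \<Longrightarrow> measure P B = measure N B + measure Q B"
    using finite_borel_measure_difference[OF P(1) N(1)] by metis
  define B where "B = {x. k x < 0}"
  have Bb: "B \<in> sets borel"
  proof -
    have "{x \<in> space \<kappa>. k x < 0} \<in> sets \<kappa>" using km by measurable
    then show ?thesis by (simp add: B_def borel_UNIV M_is_borel)
  qed
  have "measure P B = (\<integral>x. 0 \<partial>\<kappa>)" unfolding P(2)[OF Bb]
    by (rule Bochner_Integration.integral_cong) (auto simp: B_def indicator_def)
  then have "measure P B = 0" by simp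
  then have "measure N B = 0" using Q(2)[OF Bb] measure_nonneg[of N B] measure_nonneg[of Q B] by linarith
  then have "AE x in \<kappa>. indicator B x * (indicator J x * max 0 (- k x)) = 0"
    unfolding N(2)[OF Bb] by (subst (asm) integral_nonneg_eq_0_iff_AE[OF bi[OF im Bb]]) auto
  then show ?thesis
    by eventually_elim (auto simp: B_def J_def indicator_def split: if_splits)
qed

text \<open>Both points are approached from the right by points outside \<open>D\<close>.\<close>

lemma right_continuous_mono_from_dense:
  fixes \<Phi> :: "real \<Rightarrow> real"
  assumes rc: "\<And>x. continuous (at_right x) \<Phi>" and D: "countable D"
    and mono: "\<And>s t. s0 < s \<Longrightarrow> s < t \<Longrightarrow> t < t0 \<Longrightarrow> s \<notin> D \<Longrightarrow> t \<notin> D \<Longrightarrow> \<Phi> s \<le> \<Phi> t"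
    and st: "s0 < s" "s < t" "t < t0"
  shows "\<Phi> s \<le> \<Phi> t"
proof (rule ccontr)
  assume neg: "\<not> \<Phi> s \<le> \<Phi> t"
  define m where "m = (\<Phi> s + \<Phi> t) / 2"
  have m: "\<Phi> t < m" "m < \<Phi> s" using neg by (auto simp: m_def field_simps)
  have "eventually (\<lambda>x. m < \<Phi> x) (at_right s)" "eventually (\<lambda>x. \<Phi> x < m) (at_right t)"
    using rc[of s] rc[of t] m by (auto simp: continuous_within dest: order_tendstoD)
  then obtain s2 t2 where s2: "s < s2" "\<And>x. s < x \<Longrightarrow> x < s2 \<Longrightarrow> m < \<Phi> x" and t2: "t < t2" "\<And>x. t < x \<Longrightarrow> x < t2 \<Longrightarrow> \<Phi> x < m"
    unfolding eventually_at_right_field by blast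
  have ex: "\<exists>x. u < x \<and> x < v \<and> x \<notin> D" if "u < v" for u v :: real
  proof -
    have "uncountable ({u<..<v} - D)" using D that by (simp add: uncountable_open_interval uncountable_minus_countable)
    then have "{u<..<v} - D \<noteq> {}" by fastforce
    then show ?thesis by auto
  qed
  obtain s' where s': "s < s'" "s' < min s2 t" "s' \<notin> D" using ex[of s "min s2 t"] s2 st by auto
  obtain t' where t': "t < t'" "t' < min t2 t0" "t' \<notin> D" using ex[of t "min t2 t0"] t2 st by auto
  have "\<Phi> s' \<le> \<Phi> t'" by (rule mono) (use s' t' st in auto)
  moreover have "m < \<Phi> s'" "\<Phi> t' < m" using s2(2)[of s'] t2(2)[of t'] s' t' by auto
  ultimately show False by linarith
qed

section \<open>The singular part of the multiplier\<close>

context linear_system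
begin

text \<open>By the weighted convergence in mean, mass of the densities \<open>ls n\<close> that is missing in \<open>lam\<close> sits where \<open>\<bar>g t\<bar> + norm (gu t)\<close>
  is small. There the weight \<open>w\<close> is nonnegative, so this mass can only increase the limit.\<close>

lemma limit_lower_bound:
  assumes ls: "\<And>n. ls n \<in> borel_measurable L" "\<And>n t. 0 \<le> ls n t" "\<And>n t. ls n t \<le> C n"
    and lam: "integrable L lam" "AE t in L. 0 \<le> lam t" "AE t in L. lam t * g t = 0" "\<And>t. gu t = 0 \<Longrightarrow> lam t = 0"
    and L1: "(\<lambda>n. \<integral>t. \<bar>ls n t - lam t\<bar> * (\<bar>g t\<bar> + norm (gu t)) \<partial>L) \<longlonglongrightarrow> 0"
    and w: "w \<in> borel_measurable L" "\<And>t. t \<in> {a..b} \<Longrightarrow> \<bar>w t\<bar> \<le> c"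
    and I: "I \<in> sets borel" and \<delta>: "\<delta> > 0"
    and pos: "AE t in L. t \<in> I \<and> \<bar>g t\<bar> + norm (gu t) < \<delta> \<longrightarrow> 0 \<le> w t"
    and lim: "(\<lambda>n. \<integral>t. indicator I t * (ls n t * w t) \<partial>L) \<longlonglongrightarrow> \<beta>"
  shows "(\<integral>t. indicator I t * (lam t * w t) \<partial>L) \<le> \<beta>"
proof -
  define m where "m t = \<bar>g t\<bar> + norm (gu t)" for t
  have mm: "m \<in> borel_measurable L" unfolding m_def[abs_def] by measurable
  have mb: "0 \<le> m t" "t \<in> {a..b} \<Longrightarrow> m t \<le> 2 * K" for t
    using g_bound[of t] gu_bound[of t] by (auto simp: m_def)
  have c0: "c \<ge> 0" using w(2)[of a] ab by auto
  have Ib: "integrable L (\<lambda>t. indicator S t * h t)" if "integrable L h" "S \<in> sets borel" for h :: "real \<Rightarrow> real" and S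
    using integrable_indicator_lebesgue_on[OF that] by simp
  have lsw: "integrable L (\<lambda>t. ls n t * w t)" for n
    using bounded_mult_integrable[OF ls w(1), of c] w(2) by simp
  have lsi: "integrable L (ls n)" for n
    using bounded_mult_integrable[OF ls, of "\<lambda>_. 1 :: real" 1 n] by simp
  have bmult: "integrable L (\<lambda>t. h t * f t)" if "integrable L h" "f \<in> borel_measurable L" "\<And>t. t \<in> {a..b} \<Longrightarrow> \<bar>f t\<bar> \<le> d"
    for h f :: "real \<Rightarrow> real" and d
  proof (rule Bochner_Integration.integrable_bound[where f = "\<lambda>t. d * h t"])
    show "integrable L (\<lambda>t. d * h t)" using that(1) by simp
    show "(\<lambda>t. h t * f t) \<in> borel_measurable L" using that by measurable
    show "AE t in L. norm (h t * f t) \<le> norm (d * h t)"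
    proof (rule AE_I2)
      fix t assume "t \<in> space L"
      then have "\<bar>f t\<bar> \<le> \<bar>d\<bar>" using that(3)[of t] by auto
      then show "norm (h t * f t) \<le> norm (d * h t)" by (simp add: abs_mult mult_right_mono mult.commute)
    qed
  qed
  have lamw: "integrable L (\<lambda>t. lam t * w t)" by (rule bmult[OF lam(1) w])
  have dm: "integrable L (\<lambda>t. \<bar>ls n t - lam t\<bar> * m t)" for n
    by (rule bmult[where d = "2 * K"]) (use lsi[of n] lam(1) mm mb in auto)
  define T where "T d = (\<integral>t. lam t * (if m t < d then 1 else 0) \<partial>L)" for d :: real
  have Tm: "(\<lambda>t. if m t < d then 1 else 0 :: real) \<in> borel_measurable L" for d using mm by measurable
  have Ti: "integrable L (\<lambda>t. lam t * (if m t < d then 1 else 0))" for d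
    by (rule bmult[OF lam(1) Tm, where d = 1]) auto

  \<comment> \<open>Where \<open>m \<ge> d\<close> the densities converge in mean; where \<open>m < d\<close> only the mass of \<open>lam\<close> can be lost.\<close>
  have est: "(\<integral>t. indicator I t * (lam t * w t) \<partial>L) - \<beta> \<le> c * T d" if d: "0 < d" "d \<le> \<delta>" for d
  proof -
    have step: "(\<integral>t. indicator I t * (lam t * w t) \<partial>L) - (\<integral>t. indicator I t * (ls n t * w t) \<partial>L)
       \<le> c * T d + (c / d) * (\<integral>t. \<bar>ls n t - lam t\<bar> * m t \<partial>L)" for n
    proof -
      have "(\<integral>t. indicator I t * (lam t * w t) \<partial>L) - (\<integral>t. indicator I t * (ls n t * w t) \<partial>L)
         = (\<integral>t. indicator I t * (lam t * w t) - indicator I t * (ls n t * w t) \<partial>L)"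
        by (rule Bochner_Integration.integral_diff[symmetric]) (rule Ib[OF lamw I], rule Ib[OF lsw I])
      also have "\<dots> \<le> (\<integral>t. c * (lam t * (if m t < d then 1 else 0)) + (c / d) * (\<bar>ls n t - lam t\<bar> * m t) \<partial>L)"
      proof (rule integral_mono_AE)
        show "integrable L (\<lambda>t. indicator I t * (lam t * w t) - indicator I t * (ls n t * w t))"
          by (intro Bochner_Integration.integrable_diff Ib lamw lsw I)
        show "integrable L (\<lambda>t. c * (lam t * (if m t < d then 1 else 0)) + (c / d) * (\<bar>ls n t - lam t\<bar> * m t))"
          by (intro Bochner_Integration.integrable_add integrable_mult_right Ti dm)
        show "AE t in L. indicator I t * (lam t * w t) - indicator I t * (ls n t * w t)
            \<le> c * (lam t * (if m t < d then 1 else 0)) + (c / d) * (\<bar>ls n t - lam t\<bar> * m t)"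
          using lam(2) pos AE_space
        proof eventually_elim
          case (elim t)
          then have t: "t \<in> {a..b}" by simp
          have wc: "\<bar>w t\<bar> \<le> c" by (rule w(2)[OF t])
          have n1: "0 \<le> (c / d) * (\<bar>ls n t - lam t\<bar> * m t)" using c0 d mb(1)[of t] by simp
          show ?case
          proof (cases "t \<in> I")
            case False
            then show ?thesis using n1 elim(1) c0 by simp
          next
            case True
            show ?thesis
            proof (cases "m t < d")
              case md: True
              then have "0 \<le> w t" using elim(2) True d by (simp add: m_def)
              then have "0 \<le> ls n t * w t" using ls(2) by simp
              moreover have "lam t * w t \<le> c * lam t"
                using mult_left_mono[of "w t" c "lam t"] wc elim(1) by (simp add: mult.commute)
              ultimately show ?thesis using True md n1 by simp
            next
              case md: False
              have "lam t * w t - ls n t * w t \<le> \<bar>ls n t - lam t\<bar> * \<bar>w t\<bar>"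
                by (simp add: left_diff_distrib[symmetric] abs_mult[symmetric] abs_minus_commute)
              also have "\<dots> \<le> \<bar>ls n t - lam t\<bar> * c" by (intro mult_left_mono wc) simp
              also have "\<dots> \<le> \<bar>ls n t - lam t\<bar> * (c * (m t / d))"
                using md d c0 by (intro mult_left_mono) (auto simp: field_simps intro: mult_left_mono)
              finally show ?thesis using True md by (simp add: mult_ac)
            qed
          qed
        qed
      qed
      also have "\<dots> = c * T d + (c / d) * (\<integral>t. \<bar>ls n t - lam t\<bar> * m t \<partial>L)"
        unfolding T_def using Ti[of d] dm[of n] by (subst Bochner_Integration.integral_add) auto
      finally show ?thesis .
    qed
    have "(\<lambda>n. c * T d + (c / d) * (\<integral>t. \<bar>ls n t - lam t\<bar> * m t \<partial>L)) \<longlonglongrightarrow> c * T d + (c / d) * 0"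
      by (intro tendsto_intros) (use L1 in \<open>simp add: m_def\<close>)
    moreover have "(\<lambda>n. (\<integral>t. indicator I t * (lam t * w t) \<partial>L) - (\<integral>t. indicator I t * (ls n t * w t) \<partial>L)) \<longlonglongrightarrow> (\<integral>t. indicator I t * (lam t * w t) \<partial>L) - \<beta>"
      by (intro tendsto_intros lim)
    ultimately show ?thesis using LIMSEQ_le step by (metis (no_types, lifting) add.right_neutral mult_zero_right)
  qed
  define ds where "ds n = \<delta> / real (Suc n)" for n
  have ds: "0 < ds n" "ds n \<le> \<delta>" for n using \<delta> by (auto simp: ds_def field_simps)
  have ds0: "ds \<longlonglongrightarrow> 0" unfolding ds_def using LIMSEQ_Suc[OF lim_const_over_n[of \<delta>]] by simp
  have "(\<lambda>n. T (ds n)) \<longlonglongrightarrow> (\<integral>t. 0 \<partial>L)"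
    unfolding T_def
  proof (rule integral_dominated_convergence[where w = "\<lambda>t. \<bar>lam t\<bar>"])
    show "AE t in L. (\<lambda>n. lam t * (if m t < ds n then 1 else 0)) \<longlonglongrightarrow> 0"
    proof (rule AE_I2)
      fix t
      show "(\<lambda>n. lam t * (if m t < ds n then 1 else 0)) \<longlonglongrightarrow> 0"
      proof (cases "m t = 0")
        case True
        then have "gu t = 0" using abs_ge_zero[of "g t"] norm_ge_zero[of "gu t"] unfolding m_def by (metis add_nonneg_eq_0_iff norm_eq_zero)
        then show ?thesis by (simp add: lam(4))
      next
        case False
        then have "0 < m t" using mb(1)[of t] by simp
        from order_tendstoD(2)[OF ds0 this]
        have "eventually (\<lambda>n. lam t * (if m t < ds n then 1 else 0) = 0) sequentially" by eventually_elim simp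
        then show ?thesis by (rule tendsto_eventually)
      qed
    qed
    show "AE t in L. norm (lam t * (if m t < ds n then 1 else 0)) \<le> \<bar>lam t\<bar>" for n by simp
    show "(\<lambda>t. lam t * (if m t < ds n then 1 else 0)) \<in> borel_measurable L" for n using Ti by auto
  qed (use lam in auto)
  then have T0: "(\<lambda>n. c * T (ds n)) \<longlonglongrightarrow> c * 0" by (intro tendsto_intros) simp
  have "(\<integral>t. indicator I t * (lam t * w t) \<partial>L) - \<beta> \<le> c * 0"
    by (rule LIMSEQ_le_const[OF T0]) (use est ds in auto)
  then show ?thesis by simp
qed

end

lemma finite_borel_measure_radon_nikodym:
  assumes \<eta>: "finite_borel_measure \<eta>" and \<kappa>: "finite_borel_measure \<kappa>"
    and le: "\<And>s t. s < t \<Longrightarrow> measure \<kappa> {s<..t} \<le> c * measure \<eta> {s<..t}" and c: "c \<ge> 0"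
  obtains k :: "real \<Rightarrow> real" where "k \<in> borel_measurable borel" "integrable \<eta> k"
    "\<And>B. B \<in> sets borel \<Longrightarrow> (\<integral>x. indicator B x * k x \<partial>\<eta>) = measure \<kappa> B"
proof -
  interpret e: finite_borel_measure \<eta> by (rule \<eta>)
  interpret k: finite_borel_measure \<kappa> by (rule \<kappa>)
  have id: "(\<lambda>x. x) \<in> measurable \<eta> borel" by (simp add: measurable_def e.borel_UNIV e.M_is_borel)
  obtain N where N: "finite_borel_measure N" "\<And>B. B \<in> sets borel \<Longrightarrow> measure N B = (\<integral>x. indicator B x * c \<partial>\<eta>)"
    by (rule borel_measure_of_density[OF id, of "\<lambda>_. c"]) (use c in auto)
  have N': "measure N B = c * measure \<eta> B" if "B \<in> sets borel" for B
    using that by (simp add: N(2) e.borel_UNIV e.M_is_borel mult.commute)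
  obtain Q where Q: "finite_borel_measure Q" "\<And>B. B \<in> sets borel \<Longrightarrow> measure N B = measure \<kappa> B + measure Q B"
    by (rule finite_borel_measure_difference[OF N(1) \<kappa>]) (use le N' in auto)
  have leB: "measure \<kappa> B \<le> c * measure \<eta> B" if "B \<in> sets borel" for B
    using Q(2)[OF that] N'[OF that] measure_nonneg[of Q B] by linarith
  have ac: "absolutely_continuous \<eta> \<kappa>"
    unfolding absolutely_continuous_def
  proof
    fix B assume B: "B \<in> null_sets \<eta>"
    then have Bb: "B \<in> sets borel" by (auto simp: e.M_is_borel null_sets_def)
    have "measure \<eta> B = 0" using B by (simp add: measure_def null_sets_def)
    then have "measure \<kappa> B = 0" using leB[OF Bb] measure_nonneg[of \<kappa> B] by simp
    then show "B \<in> null_sets \<kappa>" using Bb by (simp add: null_sets_def k.M_is_borel k.emeasure_eq_measure)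
  qed
  obtain D where D: "D \<in> borel_measurable \<eta>" "AE x in \<eta>. RN_deriv \<eta> \<kappa> x = ennreal (D x)" "\<And>x. 0 \<le> D x"
    by (rule e.real_RN_deriv[OF k.finite_measure_axioms ac]) (auto simp: e.M_is_borel k.M_is_borel)
  have dens: "density \<eta> (\<lambda>x. ennreal (D x)) = \<kappa>"
  proof -
    have "density \<eta> (RN_deriv \<eta> \<kappa>) = \<kappa>"
      by (rule e.density_RN_deriv[OF ac]) (simp add: e.M_is_borel k.M_is_borel)
    moreover have "density \<eta> (RN_deriv \<eta> \<kappa>) = density \<eta> (\<lambda>x. ennreal (D x))"
      by (rule density_cong) (use D in auto)
    ultimately show ?thesis by simp
  qed
  have em: "(\<integral>\<^sup>+x. ennreal (indicator B x * D x) \<partial>\<eta>) = ennreal (measure \<kappa> B)" if B: "B \<in> sets borel" for B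
  proof -
    have "emeasure \<kappa> B = (\<integral>\<^sup>+x. ennreal (D x) * indicator B x \<partial>\<eta>)"
      using emeasure_density[of "\<lambda>x. ennreal (D x)" \<eta> B] D(1) B unfolding dens by (simp add: e.M_is_borel)
    also have "\<dots> = (\<integral>\<^sup>+x. ennreal (indicator B x * D x) \<partial>\<eta>)"
      by (rule nn_integral_cong) (auto simp: indicator_def)
    finally show ?thesis by (simp add: k.emeasure_eq_measure)
  qed
  have Di: "integrable \<eta> D"
    by (rule integrableI_bounded[OF D(1)]) (use em[of UNIV] D(3) in simp)
  show ?thesis
  proof
    show "D \<in> borel_measurable borel" using D(1) by (simp cong: measurable_cong_sets[OF e.M_is_borel refl])
    show "integrable \<eta> D" by (rule Di)
    fix B :: "real set" assume B: "B \<in> sets borel"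
    have "integrable \<eta> (\<lambda>x. indicator B x * D x)"
      using integrable_real_mult_indicator[of B \<eta> D] B Di by (simp add: e.M_is_borel mult.commute)
    then have "(\<integral>x. indicator B x * D x \<partial>\<eta>) = enn2real (\<integral>\<^sup>+x. ennreal (indicator B x * D x) \<partial>\<eta>)"
      by (intro integral_eq_nn_integral) (use D(3) in auto)
    then show "(\<integral>x. indicator B x * D x \<partial>\<eta>) = measure \<kappa> B" by (simp add: em[OF B])
  qed
qed

text \<open>A strict separation of a point from a bounded set survives a small change of the normal vector and of the level, so
  countably many half-spaces suffice.\<close>

lemma separate_from_convex_hull:
  fixes S :: "'a::euclidean_space set"
  assumes S: "compact S" and z: "z \<notin> convex hull S" and Q: "\<And>U. open U \<Longrightarrow> U \<noteq> {} \<Longrightarrow> \<exists>q\<in>Q. q \<in> U"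
  obtains q r where "q \<in> Q" "r \<in> \<rat>" "r < q \<bullet> z" "\<And>y. y \<in> S \<Longrightarrow> q \<bullet> y < r"
proof -
  have "\<exists>q0 r0. r0 < q0 \<bullet> z \<and> (\<forall>y\<in>S. q0 \<bullet> y < r0)"
  proof (cases "S = {}")
    case True
    then show ?thesis by (intro exI[of _ 0] exI[of _ "-1"]) simp
  next
    case False
    obtain d e where "d \<bullet> z < e" "\<forall>y\<in>convex hull S. e < d \<bullet> y"
      using separating_hyperplane_closed_point[OF convex_convex_hull compact_imp_closed[OF compact_convex_hull[OF S]] z] by blast
    then show ?thesis using hull_subset[of S convex]
      by (intro exI[of _ "- d"] exI[of _ "- e"]) auto
  qed
  then obtain q0 r0 where q0: "r0 < q0 \<bullet> z" "\<And>y. y \<in> S \<Longrightarrow> q0 \<bullet> y < r0" by blast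
  obtain B where B: "B > 0" "\<And>y. y \<in> insert z S \<Longrightarrow> norm y \<le> B"
    using bounded_pos[of "insert z S"] compact_imp_bounded[OF S] by auto
  define \<epsilon> where "\<epsilon> = (q0 \<bullet> z - r0) / 3"
  have \<epsilon>: "\<epsilon> > 0" using q0 by (simp add: \<epsilon>_def)
  have e3: "q0 \<bullet> z = r0 + 3 * \<epsilon>" by (simp add: \<epsilon>_def field_simps)
  have "0 < \<epsilon> / B" using \<epsilon> B by simp
  then have "ball q0 (\<epsilon> / B) \<noteq> {}" by simp
  then obtain q where q: "q \<in> Q" "q \<in> ball q0 (\<epsilon> / B)" using Q[of "ball q0 (\<epsilon> / B)"] by auto
  have close: "\<bar>q \<bullet> y - q0 \<bullet> y\<bar> \<le> \<epsilon>" if "y \<in> insert z S" for y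
  proof -
    have "\<bar>(q - q0) \<bullet> y\<bar> \<le> (\<epsilon> / B) * B"
      by (rule abs_inner_le) (use q B(2)[OF that] in \<open>auto simp: dist_norm norm_minus_commute\<close>)
    then show ?thesis using B by (simp add: inner_diff_left)
  qed
  obtain r where r: "r \<in> \<rat>" "r0 + \<epsilon> < r" "r < r0 + 2 * \<epsilon>" using Rats_dense_in_real[of "r0 + \<epsilon>" "r0 + 2 * \<epsilon>"] \<epsilon> by auto
  show ?thesis
  proof
    show "r < q \<bullet> z" using close[OF insertI1] r e3 by linarith
    show "q \<bullet> y < r" if "y \<in> S" for y using close[of y] q0(2)[OF that] r that by simp
  qed (use q r in auto)
qed

context linear_system
begin

text \<open>Let \<open>\<eta>\<close> and \<open>\<sigma>\<close> be what remains of the limits of \<open>ls n\<close> and \<open>ls n t *\<^sub>R gx t\<close> after removal of the densities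
  \<open>lam t\<close> and \<open>lam t *\<^sub>R gx t\<close>. By \<open>limit_lower_bound\<close>, \<open>r * \<eta> - q \<bullet> \<sigma> \<ge> 0\<close> on a time interval over which \<open>q \<bullet> P < r\<close> on \<open>Z\<close>.
  With bounds that hold everywhere this gives \<open>\<eta> \<ge> 0\<close> and that \<open>\<sigma>\<close> is dominated by \<open>\<eta>\<close>, hence \<open>\<sigma> = s \<eta>\<close>. With
  countably many \<open>q\<close>, \<open>r\<close> and intervals it gives, almost everywhere at once, that \<open>s x\<close> lies in every half-space
  containing the values of \<open>P\<close> over \<open>x\<close>. If \<open>Z\<close> has no point over \<open>x\<close>, the hull is empty, so such \<open>x\<close> form a null set.\<close>

lemma singular_multiplier:
  fixes Z :: "(real \<times> 'c::euclidean_space) set" and P :: "real \<times> 'c \<Rightarrow> 'a"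
  assumes ls: "\<And>n. ls n \<in> borel_measurable L" "\<And>n t. 0 \<le> ls n t" "\<And>n t. ls n t \<le> C n"
    and lam: "integrable L lam" "AE t in L. 0 \<le> lam t" "AE t in L. lam t * g t = 0" "\<And>t. gu t = 0 \<Longrightarrow> lam t = 0"
    and L1: "(\<lambda>n. \<integral>t. \<bar>ls n t - lam t\<bar> * (\<bar>g t\<bar> + norm (gu t)) \<partial>L) \<longlonglongrightarrow> 0"
    and lim0: "limit_measure a b ls \<mu>0"
    and limi: "\<And>i. i \<in> Basis \<Longrightarrow> limit_measure a b (\<lambda>n t. ls n t * (K + gx t \<bullet> i)) (\<mu> i)"
    and Z: "compact Z" and P: "continuous_on Z P"
    and sep: "\<And>q r s0 t0. (\<And>z. z \<in> Z \<Longrightarrow> s0 \<le> fst z \<Longrightarrow> fst z \<le> t0 \<Longrightarrow> q \<bullet> P z < r) \<Longrightarrow>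
       \<exists>\<delta>>0. AE t in L. s0 \<le> t \<and> t \<le> t0 \<and> \<bar>g t\<bar> + norm (gu t) < \<delta> \<longrightarrow> q \<bullet> gx t \<le> r"
  obtains \<eta> s where "finite_borel_measure \<eta>" "s \<in> borel_measurable borel" "integrable \<eta> s"
    "AE x in \<eta>. x \<in> fst ` Z \<and> s x \<in> convex hull (P ` {z\<in>Z. fst z = x})"
    "\<And>B. B \<in> sets borel \<Longrightarrow> measure \<mu>0 B = (\<integral>t. indicator B t * lam t \<partial>L) + measure \<eta> B"
    "\<And>B. B \<in> sets borel \<Longrightarrow> (\<Sum>i\<in>Basis. (measure (\<mu> i) B - K * measure \<mu>0 B) *\<^sub>R i) =
        (\<integral>t. indicator B t *\<^sub>R (lam t *\<^sub>R gx t) \<partial>L) + (\<integral>t. indicator B t *\<^sub>R s t \<partial>\<eta>)"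
proof -
  have fin0: "finite_borel_measure \<mu>0" and fini: "\<And>i. i \<in> Basis \<Longrightarrow> finite_borel_measure (\<mu> i)"
    using lim0 limi by (auto simp: limit_measure_def)
  have idL: "(\<lambda>x. x) \<in> measurable L borel" by (intro continuous_on_interval_measurable continuous_intros)
  have wi: "K + gx t \<bullet> i \<ge> 0" "K - gx t \<bullet> i \<ge> 0" "\<bar>K + gx t \<bullet> i\<bar> \<le> 2 * K" if "i \<in> Basis" "t \<in> {a..b}" for i t
    using abs_inner_le[OF gx_bound[OF that(2)], of i 1] that(1) by auto
  have lmult: "integrable L (\<lambda>t. lam t * f t)" if "f \<in> borel_measurable L" "\<And>t. t \<in> {a..b} \<Longrightarrow> \<bar>f t\<bar> \<le> d" for f :: "real \<Rightarrow> real" and d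
  proof (rule Bochner_Integration.integrable_bound[where f = "\<lambda>t. d * lam t"])
    show "integrable L (\<lambda>t. d * lam t)" using lam(1) by simp
    show "(\<lambda>t. lam t * f t) \<in> borel_measurable L" using that(1) lam(1) by measurable
    show "AE t in L. norm (lam t * f t) \<le> norm (d * lam t)"
    proof (rule AE_I2)
      fix t assume "t \<in> space L"
      then have "\<bar>f t\<bar> \<le> \<bar>d\<bar>" using that(2)[of t] by auto
      then show "norm (lam t * f t) \<le> norm (d * lam t)" by (simp add: abs_mult mult_right_mono mult.commute)
    qed
  qed
  have lamwi: "integrable L (\<lambda>t. lam t * (K + gx t \<bullet> i))" if "i \<in> Basis" for i
  proof (rule lmult[where d = "2 * K"])
    show "\<bar>K + gx t \<bullet> i\<bar> \<le> 2 * K" if "t \<in> {a..b}" for t by (rule wi(3)[OF \<open>i \<in> Basis\<close> that])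
  qed measurable
  have Ib: "integrable L (\<lambda>t. indicator S t * h t)" if "integrable L h" "S \<in> sets borel" for h :: "real \<Rightarrow> real" and S
    using integrable_indicator_lebesgue_on[OF that] by simp
  obtain \<nu>0 where \<nu>0: "finite_borel_measure \<nu>0" "\<And>B. B \<in> sets borel \<Longrightarrow> measure \<nu>0 B = (\<integral>t. indicator B t * lam t \<partial>L)"
    using borel_measure_of_density[OF idL lam(1,2)] by blast
  have "\<exists>\<nu>. finite_borel_measure \<nu> \<and> (\<forall>B\<in>sets borel. measure \<nu> B = (\<integral>t. indicator B t * (lam t * (K + gx t \<bullet> i)) \<partial>L))"
    if i: "i \<in> Basis" for i
  proof -
    have "AE t in L. 0 \<le> lam t * (K + gx t \<bullet> i)"
      using lam(2) AE_space by eventually_elim (use wi[OF i] in auto)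
    then obtain \<nu> where "finite_borel_measure \<nu>" "\<And>B. B \<in> sets borel \<Longrightarrow> measure \<nu> B = (\<integral>t. indicator B t * (lam t * (K + gx t \<bullet> i)) \<partial>L)"
      by (rule borel_measure_of_density[OF idL lamwi[OF i]]) auto
    then show ?thesis by blast
  qed
  then have "\<forall>i\<in>Basis. \<exists>\<nu>. finite_borel_measure \<nu> \<and> (\<forall>B\<in>sets borel. measure \<nu> B = (\<integral>t. indicator B t * (lam t * (K + gx t \<bullet> i)) \<partial>L))" ..
  from bchoice[OF this] obtain \<nu> where \<nu>': "\<forall>i\<in>Basis. finite_borel_measure (\<nu> i) \<and>
    (\<forall>B\<in>sets borel. measure (\<nu> i) B = (\<integral>t. indicator B t * (lam t * (K + gx t \<bullet> i)) \<partial>L))" ..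
  note \<nu> = \<nu>'[rule_format, THEN conjunct1] \<nu>'[rule_format, THEN conjunct2, rule_format]
  have lgi: "integrable L (\<lambda>t. ls n t * (K + gx t \<bullet> i))" if "i \<in> Basis" for n i
    using bounded_mult_integrable[OF ls, of "\<lambda>t. K + gx t \<bullet> i" "2 * K"] wi[OF that] by simp
  have lsi: "integrable L (ls n)" for n
    using bounded_mult_integrable[OF ls, of "\<lambda>_. 1 :: real" 1 n] by simp

  \<comment> \<open>Every affine weight \<open>c0 + q \<bullet> gx\<close> is a combination of the weights \<open>1\<close> and \<open>K + gx \<bullet> i\<close>.\<close>
  define tot where "tot q = (\<Sum>i\<in>(Basis :: 'a set). q \<bullet> i)" for q :: 'a
  have w_eq: "c0 + q \<bullet> gx t = (c0 - K * tot q) + (\<Sum>i\<in>Basis. (q \<bullet> i) * (K + gx t \<bullet> i))" for c0 q t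
  proof -
    have "(\<Sum>i\<in>Basis. (q \<bullet> i) * (K + gx t \<bullet> i)) = K * tot q + (\<Sum>i\<in>Basis. (q \<bullet> i) * (gx t \<bullet> i))"
      unfolding tot_def sum_distrib_left sum.distrib[symmetric] by (rule sum.cong) (auto simp: algebra_simps)
    also have "(\<Sum>i\<in>Basis. (q \<bullet> i) * (gx t \<bullet> i)) = q \<bullet> gx t" by (rule euclidean_inner[symmetric])
    finally show ?thesis by simp
  qed
  have split: "(\<integral>t. indicator B t * (h t * (c0 + q \<bullet> gx t)) \<partial>L) =
      (c0 - K * tot q) * (\<integral>t. indicator B t * h t \<partial>L) + (\<Sum>i\<in>Basis. (q \<bullet> i) * (\<integral>t. indicator B t * (h t * (K + gx t \<bullet> i)) \<partial>L))"
    if h: "integrable L h" "\<And>i. i \<in> Basis \<Longrightarrow> integrable L (\<lambda>t. h t * (K + gx t \<bullet> i))" and B: "B \<in> sets borel" for h B c0 q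
  proof -
    have "(\<integral>t. indicator B t * (h t * (c0 + q \<bullet> gx t)) \<partial>L)
       = (\<integral>t. (c0 - K * tot q) * (indicator B t * h t) + (\<Sum>i\<in>Basis. (q \<bullet> i) * (indicator B t * (h t * (K + gx t \<bullet> i)))) \<partial>L)"
      by (rule Bochner_Integration.integral_cong) (simp_all add: w_eq distrib_left sum_distrib_left mult_ac)
    also have "\<dots> = (c0 - K * tot q) * (\<integral>t. indicator B t * h t \<partial>L) + (\<Sum>i\<in>Basis. (q \<bullet> i) * (\<integral>t. indicator B t * (h t * (K + gx t \<bullet> i)) \<partial>L))"
      using Ib[OF h(1) B] Ib[OF h(2) B] by (subst Bochner_Integration.integral_add) (auto simp: Bochner_Integration.integral_sum)
    finally show ?thesis .
  qed

  obtain D0 where D0: "countable D0" "\<And>t. t \<notin> D0 \<Longrightarrow> (\<lambda>n. cumul a b (ls n) t) \<longlonglongrightarrow> measure \<mu>0 {..t}"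
    using lim0 unfolding limit_measure_def by blast
  have "\<forall>i\<in>Basis. \<exists>D. countable D \<and> (\<forall>t. t \<notin> D \<longrightarrow> (\<lambda>n. cumul a b (\<lambda>t. ls n t * (K + gx t \<bullet> i)) t) \<longlonglongrightarrow> measure (\<mu> i) {..t})"
    using limi unfolding limit_measure_def by blast
  from bchoice[OF this] obtain Di where Di': "\<forall>i\<in>Basis. countable (Di i) \<and>
     (\<forall>t. t \<notin> Di i \<longrightarrow> (\<lambda>n. cumul a b (\<lambda>t. ls n t * (K + gx t \<bullet> i)) t) \<longlonglongrightarrow> measure (\<mu> i) {..t})" ..
  note Di = Di'[rule_format, THEN conjunct1] Di'[rule_format, THEN conjunct2, rule_format]
  define D where "D = D0 \<union> (\<Union>i\<in>Basis. Di i)"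
  have Dc: "countable D"
    unfolding D_def by (intro countable_Un countable_UN D0 Di countable_finite[OF finite_Basis])
  have Ioc: "measure m {s<..t} = measure m {..t} - measure m {..s}" if "finite_borel_measure m" "s < t" for m s t
    using finite_borel_measure.cdf_diff_eq[OF that] by (simp add: cdf_def)

  \<comment> \<open>\<open>\<Psi> c0 q\<close> is the value of \<open>c0 * \<eta> + q \<bullet> \<sigma>\<close> on a set, where \<open>\<eta>\<close> and \<open>\<sigma>\<close> are the singular remainders.\<close>
  define \<Psi> where "\<Psi> c0 q B = (c0 - K * tot q) * (measure \<mu>0 B - measure \<nu>0 B) + (\<Sum>i\<in>Basis. (q \<bullet> i) * (measure (\<mu> i) B - measure (\<nu> i) B))" for c0 q B
  \<comment> \<open>Off the countable set \<open>D\<close> the distribution functions converge and the bound passes to the limit; elsewhere it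
    follows by right-continuity, at the price of an open interval \<open>{s0<..<t0}\<close> around \<open>{s<..t}\<close>.\<close>
  have key: "0 \<le> \<Psi> c0 q {s<..t}"
    if \<delta>: "\<delta> > 0" and pos: "AE t in L. s0 \<le> t \<and> t \<le> t0 \<and> \<bar>g t\<bar> + norm (gu t) < \<delta> \<longrightarrow> 0 \<le> c0 + q \<bullet> gx t"
      and st: "s0 < s" "s < t" "t < t0" for c0 q s0 t0 s t \<delta>
  proof -
    have base: "0 \<le> \<Psi> c0 q {s<..t}" if st: "s0 < s" "s < t" "t < t0" and nD: "s \<notin> D" "t \<notin> D" for s t
    proof -
      define \<beta> where "\<beta> = (c0 - K * tot q) * measure \<mu>0 {s<..t} + (\<Sum>i\<in>Basis. (q \<bullet> i) * measure (\<mu> i) {s<..t})"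
      have l0: "(\<lambda>n. \<integral>x. indicator {s<..t} x * ls n x \<partial>L) \<longlonglongrightarrow> measure \<mu>0 {s<..t}"
      proof -
        have "(\<lambda>n. cumul a b (ls n) t - cumul a b (ls n) s) \<longlonglongrightarrow> measure \<mu>0 {..t} - measure \<mu>0 {..s}"
          by (intro tendsto_intros D0) (use nD in \<open>auto simp: D_def\<close>)
        then show ?thesis using cumul_diff[OF lsi less_imp_le[OF st(2)]] Ioc[OF fin0 st(2)] by simp
      qed
      have li: "(\<lambda>n. \<integral>x. indicator {s<..t} x * (ls n x * (K + gx x \<bullet> i)) \<partial>L) \<longlonglongrightarrow> measure (\<mu> i) {s<..t}" if i: "i \<in> Basis" for i
      proof -
        have "(\<lambda>n. cumul a b (\<lambda>t. ls n t * (K + gx t \<bullet> i)) t - cumul a b (\<lambda>t. ls n t * (K + gx t \<bullet> i)) s) \<longlonglongrightarrow> measure (\<mu> i) {..t} - measure (\<mu> i) {..s}"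
          by (intro tendsto_intros Di i) (use nD i in \<open>auto simp: D_def\<close>)
        then show ?thesis using cumul_diff[OF lgi[OF i] less_imp_le[OF st(2)]] Ioc[OF fini[OF i] st(2)] by simp
      qed
      have lim: "(\<lambda>n. \<integral>x. indicator {s<..t} x * (ls n x * (c0 + q \<bullet> gx x)) \<partial>L) \<longlonglongrightarrow> \<beta>"
        unfolding \<beta>_def split[OF lsi lgi, of "{s<..t}", simplified] by (intro tendsto_intros l0 li)
      have "(\<integral>x. indicator {s<..t} x * (lam x * (c0 + q \<bullet> gx x)) \<partial>L) \<le> \<beta>"
      proof (rule limit_lower_bound[OF ls lam L1 _ _ _ \<delta> _ lim])
        show "\<bar>c0 + q \<bullet> gx x\<bar> \<le> \<bar>c0\<bar> + norm q * K" if "x \<in> {a..b}" for x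
          using abs_inner_le[OF order_refl gx_bound[OF that], of q] by linarith
        show "AE x in L. x \<in> {s<..t} \<and> \<bar>g x\<bar> + norm (gu x) < \<delta> \<longrightarrow> 0 \<le> c0 + q \<bullet> gx x"
          using pos by eventually_elim (use st in auto)
      qed auto
      then show ?thesis
        unfolding split[OF lam(1) lamwi, of "{s<..t}", simplified] \<beta>_def \<Psi>_def \<nu>0(2)[of "{s<..t}", simplified]
        using \<nu>(2)[of _ "{s<..t}"] by (simp add: algebra_simps sum.distrib sum_subtractf)
    qed
    define \<Phi> where "\<Phi> t = \<Psi> c0 q {..t}" for t
    have diff: "\<Psi> c0 q {s<..t} = \<Phi> t - \<Phi> s" if "s < t" for s t
    proof -
      have "(\<Sum>i\<in>Basis. (q \<bullet> i) * (measure (\<mu> i) {s<..t} - measure (\<nu> i) {s<..t})) =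
          (\<Sum>i\<in>Basis. (q \<bullet> i) * (measure (\<mu> i) {..t} - measure (\<nu> i) {..t})) - (\<Sum>i\<in>Basis. (q \<bullet> i) * (measure (\<mu> i) {..s} - measure (\<nu> i) {..s}))"
        unfolding sum_subtractf[symmetric]
        by (rule sum.cong) (simp_all add: Ioc[OF fini that] Ioc[OF \<nu>(1) that] right_diff_distrib)
      then show ?thesis
        unfolding \<Phi>_def \<Psi>_def Ioc[OF fin0 that] Ioc[OF \<nu>0(1) that] by (simp add: algebra_simps)
    qed
    have "\<Phi> s \<le> \<Phi> t"
    proof (rule right_continuous_mono_from_dense[OF _ Dc _ st])
      have rc: "continuous (at_right x) (\<lambda>t. measure m {..t})" if "finite_borel_measure m" for m x
        using finite_borel_measure.cdf_is_right_cont[OF that, of x] by (simp add: cdf_def[abs_def])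
      show "continuous (at_right x) \<Phi>" for x
        unfolding \<Phi>_def \<Psi>_def by (intro continuous_intros rc fin0 fini \<nu>0 \<nu>)
      show "\<Phi> s \<le> \<Phi> t" if "s0 < s" "s < t" "t < t0" "s \<notin> D" "t \<notin> D" for s t
        using base[OF that] diff[OF that(2)] by simp
    qed
    then show ?thesis using diff[OF st(2)] by simp
  qed

  have sum_B: "(\<Sum>j\<in>Basis. (c *\<^sub>R i \<bullet> j) * f j) = c * f i" if i: "i \<in> Basis" for i and f :: "'a \<Rightarrow> real" and c
  proof -
    have "(\<Sum>j\<in>Basis. (c *\<^sub>R i \<bullet> j) * f j) = (\<Sum>j\<in>Basis. if j = i then c * f i else 0)"
      by (rule sum.cong) (use i in \<open>auto simp: inner_Basis\<close>)
    then show ?thesis using i by simp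
  qed
  have tot_B: "tot (c *\<^sub>R i) = c" if "i \<in> Basis" for i c
    using sum_B[OF that, of c "\<lambda>_. 1"] by (simp add: tot_def)
  have tot_0: "tot 0 = 0" by (simp add: tot_def)
  have pos_all: "0 \<le> \<Psi> c0 q {s<..t}" if "s < t" "\<And>t. t \<in> {a..b} \<Longrightarrow> 0 \<le> c0 + q \<bullet> gx t" for c0 q s t
    by (rule key[of 1 "s - 1" "t + 1"]) (use that in \<open>auto intro!: AE_I2\<close>)
  have le0: "measure \<nu>0 {s<..t} \<le> measure \<mu>0 {s<..t}" if "s < t" for s t
    using pos_all[OF that, of 1 0] by (simp add: \<Psi>_def tot_0)
  have lei: "measure (\<nu> i) {s<..t} \<le> measure (\<mu> i) {s<..t}" if "s < t" "i \<in> Basis" for s t i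
    using pos_all[OF that(1), of K "1 *\<^sub>R i"] wi(1)[OF that(2)] unfolding \<Psi>_def tot_B[OF that(2)] sum_B[OF that(2)]
    by (simp add: inner_commute)
  obtain \<eta> where \<eta>: "finite_borel_measure \<eta>" "\<And>B. B \<in> sets borel \<Longrightarrow> measure \<mu>0 B = measure \<nu>0 B + measure \<eta> B"
    using finite_borel_measure_difference[OF fin0 \<nu>0(1) le0] by metis
  have "\<exists>\<kappa>. finite_borel_measure \<kappa> \<and> (\<forall>B\<in>sets borel. measure (\<mu> i) B = measure (\<nu> i) B + measure \<kappa> B)" if i: "i \<in> Basis" for i
    using finite_borel_measure_difference[OF fini[OF i] \<nu>(1)[OF i] lei[OF _ i]] by metis
  then obtain \<eta>i where \<eta>i: "\<And>i. i \<in> Basis \<Longrightarrow> finite_borel_measure (\<eta>i i)"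
    "\<And>i B. i \<in> Basis \<Longrightarrow> B \<in> sets borel \<Longrightarrow> measure (\<mu> i) B = measure (\<nu> i) B + measure (\<eta>i i) B" by metis
  have \<Psi>_eq: "\<Psi> c0 q B = (c0 - K * tot q) * measure \<eta> B + (\<Sum>i\<in>Basis. (q \<bullet> i) * measure (\<eta>i i) B)" if "B \<in> sets borel" for c0 q B
    unfolding \<Psi>_def using \<eta>(2)[OF that] \<eta>i(2)[OF _ that] by simp
  have dom: "measure (\<eta>i i) {s<..t} \<le> (2 * K) * measure \<eta> {s<..t}" if "s < t" "i \<in> Basis" for s t i
    using pos_all[OF that(1), of K "(- 1) *\<^sub>R i"] wi(2)[OF that(2)]
    unfolding \<Psi>_eq[of "{s<..t}", simplified] tot_B[OF that(2)] sum_B[OF that(2)] by (simp add: inner_commute)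
  interpret e: finite_borel_measure \<eta> by (rule \<eta>(1))
  have "\<exists>k::real \<Rightarrow> real. k \<in> borel_measurable borel \<and> integrable \<eta> k \<and> (\<forall>B\<in>sets borel. (\<integral>x. indicator B x * k x \<partial>\<eta>) = measure (\<eta>i i) B)"
    if i: "i \<in> Basis" for i
    by (rule finite_borel_measure_radon_nikodym[OF \<eta>(1) \<eta>i(1)[OF i] dom[OF _ i]]) (use K_nonneg in auto)
  then obtain k :: "'a \<Rightarrow> real \<Rightarrow> real" where k: "\<And>i. i \<in> Basis \<Longrightarrow> k i \<in> borel_measurable borel" "\<And>i. i \<in> Basis \<Longrightarrow> integrable \<eta> (k i)"
    "\<And>i B. i \<in> Basis \<Longrightarrow> B \<in> sets borel \<Longrightarrow> (\<integral>x. indicator B x * k i x \<partial>\<eta>) = measure (\<eta>i i) B" by metis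
  define s where "s x = (\<Sum>i\<in>Basis. (k i x - K) *\<^sub>R i)" for x
  have sm: "s \<in> borel_measurable borel" unfolding s_def[abs_def]
    by (intro borel_measurable_sum borel_measurable_scaleR borel_measurable_diff k) auto
  have si: "integrable \<eta> s" unfolding s_def[abs_def]
    by (intro Bochner_Integration.integrable_sum integrable_scaleR_left Bochner_Integration.integrable_diff k e.integrable_const)
  have s_inner: "s x \<bullet> i = k i x - K" if "i \<in> Basis" for x i
    unfolding s_def using that by (simp add: inner_sum_left_Basis)
  have Be: "integrable \<eta> (\<lambda>x. indicator B x *\<^sub>R h x)" if "integrable \<eta> h" "B \<in> sets borel" for h :: "real \<Rightarrow> 'd::euclidean_space" and B
    using integrable_mult_indicator[of B \<eta> h] that by (simp add: e.M_is_borel)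
  have mB: "(\<integral>x. indicator B x \<partial>\<eta>) = measure \<eta> B" if "B \<in> sets borel" for B
    using that by (simp add: e.borel_UNIV e.M_is_borel)
  have iB: "integrable \<eta> (indicator B :: real \<Rightarrow> real)" if "B \<in> sets borel" for B
    using Be[OF e.integrable_const that, of "1::real"] by simp
  have s_int: "(\<integral>x. indicator B x *\<^sub>R s x \<partial>\<eta>) \<bullet> i = measure (\<eta>i i) B - K * measure \<eta> B" if i: "i \<in> Basis" and B: "B \<in> sets borel" for i B
  proof -
    have "(\<integral>x. indicator B x *\<^sub>R s x \<partial>\<eta>) \<bullet> i = (\<integral>x. (indicator B x *\<^sub>R s x) \<bullet> i \<partial>\<eta>)"
      by (rule integral_inner_left[symmetric]) (use Be[OF si B] in simp)
    also have "\<dots> = (\<integral>x. indicator B x *\<^sub>R k i x - K * indicator B x \<partial>\<eta>)"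
      by (rule Bochner_Integration.integral_cong) (auto simp: s_inner[OF i] algebra_simps)
    also have "\<dots> = (\<integral>x. indicator B x *\<^sub>R k i x \<partial>\<eta>) - K * (\<integral>x. indicator B x \<partial>\<eta>)"
      using Bochner_Integration.integral_diff[OF Be[OF k(2)[OF i] B] integrable_mult_right[OF iB[OF B]], of K]
      by (simp only: integral_mult_right_zero)
    finally show ?thesis using k(3)[OF i B] mB[OF B] by simp
  qed
  have affine: "(\<integral>x. indicator B x * (c0 + q \<bullet> s x) \<partial>\<eta>) = \<Psi> c0 q B" if B: "B \<in> sets borel" for c0 q B
  proof -
    have "(\<integral>x. indicator B x * (c0 + q \<bullet> s x) \<partial>\<eta>) = (\<integral>x. c0 * indicator B x + q \<bullet> (indicator B x *\<^sub>R s x) \<partial>\<eta>)"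
      by (rule Bochner_Integration.integral_cong) (auto simp: algebra_simps)
    also have "\<dots> = c0 * measure \<eta> B + q \<bullet> (\<integral>x. indicator B x *\<^sub>R s x \<partial>\<eta>)"
      using Bochner_Integration.integral_add[OF integrable_mult_right[OF iB[OF B]] integrable_inner_right[OF Be[OF si B]], of c0 q]
        integral_inner_right[OF Be[OF si B], of q]
      by (simp only: integral_mult_right_zero mB[OF B])
    also have "q \<bullet> (\<integral>x. indicator B x *\<^sub>R s x \<partial>\<eta>) = (\<Sum>i\<in>Basis. (q \<bullet> i) * (measure (\<eta>i i) B - K * measure \<eta> B))"
      by (subst euclidean_inner) (rule sum.cong, use s_int[OF _ B] in auto)
    finally show ?thesis unfolding \<Psi>_eq[OF B] tot_def
      by (simp add: algebra_simps sum_subtractf sum_distrib_left sum_distrib_right)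
  qed
  have affine_i: "integrable \<eta> (\<lambda>x. c0 + q \<bullet> s x)" for c0 q using si by simp

  obtain Q :: "'a set" where Q: "countable Q" "\<And>U. open U \<Longrightarrow> U \<noteq> {} \<Longrightarrow> \<exists>q\<in>Q. q \<in> U"
    by (rule countable_dense_setE) auto
  \<comment> \<open>The bound on \<open>P\<close> is required over the larger interval \<open>{s0..t0}\<close>, the conclusion drawn on \<open>{s1<..t1}\<close>.\<close>
  define X where "X = {(q, r, s0, s1, t1, t0). q \<in> Q \<and> r \<in> \<rat> \<and> s0 \<in> \<rat> \<and> s1 \<in> \<rat> \<and> t1 \<in> \<rat> \<and> t0 \<in> (\<rat> :: real set) \<and>
      s0 < s1 \<and> t1 < t0 \<and> (\<forall>z\<in>Z. s0 \<le> fst z \<and> fst z \<le> t0 \<longrightarrow> q \<bullet> P z < r)}"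
  have "countable (Q \<times> \<rat> \<times> \<rat> \<times> \<rat> \<times> \<rat> \<times> (\<rat> :: real set))" by (intro countable_SIGMA Q countable_rat)
  then have Xc: "countable X" by (rule countable_subset[rotated]) (auto simp: X_def)
  have "AE x in \<eta>. x \<in> {s1<..t1} \<longrightarrow> 0 \<le> r + (- q) \<bullet> s x" if qX: "(q, r, s0, s1, t1, t0) \<in> X" for q r s0 s1 t1 t0
  proof -
    obtain \<delta> where \<delta>: "\<delta> > 0" "AE t in L. s0 \<le> t \<and> t \<le> t0 \<and> \<bar>g t\<bar> + norm (gu t) < \<delta> \<longrightarrow> q \<bullet> gx t \<le> r"
      using sep[of s0 t0 q r] qX by (auto simp: X_def)
    have pos: "AE t in L. s0 \<le> t \<and> t \<le> t0 \<and> \<bar>g t\<bar> + norm (gu t) < \<delta> \<longrightarrow> 0 \<le> r + (- q) \<bullet> gx t"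
      using \<delta>(2) by eventually_elim simp
    show ?thesis
    proof (rule density_nonneg_if_nonneg_on_intervals[OF \<eta>(1) affine_i])
      fix s' t' assume "s1 \<le> s'" "s' < t'" "t' \<le> t1"
      then show "0 \<le> (\<integral>x. indicator {s'<..t'} x * (r + (- q) \<bullet> s x) \<partial>\<eta>)"
        unfolding affine[of "{s'<..t'}", simplified] by (intro key[OF \<delta>(1) pos]) (use qX in \<open>auto simp: X_def\<close>)
    qed
  qed
  then have "\<forall>\<xi>\<in>X. AE x in \<eta>. (case \<xi> of (q, r, s0, s1, t1, t0) \<Rightarrow> x \<in> {s1<..t1} \<longrightarrow> q \<bullet> s x \<le> r)" by auto
  then have "AE x in \<eta>. \<forall>\<xi>\<in>X. (case \<xi> of (q, r, s0, s1, t1, t0) \<Rightarrow> x \<in> {s1<..t1} \<longrightarrow> q \<bullet> s x \<le> r)"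
    by (simp add: AE_ball_countable[OF Xc])
  then have incl: "AE x in \<eta>. x \<in> fst ` Z \<and> s x \<in> convex hull (P ` {z\<in>Z. fst z = x})"
  proof eventually_elim
    case (elim x)
    have cZ: "compact {z\<in>Z. fst z = x}"
    proof -
      have "closed {z :: real \<times> 'c. fst z = x}" by (intro closed_Collect_eq continuous_intros)
      from compact_Int_closed[OF Z this] show ?thesis by (simp add: Int_def)
    qed
    have cP: "compact (P ` {z\<in>Z. fst z = x})"
      by (intro compact_continuous_image continuous_on_subset[OF P] cZ) auto
    have "s x \<in> convex hull (P ` {z\<in>Z. fst z = x})"
    proof (rule ccontr)
      assume "\<not> ?thesis"
      then obtain q r where q: "q \<in> Q" "r \<in> \<rat>" "r < q \<bullet> s x" "\<And>y. y \<in> P ` {z\<in>Z. fst z = x} \<Longrightarrow> q \<bullet> y < r"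
        by (rule separate_from_convex_hull[OF cP _ Q(2)]) auto
      define E where "E = {z\<in>Z. r \<le> q \<bullet> P z}"
      have "compact E"
      proof -
        have "closedin (top_of_set Z) (Z \<inter> (\<lambda>z. q \<bullet> P z) -` {r..})"
          by (rule continuous_closedin_preimage) (auto intro!: continuous_intros P)
        then have "compact (Z \<inter> (\<lambda>z. q \<bullet> P z) -` {r..})" using closedin_compact[OF Z] by blast
        moreover have "Z \<inter> (\<lambda>z. q \<bullet> P z) -` {r..} = E" by (auto simp: E_def)
        ultimately show ?thesis by simp
      qed
      then have "closed (fst ` E)" by (intro compact_imp_closed compact_continuous_image continuous_intros)
      moreover have "x \<notin> fst ` E" using q(4) by (force simp: E_def)
      ultimately obtain \<rho> where \<rho>: "\<rho> > 0" "ball x \<rho> \<inter> fst ` E = {}"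
        using separate_point_closed[of "fst ` E" x] by (metis ball_eq_empty disjoint_iff dist_commute linorder_not_less mem_ball)
      obtain s0 where s0: "s0 \<in> \<rat>" "x - \<rho> < s0" "s0 < x - \<rho>/2" using Rats_dense_in_real[of "x - \<rho>" "x - \<rho>/2"] \<rho> by auto
      obtain s1 where s1: "s1 \<in> \<rat>" "x - \<rho>/2 < s1" "s1 < x" using Rats_dense_in_real[of "x - \<rho>/2" x] \<rho> by auto
      obtain t1 where t1: "t1 \<in> \<rat>" "x < t1" "t1 < x + \<rho>/2" using Rats_dense_in_real[of x "x + \<rho>/2"] \<rho> by auto
      obtain t0 where t0: "t0 \<in> \<rat>" "x + \<rho>/2 < t0" "t0 < x + \<rho>" using Rats_dense_in_real[of "x + \<rho>/2" "x + \<rho>"] \<rho> by auto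
      have "q \<bullet> P z < r" if z: "z \<in> Z" "s0 \<le> fst z" "fst z \<le> t0" for z
      proof (rule ccontr)
        assume "\<not> ?thesis"
        then have "fst z \<in> fst ` E" using z by (auto simp: E_def)
        moreover have "fst z \<in> ball x \<rho>" using z s0 t0 by (auto simp: dist_real_def)
        ultimately show False using \<rho> by blast
      qed
      then have "(q, r, s0, s1, t1, t0) \<in> X" using q s0 s1 t1 t0 by (auto simp: X_def)
      then have "q \<bullet> s x \<le> r" using elim s1 t1 by fastforce
      then show False using q by simp
    qed
    moreover from this have "{z\<in>Z. fst z = x} \<noteq> {}" by (metis convex_hull_empty empty_iff image_empty)
    then have "x \<in> fst ` Z" by force
    ultimately show ?case by simp
  qed

  have sigma: "(\<Sum>i\<in>Basis. (measure (\<mu> i) B - K * measure \<mu>0 B) *\<^sub>R i) =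
        (\<integral>t. indicator B t *\<^sub>R (lam t *\<^sub>R gx t) \<partial>L) + (\<integral>t. indicator B t *\<^sub>R s t \<partial>\<eta>)" (is "?l = ?r") if B: "B \<in> sets borel" for B
  proof (rule euclidean_eqI)
    fix i :: 'a assume i: "i \<in> Basis"
    have lg: "integrable L (\<lambda>t. lam t *\<^sub>R gx t)"
    proof (rule Bochner_Integration.integrable_bound[where f = "\<lambda>t. K * lam t"])
      show "AE t in L. norm (lam t *\<^sub>R gx t) \<le> norm (K * lam t)"
      proof (rule AE_I2)
        fix t assume "t \<in> space L"
        then have "\<bar>lam t\<bar> * norm (gx t) \<le> \<bar>lam t\<bar> * K" by (intro mult_left_mono gx_bound) auto
        then show "norm (lam t *\<^sub>R gx t) \<le> norm (K * lam t)" using K_nonneg by (simp add: abs_mult mult.commute)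
      qed
    qed (use lam(1) in auto)
    have "(\<integral>t. indicator B t *\<^sub>R (lam t *\<^sub>R gx t) \<partial>L) \<bullet> i = (\<integral>t. (indicator B t *\<^sub>R (lam t *\<^sub>R gx t)) \<bullet> i \<partial>L)"
      by (rule integral_inner_left[symmetric]) (use integrable_indicator_lebesgue_on[OF lg B] in simp)
    also have "\<dots> = (\<integral>t. indicator B t * (lam t * (K + gx t \<bullet> i)) - K * (indicator B t * lam t) \<partial>L)"
      by (rule Bochner_Integration.integral_cong) (auto simp: algebra_simps)
    also have "\<dots> = measure (\<nu> i) B - K * measure \<nu>0 B"
      using Ib[OF lamwi[OF i] B] Ib[OF lam(1) B] \<nu>(2)[OF i B] \<nu>0(2)[OF B] by simp
    finally have 1: "(\<integral>t. indicator B t *\<^sub>R (lam t *\<^sub>R gx t) \<partial>L) \<bullet> i = measure (\<nu> i) B - K * measure \<nu>0 B" .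
    have "?l \<bullet> i = measure (\<mu> i) B - K * measure \<mu>0 B" using i by (simp add: inner_sum_left_Basis)
    then show "?l \<bullet> i = ?r \<bullet> i"
      using 1 s_int[OF i B] \<eta>(2)[OF B] \<eta>i(2)[OF i B] by (simp add: inner_add_left algebra_simps)
  qed
  show ?thesis
    by (rule that[OF \<eta>(1) sm si incl _ sigma]) (use \<eta>(2) \<nu>0(2) in auto)
qed

end

section \<open>Gradients, closure in measure, and bounded variation\<close>

lemma AE_lebesgue_on_iff_negligible:
  "(AE t in lebesgue_on {a..b::real}. Q t) \<longleftrightarrow> (\<exists>N. negligible N \<and> (\<forall>t\<in>{a..b} - N. Q t))"
proof
  assume "AE t in lebesgue_on {a..b}. Q t"
  then have "AE t in lebesgue. t \<in> {a..b} \<longrightarrow> Q t" by (subst (asm) AE_restrict_space_iff) auto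
  then obtain N where "{t \<in> space lebesgue. \<not> (t \<in> {a..b} \<longrightarrow> Q t)} \<subseteq> N" "emeasure lebesgue N = 0" "N \<in> sets lebesgue"
    by (rule AE_E)
  moreover from this have "N \<in> null_sets lebesgue" by (intro null_setsI)
  ultimately show "\<exists>N. negligible N \<and> (\<forall>t\<in>{a..b} - N. Q t)"
    by (intro exI[of _ N]) (auto simp: negligible_iff_null_sets)
next
  assume "\<exists>N. negligible N \<and> (\<forall>t\<in>{a..b} - N. Q t)"
  then obtain N where N: "negligible N" "\<forall>t\<in>{a..b} - N. Q t" by blast
  then have "AE t in lebesgue. t \<notin> N" using AE_not_in negligible_iff_null_sets by blast
  then have "AE t in lebesgue. t \<in> {a..b} \<longrightarrow> Q t" by eventually_elim (use N in auto)
  then show "AE t in lebesgue_on {a..b}. Q t" by (subst AE_restrict_space_iff) auto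
qed

lemma abs_continuous_on_subinterval:
  "abs_continuous_on a b x \<Longrightarrow> a \<le> c \<Longrightarrow> d \<le> b \<Longrightarrow> abs_continuous_on c d x"
  unfolding abs_continuous_on_def by (meson order_trans)

lemma abs_continuous_on_imp_continuous_on:
  assumes "abs_continuous_on a b x"
  shows "continuous_on {a..b} x"
proof (rule continuous_onI)
  fix s e :: real assume s: "s \<in> {a..b}" and e: "e > 0"
  obtain \<delta> where \<delta>: "\<delta> > 0" "\<forall>(S :: nat set) l r. finite S \<and> (\<forall>i\<in>S. a \<le> l i \<and> l i \<le> r i \<and> r i \<le> b) \<and>
       disjoint_family_on (\<lambda>i. {l i<..<r i}) S \<and> (\<Sum>i\<in>S. r i - l i) < \<delta>
       \<longrightarrow> (\<Sum>i\<in>S. norm (x (r i) - x (l i))) < e"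
    using abs_continuous_on_finite_family[OF assms e, where 'c = nat] by blast
  have "dist (x t) (x s) \<le> e" if t: "t \<in> {a..b}" "dist t s < \<delta>" for t
  proof -
    have "norm (x (max s t) - x (min s t)) < e"
      using \<delta>(2)[rule_format, of "{0}" "\<lambda>_. min s t" "\<lambda>_. max s t"] s t
      by (auto simp: disjoint_family_on_def dist_real_def max_def min_def split: if_splits)
    then show ?thesis by (cases "s \<le> t") (auto simp: dist_norm max_def min_def norm_minus_commute)
  qed
  then show "\<exists>d>0. \<forall>t\<in>{a..b}. dist t s < d \<longrightarrow> dist (x t) (x s) \<le> e" using \<delta>(1) by blast
qed

text \<open>In terms of row vectors this is \<open>p F_x(z)\<close>. The adjoint covers vector-valued \<open>F\<close>, as in the Pontryagin function, and with
  \<open>p = 1\<close> the gradient of a real-valued \<open>F\<close>.\<close>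

definition partial1 :: "('z \<Rightarrow> ('a::euclidean_space \<times> 'b::euclidean_space) \<Rightarrow>\<^sub>L 'c::euclidean_space) \<Rightarrow> 'z \<Rightarrow> 'c \<Rightarrow> 'a" where
  "partial1 F' z p = adjoint (\<lambda>y. F' z (y, 0)) p"

definition partial2 :: "('z \<Rightarrow> ('a::euclidean_space \<times> 'b::euclidean_space) \<Rightarrow>\<^sub>L 'c::euclidean_space) \<Rightarrow> 'z \<Rightarrow> 'c \<Rightarrow> 'b" where
  "partial2 F' z p = adjoint (\<lambda>v. F' z (0, v)) p"

lemma linear_partial: "linear (\<lambda>y. blinfun_apply T (y, 0))" "linear (\<lambda>v. blinfun_apply T (0, v))"
  for T :: "('a::euclidean_space \<times> 'b::euclidean_space) \<Rightarrow>\<^sub>L 'c::euclidean_space"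
proof -
  have "linear (blinfun_apply T \<circ> (\<lambda>y. (y, 0)))" "linear (blinfun_apply T \<circ> (\<lambda>v. (0, v)))"
    by (intro linear_compose bounded_linear.linear[OF blinfun.bounded_linear_right]; simp add: linear_iff)+
  then show "linear (\<lambda>y. blinfun_apply T (y, 0))" "linear (\<lambda>v. blinfun_apply T (0, v))" by (simp_all add: o_def)
qed

lemma partial_inner: "y \<bullet> partial1 F' z p = F' z (y, 0) \<bullet> p" "v \<bullet> partial2 F' z p = F' z (0, v) \<bullet> p"
  unfolding partial1_def partial2_def by (rule adjoint_works[OF linear_partial(1)], rule adjoint_works[OF linear_partial(2)])

lemma partial_norm: "norm (partial1 F' z p) \<le> norm (F' z) * norm p" "norm (partial2 F' z p) \<le> norm (F' z) * norm p"
proof -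
  show "norm (partial1 F' z p) \<le> norm (F' z) * norm p" unfolding partial1_def
    by (rule norm_adjoint_le[OF linear_partial(1)]) (use norm_blinfun[of "F' z" "(_, 0)"] in \<open>simp add: norm_Pair\<close>)
  show "norm (partial2 F' z p) \<le> norm (F' z) * norm p" unfolding partial2_def
    by (rule norm_adjoint_le[OF linear_partial(2)]) (use norm_blinfun[of "F' z" "(0, _)"] in \<open>simp add: norm_Pair\<close>)
qed

lemma continuous_partial:
  fixes F' :: "'z::euclidean_space \<Rightarrow> ('a::euclidean_space \<times> 'b::euclidean_space) \<Rightarrow>\<^sub>L 'c::euclidean_space"
    and S :: "'w::t2_space set"
  assumes F': "continuous_on UNIV F'" and h: "continuous_on S h" and k: "continuous_on S k"
  shows "continuous_on S (\<lambda>w. partial1 F' (h w) (k w))" "continuous_on S (\<lambda>w. partial2 F' (h w) (k w))"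
proof -
  have 1: "continuous_on S (\<lambda>w. F' (h w))" by (rule continuous_on_compose2[OF F' h]) simp
  show "continuous_on S (\<lambda>w. partial1 F' (h w) (k w))"
    by (subst continuous_on_componentwise) (auto simp: inner_commute[of _ "_ :: 'a"] partial_inner intro!: continuous_intros 1 k)
  show "continuous_on S (\<lambda>w. partial2 F' (h w) (k w))"
    by (subst continuous_on_componentwise) (auto simp: inner_commute[of _ "_ :: 'b"] partial_inner intro!: continuous_intros 1 k)
qed

lemma gradient_of_inner:
  assumes "\<And>z. (f has_derivative blinfun_apply (F' z)) (at z)"
  shows "grad_1 (\<lambda>z. p \<bullet> f z) z = partial1 F' z p" "grad_2 (\<lambda>z. p \<bullet> f z) z = partial2 F' z p"
proof -
  obtain x u where z: "z = (x, u)" by force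
  have "((\<lambda>y. f (y, u)) has_derivative (\<lambda>h. F' (x, u) (h, 0))) (at x)"
    by (rule has_derivative_compose[of "\<lambda>y. (y, u)" "\<lambda>h. (h, 0)" x UNIV f "blinfun_apply (F' (x, u))", simplified])
       (auto intro!: derivative_eq_intros assms)
  then have "((\<lambda>y. p \<bullet> f (y, u)) has_derivative (\<lambda>h. p \<bullet> F' (x, u) (h, 0))) (at x)"
    by (auto intro!: derivative_eq_intros)
  then show "grad_1 (\<lambda>z. p \<bullet> f z) z = partial1 F' z p"
    unfolding grad_1_def z by (intro gradient_eq) (simp add: gderiv_def partial_inner inner_commute)
  have "((\<lambda>v. f (x, v)) has_derivative (\<lambda>h. F' (x, u) (0, h))) (at u)"
    by (rule has_derivative_compose[of "\<lambda>v. (x, v)" "\<lambda>h. (0, h)" u UNIV f "blinfun_apply (F' (x, u))", simplified])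
       (auto intro!: derivative_eq_intros assms)
  then have "((\<lambda>v. p \<bullet> f (x, v)) has_derivative (\<lambda>h. p \<bullet> F' (x, u) (0, h))) (at u)"
    by (auto intro!: derivative_eq_intros)
  then show "grad_2 (\<lambda>z. p \<bullet> f z) z = partial2 F' z p"
    unfolding grad_2_def z by (intro gradient_eq) (simp add: gderiv_def partial_inner inner_commute)
qed

lemma gradient_of_real:
  fixes f :: "'a::euclidean_space \<times> 'b::euclidean_space \<Rightarrow> real"
  assumes "\<And>z. (f has_derivative blinfun_apply (F' z)) (at z)"
  shows "grad_1 f z = partial1 F' z 1" "grad_2 f z = partial2 F' z 1"
  using gradient_of_inner[OF assms, of 1 z] by simp_all

lemma clm_closed: "closed (clm a b u)"
proof -
  have "open (- clm a b u)"
  proof (subst open_subopen, intro ballI)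
    fix z assume "z \<in> - clm a b u"
    then obtain O' where O': "open O'" "z \<in> O'" "\<not> emeasure lebesgue (fst ` (O' \<inter> {(t, u t) | t. t \<in> {a..b}})) > 0"
      by (auto simp: clm_def)
    then have "O' \<subseteq> - clm a b u" by (auto simp: clm_def)
    then show "\<exists>T. open T \<and> z \<in> T \<and> T \<subseteq> - clm a b u" using O' by blast
  qed
  then show ?thesis by (simp add: closed_def)
qed

lemma clm_bounded:
  fixes u :: "real \<Rightarrow> 'b::euclidean_space"
  assumes M: "AE t in lebesgue_on {a..b}. norm (u t) \<le> M"
  shows "clm a b u \<subseteq> {a..b} \<times> cball 0 M"
proof
  fix z assume z: "z \<in> clm a b u"
  show "z \<in> {a..b} \<times> cball 0 M"
  proof (rule ccontr)
    assume "z \<notin> {a..b} \<times> cball 0 M"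
    moreover have "open (- ({a..b} \<times> cball (0::'b) M))" by (intro open_Compl closed_Times) auto
    ultimately have pos: "emeasure lebesgue (fst ` (- ({a..b} \<times> cball (0::'b) M) \<inter> {(t, u t) | t. t \<in> {a..b}})) > 0"
      using z unfolding clm_def by blast
    obtain N where N: "negligible N" "\<forall>t\<in>{a..b} - N. norm (u t) \<le> M"
      using M by (auto simp: AE_lebesgue_on_iff_negligible)
    have "fst ` (- ({a..b} \<times> cball (0::'b) M) \<inter> {(t, u t) | t. t \<in> {a..b}}) \<subseteq> N" using N(2) by force
    then have "negligible (fst ` (- ({a..b} \<times> cball (0::'b) M) \<inter> {(t, u t) | t. t \<in> {a..b}}))"
      using N(1) negligible_subset by blast
    then show False using pos by (simp add: negligible_iff_null_sets null_sets_def)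
  qed
qed

text \<open>A point of the graph that is missed has a neighbourhood from a countable base over which the graph projects to a null set;
  there are only countably many of these null sets.\<close>

lemma AE_graph_in_clm:
  fixes u :: "real \<Rightarrow> 'b::euclidean_space"
  assumes u: "u \<in> borel_measurable (lebesgue_on {a..b})"
  shows "AE t in lebesgue_on {a..b}. (t, u t) \<in> clm a b u"
proof -
  obtain \<B> :: "(real \<times> 'b) set set" where \<B>: "countable \<B>" "topological_basis \<B>" using ex_countable_basis by blast
  define sh where "sh U = fst ` (U \<inter> {(t, u t) | t. t \<in> {a..b}})" for U
  have sh: "sh U \<in> sets lebesgue" if U: "open U" for U
  proof -
    have "(\<lambda>t. (t, u t)) \<in> borel_measurable (lebesgue_on {a..b})"
      by (intro borel_measurable_Pair u continuous_on_interval_measurable continuous_intros)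
    then have "(\<lambda>t. (t, u t)) -` U \<inter> {a..b} \<in> sets (lebesgue_on {a..b})"
      using U by (auto dest: measurable_sets[of _ _ borel U])
    moreover have "sh U = (\<lambda>t. (t, u t)) -` U \<inter> {a..b}" unfolding sh_def by force
    ultimately show ?thesis by (simp add: sets_restrict_space_iff)
  qed
  define \<N> where "\<N> = {U\<in>\<B>. emeasure lebesgue (sh U) = 0}"
  have neg: "negligible (sh U)" if "U \<in> \<N>" for U
    using that sh[of U] topological_basis_open[OF \<B>(2), of U] by (simp add: \<N>_def negligible_iff_null_sets null_sets_def)
  have "countable \<N>" using \<B>(1) by (auto simp: \<N>_def intro: countable_subset)
  then have N: "negligible (\<Union>U\<in>\<N>. sh U)" using neg by (intro negligible_countable_Union) auto
  have "(t, u t) \<in> clm a b u" if t: "t \<in> {a..b} - (\<Union>U\<in>\<N>. sh U)" for t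
    unfolding clm_def mem_Collect_eq
  proof (intro allI impI, elim conjE)
    fix O' assume O': "open O'" "(t, u t) \<in> O'"
    then obtain U where U: "U \<in> \<B>" "(t, u t) \<in> U" "U \<subseteq> O'" using \<B>(2) by (metis topological_basisE)
    have "t \<in> sh U" using U t unfolding sh_def by force
    then have "emeasure lebesgue (sh U) > 0" using U t by (auto simp: \<N>_def zero_less_iff_neq_zero)
    moreover have "emeasure lebesgue (sh U) \<le> emeasure lebesgue (sh O')"
      by (rule emeasure_mono[OF _ sh[OF O'(1)]]) (use U(3) in \<open>auto simp: sh_def\<close>)
    ultimately have "emeasure lebesgue (sh O') > 0" by (rule order_less_le_trans)
    then show "emeasure lebesgue (fst ` (O' \<inter> {(t, u t) | t. t \<in> {a..b}})) > 0" by (simp add: sh_def)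
  qed
  then show ?thesis using N by (auto simp: AE_lebesgue_on_iff_negligible)
qed

lemma bounded_variation_if_dominated:
  assumes dom: "\<And>s t. s \<le> t \<Longrightarrow> norm (p t - p s) \<le> h t - h s" and b: "\<And>t. \<bar>h t\<bar> \<le> (c::real)"
  shows "bounded_variation p"
  unfolding bounded_variation_def
proof (intro exI allI impI)
  fix k :: nat and r :: "nat \<Rightarrow> real" assume r: "mono_on {..k} r"
  have "(\<Sum>i<k. norm (p (r (Suc i)) - p (r i))) \<le> (\<Sum>i<k. h (r (Suc i)) - h (r i))"
    by (rule sum_mono, rule dom, rule mono_onD[OF r]) auto
  also have "\<dots> = h (r k) - h (r 0)" by (rule sum_lessThan_telescope)
  also have "\<dots> \<le> 2 * c" using b[of "r k"] b[of "r 0"] by linarith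
  finally show "(\<Sum>i<k. norm (p (r (Suc i)) - p (r i))) \<le> 2 * c" .
qed

lemma (in finite_borel_measure) measure_lessThan_at_left: "((\<lambda>s. measure M {..<s}) \<longlongrightarrow> measure M {..<t}) (at_left t)"
proof (rule tendsto_sandwich)
  \<comment> \<open>The point \<open>2 * s - t\<close> lies as far to the left of \<open>s\<close> as \<open>t\<close> lies to the right.\<close>
  have le: "cdf M (2 * s - t) \<le> measure M {..<s}" if "s < t" for s
    unfolding cdf_def by (rule finite_measure_mono) (use that in \<open>auto simp: M_is_borel\<close>)
  have ge: "measure M {..<s} \<le> cdf M s" for s
    unfolding cdf_def by (rule finite_measure_mono) (auto simp: M_is_borel)
  show "eventually (\<lambda>s. cdf M (2 * s - t) \<le> measure M {..<s}) (at_left t)"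
    using le by (auto simp: eventually_at_left_field intro!: exI[of _ "t - 1"])
  show "eventually (\<lambda>s. measure M {..<s} \<le> cdf M s) (at_left t)" using ge by simp
  show "(cdf M \<longlongrightarrow> measure M {..<t}) (at_left t)" by (rule cdf_at_left)
  have "filterlim (\<lambda>s. 2 * s - t) (at_left t) (at_left t)"
    unfolding filterlim_at
  proof
    have "((\<lambda>s. 2 * s - t) \<longlongrightarrow> 2 * t - t) (at_left t)" by (intro tendsto_intros)
    then show "((\<lambda>s. 2 * s - t) \<longlongrightarrow> t) (at_left t)" by simp
    show "eventually (\<lambda>s. 2 * s - t \<in> {..<t} \<and> 2 * s - t \<noteq> t) (at_left t)"
      by (auto simp: eventually_at_left_field intro!: exI[of _ "t - 1"])
  qed
  then show "((\<lambda>s. cdf M (2 * s - t)) \<longlongrightarrow> measure M {..<t}) (at_left t)"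
    by (rule filterlim_compose[OF cdf_at_left])
qed

lemma (in finite_borel_measure) measure_lessThan_at_right: "((\<lambda>s. measure M {..<s}) \<longlongrightarrow> measure M {..t}) (at_right t)"
proof (rule tendsto_sandwich)
  have le: "cdf M t \<le> measure M {..<s}" if "t < s" for s
    unfolding cdf_def by (rule finite_measure_mono) (use that in \<open>auto simp: M_is_borel\<close>)
  have ge: "measure M {..<s} \<le> cdf M s" for s
    unfolding cdf_def by (rule finite_measure_mono) (auto simp: M_is_borel)
  show "eventually (\<lambda>s. cdf M t \<le> measure M {..<s}) (at_right t)"
    using le by (auto simp: eventually_at_right_field intro!: exI[of _ "t + 1"])
  show "eventually (\<lambda>s. measure M {..<s} \<le> cdf M s) (at_right t)" using ge by simp
  show "((\<lambda>s. cdf M t) \<longlongrightarrow> measure M {..t}) (at_right t)" by (simp add: cdf_def)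
  show "(cdf M \<longlongrightarrow> measure M {..t}) (at_right t)"
    using cdf_is_right_cont[of t] by (simp add: continuous_within cdf_def)
qed

lemma integral_indicator_sums:
  fixes h :: "'a \<Rightarrow> 'b::{banach, second_countable_topology}"
  assumes h: "integrable M h" and A: "\<And>i::nat. A i \<in> sets M" "disjoint_family A"
  shows "(\<lambda>i. \<integral>x. indicator (A i) x *\<^sub>R h x \<partial>M) sums (\<integral>x. indicator (\<Union>i. A i) x *\<^sub>R h x \<partial>M)"
proof -
  have i: "integrable M (\<lambda>x. indicator S x *\<^sub>R h x)" if "S \<in> sets M" for S by (rule integrable_mult_indicator[OF that h])
  have part: "(\<Sum>i<n. \<integral>x. indicator (A i) x *\<^sub>R h x \<partial>M) = (\<integral>x. indicator (\<Union>i<n. A i) x *\<^sub>R h x \<partial>M)" for n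
  proof -
    have "(\<Sum>i<n. \<integral>x. indicator (A i) x *\<^sub>R h x \<partial>M) = (\<integral>x. (\<Sum>i<n. indicator (A i) x *\<^sub>R h x) \<partial>M)"
      by (rule Bochner_Integration.integral_sum[symmetric]) (rule i[OF A(1)])
    also have "\<dots> = (\<integral>x. indicator (\<Union>i<n. A i) x *\<^sub>R h x \<partial>M)"
    proof (rule Bochner_Integration.integral_cong[OF refl])
      fix x
      have "disjoint_family_on A {..<n}" using A(2) by (rule disjoint_family_on_mono[rotated]) simp
      then have "(\<Sum>i<n. indicator (A i) x :: real) = indicator (\<Union>i<n. A i) x"
        by (rule indicator_UN_disjoint[symmetric, rotated]) simp
      then show "(\<Sum>i<n. indicator (A i) x *\<^sub>R h x) = indicator (\<Union>i<n. A i) x *\<^sub>R h x"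
        by (simp add: scaleR_sum_left[symmetric])
    qed
    finally show ?thesis .
  qed
  have "(\<lambda>n. \<integral>x. indicator (\<Union>i<n. A i) x *\<^sub>R h x \<partial>M) \<longlonglongrightarrow> (\<integral>x. indicator (\<Union>i. A i) x *\<^sub>R h x \<partial>M)"
  proof (rule integral_dominated_convergence[where w = "\<lambda>x. norm (h x)"])
    show "AE x in M. (\<lambda>n. indicator (\<Union>i<n. A i) x *\<^sub>R h x) \<longlonglongrightarrow> indicator (\<Union>i. A i) x *\<^sub>R h x"
      by (intro AE_I2 tendsto_scaleR tendsto_const LIMSEQ_indicator_UN)
    show "AE x in M. norm (indicator (\<Union>i<n. A i) x *\<^sub>R h x) \<le> norm (h x)" for n by (auto simp: indicator_def)
    have "(\<Union>i. A i) \<in> sets M" "(\<Union>i<n. A i) \<in> sets M" for n using A(1) by auto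
    then show "(\<lambda>x. indicator (\<Union>i. A i) x *\<^sub>R h x) \<in> borel_measurable M"
      "(\<lambda>x. indicator (\<Union>i<n. A i) x *\<^sub>R h x) \<in> borel_measurable M" for n
      using i borel_measurable_integrable by blast+
  qed (use h in simp)
  then show ?thesis by (simp add: sums_def part)
qed

section \<open>Multipliers at a weak minimum\<close>

text \<open>The descent is constructed at a representative \<open>u\<close> that is bounded everywhere; its result is admissible and near the given
  process, as \<open>u\<close> and \<open>uh\<close> agree almost everywhere.\<close>

lemma weak_minimum_excludes_descent:
  fixes f :: "(real ^ 'n) \<times> (real ^ 'm) \<Rightarrow> real ^ 'n" and v :: "real \<Rightarrow> real ^ 'm"
  assumes ab: "a < b"
    and f: "\<And>z. (f has_derivative blinfun_apply (f' z)) (at z)" "continuous_on UNIV f'"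
    and G: "\<And>z. (G has_derivative blinfun_apply (G' z)) (at z)" "continuous_on UNIV G'"
    and J: "\<And>z. (J has_derivative blinfun_apply (J' z)) (at z)" "continuous_on UNIV J'"
    and wm: "weak_minimum a b J f G x uh"
    and x: "continuous_on {a..b} x" "\<And>t. t \<in> {a..b} \<Longrightarrow> x t = x a + integral {a..t} (\<lambda>s. f (x s, u s))"
    and u: "u \<in> borel_measurable (lebesgue_on {a..b})" "\<And>t. norm (u t) \<le> M" "AE t in lebesgue_on {a..b}. u t = uh t"
    and v: "v \<in> borel_measurable (lebesgue_on {a..b})" "\<And>t. norm (v t) \<le> 1"
    and y: "continuous_on {a..b} y"
      "\<And>t. t \<in> {a..b} \<Longrightarrow> y t = y a + integral {a..t} (\<lambda>s. f' (x s, u s) (y s, v s))"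
    and Jneg: "J' (x a, x b) (y a, y b) < 0"
    and c: "c > 0" and Gneg: "AE t in lebesgue_on {a..b}. G (x t, u t) + G' (x t, u t) (y t, v t) \<le> - c"
  shows False
proof -
  let ?L = "lebesgue_on {a..b}"
  obtain \<epsilon> where adm: "admissible a b f G x uh" and \<epsilon>: "\<epsilon> > 0" and opt: "\<And>xx uu. admissible a b f G xx uu \<Longrightarrow>
        ereal (C_norm a b (\<lambda>t. xx t - x t)) + Linf_norm ?L (\<lambda>t. uu t - uh t) < ereal \<epsilon> \<Longrightarrow> J (xx a, xx b) \<ge> J (x a, x b)"
    using wm unfolding weak_minimum_def by blast
  have uhm: "uh \<in> borel_measurable ?L" using adm by (simp add: admissible_def in_Linf_def)
  have Gle: "AE t in ?L. G (x t, u t) \<le> 0"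
    using adm u(3) unfolding admissible_def by (auto elim: eventually_elim2)
  obtain xx \<theta> where \<theta>: "0 < \<theta>" "\<theta> < \<epsilon> / 3" and xx: "continuous_on {a..b} xx"
    "\<And>t. t \<in> {a..b} \<Longrightarrow> xx t = xx a + integral {a..t} (\<lambda>s. f (xx s, u s + \<theta> *\<^sub>R v s))"
    "\<And>t. t \<in> {a..b} \<Longrightarrow> norm (xx t - x t) < \<epsilon> / 3"
    "AE t in ?L. G (xx t, u t + \<theta> *\<^sub>R v t) \<le> 0"
    "J (xx a, xx b) < J (x a, x b)"
  proof (rule feasible_descent_from_linearization[where \<epsilon> = "\<epsilon> / 3" and f = f and f' = f' and G = G and G' = G' and J = J and J' = J'
        and x = x and u = u and v = v and y = y and c = c and M = M, OF ab])
    show "0 < \<epsilon> / 3" using \<epsilon> by simp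
  qed (rule f G J x u(1,2) Gle v y Jneg c Gneg | assumption | blast)+
  define uu where "uu t = u t + \<theta> *\<^sub>R v t" for t
  have uum: "uu \<in> borel_measurable ?L" unfolding uu_def[abs_def] using u v by measurable
  have vth: "norm (\<theta> *\<^sub>R v t) \<le> \<theta>" for t using v(2)[of t] \<theta> mult_left_le[of "norm (v t)" \<theta>] by simp
  have uub: "norm (uu t) \<le> M + \<theta>" for t using norm_triangle_ineq[of "u t" "\<theta> *\<^sub>R v t"] u(2)[of t] vth[of t] by (simp add: uu_def)
  obtain X where X: "X \<ge> 0" "\<forall>t\<in>{a..b}. norm (xx t) \<le> X" using continuous_on_interval_bound[OF xx(1)] by auto
  have fcont: "continuous_on UNIV f" using f(1) has_derivative_continuous by (blast intro: continuous_at_imp_continuous_on)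
  have "compact (f ` cball 0 (X + (M + \<theta>)))" by (intro compact_continuous_image continuous_on_subset[OF fcont]) auto
  then have "bounded (f ` cball 0 (X + (M + \<theta>)))" by (rule compact_imp_bounded)
  then obtain Cf where "\<forall>y\<in>f ` cball 0 (X + (M + \<theta>)). norm y \<le> Cf" unfolding bounded_iff ..
  then have Cf: "norm (f z) \<le> Cf" if "norm z \<le> X + (M + \<theta>)" for z
    using that by auto
  have fb: "norm (f (xx t, uu t)) \<le> Cf" if "t \<in> {a..b}" for t
    by (rule Cf) (use norm_Pair_le[of "xx t" "uu t"] X(2) uub[of t] that in fastforce)
  have fm: "(\<lambda>t. f (xx t, uu t)) \<in> borel_measurable ?L"
    by (rule measurable_along_process[OF fcont continuous_on_interval_measurable[OF xx(1)] uum])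
  have fi: "(\<lambda>t. f (xx t, uu t)) integrable_on {a..b}" by (rule integrable_on_bounded[OF fm fb])
  have xxeq: "xx t = xx a + integral {a..t} (\<lambda>s. f (xx s, uu s))" if "t \<in> {a..b}" for t
    using xx(2)[OF that] by (simp add: uu_def)
  have "abs_continuous_on a b xx"
    by (rule lipschitz_imp_abs_continuous_on, rule indefinite_integral_lipschitz[OF fi fb xxeq]) auto
  moreover have "in_Linf ?L uu"
  proof -
    have "esssup ?L (\<lambda>t. ereal (norm (uu t))) \<le> ereal (M + \<theta>)" by (rule esssup_I) (use uum uub in auto)
    then show ?thesis using uum by (auto simp: in_Linf_def Linf_norm_def intro: order.strict_trans1)
  qed
  moreover have "AE t in ?L. (xx has_vector_derivative f (xx t, uu t)) (at t within {a..b}) \<and> G (xx t, uu t) \<le> 0"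
  proof -
    obtain N where N: "negligible N" "\<And>t. t \<in> {a..b} - N \<Longrightarrow>
        ((\<lambda>t. integral {a..t} (\<lambda>s. f (xx s, uu s))) has_vector_derivative f (xx t, uu t)) (at t within {a..b})"
      using indefinite_integral_has_vector_derivative[OF fi] by blast
    have "(xx has_vector_derivative f (xx t, uu t)) (at t within {a..b})" if t: "t \<in> {a..b} - N" for t
    proof (rule has_vector_derivative_transform)
      show "((\<lambda>t. xx a + integral {a..t} (\<lambda>s. f (xx s, uu s))) has_vector_derivative f (xx t, uu t)) (at t within {a..b})"
        using N(2)[OF t] by (auto intro!: derivative_eq_intros)
    qed (use t xxeq in blast)+
    then have "AE t in ?L. (xx has_vector_derivative f (xx t, uu t)) (at t within {a..b})"
      using N(1) by (auto simp: AE_lebesgue_on_iff_negligible)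
    with xx(4) show ?thesis by eventually_elim (simp add: uu_def)
  qed
  ultimately have "admissible a b f G xx uu" by (simp add: admissible_def)
  moreover have "ereal (C_norm a b (\<lambda>t. xx t - x t)) + Linf_norm ?L (\<lambda>t. uu t - uh t) < ereal \<epsilon>"
  proof -
    have "C_norm a b (\<lambda>t. xx t - x t) \<le> \<epsilon> / 3"
      unfolding C_norm_def by (rule cSUP_least) (use ab xx(3) in \<open>auto intro: less_imp_le\<close>)
    moreover have "Linf_norm ?L (\<lambda>t. uu t - uh t) \<le> ereal (\<epsilon> / 3)"
      unfolding Linf_norm_def
    proof (rule esssup_I)
      show "(\<lambda>t. ereal (norm (uu t - uh t))) \<in> borel_measurable ?L" using uum uhm by measurable
      show "AE t in ?L. ereal (norm (uu t - uh t)) \<le> ereal (\<epsilon> / 3)"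
        using u(3)
      proof eventually_elim
        case (elim t)
        then show ?case using vth[of t] \<theta> by (simp add: uu_def del: norm_scaleR)
      qed
    qed
    ultimately have "ereal (C_norm a b (\<lambda>t. xx t - x t)) + Linf_norm ?L (\<lambda>t. uu t - uh t) \<le> ereal (\<epsilon> / 3) + ereal (\<epsilon> / 3)"
      by (intro add_mono) auto
    also have "\<dots> < ereal \<epsilon>" using \<epsilon> by simp
    finally show ?thesis .
  qed
  ultimately have "J (xx a, xx b) \<ge> J (x a, x b)" by (rule opt)
  then show False using xx(5) by simp
qed

lemma bounded_representative:
  fixes uh :: "real \<Rightarrow> 'b::euclidean_space"
  assumes "in_Linf (lebesgue_on {a..b}) uh"
  obtains u M where "u \<in> borel_measurable (lebesgue_on {a..b})" "M \<ge> 0" "\<And>t. norm (u t) \<le> M"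
    "AE t in lebesgue_on {a..b}. u t = uh t"
proof -
  let ?L = "lebesgue_on {a..b}"
  have m: "uh \<in> borel_measurable ?L" and fin: "Linf_norm ?L uh < \<infinity>" using assms by (auto simp: in_Linf_def)
  obtain M where M: "AE t in ?L. norm (uh t) \<le> M"
  proof (cases "Linf_norm ?L uh")
    case (real r)
    then have "AE t in ?L. norm (uh t) \<le> r"
      using esssup_AE[of "\<lambda>t. ereal (norm (uh t))" ?L] by (simp add: Linf_norm_def)
    then show ?thesis using that by blast
  next
    case PInf
    then show ?thesis using fin by simp
  next
    case MInf
    then have "AE t in ?L. norm (uh t) \<le> 0"
      using esssup_AE[of "\<lambda>t. ereal (norm (uh t))" ?L] by (auto simp: Linf_norm_def elim: eventually_mono)
    then show ?thesis using that by blast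
  qed
  define u where "u t = (if norm (uh t) \<le> M then uh t else 0)" for t
  show ?thesis
  proof
    show "u \<in> borel_measurable ?L" unfolding u_def[abs_def] using m by measurable
    show "\<bar>M\<bar> \<ge> 0" "norm (u t) \<le> \<bar>M\<bar>" for t by (auto simp: u_def)
    show "AE t in ?L. u t = uh t" using M by eventually_elim (simp add: u_def)
  qed
qed

lemma admissible_trajectory_integral:
  fixes x :: "real \<Rightarrow> real ^ 'n" and uh :: "real \<Rightarrow> real ^ 'm"
  assumes adm: "admissible a b f G x uh" and u: "AE t in lebesgue_on {a..b}. u t = uh t" and t: "t \<in> {a..b}"
  shows "x t = x a + integral {a..t} (\<lambda>s. f (x s, u s))"
proof -
  have "AE t in lebesgue_on {a..b}. (x has_vector_derivative f (x t, u t)) (at t within {a..b})"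
    using adm u unfolding admissible_def by (auto elim: eventually_elim2)
  then obtain N where N: "negligible N" "\<forall>t\<in>{a..b} - N. (x has_vector_derivative f (x t, u t)) (at t within {a..b})"
    by (auto simp: AE_lebesgue_on_iff_negligible)
  have "((\<lambda>s. f (x s, u s)) has_integral x t - x a) {a..t}"
  proof (rule abs_continuous_has_integral[OF _ _ N(1)])
    show "abs_continuous_on a t x" using adm t by (auto simp: admissible_def intro: abs_continuous_on_subinterval)
    show "(x has_vector_derivative f (x s, u s)) (at s within {a..t})" if "s \<in> {a..t} - N" for s
      by (rule has_vector_derivative_within_subset[of _ _ _ "{a..b}"]) (use N(2) that t in auto)
  qed (use t in auto)
  then show ?thesis by (simp add: integral_unique)
qed

lemma set_integral_lebesgue_on:
  fixes h :: "real \<Rightarrow> 'c::euclidean_space"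
  assumes "B \<subseteq> {a..b}"
  shows "(LINT t:B|lebesgue. h t) = (\<integral>t. indicator B t *\<^sub>R h t \<partial>lebesgue_on {a..b})"
  unfolding set_lebesgue_integral_def
  by (subst integral_restrict_space) (use assms in \<open>auto intro!: Bochner_Integration.integral_cong simp: indicator_def\<close>)

context linear_system
begin

text \<open>The adjoint variable is an absolutely continuous function plus the vector measure of \<open>{t..}\<close> plus a constant. Its
  variation is dominated by \<open>y\<close> being Lipschitz and by the measures \<open>\<mu>0\<close> and \<open>\<mu> i\<close>; clamping the argument of \<open>y\<close> and the
  vanishing of the measures outside \<open>{a..b}\<close> make it constant on both sides of the interval, with the jumps at the
  endpoints given by the atoms there.\<close>

lemma adjoint_bounded_variation:
  assumes p: "p \<in> borel_measurable borel" "bounded (range p)"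
    and y: "continuous_on {a..b} y" "\<And>t. t \<in> {a..b} \<Longrightarrow> y t = integral {t..b} (\<lambda>s. AT s (p s))"
    and p_form: "\<And>t. p t = y (max a (min b t)) + (\<Sum>i\<in>Basis. ((measure (\<mu> i) UNIV - measure (\<mu> i) {..<t}) - K * (measure \<mu>0 UNIV - measure \<mu>0 {..<t})) *\<^sub>R i) + \<alpha> *\<^sub>R j1"
    and fin: "finite_borel_measure \<mu>0" "\<And>i. i \<in> Basis \<Longrightarrow> finite_borel_measure (\<mu> i)"
    and out: "measure \<mu>0 (- {a..b}) = 0" "\<And>i. i \<in> Basis \<Longrightarrow> measure (\<mu> i) (- {a..b}) = 0"
    and lam: "integrable L lam" and \<eta>: "finite_borel_measure \<eta>" and s: "integrable \<eta> s"
    and vec: "\<And>S. S \<in> sets borel \<Longrightarrow> (\<Sum>i\<in>Basis. (measure (\<mu> i) S - K * measure \<mu>0 S) *\<^sub>R i) =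
        (\<integral>t. indicator S t *\<^sub>R (lam t *\<^sub>R gx t) \<partial>L) + (\<integral>t. indicator S t *\<^sub>R s t \<partial>\<eta>)"
  shows "BV a b p" and "left_lim p t = p t" and "right_lim p b = \<alpha> *\<^sub>R j1"
    and "S \<in> borel_subsets a b \<Longrightarrow> - BV_measure a b p S = (\<integral>t. indicator S t *\<^sub>R AT t (p t) \<partial>L)
      + (\<integral>t. indicator S t *\<^sub>R (lam t *\<^sub>R gx t) \<partial>L) + (\<integral>t. indicator S t *\<^sub>R s t \<partial>\<eta>)"
proof -
  interpret e: finite_borel_measure \<eta> by (rule \<eta>)
  define V where "V S = (\<Sum>i\<in>(Basis :: 'a set). (measure (\<mu> i) S - K * measure \<mu>0 S) *\<^sub>R i)" for S
  define cl where "cl t = max a (min b t)" for t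
  have clI: "cl t \<in> {a..b}" for t using ab by (auto simp: cl_def)
  have cl_id: "cl t = t" if "t \<in> {a..b}" for t using that by (simp add: cl_def min_absorb2 max_absorb2)
  have p_eq: "p t = y (cl t) + (V UNIV - V {..<t}) + \<alpha> *\<^sub>R j1" for t
    unfolding p_form V_def cl_def sum_subtractf[symmetric] by (simp add: algebra_simps)
  obtain Bp where Bp: "\<And>t. norm (p t) \<le> Bp" using p(2) unfolding bounded_iff by blast
  have Bp0: "Bp \<ge> 0" using Bp[of a] norm_ge_zero order_trans by blast
  have pL: "p \<in> borel_measurable L"
    using p(1) by (intro measurable_restrict_space1 measurable_completion) simp
  have ATm: "(\<lambda>t. AT t (p t)) \<in> borel_measurable L" by (rule AT_comp_measurable[OF pL])
  have ATb: "norm (AT t (p t)) \<le> K * Bp" if "t \<in> {a..b}" for t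
    using AT_bound[OF that, of "p t"] mult_left_mono[OF Bp[of t] K_nonneg] by linarith
  have ATi: "integrable L (\<lambda>t. AT t (p t))" "(\<lambda>t. AT t (p t)) integrable_on {a..b}"
    by (rule integrable_lebesgue_on_bounded[OF ATm ATb], simp, rule integrable_on_bounded[OF ATm ATb], simp)
  have ydiff: "y c - y d = integral {c..d} (\<lambda>s. AT s (p s))" if "a \<le> c" "c \<le> d" "d \<le> b" for c d
  proof -
    have "(\<lambda>s. AT s (p s)) integrable_on {c..b}" using integrable_on_subinterval[OF ATi(2), of c b] that by auto
    from Henstock_Kurzweil_Integration.integral_combine[OF that(2,3) this] show ?thesis
      using y(2)[of c] y(2)[of d] that by (simp add: algebra_simps)
  qed
  have ylip: "norm (y d - y c) \<le> K * Bp * (d - c)" if cd: "a \<le> c" "c \<le> d" "d \<le> b" for c d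
  proof -
    have "((\<lambda>s. AT s (p s)) has_integral (y c - y d)) {c..d}"
      using ydiff[OF cd] integrable_on_subinterval[OF ATi(2), of c d] cd by (simp add: has_integral_iff)
    from has_integral_bound_real[where S = "{}", OF _ _ this] show ?thesis
      using ATb cd K_nonneg Bp0 by (simp add: norm_minus_commute)
  qed
  have mono_m: "measure M {..<c} \<le> measure M {..<d}" if "finite_borel_measure M" "c \<le> d" for M c d
  proof -
    interpret M: finite_borel_measure M by (rule that(1))
    show ?thesis by (rule M.finite_measure_mono) (use that in \<open>auto simp: M.M_is_borel\<close>)
  qed
  have le_m: "measure M {..<c} \<le> measure M UNIV" if "finite_borel_measure M" for M c
  proof -
    interpret M: finite_borel_measure M by (rule that)
    show ?thesis by (rule M.finite_measure_mono) (auto simp: M.M_is_borel)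
  qed
  have bv: "bounded_variation p"
  proof (rule bounded_variation_if_dominated)
    define h where "h t = K * Bp * cl t + (\<Sum>i\<in>(Basis :: 'a set). measure (\<mu> i) {..<t} + K * measure \<mu>0 {..<t})" for t
    show "norm (p d - p c) \<le> h d - h c" if cd: "c \<le> d" for c d
    proof -
      have "cl c \<le> cl d" using cd by (auto simp: cl_def)
      then have 1: "norm (y (cl d) - y (cl c)) \<le> K * Bp * (cl d - cl c)" using ylip clI[of c] clI[of d] by auto
      have "V {..<d} - V {..<c} = (\<Sum>i\<in>Basis. ((measure (\<mu> i) {..<d} - measure (\<mu> i) {..<c}) - K * (measure \<mu>0 {..<d} - measure \<mu>0 {..<c})) *\<^sub>R i)"
        unfolding V_def sum_subtractf[symmetric] by (rule sum.cong) (auto simp: algebra_simps)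
      also have "norm \<dots> \<le> (\<Sum>i\<in>(Basis :: 'a set). (measure (\<mu> i) {..<d} - measure (\<mu> i) {..<c}) + K * (measure \<mu>0 {..<d} - measure \<mu>0 {..<c}))"
      proof (rule sum_norm_le)
        fix i :: "'a" assume i: "i \<in> Basis"
        have "0 \<le> K * (measure \<mu>0 {..<d} - measure \<mu>0 {..<c})" using mono_m[OF fin(1) cd] K_nonneg by simp
        then show "norm (((measure (\<mu> i) {..<d} - measure (\<mu> i) {..<c}) - K * (measure \<mu>0 {..<d} - measure \<mu>0 {..<c})) *\<^sub>R i)
          \<le> (measure (\<mu> i) {..<d} - measure (\<mu> i) {..<c}) + K * (measure \<mu>0 {..<d} - measure \<mu>0 {..<c})"
          using mono_m[OF fin(2)[OF i] cd] i by (simp add: abs_le_iff)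
      qed
      also have "\<dots> = (\<Sum>i\<in>(Basis :: 'a set). measure (\<mu> i) {..<d} + K * measure \<mu>0 {..<d}) - (\<Sum>i\<in>(Basis :: 'a set). measure (\<mu> i) {..<c} + K * measure \<mu>0 {..<c})"
        unfolding sum_subtractf[symmetric] by (rule sum.cong) (auto simp: algebra_simps)
      finally have 2: "norm (V {..<d} - V {..<c}) \<le> \<dots>" .
      have "p d - p c = (y (cl d) - y (cl c)) - (V {..<d} - V {..<c})" by (simp add: p_eq)
      then have "norm (p d - p c) \<le> norm (y (cl d) - y (cl c)) + norm (V {..<d} - V {..<c})" by (simp add: norm_triangle_ineq4)
      then show ?thesis using 1 2 by (simp add: h_def algebra_simps)
    qed
    show "\<bar>h t\<bar> \<le> K * Bp * (\<bar>a\<bar> + \<bar>b\<bar>) + (\<Sum>i\<in>(Basis :: 'a set). measure (\<mu> i) UNIV + K * measure \<mu>0 UNIV)" for t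
    proof -
      have "\<bar>cl t\<bar> \<le> \<bar>a\<bar> + \<bar>b\<bar>" using clI[of t] by auto
      then have 1: "\<bar>K * Bp * cl t\<bar> \<le> K * Bp * (\<bar>a\<bar> + \<bar>b\<bar>)"
        using K_nonneg Bp0 by (simp add: abs_mult mult_left_mono)
      have "\<bar>\<Sum>i\<in>(Basis :: 'a set). measure (\<mu> i) {..<t} + K * measure \<mu>0 {..<t}\<bar> \<le> (\<Sum>i\<in>(Basis :: 'a set). measure (\<mu> i) UNIV + K * measure \<mu>0 UNIV)"
      proof (rule order_trans[OF sum_abs sum_mono])
        fix i :: "'a" assume i: "i \<in> Basis"
        show "\<bar>measure (\<mu> i) {..<t} + K * measure \<mu>0 {..<t}\<bar> \<le> measure (\<mu> i) UNIV + K * measure \<mu>0 UNIV"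
          using le_m[OF fin(2)[OF i], of t] mult_left_mono[OF le_m[OF fin(1), of t] K_nonneg] K_nonneg by simp
      qed
      then show ?thesis using 1 unfolding h_def by linarith
    qed
  qed
  have cl_cont: "continuous_on UNIV (\<lambda>t. y (cl t))"
    by (rule continuous_on_compose2[OF y(1)]) (use clI in \<open>auto simp: cl_def intro!: continuous_intros\<close>)
  have ylim: "((\<lambda>t. y (cl t)) \<longlongrightarrow> y (cl t)) (at t within S)" for t S
    using cl_cont by (simp add: continuous_on_def) (meson tendsto_within_subset subset_UNIV)
  have pleft: "(p \<longlongrightarrow> p t) (at_left t)" for t
    unfolding p_eq[abs_def] V_def
    by (intro tendsto_intros ylim finite_borel_measure.measure_lessThan_at_left fin)
  define pr where "pr t = y (cl t) + (V UNIV - V {..t}) + \<alpha> *\<^sub>R j1" for t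
  have pright: "(p \<longlongrightarrow> pr t) (at_right t)" for t
    unfolding p_eq[abs_def] V_def pr_def
    by (intro tendsto_intros ylim finite_borel_measure.measure_lessThan_at_right fin)
  have ll: "left_lim p t = p t" for t unfolding left_lim_def by (rule tendsto_Lim[OF _ pleft]) simp
  have rl: "right_lim p t = pr t" for t unfolding right_lim_def by (rule tendsto_Lim[OF _ pright]) simp
  have V0: "V S = 0" if "S \<in> sets borel" "S \<subseteq> - {a..b}" for S
  proof -
    have "measure M S = 0" if "finite_borel_measure M" "measure M (- {a..b}) = 0" for M
    proof -
      interpret M: finite_borel_measure M by (rule that(1))
      have "measure M S \<le> measure M (- {a..b})"
        by (rule M.finite_measure_mono) (use \<open>S \<subseteq> - {a..b}\<close> in \<open>auto simp: M.M_is_borel\<close>)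
      then show ?thesis using that(2) measure_nonneg[of M S] by linarith
    qed
    then show ?thesis using fin out by (simp add: V_def)
  qed
  have Vadd: "V (S \<union> T) = V S + V T" if ST: "S \<in> sets borel" "T \<in> sets borel" "S \<inter> T = {}" for S T
  proof -
    have "measure M (S \<union> T) = measure M S + measure M T" if "finite_borel_measure M" for M
    proof -
      interpret M: finite_borel_measure M by (rule that)
      show ?thesis by (rule M.finite_measure_Union) (use ST in \<open>auto simp: M.M_is_borel\<close>)
    qed
    then show ?thesis using fin unfolding V_def sum.distrib[symmetric] by (intro sum.cong) (auto simp: algebra_simps)
  qed
  have Vend: "V {..<t} = V UNIV" "V {..b} = V UNIV" if "b < t" for t
  proof -
    have "V {t..} = 0" "V {b<..} = 0" by (rule V0, use that in auto)+
    then have *: "V ({..<t} \<union> {t..}) = V {..<t}" "V ({..b} \<union> {b<..}) = V {..b}"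
      by (subst Vadd; auto)+
    have "{..<t} \<union> {t..} = UNIV" "{..b} \<union> {b<..} = UNIV" by auto
    with * show "V {..<t} = V UNIV" "V {..b} = V UNIV" by simp_all
  qed
  have BVp: "BV a b p"
    unfolding BV_def
  proof (intro conjI allI impI bv)
    show "continuous (at_left t) p" for t using pleft by (simp add: continuous_within)
    show "p t = p a" if "t \<le> a" for t
    proof -
      have "cl t = cl a" using that ab by (simp add: cl_def)
      moreover have "V {..<t} = 0" "V {..<a} = 0" by (rule V0, use that in auto)+
      ultimately show ?thesis by (simp add: p_eq)
    qed
    show "\<exists>c. \<forall>t>b. p t = c"
    proof (intro exI allI impI)
      fix t assume t: "b < t"
      then have "cl t = b" using ab by (simp add: cl_def)
      then show "p t = y b + \<alpha> *\<^sub>R j1" using Vend[OF t] by (simp add: p_eq)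
    qed
  qed

  \<comment> \<open>Since a vector measure is determined by its values on closed intervals, \<open>\<rho>\<close> need only be compared with \<open>p\<close> there.\<close>
  have lamg: "integrable L (\<lambda>t. lam t *\<^sub>R gx t)"
  proof (rule Bochner_Integration.integrable_bound[where f = "\<lambda>t. K * lam t"])
    show "AE t in L. norm (lam t *\<^sub>R gx t) \<le> norm (K * lam t)"
    proof (rule AE_I2)
      fix t assume "t \<in> space L"
      then have "\<bar>lam t\<bar> * norm (gx t) \<le> \<bar>lam t\<bar> * K" by (intro mult_left_mono gx_bound) auto
      then show "norm (lam t *\<^sub>R gx t) \<le> norm (K * lam t)" using K_nonneg by (simp add: abs_mult mult.commute)
    qed
  qed (use lam in auto)
  define \<rho> where "\<rho> B = (if B \<in> borel_subsets a b then - ((\<integral>t. indicator B t *\<^sub>R AT t (p t) \<partial>L)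
      + (\<integral>t. indicator B t *\<^sub>R (lam t *\<^sub>R gx t) \<partial>L) + (\<integral>t. indicator B t *\<^sub>R s t \<partial>\<eta>)) else 0)" for B
  have dp: "BV_measure a b p = \<rho>"
  proof (rule BV_measure_eq)
    show "vector_measure a b \<rho>"
      unfolding vector_measure_def
    proof (intro conjI allI impI)
      fix A :: "nat \<Rightarrow> real set" assume A: "range A \<subseteq> borel_subsets a b \<and> disjoint_family A"
      then have Ab: "A i \<in> sets borel" "A i \<subseteq> {a..b}" for i by (auto simp: borel_subsets_def)
      then have U: "(\<Union>i. A i) \<in> borel_subsets a b" "A i \<in> borel_subsets a b" for i by (auto simp: borel_subsets_def)
      have AL: "A i \<in> sets L" for i
        using Ab[of i] by (auto simp: sets_restrict_space_iff intro: sets_completionI_sets)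
      show "(\<lambda>i. \<rho> (A i)) sums \<rho> (\<Union>i. A i)"
        unfolding \<rho>_def if_P[OF U(1)] if_P[OF U(2)]
        by (intro sums_minus sums_add integral_indicator_sums ATi(1) lamg s AL) (use A Ab in \<open>auto simp: e.M_is_borel\<close>)
    qed (simp add: \<rho>_def)
    fix c d assume cd: "a \<le> c" "c \<le> d" "d \<le> b"
    have B: "{c..d} \<in> borel_subsets a b" using cd by (auto simp: borel_subsets_def)
    have "(\<integral>t. indicator {c..d} t *\<^sub>R AT t (p t) \<partial>L) = integral {a..b} (\<lambda>t. indicator {c..d} t *\<^sub>R AT t (p t))"
      by (rule lebesgue_integral_eq_integral[OF integrable_indicator_lebesgue_on[OF ATi(1)]]) auto
    also have "\<dots> = integral {a..b} (\<lambda>t. if t \<in> {c..d} then AT t (p t) else 0)" by (rule integral_cong) auto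
    also have "\<dots> = integral ({c..d} \<inter> {a..b}) (\<lambda>t. AT t (p t))" by (rule Henstock_Kurzweil_Integration.integral_restrict_Int)
    also have "{c..d} \<inter> {a..b} = {c..d}" using cd by auto
    also have "integral {c..d} (\<lambda>t. AT t (p t)) = y c - y d" using ydiff[OF cd] by simp
    finally have "\<rho> {c..d} = - ((y c - y d) + V {c..d})"
      unfolding \<rho>_def if_P[OF B] V_def using vec[of "{c..d}"] by simp
    moreover have "V {..d} = V {..<c} + V {c..d}"
    proof -
      have "{..d} = {..<c} \<union> {c..d}" using cd by auto
      moreover have "V ({..<c} \<union> {c..d}) = V {..<c} + V {c..d}" by (rule Vadd) auto
      ultimately show ?thesis by simp
    qed
    ultimately show "\<rho> {c..d} = right_lim p d - left_lim p c"
      unfolding ll rl pr_def p_eq using cl_id[of c] cl_id[of d] cd by (simp add: algebra_simps)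
  qed
  show "BV a b p" by (rule BVp)
  show "left_lim p t = p t" by (rule ll)
  show "right_lim p b = \<alpha> *\<^sub>R j1"
    using y(2)[of b] ab Vend(2)[of "b + 1"] cl_id[of b] unfolding rl pr_def by simp
  show "- BV_measure a b p S = (\<integral>t. indicator S t *\<^sub>R AT t (p t) \<partial>L)
      + (\<integral>t. indicator S t *\<^sub>R (lam t *\<^sub>R gx t) \<partial>L) + (\<integral>t. indicator S t *\<^sub>R s t \<partial>\<eta>)" if "S \<in> borel_subsets a b"
    unfolding dp \<rho>_def if_P[OF that] by simp
qed

end

text \<open>The points of \<open>\<Gamma>\<close> over \<open>{s0..s1}\<close> that violate the bound form a compact set, on which \<open>m\<close> is positive and therefore
  bounded below by some \<open>\<delta> > 0\<close>.\<close>

lemma affine_bound_near_zeros: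
  fixes P :: "real \<times> 'c::euclidean_space \<Rightarrow> 'a::euclidean_space" and m :: "real \<times> 'c \<Rightarrow> real"
  assumes \<Gamma>: "compact \<Gamma>" and P: "continuous_on \<Gamma> P" and m: "continuous_on \<Gamma> m" "\<And>w. w \<in> \<Gamma> \<Longrightarrow> 0 \<le> m w"
    and u: "AE t in M. (t, u t) \<in> \<Gamma>"
    and less: "\<And>w. w \<in> \<Gamma> \<Longrightarrow> m w = 0 \<Longrightarrow> s0 \<le> fst w \<Longrightarrow> fst w \<le> s1 \<Longrightarrow> q \<bullet> P w < r"
  shows "\<exists>\<delta>>0. AE t in M. s0 \<le> t \<and> t \<le> s1 \<and> m (t, u t) < \<delta> \<longrightarrow> q \<bullet> P (t, u t) \<le> r"
proof -
  define E where "E = {w\<in>\<Gamma>. q \<bullet> P w \<in> {r..}} \<inter> {w\<in>\<Gamma>. fst w \<in> {s0..s1}}"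
  have cut: "compact {w\<in>\<Gamma>. h w \<in> S}" if "continuous_on \<Gamma> h" "closed S" for h :: "real \<times> 'c \<Rightarrow> real" and S
  proof -
    have "compact (\<Gamma> \<inter> h -` S)" using closedin_compact[OF \<Gamma> continuous_closedin_preimage[OF that]] .
    moreover have "\<Gamma> \<inter> h -` S = {w\<in>\<Gamma>. h w \<in> S}" by auto
    ultimately show ?thesis by simp
  qed
  have E: "compact E" unfolding E_def
    by (intro compact_Int cut continuous_intros P closed_atLeast closed_atLeastAtMost)
  have "\<exists>\<delta>>0. \<forall>w\<in>E. \<delta> \<le> m w"
  proof (cases "E = {}")
    case True
    then show ?thesis by (intro exI[of _ 1]) simp
  next
    case False
    have "continuous_on E m" by (rule continuous_on_subset[OF m(1)]) (auto simp: E_def)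
    then obtain w0 where w0: "w0 \<in> E" "\<forall>w\<in>E. m w0 \<le> m w" using continuous_attains_inf[OF E False] by blast
    have "m w0 \<noteq> 0" using w0(1) less[of w0] by (fastforce simp: E_def)
    then have "m w0 > 0" using m(2)[of w0] w0(1) by (auto simp: E_def less_le)
    then show ?thesis using w0(2) by blast
  qed
  then obtain \<delta> where \<delta>: "\<delta> > 0" "\<forall>w\<in>E. \<delta> \<le> m w" by blast
  have "AE t in M. s0 \<le> t \<and> t \<le> s1 \<and> m (t, u t) < \<delta> \<longrightarrow> q \<bullet> P (t, u t) \<le> r"
    using u by eventually_elim (use \<delta>(2) in \<open>force simp: E_def\<close>)
  then show ?thesis using \<delta>(1) by blast
qed

theorem theorem3:
  fixes t0 t1 :: real
    and J :: "(real ^ 'n) \<times> (real ^ 'n) \<Rightarrow> real"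
    and f :: "(real ^ 'n) \<times> (real ^ 'm) \<Rightarrow> real ^ 'n"
    and G :: "(real ^ 'n) \<times> (real ^ 'm) \<Rightarrow> real"
    and xh :: "real \<Rightarrow> real ^ 'n"
    and uh :: "real \<Rightarrow> real ^ 'm"
  assumes "t0 < t1"
    and "cont_differentiable J" and "cont_differentiable f" and "cont_differentiable G"
    and "phase_points G \<noteq> {}"
    and "weak_minimum t0 t1 J f G xh uh"
  shows "\<exists>(\<alpha>0 :: real) (p :: real \<Rightarrow> real ^ 'n) (lam :: real \<Rightarrow> real) (\<eta> :: real measure)
            (s :: real \<Rightarrow> real ^ 'n).
      BV t0 t1 p \<and>
      integrable (lebesgue_on {t0..t1}) lam \<and>
      nonneg_radon_on t0 t1 \<eta> \<and>
      in_Linf (completion \<eta>) s \<and>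
      \<comment> \<open>sign conditions and complementary slackness\<close>
      \<alpha>0 \<ge> 0 \<and>
      (AE t in lebesgue_on {t0..t1}. lam t \<ge> 0 \<and> lam t * G (xh t, uh t) = 0) \<and>
      density \<eta> (indicator (phase_times t0 t1 G xh uh)) = \<eta> \<and>
      \<comment> \<open>nontriviality\<close>
      \<alpha>0 + (\<integral>t. \<bar>lam t\<bar> \<partial>lebesgue_on {t0..t1}) + measure \<eta> {t0..t1} > 0 \<and>
      \<comment> \<open>inclusion for the density of the singular part\<close>
      (\<exists>R \<in> sets (completion \<eta>). R \<subseteq> phase_times t0 t1 G xh uh \<and>
         measure (completion \<eta>) R = measure \<eta> {t0..t1} \<and>
         (\<forall>t\<in>R. s t \<in> convex hull phase_gradients G (clm_process_at t0 t1 xh uh t))) \<and>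
      \<comment> \<open>adjoint equation\<close>
      (\<forall>B \<in> borel_subsets t0 t1.
         - BV_measure t0 t1 p B =
             (LINT t:B|lebesgue. grad_1 (pontryagin f (p t)) (xh t, uh t)) +
             (LINT t:B|lebesgue. lam t *\<^sub>R grad_1 G (xh t, uh t)) +
             (LINT t:B|completion \<eta>. s t)) \<and>
      \<comment> \<open>transversality\<close>
      - left_lim p t0 = \<alpha>0 *\<^sub>R grad_1 J (xh t0, xh t1) \<and>
      right_lim p t1 = \<alpha>0 *\<^sub>R grad_2 J (xh t0, xh t1) \<and>
      \<comment> \<open>stationarity in the control\<close>
      (AE t in lebesgue_on {t0..t1}.
         grad_2 (pontryagin f (p t)) (xh t, uh t) + lam t *\<^sub>R grad_2 G (xh t, uh t) = 0)"
proof -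
  let ?L = "lebesgue_on {t0..t1}"
  note ab = assms(1)
  obtain f' where f: "\<And>z. (f has_derivative blinfun_apply (f' z)) (at z)" "continuous_on UNIV f'"
    using assms(3) unfolding cont_differentiable_def by blast
  obtain G' where G: "\<And>z. (G has_derivative blinfun_apply (G' z)) (at z)" "continuous_on UNIV G'"
    using assms(4) unfolding cont_differentiable_def by blast
  obtain J' where J: "\<And>z. (J has_derivative blinfun_apply (J' z)) (at z)" "continuous_on UNIV J'"
    using assms(2) unfolding cont_differentiable_def by blast
  have adm: "admissible t0 t1 f G xh uh" using assms(6) by (simp add: weak_minimum_def)
  obtain u M where u: "u \<in> borel_measurable ?L" "\<And>t. norm (u t) \<le> M" and M0: "M \<ge> 0" and u_eq: "AE t in ?L. u t = uh t"
  proof (rule bounded_representative)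
    show "in_Linf ?L uh" using adm by (simp add: admissible_def)
  qed blast
  have uhm: "uh \<in> borel_measurable ?L" using adm by (simp add: admissible_def in_Linf_def)
  have "abs_continuous_on t0 t1 xh" using adm by (simp add: admissible_def)
  then have x: "continuous_on {t0..t1} xh" "\<And>t. t \<in> {t0..t1} \<Longrightarrow> xh t = xh t0 + integral {t0..t} (\<lambda>s. f (xh s, u s))"
    by (auto intro: abs_continuous_on_imp_continuous_on admissible_trajectory_integral[OF adm u_eq])
  have xm: "xh \<in> borel_measurable ?L" by (rule continuous_on_interval_measurable[OF x(1)])
  obtain X where X: "X \<ge> 0" "\<forall>t\<in>{t0..t1}. norm (xh t) \<le> X" using continuous_on_interval_bound[OF x(1)] by auto
  define R where "R = X + M"
  have zR: "norm (xh t, u t) \<le> R" if "t \<in> {t0..t1}" for t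
    using norm_Pair_le[of "xh t" "u t"] X(2) u(2)[of t] that by (fastforce simp: R_def)
  have R0: "R \<ge> 0" using X M0 by (simp add: R_def)
  obtain Lf where Lf: "Lf \<ge> 0" "\<And>z. norm z \<le> R \<Longrightarrow> norm (f' z) \<le> Lf"
    using C1_lipschitz_on_ball[where R = R, OF f] by metis
  obtain Lg where Lg: "Lg \<ge> 0" "\<And>z. norm z \<le> R \<Longrightarrow> norm (G' z) \<le> Lg"
    "\<And>z w. norm z \<le> R \<Longrightarrow> norm w \<le> R \<Longrightarrow> norm (G z - G w) \<le> Lg * norm (z - w)"
    using C1_lipschitz_on_ball[where R = R, OF G] by metis
  define K where "K = Lf + Lg + \<bar>G 0\<bar> + Lg * R"
  have K: "Lf \<le> K" "Lg \<le> K" "\<bar>G 0\<bar> + Lg * R \<le> K" using Lf(1) Lg(1) R0 by (auto simp: K_def)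
  have Gcont: "continuous_on UNIV G" using G(1) has_derivative_continuous by (blast intro: continuous_at_imp_continuous_on)
  have f'm: "(\<lambda>t. f' (xh t, u t) d) \<in> borel_measurable ?L" for d
    by (rule measurable_derivative_along_process[OF f(2) xm u(1)]) simp
  have p1: "continuous_on UNIV (\<lambda>z. partial1 G' z 1)" "continuous_on UNIV (\<lambda>z. partial2 G' z 1)"
    by (intro continuous_partial G continuous_intros)+
  define \<xi> where "\<xi> = (xh t0, xh t1)"
  interpret linear_system t0 t1 K "\<lambda>t y. f' (xh t, u t) (y, 0)" "\<lambda>t v. f' (xh t, u t) (0, v)"
    "\<lambda>t. partial1 G' (xh t, u t) 1" "\<lambda>t. partial2 G' (xh t, u t) 1" "\<lambda>t. G (xh t, u t)"
    "partial1 J' \<xi> 1" "partial2 J' \<xi> 1"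
  proof (rule linear_system.intro)
    show "linear (\<lambda>y. f' (xh t, u t) (y, 0))" "linear (\<lambda>v. f' (xh t, u t) (0, v))" for t by (rule linear_partial)+
    fix t assume t: "t \<in> {t0..t1}"
    have nf: "norm (f' (xh t, u t)) \<le> K" using Lf(2)[OF zR[OF t]] K by linarith
    show "norm (f' (xh t, u t) (y, 0)) \<le> K * norm y" for y
      using norm_blinfun[of "f' (xh t, u t)" "(y, 0)"] mult_right_mono[OF nf norm_ge_zero, of y] by (simp add: norm_Pair)
    show "norm (f' (xh t, u t) (0, v)) \<le> K * norm v" for v
      using norm_blinfun[of "f' (xh t, u t)" "(0, v)"] mult_right_mono[OF nf norm_ge_zero, of v] by (simp add: norm_Pair)
    show "norm (partial1 G' (xh t, u t) 1) \<le> K" "norm (partial2 G' (xh t, u t) 1) \<le> K"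
      using partial_norm[of G' "(xh t, u t)" 1] Lg(2)[OF zR[OF t]] K by simp_all
    have "norm (G (xh t, u t) - G 0) \<le> Lg * R"
      using Lg(3)[OF zR[OF t], of 0] mult_left_mono[OF zR[OF t] Lg(1)] R0 by simp
    then show "\<bar>G (xh t, u t)\<bar> \<le> K" using K by simp
  next
    show "AE t in ?L. G (xh t, u t) \<le> 0" using adm u_eq unfolding admissible_def by (auto elim: eventually_elim2)
  qed (fact ab f'm measurable_along_process[OF p1(1) xm u(1)] measurable_along_process[OF p1(2) xm u(1)] measurable_along_process[OF Gcont xm u(1)])+
  have AT_eq: "AT t p = partial1 f' (xh t, u t) p" and BT_eq: "BT t p = partial2 f' (xh t, u t) p" for t p
    by (simp_all add: AT_def BT_def partial1_def partial2_def)

  \<comment> \<open>The adjoint partial derivatives turn \<open>cost\<close> and \<open>slack\<close> into the linearizations of \<open>J\<close> and \<open>G\<close>.\<close>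
  have no_descent: "\<not> (AE t in ?L. slack e v t \<le> - c)" if c: "c > 0" and ev: "(e, v) \<in> W" and cost: "cost e v \<le> - c" for c e v
  proof
    assume sl: "AE t in ?L. slack e v t \<le> - c"
    have v: "v \<in> borel_measurable ?L" "\<And>t. norm (v t) \<le> 1" using ev by (auto simp: unit_processes_def)
    have split: "blinfun_apply T (p, q) = T (p, 0) + T (0, q)" for T :: "('x::euclidean_space \<times> 'y::euclidean_space) \<Rightarrow>\<^sub>L 'z::euclidean_space" and p q
      by (simp flip: blinfun.add_right)
    have y: "continuous_on {t0..t1} (traj e v)"
      "\<And>t. t \<in> {t0..t1} \<Longrightarrow> traj e v t = e + integral {t0..t} (\<lambda>s. f' (xh s, u s) (traj e v s, v s))"
      using is_traj_traj[OF ev] by (auto simp: is_traj_def split[of "f' (xh s, u s)" "traj e v s" "v s" for s])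
    have ya: "traj e v t0 = e" using y(2)[of t0] ab by simp
    have Jn: "J' (xh t0, xh t1) (traj e v t0, traj e v t1) < 0"
    proof -
      have "J' (xh t0, xh t1) (traj e v t0, traj e v t1) = cost e v"
        unfolding ya split[of "J' (xh t0, xh t1)" e "traj e v t1"] cost_def
        unfolding \<xi>_def
        by (simp add: inner_commute[of "partial1 J' _ _"] inner_commute[of "partial2 J' _ _"] partial_inner)
      then show ?thesis using cost c by simp
    qed
    have Gn: "AE t in ?L. G (xh t, u t) + G' (xh t, u t) (traj e v t, v t) \<le> - c"
      using sl
    proof eventually_elim
      case (elim t)
      have "slack e v t = G (xh t, u t) + G' (xh t, u t) (traj e v t, v t)"
        unfolding slack_def split[of "G' (xh t, u t)" "traj e v t" "v t"]
        by (simp add: inner_commute[of "partial1 G' _ _"] inner_commute[of "partial2 G' _ _"] partial_inner)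
      then show ?case using elim by simp
    qed
    show False
      by (rule weak_minimum_excludes_descent[OF ab f G J assms(6) x u u_eq v y(1) _ Jn c Gn]) (use y(2) ya in auto)
  qed

  obtain ls C lam \<mu>0 \<mu> \<alpha> p y where
    ls: "\<And>n. ls n \<in> borel_measurable L" "\<And>n t. 0 \<le> ls n t" "\<And>n t. ls n t \<le> C n"
    and lam: "integrable L lam" "AE t in L. 0 \<le> lam t" "AE t in L. lam t * G (xh t, u t) = 0" "\<And>t. partial2 G' (xh t, u t) 1 = 0 \<Longrightarrow> lam t = 0"
    and L1: "(\<lambda>n. \<integral>t. \<bar>ls n t - lam t\<bar> * (\<bar>G (xh t, u t)\<bar> + norm (partial2 G' (xh t, u t) 1)) \<partial>L) \<longlonglongrightarrow> 0"
    and lim0: "limit_measure t0 t1 ls \<mu>0" and limi: "\<And>i. i \<in> Basis \<Longrightarrow> limit_measure t0 t1 (\<lambda>n t. ls n t * (K + partial1 G' (xh t, u t) 1 \<bullet> i)) (\<mu> i)"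
    and \<alpha>: "\<alpha> \<ge> 0" "\<alpha> + measure \<mu>0 UNIV = 1"
    and y: "continuous_on {t0..t1} y" "\<And>t. t \<in> {t0..t1} \<Longrightarrow> y t = integral {t..t1} (\<lambda>s. AT s (p s))"
    and p_form: "\<And>t. p t = y (max t0 (min t1 t)) + (\<Sum>i\<in>Basis. ((measure (\<mu> i) UNIV - measure (\<mu> i) {..<t}) - K * (measure \<mu>0 UNIV - measure \<mu>0 {..<t})) *\<^sub>R i) + \<alpha> *\<^sub>R partial2 J' \<xi> 1"
    and pm: "p \<in> borel_measurable borel" and pbd: "bounded (range p)" and trans: "\<alpha> *\<^sub>R partial1 J' \<xi> 1 + p t0 = 0"
    and stat: "AE t in L. BT t (p t) + lam t *\<^sub>R partial2 G' (xh t, u t) 1 = 0"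
    by (rule limit_multipliers[OF no_descent]) blast+

  \<comment> \<open>The zeros of \<open>m\<close> in \<open>\<Gamma>\<close>, collected in \<open>Z\<close> below, are the phase points met by the closure in measure.\<close>
  define \<Gamma> where "\<Gamma> = clm t0 t1 uh"
  have \<Gamma>b: "\<Gamma> \<subseteq> {t0..t1} \<times> cball 0 M"
    unfolding \<Gamma>_def
  proof (rule clm_bounded)
    show "AE t in ?L. norm (uh t) \<le> M" using u_eq by eventually_elim (metis u(2))
  qed
  have \<Gamma>c: "compact \<Gamma>"
    using clm_closed[of t0 t1 uh] \<Gamma>b compact_Int_closed[OF compact_Times[OF compact_Icc compact_cball]] unfolding \<Gamma>_def
    by (metis inf.absorb2)
  have \<Gamma>u: "AE t in ?L. (t, u t) \<in> \<Gamma>"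
    using AE_graph_in_clm[OF uhm] u_eq unfolding \<Gamma>_def by eventually_elim simp
  have curve: "continuous_on \<Gamma> (\<lambda>w. (xh (fst w), snd w))"
    by (intro continuous_intros continuous_on_compose2[OF x(1)]) (use \<Gamma>b in auto)
  define P where "P w = partial1 G' (xh (fst w), snd w) 1" for w :: "real \<times> (real ^ 'm)"
  define m where "m w = \<bar>G (xh (fst w), snd w)\<bar> + norm (partial2 G' (xh (fst w), snd w) 1)" for w :: "real \<times> (real ^ 'm)"
  have Pc: "continuous_on \<Gamma> P" unfolding P_def[abs_def] by (intro continuous_partial(1)[OF G(2) curve] continuous_intros)
  have mc: "continuous_on \<Gamma> m" unfolding m_def[abs_def]
    by (intro continuous_intros continuous_partial(2)[OF G(2) curve] continuous_on_compose2[OF Gcont curve]) auto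
  define Z where "Z = {w\<in>\<Gamma>. m w = 0}"
  have closed_cut: "compact {w\<in>\<Gamma>. h w \<in> S}" if "continuous_on \<Gamma> h" "closed S" for h :: "real \<times> (real ^ 'm) \<Rightarrow> real" and S
  proof -
    have "closedin (top_of_set \<Gamma>) (\<Gamma> \<inter> h -` S)" by (rule continuous_closedin_preimage[OF that])
    then have "compact (\<Gamma> \<inter> h -` S)" using closedin_compact[OF \<Gamma>c] by blast
    moreover have "\<Gamma> \<inter> h -` S = {w\<in>\<Gamma>. h w \<in> S}" by auto
    ultimately show ?thesis by simp
  qed
  have Zc: "compact Z" using closed_cut[OF mc, of "{0}"] by (simp add: Z_def)
  have Zsub: "Z \<subseteq> \<Gamma>" by (auto simp: Z_def)
  have sep: "\<exists>\<delta>>0. AE t in L. s0 \<le> t \<and> t \<le> s1 \<and> \<bar>G (xh t, u t)\<bar> + norm (partial2 G' (xh t, u t) 1) < \<delta> \<longrightarrow> q \<bullet> partial1 G' (xh t, u t) 1 \<le> r"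
    if "\<And>z. z \<in> Z \<Longrightarrow> s0 \<le> fst z \<Longrightarrow> fst z \<le> s1 \<Longrightarrow> q \<bullet> P z < r" for q r s0 s1
    using affine_bound_near_zeros[OF \<Gamma>c Pc mc _ \<Gamma>u, of s0 s1 q r] that by (simp add: Z_def m_def P_def)
  obtain \<eta> s where \<eta>: "finite_borel_measure \<eta>" and s: "s \<in> borel_measurable borel" "integrable \<eta> s"
    and incl: "AE x in \<eta>. x \<in> fst ` Z \<and> s x \<in> convex hull (P ` {z\<in>Z. fst z = x})"
    and mass: "\<And>B. B \<in> sets borel \<Longrightarrow> measure \<mu>0 B = (\<integral>t. indicator B t * lam t \<partial>L) + measure \<eta> B"
    and vec: "\<And>B. B \<in> sets borel \<Longrightarrow> (\<Sum>i\<in>Basis. (measure (\<mu> i) B - K * measure \<mu>0 B) *\<^sub>R i) =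
        (\<integral>t. indicator B t *\<^sub>R (lam t *\<^sub>R partial1 G' (xh t, u t) 1) \<partial>L) + (\<integral>t. indicator B t *\<^sub>R s t \<partial>\<eta>)"
    by (rule singular_multiplier[OF ls lam L1 lim0 limi Zc continuous_on_subset[OF Pc Zsub] sep]) blast+
  interpret e: finite_borel_measure \<eta> by (rule \<eta>)
  have fin0: "finite_borel_measure \<mu>0" and fini: "\<And>i. i \<in> Basis \<Longrightarrow> finite_borel_measure (\<mu> i)"
    and out0: "measure \<mu>0 (- {t0..t1}) = 0" and outi: "\<And>i. i \<in> Basis \<Longrightarrow> measure (\<mu> i) (- {t0..t1}) = 0"
    using lim0 limi by (auto simp: limit_measure_def)

  have g1G: "grad_1 G z = partial1 G' z 1" and g2G: "grad_2 G z = partial2 G' z 1" for z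
    by (rule gradient_of_real[OF G(1)])+
  have g1J: "grad_1 J z = partial1 J' z 1" and g2J: "grad_2 J z = partial2 J' z 1" for z
    by (rule gradient_of_real[OF J(1)])+
  have g1f: "grad_1 (pontryagin f q) z = partial1 f' z q" and g2f: "grad_2 (pontryagin f q) z = partial2 f' z q" for q z
    using gradient_of_inner[OF f(1), of q z] by (simp_all add: pontryagin_def[abs_def])

  have phase: "phase_gradients G (clm_process_at t0 t1 xh uh t) = P ` {z\<in>Z. fst z = t}" for t
    unfolding phase_gradients_def clm_process_at_def clm_at_def phase_points_def g1G g2G Z_def m_def P_def \<Gamma>_def
    by (force simp: add_nonneg_eq_0_iff split: if_splits)
  have times: "phase_times t0 t1 G xh uh = fst ` Z"
  proof -
    have "t \<in> {t0..t1}" if "(t, v) \<in> \<Gamma>" for t v using \<Gamma>b that by auto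
    then show ?thesis
      unfolding phase_times_def clm_process_at_def clm_at_def phase_points_def g2G Z_def m_def \<Gamma>_def
      by (force simp: add_nonneg_eq_0_iff)
  qed
  define D where "D = fst ` Z"
  have Dc: "compact D" unfolding D_def by (intro compact_continuous_image continuous_intros Zc)
  have DI: "D \<subseteq> {t0..t1}" using \<Gamma>b Zsub by (auto simp: D_def)

  \<comment> \<open>So far \<open>\<eta>\<close> is a measure on the whole line, carried by the interval.\<close>
  define \<eta>r where "\<eta>r = restrict_space \<eta> {t0..t1}"
  have I\<eta>: "{t0..t1} \<inter> space \<eta> \<in> sets \<eta>" by (simp add: e.M_is_borel e.borel_UNIV)
  have sets_r: "sets \<eta>r = sets (restrict_space borel {t0..t1})" unfolding \<eta>r_def by (rule sets_restrict_space_cong[OF e.M_is_borel])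
  have space_r: "space \<eta>r = {t0..t1}" by (simp add: \<eta>r_def space_restrict_space e.borel_UNIV)
  have setsI: "B \<in> sets \<eta>r \<longleftrightarrow> B \<in> borel_subsets t0 t1" for B
    unfolding sets_r borel_subsets_def by (auto simp: sets_restrict_space_iff)
  have meas_r: "emeasure \<eta>r B = emeasure \<eta> B" "measure \<eta>r B = measure \<eta> B" if "B \<subseteq> {t0..t1}" for B
    unfolding \<eta>r_def using I\<eta> that by (simp_all add: emeasure_restrict_space measure_restrict_space)
  interpret r: finite_measure \<eta>r
    by (rule finite_measureI) (simp add: space_r meas_r)
  have incl_r: "AE x in \<eta>r. x \<in> D \<and> s x \<in> convex hull (P ` {z\<in>Z. fst z = x})"
    unfolding \<eta>r_def using incl by (subst AE_restrict_space_iff[OF I\<eta>]) (auto simp: D_def elim: eventually_mono)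
  have \<eta>I: "measure \<eta> {t0..t1} = measure \<eta> UNIV"
  proof -
    have "AE x in \<eta>. x \<in> {t0..t1} \<longleftrightarrow> x \<in> UNIV" using incl by eventually_elim (use DI in \<open>auto simp: D_def\<close>)
    then show ?thesis by (rule e.finite_measure_eq_AE) (auto simp: e.M_is_borel)
  qed
  have sr: "s \<in> borel_measurable \<eta>r" unfolding \<eta>r_def
    by (rule measurable_restrict_space1) (use s(1) in \<open>simp cong: measurable_cong_sets[OF e.M_is_borel refl]\<close>)
  have int_r: "(LINT t:B|completion \<eta>r. s t) = (\<integral>t. indicator B t *\<^sub>R s t \<partial>\<eta>)" if B: "B \<in> borel_subsets t0 t1" for B
  proof -
    have "(\<lambda>t. indicator B t *\<^sub>R s t) \<in> borel_measurable \<eta>r"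
      using sr B setsI by (intro borel_measurable_scaleR borel_measurable_indicator) auto
    then have "(LINT t:B|completion \<eta>r. s t) = (\<integral>t. indicator B t *\<^sub>R s t \<partial>\<eta>r)"
      unfolding set_lebesgue_integral_def by (rule integral_completion)
    also have "\<dots> = (\<integral>t. indicator {t0..t1} t *\<^sub>R (indicator B t *\<^sub>R s t) \<partial>\<eta>)"
      unfolding \<eta>r_def by (rule integral_restrict_space[OF I\<eta>])
    also have "\<dots> = (\<integral>t. indicator B t *\<^sub>R s t \<partial>\<eta>)"
      by (rule Bochner_Integration.integral_cong) (use B in \<open>auto simp: borel_subsets_def indicator_def\<close>)
    finally show ?thesis .
  qed

  have pL: "p \<in> borel_measurable L"
    using pm by (intro measurable_restrict_space1 measurable_completion) simp
  note adj_intro = adjoint_bounded_variation[OF pm pbd y p_form fin0 fini out0 outi lam(1) \<eta> s(2) vec]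
  have adj: "BV t0 t1 p" "left_lim p t = p t" "right_lim p t1 = \<alpha> *\<^sub>R partial2 J' \<xi> 1"
    "S \<in> borel_subsets t0 t1 \<Longrightarrow> - BV_measure t0 t1 p S = (\<integral>t. indicator S t *\<^sub>R AT t (p t) \<partial>L)
      + (\<integral>t. indicator S t *\<^sub>R (lam t *\<^sub>R partial1 G' (xh t, u t) 1) \<partial>L) + (\<integral>t. indicator S t *\<^sub>R s t \<partial>\<eta>)" for t S
    by (rule adj_intro; assumption)+

  have adjoint_eq: "- BV_measure t0 t1 p B = (LINT t:B|lebesgue. grad_1 (pontryagin f (p t)) (xh t, uh t)) +
             (LINT t:B|lebesgue. lam t *\<^sub>R grad_1 G (xh t, uh t)) + (LINT t:B|completion \<eta>r. s t)"
    if B: "B \<in> borel_subsets t0 t1" for B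
  proof -
    have Bs: "B \<subseteq> {t0..t1}" "B \<in> sets borel" using B by (auto simp: borel_subsets_def)
    have ind: "(indicator B :: real \<Rightarrow> real) \<in> borel_measurable L"
      by (intro borel_measurable_indicator) (use Bs in \<open>auto simp: sets_restrict_space_iff intro: sets_completionI_sets\<close>)
    have m1: "(\<lambda>t. partial1 f' (xh t, w t) (p t)) \<in> borel_measurable L" if "w \<in> borel_measurable L" for w
    proof -
      have "(\<lambda>t. (\<lambda>z. partial1 f' (fst z) (snd z)) ((xh t, w t), p t)) \<in> borel_measurable L"
        by (rule measurable_along_process[OF _ borel_measurable_Pair[OF xm that] pL]) (intro continuous_partial f continuous_intros)
      then show ?thesis by simp
    qed
    have "(\<integral>t. indicator B t *\<^sub>R partial1 f' (xh t, uh t) (p t) \<partial>L) = (\<integral>t. indicator B t *\<^sub>R AT t (p t) \<partial>L)"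
      unfolding AT_eq
      by (rule integral_cong_AE) (use m1[OF uhm] m1[OF u(1)] ind u_eq in \<open>auto elim: eventually_mono\<close>)
    moreover have "(\<integral>t. indicator B t *\<^sub>R (lam t *\<^sub>R partial1 G' (xh t, uh t) 1) \<partial>L) = (\<integral>t. indicator B t *\<^sub>R (lam t *\<^sub>R partial1 G' (xh t, u t) 1) \<partial>L)"
    proof (rule integral_cong_AE)
      show "AE t in L. indicator B t *\<^sub>R lam t *\<^sub>R partial1 G' (xh t, uh t) 1 = indicator B t *\<^sub>R lam t *\<^sub>R partial1 G' (xh t, u t) 1"
        using u_eq by eventually_elim simp
    qed (use ind lam(1) measurable_along_process[OF p1(1) xm uhm] measurable_along_process[OF p1(1) xm u(1)] in auto)
    ultimately show ?thesis
      unfolding adj(4)[OF B] g1f g1G set_integral_lebesgue_on[OF Bs(1)] int_r[OF B] by simp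
  qed

  obtain BP where BP: "\<And>w. w \<in> Z \<Longrightarrow> norm (P w) \<le> BP"
    using compact_imp_bounded[OF compact_continuous_image[OF continuous_on_subset[OF Pc Zsub] Zc]] unfolding bounded_iff by auto
  have sb: "AE x in \<eta>r. norm (s x) \<le> BP"
    using incl_r
  proof eventually_elim
    case (elim x)
    have "convex hull (P ` {z\<in>Z. fst z = x}) \<subseteq> cball 0 BP" by (rule hull_minimal) (use BP in auto)
    then show ?case using elim by auto
  qed
  have sLinf: "in_Linf (completion \<eta>r) s"
  proof -
    have sm: "s \<in> borel_measurable (completion \<eta>r)" using sr by (rule measurable_completion)
    have "esssup (completion \<eta>r) (\<lambda>t. ereal (norm (s t))) \<le> ereal BP"
      by (rule esssup_I) (use sm AE_completion[OF sb] in auto)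
    then show ?thesis using sm by (auto simp: in_Linf_def Linf_norm_def intro: order.strict_trans1)
  qed

  have Rex: "\<exists>R \<in> sets (completion \<eta>r). R \<subseteq> phase_times t0 t1 G xh uh \<and> measure (completion \<eta>r) R = measure \<eta>r {t0..t1} \<and>
         (\<forall>t\<in>R. s t \<in> convex hull phase_gradients G (clm_process_at t0 t1 xh uh t))"
  proof -
    obtain N where N: "{x \<in> space \<eta>r. \<not> (x \<in> D \<and> s x \<in> convex hull (P ` {z\<in>Z. fst z = x}))} \<subseteq> N" "emeasure \<eta>r N = 0" "N \<in> sets \<eta>r"
      using incl_r by (rule AE_E)
    have Rs: "{t0..t1} - N \<in> sets \<eta>r" using N(3) sets.top[of \<eta>r] unfolding space_r by (rule sets.Diff[rotated])
    have "measure \<eta>r ({t0..t1} - N) = measure \<eta>r {t0..t1}"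
      by (rule measure_Diff_null_set) (use N(2,3) sets.top[of \<eta>r] in \<open>auto simp: space_r null_sets_def\<close>)
    then have "measure (completion \<eta>r) ({t0..t1} - N) = measure \<eta>r {t0..t1}" using measure_completion[OF Rs] by simp
    moreover have "\<forall>t\<in>{t0..t1} - N. t \<in> D \<and> s t \<in> convex hull (P ` {z\<in>Z. fst z = t})" using N(1) space_r by auto
    ultimately show ?thesis
      unfolding times phase D_def[symmetric] using sets_completionI_sets[OF Rs] by (intro bexI[of _ "{t0..t1} - N"]) auto
  qed

  have dens: "density \<eta>r (indicator (phase_times t0 t1 G xh uh)) = \<eta>r"
  proof -
    have "D \<in> sets \<eta>r" using Dc DI by (auto simp: setsI borel_subsets_def intro: borel_compact)
    then have "density \<eta>r (indicator D) = density \<eta>r (\<lambda>_. 1)"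
      by (intro density_cong) (use incl_r in \<open>auto elim: eventually_mono\<close>)
    then show ?thesis by (simp add: times D_def density_1)
  qed

  have nontriv: "\<alpha> + (\<integral>t. \<bar>lam t\<bar> \<partial>?L) + measure \<eta>r {t0..t1} > 0"
  proof -
    have "(\<integral>t. lam t \<partial>?L) \<le> (\<integral>t. \<bar>lam t\<bar> \<partial>?L)" using lam(1) by (intro integral_mono) auto
    moreover have "measure \<mu>0 UNIV = (\<integral>t. lam t \<partial>?L) + measure \<eta> UNIV" using mass[of UNIV] by simp
    ultimately show ?thesis using \<alpha>(2) \<eta>I meas_r(2)[of "{t0..t1}"] by simp
  qed

  have trans1: "- left_lim p t0 = \<alpha> *\<^sub>R grad_1 J (xh t0, xh t1)"
    using trans unfolding adj(2) g1J \<xi>_def by (simp add: neg_eq_iff_add_eq_0 add.commute)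
  have trans2: "right_lim p t1 = \<alpha> *\<^sub>R grad_2 J (xh t0, xh t1)" by (simp add: adj(3) g2J \<xi>_def)

  have slackness: "AE t in ?L. lam t \<ge> 0 \<and> lam t * G (xh t, uh t) = 0"
    using lam(2,3) u_eq by eventually_elim simp
  have stationary: "AE t in ?L. grad_2 (pontryagin f (p t)) (xh t, uh t) + lam t *\<^sub>R grad_2 G (xh t, uh t) = 0"
    using stat u_eq by eventually_elim (simp add: g2f g2G BT_eq)
  have radon: "nonneg_radon_on t0 t1 \<eta>r" unfolding nonneg_radon_on_def using sets_r r.finite_measure_axioms by simp
  show ?thesis
    by (intro exI[of _ \<alpha>] exI[of _ p] exI[of _ lam] exI[of _ \<eta>r] exI[of _ s] conjI ballI)
       (fact adj(1) lam(1) radon sLinf \<alpha>(1) slackness dens nontriv Rex adjoint_eq trans1 trans2 stationary)+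
qed

end
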